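(* Let $\mathbb{K}$ be a field of characteristic $0$ and let $\mathcal{A}$ and $\mathcal{C}$ be connected algebraic operads over $\mathbb{K}$ sharing the same underlying finite-dimensional $\mathfrak{S}_n$-modules, $\mathcal{A}(n)=\mathcal{C}(n)$ for all $n$. Then there exists a family of $\mathfrak{S}_n$-module isomorphisms $\varphi_n:\mathcal{A}(n)\to\mathcal{C}^*(n)$, and, for the confluence law $\alpha$ associated to $\varphi$, every conilpotent $\mathcal{C}^c$-$_\alpha\mathcal{A}$-bialgebra $\mathcal{H}$ is free and cofree over its primitive elements: $\mathcal{A}(\mathrm{Prim}\,\mathcal{H})\cong\mathcal{H}\cong\mathcal{C}^c(\mathrm{Prim}\,\mathcal{H})$.
   Context: An operad $\mathcal{P}$ is connected if $\mathcal{P}(0)=0$, $\mathcal{P}(1)=\mathbb{K}\cdot\mathrm{id}$. $\mathcal{C}^*(n)=\mathrm{Hom}(\mathcal{C}(n),\mathbb{K})$ is the dual cooperad. An $\mathcal{A}$-algebra is a vector space $H$ with $\mathfrak{S}_n$-equivariant maps $\mathcal{A}(n)\otimes H^{\otimes n}\to H$; $\mathcal{A}(V)=\bigoplus_n\mathcal{A}(n)\otimes_{\mathfrak{S}_n}V^{\otimes n}$ is the free $\mathcal{A}$-algebra. A $\mathcal{C}$-coalgebra is a vector space $H$ with $\mathfrak{S}_n$-equivariant maps $\mathcal{C}(n)\otimes H\to H^{\otimes n}$, $\delta\otimes x\mapsto\delta(x)$; $\mathcal{C}^c(V)=\bigoplus_n\mathcal{C}^*(n)\otimes_{\mathfrak{S}_n}V^{\otimes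 n}$ is the cofree conilpotent $\mathcal{C}$-coalgebra. For a $\mathcal{C}$-coalgebra $H$, $\mathcal{F}_nH=\{x:\delta(x)=0\ \forall p>n,\ \forall\delta\in\mathcal{C}(p)\}$, $\mathrm{Prim}\,H=\mathcal{F}_1H$, and $H$ is conilpotent if $H=\bigcup_n\mathcal{F}_nH$. A confluence law between $\mathcal{A}$ and $\mathcal{C}$ is a family of linear maps $\alpha_{m,n}:\mathcal{C}(m)\otimes\mathcal{A}(n)\to\mathcal{A}^{\otimes m}(n)=\bigoplus_{l_1+\dots+l_m=n,\,l_i\ge1}\mathrm{Ind}_{\mathfrak{S}_{l_1}\times\dots\times\mathfrak{S}_{l_m}}^{\mathfrak{S}_n}(\mathcal{A}(l_1)\otimes\dots\otimes\mathcal{A}(l_m))$, compatible with the $\mathfrak{S}_m\times\mathfrak{S}_n$-actions and the operad structure of $\mathcal{C}$. A $\mathcal{C}^c$-$_\alpha\mathcal{A}$-bialgebra is a vector space $H$ with an $\mathcal{A}$-algebra and a $\mathcal{C}$-coalgebra structure such that $\delta(\mu(p_1,\dots,p_n))=\alpha_{m,n}(\delta\otimes\mu)(p_1,\dots,p_n)$ (evaluated in $H^{\otimes m}$ with the algebra structure on each factor) for all $\delta\in\mathcal{C}(m)$, $\mu\in\mathcal{A}(n)$, $p_i\in\mathrm{Prim}\,H$. The confluence law associated to $\mathfrak{S}_n$-isomorphisms $\varphi_n:\mathcal{A}(n)\to\mathcal{C}^*(n)$: with $M_n=\mathcal{A}(n)\otimes_{\mathfrak{S}_n}V^{\otimes n}$,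 $H_n=\mathcal{C}^*(n)\otimes_{\mathfrak{S}_n}V^{\otimes n}$, for $\delta\in\mathcal{C}(k)$, $\alpha$ is the composite $\mathcal{C}(k)\otimes M_n\xrightarrow{\mathrm{id}\otimes\varphi}\mathcal{C}(k)\otimes H_n\to\bigoplus_{l_1+\dots+l_k=n}H_{l_1}\otimes\dots\otimes H_{l_k}\xrightarrow{(\varphi^{-1})^{\otimes k}}\bigoplus M_{l_1}\otimes\dots\otimes M_{l_k}$, the middle map being the coalgebra structure of $\mathcal{C}^c(V)$; by naturality in $V$ this gives the maps $\alpha_{k,n}$. *)

theory Defs
  imports Complex_Main "HOL-Library.Function_Algebras" "HOL-Combinatorics.Permutations"
begin

text \<open>
  Conventions. A vector space is a subspace \<open>carr\<close> of an ambient type, with an explicit scalar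
  multiplication. The symmetric group on n letters is \<open>{\<sigma>. \<sigma> permutes {..<n}}\<close>; operads are right
  modules over it. On words of length n it acts on the right by \<^const>\<open>permute_list\<close>, i.e.
  \<open>(x \<cdot> \<sigma>)\<^sub>i = x\<^sub>\<sigma>\<^sub>(\<^sub>i\<^sub>)\<close>; the usual left action on tensors is \<open>\<sigma> \<cdot> x = x \<cdot> inv \<sigma>\<close>.
\<close>

section \<open>Vector spaces and linear maps\<close>

record ('k, 'v) vspace =
  carr :: "'v set"
  scl :: "'k \<Rightarrow> 'v \<Rightarrow> 'v"

definition is_vspace :: "('k::field, 'v::ab_group_add) vspace \<Rightarrow> bool" where
  "is_vspace V \<longleftrightarrow> vector_space (scl V) \<and> module.subspace (scl V) (carr V)"

definition ground :: "('k::field, 'k) vspace" where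
  "ground = \<lparr>carr = UNIV, scl = (*)\<rparr>"

definition fun_scale :: "'k::field \<Rightarrow> ('x \<Rightarrow> 'k) \<Rightarrow> 'x \<Rightarrow> 'k" where
  "fun_scale c f = (\<lambda>x. c * f x)"

definition linear_between ::
  "('k::field, 'v::ab_group_add) vspace \<Rightarrow> ('k, 'w::ab_group_add) vspace \<Rightarrow> ('v \<Rightarrow> 'w) \<Rightarrow> bool" where
  "linear_between V W f \<longleftrightarrow>
     (\<forall>x\<in>carr V. f x \<in> carr W) \<and>
     (\<forall>x\<in>carr V. \<forall>y\<in>carr V. f (x + y) = f x + f y) \<and>
     (\<forall>c. \<forall>x\<in>carr V. f (scl V c x) = scl W c (f x))"

text \<open>A function of n variables is a function on lists of length n.\<close>

definition multilinear_between ::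
  "('k::field, 'v::ab_group_add) vspace list \<Rightarrow> ('k, 'w::ab_group_add) vspace \<Rightarrow> ('v list \<Rightarrow> 'w) \<Rightarrow> bool" where
  "multilinear_between Vs W f \<longleftrightarrow>
     (\<forall>xs\<in>listset (map carr Vs). f xs \<in> carr W \<and>
        (\<forall>i<length Vs. linear_between (Vs ! i) W (\<lambda>y. f (xs[i := y]))))"

section \<open>Vector spaces presented by generators and relations\<close>

text \<open>
  All tensor products and coinvariants below are vector spaces K[X]/R presented by a set X of
  symbols and a space R of relations. Such a quotient embeds into its double dual. Its dual is the
  space Q of those functions on X which respect the relations (for a tensor product: the multilinear
  forms), and the class of a symbol x is the evaluation of the forms at x. So K[X]/R is realised as
  the span of the evaluations \<open>gen Q x\<close>, for x in X, inside the functions from forms to scalars.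
  Extending the evaluations by 0 outside Q makes equality in the quotient literal equality.
\<close>

type_synonym ('k, 'x) presented = "('x \<Rightarrow> 'k) \<Rightarrow> 'k"

definition gen :: "('x \<Rightarrow> 'k::field) set \<Rightarrow> 'x \<Rightarrow> ('k, 'x) presented" where
  "gen Q x = (\<lambda>q. if q \<in> Q then q x else 0)"

definition presented_space :: "'x set \<Rightarrow> ('x \<Rightarrow> 'k::field) set \<Rightarrow> ('k, ('k, 'x) presented) vspace" where
  "presented_space X Q = \<lparr>carr = module.span fun_scale (gen Q ` X), scl = fun_scale\<rparr>"

text \<open>
  The linear map sending the class of each symbol x to F x, for F respecting the relations
  (see \<open>lin_ext_gen\<close> below), and its version for several arguments.
\<close>

definition lin_ext ::
  "('k::field, 'x) presented \<Rightarrow> ('x \<Rightarrow> ('k, 'y) presented) \<Rightarrow> ('k, 'y) presented" where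
  "lin_ext t F = (\<lambda>q. t (\<lambda>x. F x q))"

fun multi_ext ::
  "('k::field, 'x) presented list \<Rightarrow> ('x list \<Rightarrow> ('k, 'y) presented) \<Rightarrow> ('k, 'y) presented" where
  "multi_ext [] F = F []"
| "multi_ext (t # ts) F = lin_ext t (\<lambda>x. multi_ext ts (\<lambda>xs. F (x # xs)))"

lemma vector_space_fun_scale: "vector_space (fun_scale :: 'k::field \<Rightarrow> ('x \<Rightarrow> 'k) \<Rightarrow> _)"
  by unfold_locales (auto simp: fun_scale_def fun_eq_iff algebra_simps)

interpretation fun_space: vector_space "fun_scale :: 'k::field \<Rightarrow> ('x \<Rightarrow> 'k) \<Rightarrow> _"
  by (rule vector_space_fun_scale)

lemma is_vspace_presented_space: "is_vspace (presented_space X Q)"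
  by (simp add: is_vspace_def presented_space_def vector_space_fun_scale)

lemma lin_ext_add: "lin_ext (s + t) F = lin_ext s F + lin_ext t F"
  by (auto simp: lin_ext_def)

lemma lin_ext_scale: "lin_ext (fun_scale c t) F = fun_scale c (lin_ext t F)"
  by (auto simp: lin_ext_def fun_scale_def)

lemma lin_ext_gen:
  assumes "\<And>q. (\<lambda>x. F x q) \<in> Q"
  shows "lin_ext (gen Q x) F = F x"
  using assms by (auto simp: lin_ext_def gen_def)

text \<open>The universal property of K[X]/R: a function on X that respects R, as seen by linear
  functionals on the target, factors through a linear map.\<close>

lemma presented_space_universal:
  fixes X :: "'x set" and Q :: "('x \<Rightarrow> 'k::field) set" and F :: "'x \<Rightarrow> 'w::ab_group_add"
  assumes W: "vector_space s"
    and F: "\<And>l. Vector_Spaces.linear s (*) l \<Longrightarrow> (\<lambda>x. l (F x)) \<in> Q"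
  shows "\<exists>h. linear_between (presented_space X Q) \<lparr>carr = UNIV, scl = s\<rparr> h \<and> (\<forall>x\<in>X. h (gen Q x) = F x)"
proof -
  interpret W: vector_space s by (rule W)
  interpret K: vector_space "(*) :: 'k \<Rightarrow> 'k \<Rightarrow> 'k"
    by unfold_locales (auto simp: algebra_simps)
  interpret WK: vector_space_pair s "(*) :: 'k \<Rightarrow> 'k \<Rightarrow> 'k" ..
  define L where "L = {l. Vector_Spaces.linear s ((*) :: 'k \<Rightarrow> 'k \<Rightarrow> 'k) l}"
  define R where "R t y \<longleftrightarrow> (\<forall>l\<in>L. l y = t (\<lambda>x. l (F x)))" for t y
  have ladd: "l (x + y) = l x + l y" and lscl: "l (s c x) = c * l x" if "l \<in> L" for l x y c
    using that by (auto simp: L_def WK.linear_add WK.linear_scale)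
  have sep: "y = z" if eq: "\<And>l. l \<in> L \<Longrightarrow> l y = l z" for y z
  proof (rule ccontr)
    assume "y \<noteq> z"
    then have "W.independent {y - z}" by simp
    from WK.linear_independent_extend[OF this, of "\<lambda>_. 1"]
    obtain l where l: "Vector_Spaces.linear s (*) l" "l (y - z) = 1" by auto
    then have "l y - l z = 1" by (simp add: WK.linear_diff)
    with eq[of l] l(1) show False by (simp add: L_def)
  qed
  have uniq: "y = z" if "R t y" "R t z" for t y z
    using that by (intro sep) (auto simp: R_def)
  have ex: "\<exists>y. R t y" if "t \<in> fun_space.span (gen Q ` X)" for t
    using that
  proof (induction rule: fun_space.span_induct_alt)
    case base
    have "l 0 = 0" if "l \<in> L" for l using that by (simp add: L_def WK.linear_0)
    then have "R 0 0" by (simp add: R_def)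
    then show ?case ..
  next
    case (step c t u)
    from step obtain x where x: "t = gen Q x" by auto
    from step obtain y where y: "R u y" by auto
    have "R (fun_scale c t + u) (s c (F x) + y)"
      using y F by (auto simp: R_def x ladd lscl fun_scale_def gen_def L_def)
    then show ?case ..
  qed
  define h where "h t = (THE y. R t y)" for t
  have h: "h t = y" if "R t y" for t y
    unfolding h_def using that uniq by blast
  have "linear_between (presented_space X Q) \<lparr>carr = UNIV, scl = s\<rparr> h"
    unfolding linear_between_def presented_space_def
  proof (clarsimp, intro conjI ballI allI)
    fix t u assume "t \<in> fun_space.span (gen Q ` X)" "u \<in> fun_space.span (gen Q ` X)"
    then obtain y z where yz: "R t y" "R u z" using ex by meson
    then have "R (t + u) (y + z)" by (auto simp: R_def ladd)
    with yz show "h (t + u) = h t + h u" by (simp add: h)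
  next
    fix c t assume "t \<in> fun_space.span (gen Q ` X)"
    then obtain y where y: "R t y" using ex by meson
    then have "R (fun_scale c t) (s c y)" by (auto simp: R_def lscl fun_scale_def)
    with y show "h (fun_scale c t) = s c (h t)" by (simp add: h)
  qed
  moreover have "h (gen Q x) = F x" if "x \<in> X" for x
    using F by (intro h) (auto simp: R_def gen_def L_def)
  ultimately show ?thesis by blast
qed

section \<open>Tensor powers\<close>

definition tensor_forms :: "('k::field, 'v::ab_group_add) vspace \<Rightarrow> nat \<Rightarrow> ('v list \<Rightarrow> 'k) set" where
  "tensor_forms V n = {f. multilinear_between (replicate n V) ground f}"

abbreviation pure :: "('k::field, 'v::ab_group_add) vspace \<Rightarrow> nat \<Rightarrow> 'v list \<Rightarrow> ('k, 'v list) presented" where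
  "pure V n \<equiv> gen (tensor_forms V n)"

definition tensor_power ::
  "('k::field, 'v::ab_group_add) vspace \<Rightarrow> nat \<Rightarrow> ('k, ('k, 'v list) presented) vspace" where
  "tensor_power V n = presented_space (listset (replicate n (carr V))) (tensor_forms V n)"

definition tensor_permute ::
  "('k::field, 'v::ab_group_add) vspace \<Rightarrow> nat \<Rightarrow> (nat \<Rightarrow> nat) \<Rightarrow> ('k, 'v list) presented \<Rightarrow> ('k, 'v list) presented" where
  "tensor_permute V n \<sigma> t = lin_ext t (\<lambda>xs. pure V n (permute_list \<sigma> xs))"

definition tensor_map ::
  "('k::field, 'w::ab_group_add) vspace \<Rightarrow> nat \<Rightarrow> ('v \<Rightarrow> 'w) \<Rightarrow> ('k, 'v list) presented \<Rightarrow> ('k, 'w list) presented" where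
  "tensor_map W n f t = lin_ext t (\<lambda>xs. pure W n (map f xs))"

section \<open>Block permutations\<close>

fun split_blocks :: "nat list \<Rightarrow> 'x list \<Rightarrow> 'x list list" where
  "split_blocks [] xs = []"
| "split_blocks (l # ls) xs = take l xs # split_blocks ls (drop l xs)"

definition perm_of_word :: "nat list \<Rightarrow> nat \<Rightarrow> nat" where
  "perm_of_word w = (\<lambda>i. if i < length w then w ! i else i)"

text \<open>
  \<open>block_perm \<sigma> ls\<close> permutes consecutive blocks of lengths ls, and \<open>sum_perm \<tau>s ls\<close> permutes inside
  the blocks: if \<open>map length xss = ls\<close>, then
  \<open>permute_list (block_perm \<sigma> ls) (concat xss) = concat (permute_list \<sigma> xss)\<close> and
  \<open>permute_list (sum_perm \<tau>s ls) (concat xss) = concat (map2 permute_list \<tau>s xss)\<close>.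
\<close>

definition block_perm :: "(nat \<Rightarrow> nat) \<Rightarrow> nat list \<Rightarrow> nat \<Rightarrow> nat" where
  "block_perm \<sigma> ls = perm_of_word (concat (permute_list \<sigma> (split_blocks ls [0..<sum_list ls])))"

definition sum_perm :: "(nat \<Rightarrow> nat) list \<Rightarrow> nat list \<Rightarrow> nat \<Rightarrow> nat" where
  "sum_perm \<tau>s ls = perm_of_word (concat (map2 permute_list \<tau>s (split_blocks ls [0..<sum_list ls])))"

section \<open>Symmetric modules and operads\<close>

record ('k, 'a) smodule =
  ops :: "nat \<Rightarrow> 'a set"
  act :: "nat \<Rightarrow> (nat \<Rightarrow> nat) \<Rightarrow> 'a \<Rightarrow> 'a"
  smul :: "'k \<Rightarrow> 'a \<Rightarrow> 'a"

definition arity_space :: "('k, 'a, 'z) smodule_scheme \<Rightarrow> nat \<Rightarrow> ('k, 'a) vspace" where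
  "arity_space P n = \<lparr>carr = ops P n, scl = smul P\<rparr>"

locale symmetric_module =
  fixes P :: "('k::field, 'a::ab_group_add, 'z) smodule_scheme"
  assumes vspace: "is_vspace (arity_space P n)"
    and act_linear: "\<sigma> permutes {..<n} \<Longrightarrow> linear_between (arity_space P n) (arity_space P n) (act P n \<sigma>)"
    and act_id: "a \<in> ops P n \<Longrightarrow> act P n id a = a"
    and act_comp: "\<sigma> permutes {..<n} \<Longrightarrow> \<tau> permutes {..<n} \<Longrightarrow> a \<in> ops P n \<Longrightarrow>
      act P n (\<sigma> \<circ> \<tau>) a = act P n \<tau> (act P n \<sigma> a)"

definition finite_dimensional :: "('k::field, 'a::ab_group_add, 'z) smodule_scheme \<Rightarrow> bool" where
  "finite_dimensional P \<longleftrightarrow> (\<forall>n. \<exists>B. finite B \<and> module.span (smul P) B = ops P n)"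

definition smodule_iso ::
  "('k::field, 'a::ab_group_add, 'y) smodule_scheme \<Rightarrow> ('k, 'b::ab_group_add, 'z) smodule_scheme
    \<Rightarrow> (nat \<Rightarrow> 'a \<Rightarrow> 'b) \<Rightarrow> bool" where
  "smodule_iso P R \<phi> \<longleftrightarrow> (\<forall>n.
     linear_between (arity_space P n) (arity_space R n) (\<phi> n) \<and>
     bij_betw (\<phi> n) (ops P n) (ops R n) \<and>
     (\<forall>\<sigma>. \<sigma> permutes {..<n} \<longrightarrow> (\<forall>a\<in>ops P n. \<phi> n (act P n \<sigma> a) = act R n \<sigma> (\<phi> n a))))"

text \<open>
  The linear dual with the contragredient action. Linear forms on the n-th component are extended
  by 0 to the ambient type.
\<close>

definition dual_smodule :: "('k::field, 'a::ab_group_add, 'z) smodule_scheme \<Rightarrow> ('k, 'a \<Rightarrow> 'k) smodule" where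
  "dual_smodule P = \<lparr>
     ops = (\<lambda>n. {f. linear_between (arity_space P n) ground f \<and> (\<forall>a. a \<notin> ops P n \<longrightarrow> f a = 0)}),
     act = (\<lambda>n \<sigma> f a. if a \<in> ops P n then f (act P n (inv \<sigma>) a) else 0),
     smul = fun_scale\<rparr>"

text \<open>
  \<open>gam P ls a bs\<close> is the full composite \<open>\<gamma>(a; b\<^sub>1, \<dots>, b\<^sub>k)\<close>, where k is the length of ls and
  \<open>b\<^sub>i\<close> has arity \<open>l\<^sub>i\<close>.
\<close>

record ('k, 'a) operad = "('k, 'a) smodule" +
  unit :: 'a
  gam :: "nat list \<Rightarrow> 'a \<Rightarrow> 'a list \<Rightarrow> 'a"

locale symmetric_operad = symmetric_module P
  for P :: "('k::field, 'a::ab_group_add) operad" +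
  assumes unit_closed: "unit P \<in> ops P 1"
    and gam_linear: "bs \<in> listset (map (ops P) ls) \<Longrightarrow>
      linear_between (arity_space P (length ls)) (arity_space P (sum_list ls)) (\<lambda>a. gam P ls a bs)"
    and gam_multilinear: "a \<in> ops P (length ls) \<Longrightarrow>
      multilinear_between (map (arity_space P) ls) (arity_space P (sum_list ls)) (gam P ls a)"
    and gam_unit_left: "a \<in> ops P n \<Longrightarrow> gam P [n] (unit P) [a] = a"
    and gam_unit_right: "a \<in> ops P n \<Longrightarrow> gam P (replicate n 1) a (replicate n (unit P)) = a"
    and gam_assoc: "a \<in> ops P (length lss) \<Longrightarrow> bs \<in> listset (map (\<lambda>ls. ops P (length ls)) lss) \<Longrightarrow>
      length css = length lss \<Longrightarrow> (\<And>i. i < length lss \<Longrightarrow> css ! i \<in> listset (map (ops P) (lss ! i))) \<Longrightarrow>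
      gam P (concat lss) (gam P (map length lss) a bs) (concat css) =
      gam P (map sum_list lss) a (map (\<lambda>(ls, b, cs). gam P ls b cs) (zip lss (zip bs css)))"
    and gam_equivariant_outer: "a \<in> ops P (length ls) \<Longrightarrow> bs \<in> listset (map (ops P) ls) \<Longrightarrow>
      \<sigma> permutes {..<length ls} \<Longrightarrow>
      gam P (permute_list \<sigma> ls) (act P (length ls) \<sigma> a) (permute_list \<sigma> bs) =
      act P (sum_list ls) (block_perm \<sigma> ls) (gam P ls a bs)"
    and gam_equivariant_inner: "a \<in> ops P (length ls) \<Longrightarrow> bs \<in> listset (map (ops P) ls) \<Longrightarrow>
      length \<tau>s = length ls \<Longrightarrow> (\<And>i. i < length ls \<Longrightarrow> (\<tau>s ! i) permutes {..<ls ! i}) \<Longrightarrow>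
      gam P ls a (map (\<lambda>(l, \<tau>, b). act P l \<tau> b) (zip ls (zip \<tau>s bs))) =
      act P (sum_list ls) (sum_perm \<tau>s ls) (gam P ls a bs)"

locale connected_operad = symmetric_operad +
  assumes ops_0: "ops P 0 = {0}"
    and unit_nonzero: "unit P \<noteq> 0"
    and ops_1: "ops P 1 = {smul P c (unit P) | c. True}"

section \<open>Algebras and coalgebras over an operad\<close>

locale operad_algebra =
  fixes P :: "('k::field, 'a::ab_group_add) operad"
    and H :: "('k, 'h::ab_group_add) vspace"
    and ev :: "'a \<Rightarrow> 'h list \<Rightarrow> 'h"
  assumes vspace: "is_vspace H"
    and ev_linear: "xs \<in> listset (replicate n (carr H)) \<Longrightarrow> linear_between (arity_space P n) H (\<lambda>a. ev a xs)"
    and ev_multilinear: "a \<in> ops P n \<Longrightarrow> multilinear_between (replicate n H) H (ev a)"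
    and ev_equivariant: "a \<in> ops P n \<Longrightarrow> xs \<in> listset (replicate n (carr H)) \<Longrightarrow> \<sigma> permutes {..<n} \<Longrightarrow>
      ev (act P n \<sigma> a) (permute_list \<sigma> xs) = ev a xs"
    and ev_unit: "x \<in> carr H \<Longrightarrow> ev (unit P) [x] = x"
    and ev_gam: "a \<in> ops P (length xss) \<Longrightarrow> bs \<in> listset (map (\<lambda>xs. ops P (length xs)) xss) \<Longrightarrow>
      set (concat xss) \<subseteq> carr H \<Longrightarrow>
      ev (gam P (map length xss) a bs) (concat xss) = ev a (map2 ev bs xss)"

text \<open>\<open>cop n \<delta> x\<close> is \<open>\<delta>(x)\<close> for \<open>\<delta>\<close> of arity n; \<open>cop_tensor cop H ls \<delta>s\<close> is
  \<open>\<delta>\<^sub>1 \<otimes> \<dots> \<otimes> \<delta>\<^sub>k\<close>, from the k-th to the (\<open>l\<^sub>1 + \<dots> + l\<^sub>k\<close>)-th tensor power.\<close>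

definition cop_tensor ::
  "(nat \<Rightarrow> 'a \<Rightarrow> 'h \<Rightarrow> ('k, 'h list) presented) \<Rightarrow> ('k::field, 'h::ab_group_add) vspace \<Rightarrow> nat list \<Rightarrow> 'a list
    \<Rightarrow> ('k, 'h list) presented \<Rightarrow> ('k, 'h list) presented" where
  "cop_tensor cop H ls \<delta>s t = lin_ext t (\<lambda>xs.
     multi_ext (map (\<lambda>(l, \<delta>, x). cop l \<delta> x) (zip ls (zip \<delta>s xs)))
       (\<lambda>yss. pure H (sum_list ls) (concat yss)))"

locale operad_coalgebra =
  fixes P :: "('k::field, 'a::ab_group_add) operad"
    and H :: "('k, 'h::ab_group_add) vspace"
    and cop :: "nat \<Rightarrow> 'a \<Rightarrow> 'h \<Rightarrow> ('k, 'h list) presented"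
  assumes vspace: "is_vspace H"
    and cop_linear_op: "x \<in> carr H \<Longrightarrow> linear_between (arity_space P n) (tensor_power H n) (\<lambda>\<delta>. cop n \<delta> x)"
    and cop_linear: "\<delta> \<in> ops P n \<Longrightarrow> linear_between H (tensor_power H n) (cop n \<delta>)"
    and cop_equivariant: "\<delta> \<in> ops P n \<Longrightarrow> x \<in> carr H \<Longrightarrow> \<sigma> permutes {..<n} \<Longrightarrow>
      cop n (act P n \<sigma> \<delta>) x = tensor_permute H n \<sigma> (cop n \<delta> x)"
    and cop_unit: "x \<in> carr H \<Longrightarrow> cop 1 (unit P) x = pure H 1 [x]"
    and cop_gam: "\<delta> \<in> ops P (length ls) \<Longrightarrow> \<delta>s \<in> listset (map (ops P) ls) \<Longrightarrow> x \<in> carr H \<Longrightarrow>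
      cop (sum_list ls) (gam P ls \<delta> \<delta>s) x = cop_tensor cop H ls \<delta>s (cop (length ls) \<delta> x)"

definition filtration ::
  "('k::field, 'a::ab_group_add) operad \<Rightarrow> ('k, 'h::ab_group_add) vspace
    \<Rightarrow> (nat \<Rightarrow> 'a \<Rightarrow> 'h \<Rightarrow> ('k, 'h list) presented) \<Rightarrow> nat \<Rightarrow> 'h set" where
  "filtration P H cop n = {x \<in> carr H. \<forall>p>n. \<forall>\<delta>\<in>ops P p. cop p \<delta> x = 0}"

definition Prim ::
  "('k::field, 'a::ab_group_add) operad \<Rightarrow> ('k, 'h::ab_group_add) vspace
    \<Rightarrow> (nat \<Rightarrow> 'a \<Rightarrow> 'h \<Rightarrow> ('k, 'h list) presented) \<Rightarrow> ('k, 'h) vspace" where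
  "Prim P H cop = H\<lparr>carr := filtration P H cop 1\<rparr>"

definition conilpotent ::
  "('k::field, 'a::ab_group_add) operad \<Rightarrow> ('k, 'h::ab_group_add) vspace
    \<Rightarrow> (nat \<Rightarrow> 'a \<Rightarrow> 'h \<Rightarrow> ('k, 'h list) presented) \<Rightarrow> bool" where
  "conilpotent P H cop \<longleftrightarrow> carr H = (\<Union>n. filtration P H cop n)"

definition algebra_iso ::
  "('k::field, 'a::ab_group_add) operad \<Rightarrow> ('k, 'g::ab_group_add) vspace \<Rightarrow> ('a \<Rightarrow> 'g list \<Rightarrow> 'g)
    \<Rightarrow> ('k, 'h::ab_group_add) vspace \<Rightarrow> ('a \<Rightarrow> 'h list \<Rightarrow> 'h) \<Rightarrow> ('g \<Rightarrow> 'h) \<Rightarrow> bool" where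
  "algebra_iso P G evG H evH f \<longleftrightarrow> linear_between G H f \<and> bij_betw f (carr G) (carr H) \<and>
     (\<forall>n. \<forall>a\<in>ops P n. \<forall>xs\<in>listset (replicate n (carr G)). f (evG a xs) = evH a (map f xs))"

definition coalgebra_iso ::
  "('k::field, 'a::ab_group_add) operad
    \<Rightarrow> ('k, 'g::ab_group_add) vspace \<Rightarrow> (nat \<Rightarrow> 'a \<Rightarrow> 'g \<Rightarrow> ('k, 'g list) presented)
    \<Rightarrow> ('k, 'h::ab_group_add) vspace \<Rightarrow> (nat \<Rightarrow> 'a \<Rightarrow> 'h \<Rightarrow> ('k, 'h list) presented)
    \<Rightarrow> ('g \<Rightarrow> 'h) \<Rightarrow> bool" where
  "coalgebra_iso P G copG H copH f \<longleftrightarrow> linear_between G H f \<and> bij_betw f (carr G) (carr H) \<and>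
     (\<forall>n. \<forall>\<delta>\<in>ops P n. \<forall>x\<in>carr G. copH n \<delta> (f x) = tensor_map H n f (copG n \<delta> x))"

section \<open>Free algebras and cofree conilpotent coalgebras\<close>

text \<open>
  \<open>schur P V\<close> is the direct sum of the coinvariants of \<open>P(n) \<otimes> V\<^sup>\<otimes>\<^sup>n\<close>. Its symbols are the pairs
  (b, v) with b of arity the length of v; the sum is direct because a form is an independent choice
  of a form for each length.
\<close>

definition schur_symbols :: "('k, 'b, 'z) smodule_scheme \<Rightarrow> ('k, 'v) vspace \<Rightarrow> ('b \<times> 'v list) set" where
  "schur_symbols P V = {(b, v). b \<in> ops P (length v) \<and> set v \<subseteq> carr V}"

definition schur_forms ::
  "('k::field, 'b::ab_group_add, 'z) smodule_scheme \<Rightarrow> ('k, 'v::ab_group_add) vspace \<Rightarrow> ('b \<times> 'v list \<Rightarrow> 'k) set" where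
  "schur_forms P V = {g. \<forall>n.
     (\<forall>v\<in>listset (replicate n (carr V)). linear_between (arity_space P n) ground (\<lambda>b. g (b, v))) \<and>
     (\<forall>b\<in>ops P n. multilinear_between (replicate n V) ground (\<lambda>v. g (b, v))) \<and>
     (\<forall>b\<in>ops P n. \<forall>v\<in>listset (replicate n (carr V)). \<forall>\<sigma>. \<sigma> permutes {..<n} \<longrightarrow>
        g (act P n \<sigma> b, permute_list \<sigma> v) = g (b, v))}"

definition schur ::
  "('k::field, 'b::ab_group_add, 'z) smodule_scheme \<Rightarrow> ('k, 'v::ab_group_add) vspace
    \<Rightarrow> ('k, ('k, 'b \<times> 'v list) presented) vspace" where
  "schur P V = presented_space (schur_symbols P V) (schur_forms P V)"

definition schur_map ::
  "('k::field, 'c::ab_group_add, 'z) smodule_scheme \<Rightarrow> ('k, 'v::ab_group_add) vspace \<Rightarrow> (nat \<Rightarrow> 'b \<Rightarrow> 'c)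
    \<Rightarrow> ('k, 'b \<times> 'v list) presented \<Rightarrow> ('k, 'c \<times> 'v list) presented" where
  "schur_map R V \<phi> t = lin_ext t (\<lambda>(b, v). gen (schur_forms R V) (\<phi> (length v) b, v))"

definition free_ev ::
  "('k::field, 'a::ab_group_add) operad \<Rightarrow> ('k, 'v::ab_group_add) vspace
    \<Rightarrow> 'a \<Rightarrow> ('k, 'a \<times> 'v list) presented list \<Rightarrow> ('k, 'a \<times> 'v list) presented" where
  "free_ev P V a ts = multi_ext ts (\<lambda>ps. gen (schur_forms P V)
     (gam P (map (length \<circ> snd) ps) a (map fst ps), concat (map snd ps)))"

definition compositions :: "nat \<Rightarrow> nat \<Rightarrow> nat list set" where
  "compositions k n = {ls. length ls = k \<and> sum_list ls = n \<and> (\<forall>l\<in>set ls. 1 \<le> l)}"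

text \<open>Representatives of the cosets \<open>\<sigma> (S\<^sub>l\<^sub>1 \<times> \<dots> \<times> S\<^sub>l\<^sub>k)\<close>.\<close>

definition unshuffles :: "nat list \<Rightarrow> (nat \<Rightarrow> nat) set" where
  "unshuffles ls = {\<sigma>. \<sigma> permutes {..<sum_list ls} \<and>
     (\<forall>w\<in>set (split_blocks ls (map \<sigma> [0..<sum_list ls])). sorted w)}"

definition basis_of :: "('k::field, 'a::ab_group_add, 'z) smodule_scheme \<Rightarrow> nat \<Rightarrow> 'a set" where
  "basis_of P n = (SOME B. finite B \<and> \<not> module.dependent (smul P) B \<and> module.span (smul P) B = ops P n)"

definition dual_basis_of :: "('k::field, 'a::ab_group_add, 'z) smodule_scheme \<Rightarrow> nat \<Rightarrow> 'a \<Rightarrow> 'a \<Rightarrow> 'k" where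
  "dual_basis_of P n b = (\<lambda>c. module.representation (smul P) (basis_of P n) c b)"

text \<open>
  The coalgebra structure of \<open>C\<^sup>c(V) = schur (dual_smodule C) V\<close>. The decomposition map of the dual
  cooperad \<open>C\<^sup>*\<close> is the transpose of the composition of C: an operation \<open>\<delta>\<close> of arity k sends
  \<open>f \<otimes> v\<close>, with f in \<open>C\<^sup>*(n)\<close>, to the sum over \<open>l\<^sub>1 + \<dots> + l\<^sub>k = n\<close> and over the unshuffles \<open>\<sigma>\<close> of the
  form \<open>(c\<^sub>1, \<dots>, c\<^sub>k) \<mapsto> (f \<cdot> \<sigma>)(\<gamma>(\<delta>; c\<^sub>1, \<dots>, c\<^sub>k))\<close>, regarded as an element of
  \<open>C\<^sup>*(l\<^sub>1) \<otimes> \<dots> \<otimes> C\<^sup>*(l\<^sub>k)\<close>, together with the blocks of \<open>v \<cdot> \<sigma>\<close>. That element is expanded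
  along dual bases; the result does not depend on the bases.
\<close>

definition cofree_cop ::
  "('k::field, 'a::ab_group_add) operad \<Rightarrow> ('k, 'v::ab_group_add) vspace
    \<Rightarrow> nat \<Rightarrow> 'a \<Rightarrow> ('k, ('a \<Rightarrow> 'k) \<times> 'v list) presented
    \<Rightarrow> ('k, ('k, ('a \<Rightarrow> 'k) \<times> 'v list) presented list) presented" where
  "cofree_cop C V k \<delta> t = lin_ext t (\<lambda>(f, v).
     \<Sum>ls\<in>compositions k (length v). \<Sum>\<sigma>\<in>unshuffles ls. \<Sum>bs\<in>listset (map (basis_of C) ls).
       fun_scale (act (dual_smodule C) (length v) \<sigma> f (gam C ls \<delta> bs))
         (pure (schur (dual_smodule C) V) k
           (map (\<lambda>(l, b, u). gen (schur_forms (dual_smodule C) V) (dual_basis_of C l b, u))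
             (zip ls (zip bs (split_blocks ls (permute_list \<sigma> v)))))))"

text \<open>The linear form on \<open>C(1) = K id\<close> with value 1 at id.\<close>

definition counit_form :: "('k::field, 'a::ab_group_add) operad \<Rightarrow> 'a \<Rightarrow> 'k" where
  "counit_form C = (\<lambda>a. module.representation (smul C) {unit C} a (unit C))"

section \<open>Confluence laws and bialgebras\<close>

text \<open>
  \<open>conf_space A m n\<close> is \<open>A\<^sup>\<otimes>\<^sup>m(n)\<close>, the direct sum over \<open>l\<^sub>1 + \<dots> + l\<^sub>m = n\<close> of the modules induced to
  \<open>S\<^sub>n\<close> from \<open>A(l\<^sub>1) \<otimes> \<dots> \<otimes> A(l\<^sub>m)\<close>, i.e. of its tensor product with \<open>K[S\<^sub>n]\<close> over
  \<open>K[S\<^sub>l\<^sub>1 \<times> \<dots> \<times> S\<^sub>l\<^sub>m]\<close>. The symbol (ls, as, w) stands for \<open>a\<^sub>1 \<otimes> \<dots> \<otimes> a\<^sub>m \<otimes> w\<close>.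
\<close>

type_synonym 'a conf_symbol = "nat list \<times> 'a list \<times> (nat \<Rightarrow> nat)"

definition conf_symbols :: "('k, 'a, 'z) smodule_scheme \<Rightarrow> nat \<Rightarrow> nat \<Rightarrow> 'a conf_symbol set" where
  "conf_symbols A m n =
     {(ls, as, w). ls \<in> compositions m n \<and> as \<in> listset (map (ops A) ls) \<and> w permutes {..<n}}"

definition conf_forms ::
  "('k::field, 'a::ab_group_add, 'z) smodule_scheme \<Rightarrow> nat \<Rightarrow> nat \<Rightarrow> ('a conf_symbol \<Rightarrow> 'k) set" where
  "conf_forms A m n = {g. \<forall>ls\<in>compositions m n. \<forall>w. w permutes {..<n} \<longrightarrow>
     multilinear_between (map (arity_space A) ls) ground (\<lambda>as. g (ls, as, w)) \<and>
     (\<forall>as\<in>listset (map (ops A) ls). \<forall>\<tau>s\<in>listset (map (\<lambda>l. {\<tau>. \<tau> permutes {..<l}}) ls).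
        g (ls, map (\<lambda>(l, \<tau>, a). act A l \<tau> a) (zip ls (zip \<tau>s as)), w) = g (ls, as, sum_perm \<tau>s ls \<circ> w))}"

definition conf_space ::
  "('k::field, 'a::ab_group_add, 'z) smodule_scheme \<Rightarrow> nat \<Rightarrow> nat \<Rightarrow> ('k, ('k, 'a conf_symbol) presented) vspace" where
  "conf_space A m n = presented_space (conf_symbols A m n) (conf_forms A m n)"

text \<open>Evaluation of an element of \<open>A\<^sup>\<otimes>\<^sup>m(n)\<close> at n elements of an A-algebra H, with values in the
  m-th tensor power of H.\<close>

definition conf_eval ::
  "('k::field, 'h::ab_group_add) vspace \<Rightarrow> ('a \<Rightarrow> 'h list \<Rightarrow> 'h) \<Rightarrow> nat
    \<Rightarrow> ('k, 'a conf_symbol) presented \<Rightarrow> 'h list \<Rightarrow> ('k, 'h list) presented" where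
  "conf_eval H ev m X ps = lin_ext X (\<lambda>(ls, as, w).
     pure H m (map2 ev as (split_blocks ls (permute_list (inv w) ps))))"

text \<open>\<open>\<alpha> m n \<delta> \<mu>\<close> is \<open>\<alpha>\<^sub>m\<^sub>,\<^sub>n(\<delta> \<otimes> \<mu>)\<close>, an element of \<open>A\<^sup>\<otimes>\<^sup>m(n)\<close>.\<close>

type_synonym ('k, 'a) conf_family = "nat \<Rightarrow> nat \<Rightarrow> 'a \<Rightarrow> 'a \<Rightarrow> ('k, 'a conf_symbol) presented"

locale bialgebra =
  operad_algebra A H ev + operad_coalgebra C H cop
  for A C :: "('k::field, 'a::ab_group_add) operad"
    and \<alpha> :: "('k, 'a) conf_family"
    and H :: "('k, 'h::ab_group_add) vspace" and ev cop +
  assumes compatible: "\<delta> \<in> ops C m \<Longrightarrow> \<mu> \<in> ops A n \<Longrightarrow> ps \<in> listset (replicate n (carr (Prim C H cop))) \<Longrightarrow>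
    cop m \<delta> (ev \<mu> ps) = conf_eval H ev m (\<alpha> m n \<delta> \<mu>) ps"

text \<open>
  The composite \<open>C(k) \<otimes> A(V) \<rightarrow> C(k) \<otimes> C\<^sup>c(V) \<rightarrow> C\<^sup>c(V)\<^sup>\<otimes>\<^sup>k \<rightarrow> A(V)\<^sup>\<otimes>\<^sup>k\<close> given by \<open>id \<otimes> \<phi>\<close>, the
  coalgebra structure of \<open>C\<^sup>c(V)\<close> and the k-th tensor power of the inverse of \<open>\<phi>\<close>.
\<close>

definition transported_cop ::
  "('k::field, 'a::ab_group_add) operad \<Rightarrow> ('k, 'a) operad \<Rightarrow> (nat \<Rightarrow> 'a \<Rightarrow> 'a \<Rightarrow> 'k)
    \<Rightarrow> ('k, 'v::ab_group_add) vspace \<Rightarrow> nat \<Rightarrow> 'a \<Rightarrow> ('k, 'a \<times> 'v list) presented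
    \<Rightarrow> ('k, ('k, 'a \<times> 'v list) presented list) presented" where
  "transported_cop A C \<phi> V k \<delta> t =
     tensor_map (schur A V) k (schur_map A V (\<lambda>l. inv_into (ops A l) (\<phi> l)))
       (cofree_cop C V k \<delta> (schur_map (dual_smodule C) V \<phi> t))"

definition coord_space :: "nat \<Rightarrow> ('k::field, nat \<Rightarrow> 'k) vspace" where
  "coord_space n = \<lparr>carr = {x. \<forall>i\<ge>n. x i = 0}, scl = fun_scale\<rparr>"

definition unit_vector :: "nat \<Rightarrow> nat \<Rightarrow> 'k::field" where
  "unit_vector i = (\<lambda>j. if j = i then 1 else 0)"

text \<open>
  The composite above is natural in V, so it is induced by maps \<open>\<alpha>\<^sub>k\<^sub>,\<^sub>n\<close> on the symmetric modules, and
  these are read off from the generic element: for \<open>V = K\<^sup>n\<close> with standard basis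
  \<open>e\<^sub>1, \<dots>, e\<^sub>n\<close>, \<open>\<alpha>\<^sub>k\<^sub>,\<^sub>n(\<delta> \<otimes> \<mu>)\<close> is the element of \<open>A\<^sup>\<otimes>\<^sup>k(n)\<close> whose value at
  \<open>e\<^sub>1, \<dots>, e\<^sub>n\<close> in \<open>A(V)\<^sup>\<otimes>\<^sup>k\<close> is the image of \<open>\<delta> \<otimes> \<mu>(e\<^sub>1, \<dots>, e\<^sub>n)\<close>. It is unique, as
  the multilinear part of \<open>A(K\<^sup>n)\<^sup>\<otimes>\<^sup>k\<close> is \<open>A\<^sup>\<otimes>\<^sup>k(n)\<close>.
\<close>

definition associated_law ::
  "('k::field, 'a::ab_group_add) operad \<Rightarrow> ('k, 'a) operad \<Rightarrow> (nat \<Rightarrow> 'a \<Rightarrow> 'a \<Rightarrow> 'k) \<Rightarrow> ('k, 'a) conf_family" where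
  "associated_law A C \<phi> k n \<delta> \<mu> =
    (let V = coord_space n; e = map unit_vector [0..<n] in
     THE X. X \<in> carr (conf_space A k n) \<and>
       conf_eval (schur A V) (free_ev A V) k X (map (\<lambda>x. gen (schur_forms A V) (unit A, [x])) e) =
       transported_cop A C \<phi> V k \<delta> (gen (schur_forms A V) (\<mu>, e)))"

end

theory Submission
  imports Defs
begin

text \<open>
  Existence of \<open>\<phi>\<close>: it suffices to find a nondegenerate invariant bilinear form on each finite-dimensional
  module M of the symmetric group. A permutation is conjugate to its inverse, so the character \<open>\<chi>\<close>
  of M satisfies \<open>\<Sum>\<chi>(\<sigma>)\<^sup>2 = \<Sum>\<chi>(\<sigma>)\<chi>(\<sigma>\<inverse>)\<close>, which is n! times the rank of the averaging projection of End(M);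
  hence averaging rank-one forms yields a nonzero invariant form \<open>\<beta>\<close>, which may be taken symmetric or
  alternating. By induction on the dimension the radical of \<open>\<beta>\<close> carries a nondegenerate form, and adding
  its pullback along an equivariant projection to \<open>\<beta>\<close> gives a nondegenerate form on M.

  Freeness: by definition of the associated law, the map \<open>f \<otimes> v \<mapsto> (\<phi>\<inverse> f)(v)\<close> from the cofree coalgebra on
  V = Prim H to H commutes with all operations of C. In top degree, \<open>\<delta>\<close> of arity n sends \<open>\<mu>(v\<^sub>1, \<dots>, v\<^sub>n)\<close> to the
  symmetrisation \<open>\<Sum>\<^sub>\<sigma> (\<phi>(\<mu>)\<cdot>\<sigma>)(\<delta>) v\<^sub>\<sigma>\<^sub>(\<^sub>1\<^sub>) \<otimes> \<dots> \<otimes> v\<^sub>\<sigma>\<^sub>(\<^sub>n\<^sub>)\<close>, which in characteristic 0 determines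
  the top-degree part of an element; this gives injectivity. For surjectivity, if x lies in the n-th step of the
  filtration then \<open>\<delta>(x)\<close> lies in \<open>V\<^sup>\<otimes>\<^sup>n\<close> for \<open>\<delta>\<close> of arity n, so symmetrising over a basis of C(n) produces an element
  of degree n whose image differs from x by an element of the previous step. As \<open>\<phi>(id)\<close> is only a multiple c of
  the counit, \<open>\<phi>\<^sub>n\<close> is first replaced by \<open>c\<^sup>-\<^sup>n \<phi>\<^sub>n\<close>, which has the same associated law.
\<close>

text \<open>The ground field is not assumed algebraically closed, so self-duality is not read off
  from irreducible characters; passing to the radical of an invariant form replaces a decomposition
  into simple modules. Symmetric and alternating forms have equal left and right radicals, which
  keeps the sum of \<beta> and the form pulled back from its radical nondegenerate. The bialgebra
  condition speaks only of operations applied to primitive elements. That is enough because A(V) is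
  spanned by generators \<mu> \<otimes> v with letters in V, so \<delta> is known on the image of
  A(V) before that image is known to be H. The associated law is given by a definite description and
  has to be replaced by an explicit sum over compositions, unshuffles and dual bases. Unshuffles do
  not form a group and the bases are arbitrary, so most of the preparation shows that this sum
  respects the relations of the quotients involved. As quotients are realised by functions on their
  forms, each such check says that some scalar function is a form.\<close>

lemma listset_Cons_iff [simp]: "x # xs \<in> listset (A # As) \<longleftrightarrow> x \<in> A \<and> xs \<in> listset As"
  by (auto simp: listset.simps(2) set_Cons_def)

declare listset.simps(2) [simp del]

lemma listset_iff_nth:
  "xs \<in> listset As \<longleftrightarrow> length xs = length As \<and> (\<forall>i<length As. xs ! i \<in> As ! i)"
proof (induction As arbitrary: xs)
  case (Cons A As)
  show ?case
    by (cases xs) (use Cons.IH in \<open>auto simp: listset.simps(2) set_Cons_def All_less_Suc2\<close>)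
qed auto

lemma listset_length: "xs \<in> listset As \<Longrightarrow> length xs = length As"
  by (simp add: listset_iff_nth)

lemma listset_replicate_iff: "xs \<in> listset (replicate n S) \<longleftrightarrow> length xs = n \<and> set xs \<subseteq> S"
  by (auto simp: listset_iff_nth in_set_conv_nth subset_iff)

lemma listset_update: "xs \<in> listset As \<Longrightarrow> y \<in> As ! i \<Longrightarrow> xs[i := y] \<in> listset As"
  by (metis length_list_update listset_iff_nth nth_list_update_eq nth_list_update_neq)

lemma listset_eq_Cons:
  "xs \<in> listset (A # As) \<longleftrightarrow> (\<exists>y ys. xs = y # ys \<and> y \<in> A \<and> ys \<in> listset As)"
  by (auto simp: listset.simps(2) set_Cons_def)

lemma sum_listset_Cons:
  "(\<Sum>xs\<in>listset (A # As). F xs) = (\<Sum>x\<in>A. \<Sum>xs\<in>listset As. F (x # xs))"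
proof -
  have "listset (A # As) = (\<lambda>(x, xs). x # xs) ` (A \<times> listset As)"
    by (auto simp: listset.simps(2) set_Cons_def)
  moreover have "inj_on (\<lambda>(x, xs). x # xs) (A \<times> listset As)" by (auto simp: inj_on_def)
  ultimately have "(\<Sum>xs\<in>listset (A # As). F xs) = (\<Sum>p\<in>A \<times> listset As. F ((\<lambda>(x, xs). x # xs) p))"
    by (simp add: sum.reindex)
  then show ?thesis by (simp add: sum.cartesian_product case_prod_beta')
qed

subsection \<open>Linear and multilinear maps between subspaces\<close>

lemma is_vspace_zero: "is_vspace V \<Longrightarrow> 0 \<in> carr V"
  unfolding is_vspace_def using module.subspace_0 module_iff_vector_space by blast

lemma is_vspace_add: "is_vspace V \<Longrightarrow> x \<in> carr V \<Longrightarrow> y \<in> carr V \<Longrightarrow> x + y \<in> carr V"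
  unfolding is_vspace_def using module.subspace_add module_iff_vector_space by blast

lemma is_vspace_scale: "is_vspace V \<Longrightarrow> x \<in> carr V \<Longrightarrow> scl V c x \<in> carr V"
  unfolding is_vspace_def using module.subspace_scale module_iff_vector_space by blast

lemma is_vspace_diff: "is_vspace V \<Longrightarrow> x \<in> carr V \<Longrightarrow> y \<in> carr V \<Longrightarrow> x - y \<in> carr V"
  unfolding is_vspace_def using module.subspace_diff module_iff_vector_space by blast

lemma is_vspace_sum: "is_vspace V \<Longrightarrow> (\<And>i. i \<in> I \<Longrightarrow> f i \<in> carr V) \<Longrightarrow> sum f I \<in> carr V"
  unfolding is_vspace_def using module.subspace_sum module_iff_vector_space by blast

lemma is_vspace_vector_space: "is_vspace V \<Longrightarrow> vector_space (scl V)"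
  by (simp add: is_vspace_def)

lemma is_vspace_ground: "is_vspace (ground :: ('k::field, 'k) vspace)"
proof -
  interpret vector_space "(*) :: 'k \<Rightarrow> _" by unfold_locales (auto simp: algebra_simps)
  show ?thesis by (simp add: is_vspace_def ground_def vector_space_axioms)
qed

lemma carr_ground [simp]: "carr ground = UNIV" and scl_ground [simp]: "scl ground = (*)"
  by (simp_all add: ground_def)

lemma carr_presented: "carr (presented_space X Q) = fun_space.span (gen Q ` X)"
  and scl_presented [simp]: "scl (presented_space X Q) = fun_scale"
  by (simp_all add: presented_space_def)

lemma linear_betweenD:
  assumes "linear_between V W f"
  shows "x \<in> carr V \<Longrightarrow> f x \<in> carr W"
    and "x \<in> carr V \<Longrightarrow> y \<in> carr V \<Longrightarrow> f (x + y) = f x + f y"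
    and "x \<in> carr V \<Longrightarrow> f (scl V c x) = scl W c (f x)"
  using assms by (auto simp: linear_between_def)

lemma linear_between_zero: "linear_between V W f \<Longrightarrow> is_vspace V \<Longrightarrow> f 0 = 0"
  using linear_betweenD(2)[of V W f 0 0] is_vspace_zero[of V] by simp

lemma linear_between_diff:
  assumes "linear_between V W f" "is_vspace V" "x \<in> carr V" "y \<in> carr V"
  shows "f (x - y) = f x - f y"
  using linear_betweenD(2)[OF assms(1), of "x - y" y] assms is_vspace_diff
  by (metis add_diff_cancel diff_add_cancel)

lemma linear_between_sum:
  assumes "linear_between V W f" "is_vspace V" "\<And>i. i \<in> I \<Longrightarrow> g i \<in> carr V"
  shows "f (\<Sum>i\<in>I. g i) = (\<Sum>i\<in>I. f (g i))"
  using assms(3)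
proof (induction I rule: infinite_finite_induct)
  case (insert i I)
  then show ?case
    using assms(1,2) by (simp add: linear_betweenD(2) is_vspace_sum)
qed (use assms linear_between_zero in auto)

lemma linear_between_compose:
  "linear_between U V f \<Longrightarrow> linear_between V W g \<Longrightarrow> linear_between U W (\<lambda>x. g (f x))"
  by (simp add: linear_between_def)

text \<open>Closure of the carrier matters: linearity also compares the two functions at sums and
  multiples.\<close>

lemma linear_between_cong:
  "(\<And>x. x \<in> carr V \<Longrightarrow> f x = g x) \<Longrightarrow> is_vspace V \<Longrightarrow> linear_between V W f = linear_between V W g"
  by (simp add: linear_between_def is_vspace_add is_vspace_scale)

lemma linear_between_inv_into:
  assumes "linear_between V W f" "bij_betw f (carr V) (carr W)" "is_vspace V"
  shows "linear_between W V (inv_into (carr V) f)"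
  unfolding linear_between_def
proof (intro conjI ballI allI)
  note b = bij_betw_inv_into_right[OF assms(2)] and i = bij_betw_inv_into_left[OF assms(2)]
  have c: "inv_into (carr V) f y \<in> carr V" if "y \<in> carr W" for y
    using assms(2) that by (metis bij_betw_imp_surj_on inv_into_into)
  fix y assume y: "y \<in> carr W"
  then show "inv_into (carr V) f y \<in> carr V" by (rule c)
  show "inv_into (carr V) f (scl W a y) = scl V a (inv_into (carr V) f y)" for a
    using i[OF is_vspace_scale[OF assms(3) c[OF y]], of a] linear_betweenD(3)[OF assms(1) c[OF y]] b y
    by simp
  fix z assume z: "z \<in> carr W"
  show "inv_into (carr V) f (y + z) = inv_into (carr V) f y + inv_into (carr V) f z"
    using i[OF is_vspace_add[OF assms(3) c[OF y] c[OF z]]] linear_betweenD(2)[OF assms(1) c[OF y] c[OF z]] b y z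
    by simp
qed

lemma multilinear_betweenD:
  assumes "multilinear_between Vs W f" "xs \<in> listset (map carr Vs)"
  shows "f xs \<in> carr W" and "i < length Vs \<Longrightarrow> linear_between (Vs ! i) W (\<lambda>y. f (xs[i := y]))"
  using assms by (auto simp: multilinear_between_def)

lemma multilinear_between_Nil [simp]: "multilinear_between [] W f \<longleftrightarrow> f [] \<in> carr W"
  by (simp add: multilinear_between_def)

lemma multilinear_between_Cons:
  "multilinear_between (V # Vs) W f \<longleftrightarrow>
    (\<forall>xs\<in>listset (map carr Vs). linear_between V W (\<lambda>x. f (x # xs))) \<and>
    (\<forall>x\<in>carr V. multilinear_between Vs W (\<lambda>xs. f (x # xs)))" (is "?L \<longleftrightarrow> ?R")
proof
  assume L: ?L
  have "linear_between V W (\<lambda>x. f (x # xs))" if xs: "xs \<in> listset (map carr Vs)" for xs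
  \<comment> \<open>If the first carrier is empty, the left side says nothing about the tails, but
    the linearity to be shown is then vacuous.\<close>
  proof (cases "carr V = {}")
    case False
    then obtain x where "x \<in> carr V" by auto
    then show ?thesis
      using multilinear_betweenD(2)[OF L, of "x # xs" 0] xs by simp
  qed (simp add: linear_between_def)
  moreover have "multilinear_between Vs W (\<lambda>xs. f (x # xs))" if "x \<in> carr V" for x
    unfolding multilinear_between_def
  proof (intro ballI conjI allI impI)
    fix xs assume "xs \<in> listset (map carr Vs)"
    then have xs: "x # xs \<in> listset (map carr (V # Vs))" using that by simp
    show "f (x # xs) \<in> carr W" by (rule multilinear_betweenD(1)[OF L xs])
    fix i assume "i < length Vs"
    then show "linear_between (Vs ! i) W (\<lambda>y. f (x # xs[i := y]))"
      using multilinear_betweenD(2)[OF L xs, of "Suc i"] by simp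
  qed
  ultimately show ?R by blast
next
  assume R: ?R
  show ?L unfolding multilinear_between_def
  proof (intro ballI conjI allI impI)
    fix xs assume "xs \<in> listset (map carr (V # Vs))"
    then obtain y ys where xs: "xs = y # ys" "y \<in> carr V" "ys \<in> listset (map carr Vs)"
      by (auto simp: listset.simps(2) set_Cons_def)
    show "f xs \<in> carr W" using R xs by (auto dest: multilinear_betweenD(1))
    fix i assume "i < length (V # Vs)"
    then show "linear_between ((V # Vs) ! i) W (\<lambda>y. f (xs[i := y]))"
      using R xs by (cases i) (auto dest: multilinear_betweenD(2))
  qed
qed

lemma multilinear_between_cong:
  assumes "\<And>xs. xs \<in> listset (map carr Vs) \<Longrightarrow> f xs = g xs" "\<And>V. V \<in> set Vs \<Longrightarrow> is_vspace V"
  shows "multilinear_between Vs W f = multilinear_between Vs W g"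
  using assms
proof (induction Vs arbitrary: f g)
  case (Cons V Vs)
  have "linear_between V W (\<lambda>x. f (x # xs)) = linear_between V W (\<lambda>x. g (x # xs))"
    if "xs \<in> listset (map carr Vs)" for xs
    using Cons.prems that by (intro linear_between_cong) auto
  moreover have "multilinear_between Vs W (\<lambda>xs. f (x # xs)) = multilinear_between Vs W (\<lambda>xs. g (x # xs))"
    if "x \<in> carr V" for x
    using Cons.prems that by (intro Cons.IH) auto
  ultimately show ?case by (simp add: multilinear_between_Cons)
qed simp

lemma linear_between_combine:
  assumes "is_vspace W" "linear_between V W f" "linear_between V W g"
  shows "linear_between V W (\<lambda>x. scl W c (f x) + g x)"
proof -
  interpret W: vector_space "scl W" using assms(1) by (rule is_vspace_vector_space)
  show ?thesis using assms
    by (auto simp: linear_between_def is_vspace_add is_vspace_scale W.scale_right_distrib W.scale_left_commute)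
qed

lemma linear_between_const_zero: "is_vspace W \<Longrightarrow> linear_between V W (\<lambda>x. 0)"
proof -
  assume W: "is_vspace W"
  interpret W: vector_space "scl W" using W by (rule is_vspace_vector_space)
  show ?thesis using W by (auto simp: linear_between_def is_vspace_zero)
qed

lemma multilinear_between_combine:
  assumes "is_vspace W" "multilinear_between Vs W f" "multilinear_between Vs W g"
  shows "multilinear_between Vs W (\<lambda>x. scl W c (f x) + g x)"
  using assms unfolding multilinear_between_def
  by (auto intro!: linear_between_combine is_vspace_add is_vspace_scale)

lemma multilinear_between_const_zero: "is_vspace W \<Longrightarrow> multilinear_between Vs W (\<lambda>x. 0)"
  unfolding multilinear_between_def
  by (auto intro!: linear_between_const_zero is_vspace_zero)

lemma multilinear_between_sum_scale:
  assumes "is_vspace W" "\<And>i. i \<in> I \<Longrightarrow> multilinear_between Vs W (f i)"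
  shows "multilinear_between Vs W (\<lambda>x. \<Sum>i\<in>I. scl W (c i) (f i x))"
  using assms(2)
proof (induction I rule: infinite_finite_induct)
  case (insert i I)
  then show ?case
    using multilinear_between_combine[OF assms(1), of Vs "f i" _ "c i"] by simp
qed (auto simp: multilinear_between_const_zero assms)

lemma linear_between_sum_scale:
  assumes "is_vspace W" "\<And>i. i \<in> I \<Longrightarrow> linear_between V W (f i)"
  shows "linear_between V W (\<lambda>x. \<Sum>i\<in>I. scl W (c i) (f i x))"
  using assms(2)
proof (induction I rule: infinite_finite_induct)
  case (insert i I)
  then show ?case
    using linear_between_combine[OF assms(1), of V "f i" _ "c i"] by simp
qed (auto simp: linear_between_const_zero assms)

lemma multilinear_between_compose:
  "multilinear_between Vs W f \<Longrightarrow> linear_between W U h \<Longrightarrow> multilinear_between Vs U (\<lambda>xs. h (f xs))"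
  unfolding multilinear_between_def
proof (intro ballI conjI allI impI)
  fix xs assume f: "\<forall>xs\<in>listset (map carr Vs). f xs \<in> carr W \<and>
        (\<forall>i<length Vs. linear_between (Vs ! i) W (\<lambda>y. f (xs[i := y])))"
    and h: "linear_between W U h" and xs: "xs \<in> listset (map carr Vs)"
  show "h (f xs) \<in> carr U" using f xs linear_betweenD(1)[OF h] by simp
  fix i assume "i < length Vs"
  then show "linear_between (Vs ! i) U (\<lambda>y. h (f (xs[i := y])))"
    using f xs by (intro linear_between_compose[OF _ h]) simp
qed

lemma multilinear_between_map:
  assumes "multilinear_between (replicate n W) U F" "linear_between V W g"
  shows "multilinear_between (replicate n V) U (\<lambda>xs. F (map g xs))"
  unfolding multilinear_between_def
proof (intro ballI conjI allI impI)
  fix xs assume "xs \<in> listset (map carr (replicate n V))"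
  then have xs: "map g xs \<in> listset (map carr (replicate n W))"
    using linear_betweenD(1)[OF assms(2)] by (auto simp: listset_replicate_iff)
  show "F (map g xs) \<in> carr U" using multilinear_betweenD(1)[OF assms(1) xs] .
  fix i assume "i < length (replicate n V)"
  then show "linear_between (replicate n V ! i) U (\<lambda>y. F (map g (xs[i := y])))"
    using linear_between_compose[OF assms(2), of U "\<lambda>y. F ((map g xs)[i := y])"]
      multilinear_betweenD(2)[OF assms(1) xs, of i] by (simp add: map_update)
qed

text \<open>\<open>permute_list \<sigma>\<close> puts the entry \<open>xs ! \<sigma> j\<close> at
  position j, so a change at position i shows up where \<sigma> j = i.\<close>

lemma permute_list_update:
  assumes "\<sigma> permutes {..<length xs}" "i < length xs"
  shows "permute_list \<sigma> (xs[i := y]) = (permute_list \<sigma> xs)[inv \<sigma> i := y]"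
proof (rule nth_equalityI)
  fix j assume "j < length (permute_list \<sigma> (xs[i := y]))"
  then have j: "j < length xs" by simp
  have "inv \<sigma> i = j \<longleftrightarrow> \<sigma> j = i" using permutes_inv_eq[OF assms(1), of i j] by metis
  moreover have "\<sigma> j < length xs" using permutes_in_image[OF assms(1), of j] j by simp
  ultimately show "permute_list \<sigma> (xs[i := y]) ! j = (permute_list \<sigma> xs)[inv \<sigma> i := y] ! j"
    using assms j by (auto simp: permute_list_nth nth_list_update)
qed simp

lemma multilinear_between_permute:
  assumes "multilinear_between (replicate n V) W F" "\<sigma> permutes {..<n}"
  shows "multilinear_between (replicate n V) W (\<lambda>xs. F (permute_list \<sigma> xs))"
  unfolding multilinear_between_def
proof (intro ballI conjI allI impI)
  fix xs assume xs0: "xs \<in> listset (map carr (replicate n V))"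
  then have n: "length xs = n" by (auto simp: listset_replicate_iff)
  have xs: "permute_list \<sigma> xs \<in> listset (map carr (replicate n V))"
    using xs0 assms(2) by (auto simp: listset_replicate_iff)
  show "F (permute_list \<sigma> xs) \<in> carr W" using multilinear_betweenD(1)[OF assms(1) xs] .
  fix i assume i: "i < length (replicate n V)"
  then have "inv \<sigma> i < n" using permutes_in_image[OF permutes_inv[OF assms(2)], of i] by simp
  then show "linear_between (replicate n V ! i) W (\<lambda>y. F (permute_list \<sigma> (xs[i := y])))"
    using multilinear_betweenD(2)[OF assms(1) xs, of "inv \<sigma> i"] i n assms(2)
    by (simp add: permute_list_update)
qed

text \<open>Span induction in several variables, one argument after the other. It is used both to
  place the values of a multilinear map in a subspace and, with the zero subspace, to compare two
  such maps on generators.\<close>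

lemma multilinear_between_span:
  assumes "multilinear_between Vs W F" "is_vspace W" "module.subspace (scl W) S"
    and "list_all2 (\<lambda>V B. is_vspace V \<and> carr V = module.span (scl V) B) Vs Bs"
    and "\<And>bs. bs \<in> listset Bs \<Longrightarrow> F bs \<in> S" "xs \<in> listset (map carr Vs)"
  shows "F xs \<in> S"
  using assms(4,1,5,6)
proof (induction arbitrary: F xs rule: list_all2_induct)
  case Nil
  then show ?case by simp
next
  case (Cons V Vs B Bs)
  interpret W: vector_space "scl W" using assms(2) by (rule is_vspace_vector_space)
  interpret V: vector_space "scl V" using Cons by (auto intro: is_vspace_vector_space)
  obtain x xs' where xs: "xs = x # xs'" "x \<in> carr V" "xs' \<in> listset (map carr Vs)"
    using Cons.prems by (auto simp: listset.simps(2) set_Cons_def)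
  have lin: "linear_between V W (\<lambda>x. F (x # xs'))"
    and ml: "\<And>x. x \<in> carr V \<Longrightarrow> multilinear_between Vs W (\<lambda>xs. F (x # xs))"
    using Cons.prems xs by (auto simp: multilinear_between_Cons)
  have V: "is_vspace V" "carr V = V.span B" using Cons by auto
  have "x \<in> V.span B" using xs V by simp
  \<comment> \<open>Membership in the carrier is carried along, since linearity is only available
    there.\<close>
  then have "x \<in> carr V \<and> F (x # xs') \<in> S"
  proof (induction rule: V.span_induct_alt)
    case base
    have "F (0 # xs') = 0" using linear_between_zero[OF lin V(1)] by simp
    then show ?case using assms(3) W.subspace_0 V(1) by (simp add: is_vspace_zero)
  next
    case (step c b y)
    then have b: "b \<in> carr V" and y: "y \<in> carr V" using V by (auto intro: V.span_base)
    have "F (b # xs') \<in> S"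
    proof (rule Cons.IH[OF ml[OF b] _ xs(3)])
      fix bs assume "bs \<in> listset Bs"
      then show "F (b # bs) \<in> S" using step(1) by (intro Cons.prems(2)) simp
    qed
    moreover have "F ((scl V c b + y) # xs') = scl W c (F (b # xs')) + F (y # xs')"
      using linear_betweenD(2,3)[OF lin] b y is_vspace_scale[OF V(1) b] by simp
    ultimately show ?case
      using step assms(3) W.subspace_add W.subspace_scale V(1) b y
      by (simp add: is_vspace_add is_vspace_scale)
  qed
  then show ?case using xs by simp
qed

subsection \<open>Spaces of forms\<close>

text \<open>\<open>gen Q x\<close> vanishes outside Q. Closure of Q under changes outside X makes the membership of a form
  depend only on its values at the symbols.\<close>

definition form_space :: "'x set \<Rightarrow> ('x \<Rightarrow> 'k::field) set \<Rightarrow> bool" where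
  "form_space X Q \<longleftrightarrow> fun_space.subspace Q \<and> (\<forall>q\<in>Q. \<forall>q'. (\<forall>x\<in>X. q' x = q x) \<longrightarrow> q' \<in> Q)"

lemma form_spaceI:
  assumes "(\<lambda>x. 0) \<in> Q" "\<And>c q q'. q \<in> Q \<Longrightarrow> q' \<in> Q \<Longrightarrow> (\<lambda>x. c * q x + q' x) \<in> Q"
    and "\<And>q q'. q \<in> Q \<Longrightarrow> (\<And>x. x \<in> X \<Longrightarrow> q' x = q x) \<Longrightarrow> q' \<in> Q"
  shows "form_space X Q"
proof -
  have "p + q \<in> Q" if "p \<in> Q" "q \<in> Q" for p q
    using assms(2)[OF that, of 1] by (simp add: plus_fun_def)
  moreover have "fun_scale c q \<in> Q" if "q \<in> Q" for c q
    using assms(2)[OF that assms(1), of c] by (simp add: fun_scale_def)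
  ultimately have "fun_space.subspace Q"
    using assms(1) by (auto simp: fun_space.subspace_def zero_fun_def)
  with assms(3) show ?thesis by (auto simp: form_space_def)
qed

lemma form_space_combine:
  assumes "form_space X Q" "q \<in> Q" "q' \<in> Q"
  shows "(\<lambda>x. c * q x + q' x) \<in> Q"
proof -
  have "fun_scale c q + q' \<in> Q"
    using assms by (auto simp: form_space_def fun_space.subspace_add fun_space.subspace_scale)
  then show ?thesis by (simp add: plus_fun_def fun_scale_def)
qed

lemma form_space_zero: "form_space X Q \<Longrightarrow> (\<lambda>x. 0) \<in> Q"
  using fun_space.subspace_0[of Q] by (simp add: form_space_def zero_fun_def)

lemma form_space_cong:
  "form_space X Q \<Longrightarrow> (\<And>x. x \<in> X \<Longrightarrow> q x = q' x) \<Longrightarrow> q \<in> Q \<longleftrightarrow> q' \<in> Q"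
  unfolding form_space_def by metis

lemma gen_in_carr: "x \<in> X \<Longrightarrow> gen Q x \<in> carr (presented_space X Q)"
  by (simp add: carr_presented fun_space.span_base)

lemma presented_induct [consumes 1, case_names zero step]:
  assumes "t \<in> carr (presented_space X Q)" "P 0"
    and "\<And>c x u. x \<in> X \<Longrightarrow> u \<in> carr (presented_space X Q) \<Longrightarrow> P u \<Longrightarrow> P (fun_scale c (gen Q x) + u)"
  shows "P t"
proof -
  have "t \<in> fun_space.span (gen Q ` X)" using assms(1) by (simp add: carr_presented)
  then have "t \<in> carr (presented_space X Q) \<and> P t"
  proof (rule fun_space.span_induct_alt)
    show "0 \<in> carr (presented_space X Q) \<and> P 0"
      using assms(2) is_vspace_zero[OF is_vspace_presented_space[of X Q]] by blast
  next
    fix c x y assume "x \<in> gen Q ` X" and y: "y \<in> carr (presented_space X Q) \<and> P y"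
    then obtain z where z: "z \<in> X" "x = gen Q z" by auto
    have "fun_scale c x \<in> carr (presented_space X Q)"
      using is_vspace_scale[OF is_vspace_presented_space[of X Q] gen_in_carr[OF z(1)], of c] z(2) by (metis scl_presented)
    then have "fun_scale c x + y \<in> carr (presented_space X Q)"
      using is_vspace_add[OF is_vspace_presented_space[of X Q]] y by blast
    then show "fun_scale c x + y \<in> carr (presented_space X Q) \<and> P (fun_scale c x + y)"
      using assms(3)[OF z(1)] y z(2) by blast
  qed
  then show ?thesis ..
qed

lemma presented_outside: "t \<in> carr (presented_space X Q) \<Longrightarrow> q \<notin> Q \<Longrightarrow> t q = 0"
 
  by (induction rule: presented_induct) (auto simp: fun_scale_def gen_def)

text \<open>Evaluations are cut off outside Q, so agreement on X is enough only because
  \<open>form_space\<close> makes q and q' forms together or not at all.\<close>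

lemma presented_cong:
  assumes "t \<in> carr (presented_space X Q)" "form_space X Q" "\<And>x. x \<in> X \<Longrightarrow> q x = q' x"
  shows "t q = t q'"
proof -
  have "q \<in> Q \<longleftrightarrow> q' \<in> Q" using form_space_cong[OF assms(2,3)] .
  with assms(1,3) show ?thesis
    by (induction rule: presented_induct) (auto simp: fun_scale_def gen_def)
qed

text \<open>Elements of the quotient act linearly on the forms; Q being a subspace keeps the
  combination clear of the cut-off.\<close>

lemma presented_combine:
  assumes "t \<in> carr (presented_space X Q)" "form_space X Q" "q \<in> Q" "q' \<in> Q"
  shows "t (\<lambda>x. c * q x + q' x) = c * t q + t q'"
  using assms(1)
proof (induction rule: presented_induct)
  case (step a x u)
  then show ?case
    using assms form_space_combine[OF assms(2-4)] by (auto simp: fun_scale_def gen_def algebra_simps)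
qed simp

lemma presented_zero:
  assumes "t \<in> carr (presented_space X Q)"
  shows "t (\<lambda>x. 0) = 0"
  using assms
  by (induction rule: presented_induct) (auto simp: fun_scale_def gen_def)

lemma presented_scale:
  assumes "t \<in> carr (presented_space X Q)" "form_space X Q" "q \<in> Q"
  shows "t (\<lambda>x. c * q x) = c * t q"
  using presented_combine[OF assms form_space_zero[OF assms(2)], of c] presented_zero[OF assms(1)] by simp

lemma presented_eqI:
  assumes "t \<in> carr (presented_space X Q)" "u \<in> carr (presented_space X Q)"
    and "\<And>q. q \<in> Q \<Longrightarrow> t q = u q"
  shows "t = u"
proof
  fix q show "t q = u q"
    using assms(3) presented_outside[OF assms(1)] presented_outside[OF assms(2)] by (cases "q \<in> Q") auto
qed

lemma linear_between_apply: "linear_between (presented_space X Q) ground (\<lambda>t. t q)"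
  by (simp add: linear_between_def fun_scale_def)

text \<open>A function of two variables that respects the relations in each of them still respects
  those of y after a quotient element has been applied in x: a generator returns G x, and forms are
  closed under combinations.\<close>

lemma form_space_swap:
  assumes "form_space X Q" "form_space Y R"
    and "\<And>x. x \<in> X \<Longrightarrow> G x \<in> R" "\<And>y. y \<in> Y \<Longrightarrow> (\<lambda>x. G x y) \<in> Q"
    and "t \<in> carr (presented_space X Q)"
  shows "(\<lambda>y. t (\<lambda>x. G x y)) \<in> R"
  using assms(5)
proof (induction rule: presented_induct)
  case zero
  show ?case using form_space_zero[OF assms(2)] by simp
next
  case (step c x u)
  note x = step.hyps(1)
  \<comment> \<open>This function agrees with the required one only on Y, where G is a form in x;
    closure of R under changes outside Y does the rest.\<close>
  have "(\<lambda>y. c * G x y + u (\<lambda>x. G x y)) \<in> R"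
    using form_space_combine[OF assms(2) assms(3)[OF x] step.IH] .
  moreover have "c * G x y + u (\<lambda>x. G x y) = (fun_scale c (gen Q x) + u) (\<lambda>x. G x y)" if "y \<in> Y" for y
    using assms(4)[OF that] by (simp add: gen_def fun_scale_def)
  ultimately show ?case by (subst (asm) form_space_cong[OF assms(2)]) auto
qed

subsection \<open>Linear maps out of presented spaces\<close>

text \<open>The criterion for F to extend linearly to the quotient. That F kills the relations is
  expressed dually: every form on the target pulls back to a form on the source.\<close>

definition presented_map ::
  "'x set \<Rightarrow> ('x \<Rightarrow> 'k::field) set \<Rightarrow> 'y set \<Rightarrow> ('y \<Rightarrow> 'k) set \<Rightarrow> ('x \<Rightarrow> ('k, 'y) presented) \<Rightarrow> bool" where
  "presented_map X Q Y R F \<longleftrightarrow>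
     (\<forall>x\<in>X. F x \<in> carr (presented_space Y R)) \<and> (\<forall>q\<in>R. (\<lambda>x. F x q) \<in> Q)"

lemma lin_ext_gen_map:
  assumes "form_space X Q" "presented_map X Q Y R F" "x \<in> X"
  shows "lin_ext (gen Q x) F = F x"
proof
  fix q
  have "(\<lambda>x. F x q) \<in> Q"
  proof (cases "q \<in> R")
    \<comment> \<open>For q outside R the values F x q vanish at all symbols, so the function is a
      form by comparison with 0.\<close>
    case False
    then have "F x q = 0" if "x \<in> X" for x
      using assms(2) that presented_outside[of "F x" Y R q] by (auto simp: presented_map_def)
    then show ?thesis
      using form_space_cong[OF assms(1), of "\<lambda>x. F x q" "\<lambda>x. 0"] form_space_zero[OF assms(1)] by simp
  qed (use assms(2) in \<open>auto simp: presented_map_def\<close>)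
  then show "lin_ext (gen Q x) F q = F x q" by (simp add: lin_ext_def gen_def)
qed

lemma lin_ext_zero: "lin_ext 0 F = 0"
  by (auto simp: lin_ext_def)

lemma lin_ext_linear:
  assumes "form_space X Q" "presented_map X Q Y R F"
  shows "linear_between (presented_space X Q) (presented_space Y R) (\<lambda>t. lin_ext t F)"
proof -
  have "lin_ext t F \<in> carr (presented_space Y R)" if "t \<in> carr (presented_space X Q)" for t
    using that 
  proof (induction rule: presented_induct)
    case zero
    show ?case using is_vspace_zero[OF is_vspace_presented_space[of Y R]] by (metis lin_ext_zero)
  next
    case (step c x u)
    note x = step.hyps(1)
    have "F x \<in> carr (presented_space Y R)" using assms(2) x by (auto simp: presented_map_def)
    then have "fun_scale c (F x) + lin_ext u F \<in> carr (presented_space Y R)"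
      using step.IH is_vspace_add[OF is_vspace_presented_space[of Y R]]
        is_vspace_scale[OF is_vspace_presented_space[of Y R]] by (metis scl_presented)
    moreover have "lin_ext (fun_scale c (gen Q x) + u) F = fun_scale c (F x) + lin_ext u F"
      by (simp add: lin_ext_add lin_ext_scale lin_ext_gen_map[OF assms x])
    ultimately show ?case by metis
  qed
  then show ?thesis by (simp add: linear_between_def lin_ext_add lin_ext_scale)
qed

lemma linear_between_combineD:
  assumes "linear_between (presented_space X Q) W f" "x \<in> X" "u \<in> carr (presented_space X Q)"
  shows "f (fun_scale c (gen Q x) + u) = scl W c (f (gen Q x)) + f u"
proof -
  note x = gen_in_carr[OF assms(2), of Q]
  have "fun_scale c (gen Q x) \<in> carr (presented_space X Q)"
    using is_vspace_scale[OF is_vspace_presented_space[of X Q] x, of c] by (metis scl_presented)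
  then show ?thesis
    using linear_betweenD(2)[OF assms(1) _ assms(3)] linear_betweenD(3)[OF assms(1) x, of c]
    by (metis scl_presented)
qed

lemma presented_linear_eqI:
  assumes "linear_between (presented_space X Q) W f" "linear_between (presented_space X Q) W g"
    and "\<And>x. x \<in> X \<Longrightarrow> f (gen Q x) = g (gen Q x)" "t \<in> carr (presented_space X Q)"
  shows "f t = g t"
  using assms(4)
proof (induction rule: presented_induct)
  case zero
  show ?case
    using linear_between_zero[OF assms(1) is_vspace_presented_space]
      linear_between_zero[OF assms(2) is_vspace_presented_space] by metis
next
  case (step c x u)
  show ?case
    using linear_between_combineD[OF assms(1) step.hyps, of c]
      linear_between_combineD[OF assms(2) step.hyps, of c] assms(3) step by metis
qed

lemma presented_linear_in:
  assumes "linear_between (presented_space X Q) W f" "is_vspace W" "module.subspace (scl W) S"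
    and "\<And>x. x \<in> X \<Longrightarrow> f (gen Q x) \<in> S" "t \<in> carr (presented_space X Q)"
  shows "f t \<in> S"
  using assms(5)
proof (induction rule: presented_induct)
  interpret W: vector_space "scl W" using assms(2) by (rule is_vspace_vector_space)
  case zero
  show ?case
    using linear_between_zero[OF assms(1) is_vspace_presented_space] W.subspace_0[OF assms(3)] by metis
next
  interpret W: vector_space "scl W" using assms(2) by (rule is_vspace_vector_space)
  case (step c x u)
  show ?case
    using linear_between_combineD[OF assms(1) step.hyps, of c] assms(3,4) step
      W.subspace_add W.subspace_scale by metis
qed

text \<open>The universal property with a subspace as target. Functionals on the ambient type
  restrict to functionals on W, and span induction keeps the image in W.\<close>

lemma presented_linear_exists:
  assumes W: "is_vspace W" and F: "\<And>x. x \<in> X \<Longrightarrow> F x \<in> carr W"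
    and Q: "\<And>l. linear_between W ground l \<Longrightarrow> (\<lambda>x. l (F x)) \<in> Q"
  shows "\<exists>h. linear_between (presented_space X Q) W h \<and> (\<forall>x\<in>X. h (gen Q x) = F x)"
proof -
  let ?U = "\<lparr>carr = UNIV, scl = scl W\<rparr>"
  have "(\<lambda>x. l (F x)) \<in> Q" if l: "Vector_Spaces.linear (scl W) (*) l" for l
  proof -
    interpret Vector_Spaces.linear "scl W" "(*)" l by (rule l)
    show ?thesis by (rule Q) (simp add: linear_between_def add scale)
  qed
  from presented_space_universal[where F = F and X = X, OF is_vspace_vector_space[OF W] this]
  obtain h where h: "linear_between (presented_space X Q) ?U h" "\<And>x. x \<in> X \<Longrightarrow> h (gen Q x) = F x" by blast
  have U: "is_vspace ?U"
    using is_vspace_vector_space[OF W]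
    by (simp add: is_vspace_def module.subspace_UNIV module_iff_vector_space)
  have "h t \<in> carr W" if "t \<in> carr (presented_space X Q)" for t
  proof (rule presented_linear_in[OF h(1) U _ _ that])
    show "module.subspace (scl ?U) (carr W)" using W by (simp add: is_vspace_def)
    show "h (gen Q x) \<in> carr W" if "x \<in> X" for x using h(2) F that by simp
  qed
  then have "linear_between (presented_space X Q) W h"
    using h(1) by (simp add: linear_between_def)
  then show ?thesis using h(2) by auto
qed

subsection \<open>Tensor powers\<close>

lemma form_space_multilinear:
  assumes "\<And>V. V \<in> set Vs \<Longrightarrow> is_vspace V"
  shows "form_space (listset (map carr Vs)) {f. multilinear_between Vs ground f}"
proof (rule form_spaceI)
  show "(\<lambda>x. 0) \<in> {f. multilinear_between Vs ground f}"
    using multilinear_between_const_zero[OF is_vspace_ground] by simp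
  show "(\<lambda>x. c * q x + q' x) \<in> {f. multilinear_between Vs ground f}"
    if "q \<in> {f. multilinear_between Vs ground f}" "q' \<in> {f. multilinear_between Vs ground f}" for c q q'
    using multilinear_between_combine[OF is_vspace_ground, of Vs q q' c] that by simp
  show "q' \<in> {f. multilinear_between Vs ground f}"
    if "q \<in> {f. multilinear_between Vs ground f}" "\<And>x. x \<in> listset (map carr Vs) \<Longrightarrow> q' x = q x" for q q'
    using multilinear_between_cong[of Vs q q' ground] that assms by auto
qed

lemma form_space_tensor:
  "is_vspace V \<Longrightarrow> form_space (listset (replicate n (carr V))) (tensor_forms V n)"
  using form_space_multilinear[of "replicate n V"] by (simp add: tensor_forms_def)

lemma presented_map_tensor:
  assumes "multilinear_between (replicate n V) (presented_space Y R) F"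
  shows "presented_map (listset (replicate n (carr V))) (tensor_forms V n) Y R F"
  unfolding presented_map_def tensor_forms_def
  using multilinear_betweenD(1)[OF assms] multilinear_between_compose[OF assms linear_between_apply]
  by simp

text \<open>Multilinearity into a quotient is tested form by form, because elements are compared by
  their values at forms; outside Q all values are 0.\<close>

lemma multilinear_presentedI:
  assumes "\<And>xs. xs \<in> listset (map carr Vs) \<Longrightarrow> F xs \<in> carr (presented_space X Q)"
    and "\<And>q. q \<in> Q \<Longrightarrow> multilinear_between Vs ground (\<lambda>xs. F xs q)"
    and "\<And>V. V \<in> set Vs \<Longrightarrow> is_vspace V"
  shows "multilinear_between Vs (presented_space X Q) F"
  unfolding multilinear_between_def
proof (intro ballI conjI allI impI)
  fix xs i assume xs: "xs \<in> listset (map carr Vs)" and i: "i < length Vs"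
  have V: "is_vspace (Vs ! i)" using i assms(3) by simp
  have c: "F (xs[i := y]) \<in> carr (presented_space X Q)" if "y \<in> carr (Vs ! i)" for y
    using listset_update[OF xs, of y i] that i by (intro assms(1)) simp
  have l: "linear_between (Vs ! i) ground (\<lambda>y. F (xs[i := y]) q)" for q
  proof (cases "q \<in> Q")
    case True
    then show ?thesis using multilinear_betweenD(2)[OF assms(2) xs i] by simp
  next
    case False
    have "linear_between (Vs ! i) ground (\<lambda>y. 0)"
      by (rule linear_between_const_zero[OF is_vspace_ground])
    then show ?thesis using linear_between_cong[OF _ V, of "\<lambda>y. F (xs[i := y]) q" "\<lambda>_. 0"]
      presented_outside[OF c False] by simp
  qed
  show "linear_between (Vs ! i) (presented_space X Q) (\<lambda>y. F (xs[i := y]))"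
    using c linear_betweenD(2,3)[OF l] by (auto simp: linear_between_def fun_eq_iff fun_scale_def)
qed (use assms(1) in simp)

lemma linear_presentedI:
  assumes "\<And>x. x \<in> carr V \<Longrightarrow> F x \<in> carr (presented_space X Q)"
    and "\<And>q. q \<in> Q \<Longrightarrow> linear_between V ground (\<lambda>x. F x q)"
    and "is_vspace V"
  shows "linear_between V (presented_space X Q) F"
proof -
  have "multilinear_between [V] (presented_space X Q) (\<lambda>xs. F (hd xs))"
    by (rule multilinear_presentedI) (use assms in \<open>auto simp: multilinear_between_Cons listset_eq_Cons\<close>)
  then show ?thesis by (simp add: multilinear_between_Cons)
qed

lemma multilinear_pure:
  assumes "is_vspace V"
  shows "multilinear_between (replicate n V) (tensor_power V n) (pure V n)"
  unfolding tensor_power_def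
proof (rule multilinear_presentedI)
  fix q assume "q \<in> tensor_forms V n"
  then show "multilinear_between (replicate n V) ground (\<lambda>xs. pure V n xs q)"
    by (simp add: gen_def tensor_forms_def)
qed (use assms in \<open>auto simp: gen_in_carr\<close>)

lemma is_vspace_tensor_power: "is_vspace (tensor_power V n)"
  by (simp add: tensor_power_def is_vspace_presented_space)

lemma scl_tensor_power [simp]: "scl (tensor_power V n) = fun_scale"
  by (simp add: tensor_power_def)

lemma lin_ext_tensor:
  assumes "is_vspace V" "multilinear_between (replicate n V) (presented_space Y R) F"
  shows "linear_between (tensor_power V n) (presented_space Y R) (\<lambda>t. lin_ext t F)"
    and "length xs = n \<Longrightarrow> set xs \<subseteq> carr V \<Longrightarrow> lin_ext (pure V n xs) F = F xs"
  using lin_ext_linear[OF form_space_tensor[OF assms(1)] presented_map_tensor[OF assms(2)]]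
    lin_ext_gen_map[OF form_space_tensor[OF assms(1)] presented_map_tensor[OF assms(2)]]
  by (auto simp: tensor_power_def listset_replicate_iff)

lemma tensor_map_linear:
  assumes "is_vspace V" "is_vspace W" "linear_between V W f"
  shows "linear_between (tensor_power V n) (tensor_power W n) (tensor_map W n f)"
    and "length xs = n \<Longrightarrow> set xs \<subseteq> carr V \<Longrightarrow> tensor_map W n f (pure V n xs) = pure W n (map f xs)"
  using lin_ext_tensor[OF assms(1) multilinear_between_map[OF multilinear_pure[OF assms(2), unfolded tensor_power_def] assms(3)]]
  unfolding tensor_power_def tensor_map_def[abs_def] by blast+

lemma tensor_permute_linear:
  assumes "is_vspace V" "\<sigma> permutes {..<n}"
  shows "linear_between (tensor_power V n) (tensor_power V n) (tensor_permute V n \<sigma>)"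
    and "length xs = n \<Longrightarrow> set xs \<subseteq> carr V \<Longrightarrow> tensor_permute V n \<sigma> (pure V n xs) = pure V n (permute_list \<sigma> xs)"
  using lin_ext_tensor[OF assms(1) multilinear_between_permute[OF multilinear_pure[OF assms(1), unfolded tensor_power_def] assms(2)]]
  unfolding tensor_power_def tensor_permute_def[abs_def] by blast+

lemma tensor_linear_eqI:
  assumes "linear_between (tensor_power V n) W f" "linear_between (tensor_power V n) W g"
    and "\<And>xs. length xs = n \<Longrightarrow> set xs \<subseteq> carr V \<Longrightarrow> f (pure V n xs) = g (pure V n xs)"
    and "t \<in> carr (tensor_power V n)"
  shows "f t = g t"
  using assms presented_linear_eqI[of "listset (replicate n (carr V))" "tensor_forms V n" W f g t]
  by (simp add: tensor_power_def listset_replicate_iff)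

lemma tensor_linear_exists:
  assumes "is_vspace V" "is_vspace W" "multilinear_between (replicate n V) W F"
  shows "\<exists>h. linear_between (tensor_power V n) W h \<and>
    (\<forall>xs. length xs = n \<longrightarrow> set xs \<subseteq> carr V \<longrightarrow> h (pure V n xs) = F xs)"
proof -
  have "\<exists>h. linear_between (presented_space (listset (replicate n (carr V))) (tensor_forms V n)) W h \<and>
      (\<forall>xs\<in>listset (replicate n (carr V)). h (pure V n xs) = F xs)"
  proof (rule presented_linear_exists[OF assms(2)])
    show "F xs \<in> carr W" if "xs \<in> listset (replicate n (carr V))" for xs
      using multilinear_betweenD(1)[OF assms(3)] that by simp
    show "(\<lambda>xs. l (F xs)) \<in> tensor_forms V n" if "linear_between W ground l" for l
      using multilinear_between_compose[OF assms(3) that] by (simp add: tensor_forms_def)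
  qed
  then show ?thesis by (auto simp: tensor_power_def listset_replicate_iff)
qed

lemma multilinear_scale_each:
  assumes "is_vspace V" "is_vspace W" "multilinear_between (replicate n V) W F"
    and "length cs = n" "length xs = n" "set xs \<subseteq> carr V"
  shows "F (map2 (scl V) cs xs) = scl W (prod_list cs) (F xs)"
  using assms(3-6)
proof (induction n arbitrary: F cs xs)
  case 0
  interpret W: vector_space "scl W" using assms(2) by (rule is_vspace_vector_space)
  from 0 show ?case by simp
next
  case (Suc n)
  interpret W: vector_space "scl W" using assms(2) by (rule is_vspace_vector_space)
  obtain c cs' x xs' where eq: "cs = c # cs'" "xs = x # xs'"
    using Suc.prems by (metis length_Suc_conv)
  have x: "x \<in> carr V" and cx: "scl V c x \<in> carr V" and xs': "xs' \<in> listset (replicate n (carr V))"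
    using Suc.prems eq assms(1) by (auto simp: is_vspace_scale listset_replicate_iff)
  have "F (scl V c x # map2 (scl V) cs' xs') = scl W (prod_list cs') (F (scl V c x # xs'))"
    using Suc.prems eq cx by (intro Suc.IH[of "\<lambda>xs. F (scl V c x # xs)"]) (auto simp: multilinear_between_Cons)
  also have "F (scl V c x # xs') = scl W c (F (x # xs'))"
  proof -
    have "linear_between V W (\<lambda>x. F (x # xs'))"
      using Suc.prems(1) xs' by (simp add: multilinear_between_Cons)
    from linear_betweenD(3)[OF this x] show ?thesis .
  qed
  finally show ?case using eq by (simp add: mult.commute)
qed

subsection \<open>Multilinear evaluation on presented spaces\<close>

text \<open>The value at G of the decomposable tensor formed by the list: each quotient element
  acts, as a functional, on its own variable. This is \<open>multi_ext\<close> seen through one form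
  of the target.\<close>

fun mev :: "('k::field, 'x) presented list \<Rightarrow> ('x list \<Rightarrow> 'k) \<Rightarrow> 'k" where
  "mev [] G = G []"
| "mev (t # ts) G = t (\<lambda>x. mev ts (\<lambda>xs. G (x # xs)))"

lemma multi_ext_apply: "multi_ext ts F q = mev ts (\<lambda>xs. F xs q)"
  by (induction ts arbitrary: F) (auto simp: lin_ext_def)

text \<open>Membership in the dual of a tensor product of presented spaces: G respects the relations
  of each factor while the other variables are symbols. The recursion runs parallel to
  \<open>mev\<close>.\<close>

fun mform :: "('x set \<times> ('x \<Rightarrow> 'k) set) list \<Rightarrow> ('x list \<Rightarrow> 'k) \<Rightarrow> bool" where
  "mform [] G \<longleftrightarrow> True"
| "mform (S # Ss) G \<longleftrightarrow> (\<forall>xs\<in>listset (map fst Ss). (\<lambda>x. G (x # xs)) \<in> snd S) \<and>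
     (\<forall>x\<in>fst S. mform Ss (\<lambda>xs. G (x # xs)))"

abbreviation pspace :: "('x set \<times> ('x \<Rightarrow> 'k::field) set) \<Rightarrow> ('k, ('k, 'x) presented) vspace" where
  "pspace S \<equiv> presented_space (fst S) (snd S)"

abbreviation form_spaces :: "('x set \<times> ('x \<Rightarrow> 'k::field) set) list \<Rightarrow> bool" where
  "form_spaces Ss \<equiv> (\<forall>S\<in>set Ss. form_space (fst S) (snd S))"

lemma mformI:
  assumes "form_spaces Ss"
    and "\<And>xs i. xs \<in> listset (map fst Ss) \<Longrightarrow> i < length Ss \<Longrightarrow> (\<lambda>x. G (xs[i := x])) \<in> snd (Ss ! i)"
  shows "mform Ss G"
  using assms
proof (induction Ss arbitrary: G)
  case (Cons S Ss)
  have "(\<lambda>x. G (x # xs)) \<in> snd S" if xs: "xs \<in> listset (map fst Ss)" for xs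
  proof (cases "fst S = {}")
    \<comment> \<open>Without symbols in the first factor there is no list to feed into the
      hypothesis, but then every function agrees with the zero form.\<close>
    case True
    then show ?thesis
      using form_space_cong[of "fst S" "snd S" "\<lambda>_. 0" "\<lambda>x. G (x # xs)"] form_space_zero Cons.prems(1) by auto
  next
    case False
    then obtain y where "y \<in> fst S" by auto
    then show ?thesis using Cons.prems(2)[of "y # xs" 0] xs by simp
  qed
  moreover have "mform Ss (\<lambda>xs. G (x # xs))" if "x \<in> fst S" for x
  proof (rule Cons.IH)
    fix xs i assume "xs \<in> listset (map fst Ss)" "i < length Ss"
    then show "(\<lambda>y. G (x # xs[i := y])) \<in> snd (Ss ! i)"
      using Cons.prems(2)[of "x # xs" "Suc i"] that by simp
  qed (use Cons.prems in simp)
  ultimately show ?case by simp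
qed simp

lemma mev_gen:
  assumes "form_spaces Ss" "mform Ss G" "xs \<in> listset (map fst Ss)"
  shows "mev (map2 (\<lambda>S x. gen (snd S) x) Ss xs) G = G xs"
  using assms
proof (induction Ss arbitrary: G xs)
  case (Cons S Ss)
  then obtain y ys where xs: "xs = y # ys" "y \<in> fst S" "ys \<in> listset (map fst Ss)"
    by (auto simp: listset_eq_Cons)
  let ?h = "\<lambda>x. mev (map2 (\<lambda>S x. gen (snd S) x) Ss ys) (\<lambda>xs. G (x # xs))"
  have h: "?h x = G (x # ys)" if "x \<in> fst S" for x
    using Cons.prems xs that by (intro Cons.IH) auto
  have "?h \<in> snd S"
    using form_space_cong[of "fst S" "snd S" ?h, OF _ h] Cons.prems xs by auto
  then show ?case using xs h by (simp add: gen_def)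
qed simp

lemma mev_cong:
  assumes "form_spaces Ss" "ts \<in> listset (map (\<lambda>S. carr (pspace S)) Ss)"
    and "\<And>xs. xs \<in> listset (map fst Ss) \<Longrightarrow> G xs = G' xs"
  shows "mev ts G = mev ts G'"
  using assms
proof (induction Ss arbitrary: G G' ts)
  case (Cons S Ss)
  then obtain t ts' where ts: "ts = t # ts'" "t \<in> carr (pspace S)"
    "ts' \<in> listset (map (\<lambda>S. carr (pspace S)) Ss)"
    by (auto simp: listset_eq_Cons)
  have "mev ts' (\<lambda>xs. G (x # xs)) = mev ts' (\<lambda>xs. G' (x # xs))" if "x \<in> fst S" for x
    using Cons.prems ts that by (intro Cons.IH) auto
  then have "t (\<lambda>x. mev ts' (\<lambda>xs. G (x # xs))) = t (\<lambda>x. mev ts' (\<lambda>xs. G' (x # xs)))"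
    by (intro presented_cong[OF ts(2)]) (use Cons.prems(1) in simp_all)
  then show ?case using ts(1) by simp
qed auto

text \<open>The induction hypothesis is used twice: with y as the parameter, and with the head
  symbol x as the parameter while y is fixed. Hence Y and R vary in the induction, and the parameter
  has the type of the symbols.\<close>

lemma mev_form:
  fixes Ss :: "('x set \<times> ('x \<Rightarrow> 'k::field) set) list" and Y :: "'x set"
  assumes "form_spaces Ss" "form_space Y R" "ts \<in> listset (map (\<lambda>S. carr (pspace S)) Ss)"
    and "\<And>y. y \<in> Y \<Longrightarrow> mform Ss (G y)" "\<And>xs. xs \<in> listset (map fst Ss) \<Longrightarrow> (\<lambda>y. G y xs) \<in> R"
  shows "(\<lambda>y. mev ts (G y)) \<in> R"
  using assms
proof (induction Ss arbitrary: G ts Y R)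
  case Nil
  then show ?case by (auto dest: listset_length)
next
  case (Cons S Ss)
  then obtain t ts' where ts: "ts = t # ts'" "t \<in> carr (pspace S)"
    "ts' \<in> listset (map (\<lambda>S. carr (pspace S)) Ss)"
    by (auto simp: listset_eq_Cons)
  have S: "form_space (fst S) (snd S)" and Ss: "form_spaces Ss" using Cons.prems(1) by auto
  have "(\<lambda>y. t (\<lambda>x. mev ts' (\<lambda>xs. G y (x # xs)))) \<in> R"
  proof (rule form_space_swap[OF S Cons.prems(2) _ _ ts(2)])
    fix x assume x: "x \<in> fst S"
    show "(\<lambda>y. mev ts' (\<lambda>xs. G y (x # xs))) \<in> R"
      by (rule Cons.IH[OF Ss Cons.prems(2) ts(3)]) (use Cons.prems(4,5) x in auto)
  next
    fix y assume y: "y \<in> Y"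
    show "(\<lambda>x. mev ts' (\<lambda>xs. G y (x # xs))) \<in> snd S"
      by (rule Cons.IH[OF Ss S ts(3)]) (use Cons.prems(4)[OF y] in auto)
  qed
  then show ?case using ts(1) by simp
qed

lemma mev_multilinear:
  assumes "form_spaces Ss" "mform Ss G"
  shows "multilinear_between (map pspace Ss) ground (\<lambda>ts. mev ts G)"
  using assms
proof (induction Ss arbitrary: G)
  case (Cons S Ss)
  have S: "form_space (fst S) (snd S)" and Ss: "form_spaces Ss" using Cons.prems(1) by auto
  have "multilinear_between (map pspace Ss) ground (\<lambda>ts. mev (t # ts) G)"
    if "t \<in> carr (pspace S)" for t
    using that
  proof (induction rule: presented_induct)
    case zero
    show ?case using multilinear_between_const_zero[OF is_vspace_ground] by simp
  next
    case (step c x u)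
    note x = step.hyps(1)
    have "multilinear_between (map pspace Ss) ground (\<lambda>ts. mev ts (\<lambda>xs. G (x # xs)))"
      using Cons x by simp
    from multilinear_between_combine[OF is_vspace_ground this step.IH, of c]
    have "multilinear_between (map pspace Ss) ground
      (\<lambda>ts. c * mev ts (\<lambda>xs. G (x # xs)) + mev (u # ts) G)" by simp
    moreover have "(\<lambda>x. mev ts (\<lambda>xs. G (x # xs))) \<in> snd S"
      if "ts \<in> listset (map (\<lambda>S. carr (pspace S)) Ss)" for ts
      by (rule mev_form[OF Ss S that]) (use Cons.prems(2) in auto)
    ultimately show ?case
      using x is_vspace_presented_space
        multilinear_between_cong[of "map pspace Ss"
          "\<lambda>ts. c * mev ts (\<lambda>xs. G (x # xs)) + mev (u # ts) G" "\<lambda>ts. mev ((fun_scale c (gen (snd S) x) + u) # ts) G" ground]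
      by (auto simp: gen_def fun_scale_def comp_def)
  qed
  then show ?case by (simp add: multilinear_between_Cons linear_between_apply)
qed simp

text \<open>Decomposable tensors pair with products of forms factor by factor. The scalar c absorbs
  the factors of the variables already passed, which are constants for the remaining ones.\<close>

lemma mev_prod:
  assumes "list_all2 (\<lambda>t S. form_space (fst S) (snd S) \<and> t \<in> carr (pspace S)) ts Ss"
    and "list_all2 (\<lambda>g S. g \<in> snd S) gs Ss"
  shows "mev ts (\<lambda>xs. c * prod_list (map2 (\<lambda>g x. g x) gs xs)) = c * prod_list (map2 (\<lambda>t g. t g) ts gs)"
  using assms
proof (induction arbitrary: gs c rule: list_all2_induct)
  case (Cons t ts S Ss)
  then obtain g gs' where gs: "gs = g # gs'" "g \<in> snd S" "list_all2 (\<lambda>g S. g \<in> snd S) gs' Ss"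
    by (auto simp: list_all2_Cons2)
  have "mev ts (\<lambda>xs. (c * g x) * prod_list (map2 (\<lambda>g x. g x) gs' xs)) =
    (c * g x) * prod_list (map2 (\<lambda>t g. t g) ts gs')" for x
    by (rule Cons.IH[OF gs(3)])
  then have "mev (t # ts) (\<lambda>xs. c * prod_list (map2 (\<lambda>g x. g x) gs xs)) =
    t (\<lambda>x. (c * prod_list (map2 (\<lambda>t g. t g) ts gs')) * g x)"
    using gs(1) by (simp add: algebra_simps)
  also have "\<dots> = (c * prod_list (map2 (\<lambda>t g. t g) ts gs')) * t g"
    using Cons.hyps gs by (intro presented_scale[of t "fst S" "snd S"]) auto
  finally show ?case using gs(1) by (simp add: algebra_simps)
qed simp

subsection \<open>Blocks and permutations\<close>

lemma permute_list_perm_of_word: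
  "length w = length xs \<Longrightarrow> permute_list (perm_of_word w) xs = map (nth xs) w"
  by (rule nth_equalityI) (simp_all add: permute_list_def perm_of_word_def)

lemma perm_of_word_permutes:
  assumes "mset w = mset [0..<n]"
  shows "perm_of_word w permutes {..<n}"
proof -
  have len: "length w = n" and d: "distinct w" and s: "set w = {..<n}"
    using mset_eq_length[OF assms] mset_eq_imp_distinct_iff[OF assms] mset_eq_setD[OF assms]
    by (auto simp: atLeast0LessThan)
  have "bij_betw (nth w) {..<n} {..<n}" using bij_betw_nth[OF d] len s by simp
  then have "bij_betw (perm_of_word w) {..<n} {..<n}"
    by (rule bij_betw_cong[THEN iffD1, rotated]) (simp add: perm_of_word_def len)
  then show ?thesis by (rule bij_imp_permutes) (simp add: perm_of_word_def len)
qed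

lemma permutes_eqI_list:
  assumes "p permutes {..<n}" "q permutes {..<n}" "map p [0..<n] = map q [0..<n]"
  shows "p = q"
proof
  fix i
  show "p i = q i"
  proof (cases "i < n")
    case True
    then have "map p [0..<n] ! i = map q [0..<n] ! i" using assms(3) by simp
    then show ?thesis using True by simp
  next
    case False
    then show ?thesis using permutes_not_in[OF assms(1)] permutes_not_in[OF assms(2)] by simp
  qed
qed

lemma map_perm_of_word: "map (perm_of_word w) [0..<length w] = w"
  by (rule nth_equalityI) (simp_all add: perm_of_word_def)

lemma permute_list_upt: "p permutes {..<n} \<Longrightarrow> permute_list p [0..<n] = map p [0..<n]"
proof (rule nth_equalityI)
  fix i assume p: "p permutes {..<n}" and "i < length (permute_list p [0..<n])"
  then have "i < n" "p i < n" using permutes_in_image[OF p, of i] by auto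
  then show "permute_list p [0..<n] ! i = map p [0..<n] ! i" by (simp add: permute_list_def)
qed simp

lemma permute_list_inv:
  assumes "p permutes {..<length xs}"
  shows "permute_list (inv p) (permute_list p xs) = xs" "permute_list p (permute_list (inv p) xs) = xs"
  using permute_list_compose[OF permutes_inv[OF assms], of p] permute_list_compose[OF assms, of "inv p"]
    permutes_inv_o[OF assms] by simp_all

lemma length_split_blocks [simp]: "length (split_blocks ls xs) = length ls"
  by (induction ls xs rule: split_blocks.induct) auto

lemma concat_split_blocks: "length xs = sum_list ls \<Longrightarrow> concat (split_blocks ls xs) = xs"
  by (induction ls xs rule: split_blocks.induct) auto

lemma split_blocks_concat: "map length xss = ls \<Longrightarrow> split_blocks ls (concat xss) = xss"
  by (induction xss arbitrary: ls) auto

lemma map_split_blocks: "map (map f) (split_blocks ls xs) = split_blocks ls (map f xs)"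
  by (induction ls xs rule: split_blocks.induct) (auto simp: take_map drop_map)

lemma map_length_split_blocks: "length xs = sum_list ls \<Longrightarrow> map length (split_blocks ls xs) = ls"
  by (induction ls xs rule: split_blocks.induct) auto

lemma length_split_blocks_nth: "length xs = sum_list ls \<Longrightarrow> i < length ls \<Longrightarrow> length (split_blocks ls xs ! i) = ls ! i"
  using map_length_split_blocks[of xs ls] by (metis length_split_blocks nth_map)

lemma set_split_blocks: "b \<in> set (split_blocks ls xs) \<Longrightarrow> set b \<subseteq> set xs"
  by (induction ls xs rule: split_blocks.induct) (auto dest: in_set_takeD in_set_dropD)

text \<open>The block that contains a position depends on the lengths alone; the quantifiers are
  ordered so that one block serves all lists and all new entries.\<close>

lemma split_blocks_update:
  assumes "j < sum_list ls"
  shows "\<exists>i<length ls. \<exists>j'<ls ! i. \<forall>(xs :: 'x list) y. length xs = sum_list ls \<longrightarrow>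
    split_blocks ls (xs[j := y]) = (split_blocks ls xs)[i := (split_blocks ls xs ! i)[j' := y]]"
  using assms
proof (induction ls arbitrary: j)
  case (Cons l ls)
  show ?case
  proof (cases "j < l")
    case True
    then show ?thesis by (intro exI[of _ 0]) (auto simp: take_update_swap intro!: exI[of _ j])
  next
    case False
    then have "j - l < sum_list ls" using Cons.prems by simp
    from Cons.IH[OF this] obtain i j' where i: "i < length ls" "j' < ls ! i"
      and h: "\<And>(xs :: 'x list) y. length xs = sum_list ls \<Longrightarrow>
        split_blocks ls (xs[j - l := y]) = (split_blocks ls xs)[i := (split_blocks ls xs ! i)[j' := y]]"
      by meson
    have "split_blocks (l # ls) (xs[j := y]) =
        (split_blocks (l # ls) xs)[Suc i := (split_blocks (l # ls) xs ! Suc i)[j' := y]]"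
      if "length xs = sum_list (l # ls)" for xs :: "'x list" and y
      using h[of "drop l xs" y] that False by (simp add: drop_update_swap)
    then show ?thesis using i by (intro exI[of _ "Suc i"]) auto
  qed
qed simp

text \<open>The Young subgroup attached to ls, kept as a list of factors; \<open>sum_perm\<close>
  embeds it in the full symmetric group.\<close>

definition block_perms :: "nat list \<Rightarrow> (nat \<Rightarrow> nat) list \<Rightarrow> bool" where
  "block_perms ls \<tau>s \<longleftrightarrow> length \<tau>s = length ls \<and> (\<forall>i<length ls. (\<tau>s ! i) permutes {..<ls ! i})"

lemma block_perms_Cons:
  "block_perms (l # ls) \<tau>s \<longleftrightarrow> (\<exists>\<tau> \<tau>s'. \<tau>s = \<tau> # \<tau>s' \<and> \<tau> permutes {..<l} \<and> block_perms ls \<tau>s')"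
  by (cases \<tau>s) (auto simp: block_perms_def All_less_Suc2)

lemma mset_concat_permute_blocks:
  "block_perms (map length xss) \<tau>s \<Longrightarrow> mset (concat (map2 permute_list \<tau>s xss)) = mset (concat xss)"
  by (induction xss arbitrary: \<tau>s) (auto simp: block_perms_Cons)

lemma map_permute_blocks:
  "block_perms (map length xss) \<tau>s \<Longrightarrow>
    map f (concat (map2 permute_list \<tau>s xss)) = concat (map2 permute_list \<tau>s (map (map f) xss))"
  by (induction xss arbitrary: \<tau>s) (auto simp: block_perms_Cons permute_list_map)

lemma sum_perm_word_mset:
  assumes "block_perms ls \<tau>s"
  shows "mset (concat (map2 permute_list \<tau>s (split_blocks ls [0..<sum_list ls]))) = mset [0..<sum_list ls]"
  using mset_concat_permute_blocks[of "split_blocks ls [0..<sum_list ls]" \<tau>s] assms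
    map_length_split_blocks[of "[0..<sum_list ls]" ls] concat_split_blocks[of "[0..<sum_list ls]" ls]
  by simp

lemma sum_perm_permutes: "block_perms ls \<tau>s \<Longrightarrow> sum_perm \<tau>s ls permutes {..<sum_list ls}"
  unfolding sum_perm_def by (rule perm_of_word_permutes) (rule sum_perm_word_mset)

text \<open>\<open>sum_perm\<close> is defined by permuting the word of positions blockwise; reading
  the entries of an arbitrary list along that word commutes with this.\<close>

lemma permute_list_sum_perm:
  assumes "map length xss = ls" "block_perms ls \<tau>s"
  shows "permute_list (sum_perm \<tau>s ls) (concat xss) = concat (map2 permute_list \<tau>s xss)"
proof -
  let ?n = "sum_list ls" let ?w = "concat (map2 permute_list \<tau>s (split_blocks ls [0..<?n]))"
  have n: "length (concat xss) = ?n" using assms(1) by (simp add: length_concat)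
  have "length ?w = ?n" using mset_eq_length[OF sum_perm_word_mset[OF assms(2)]] by simp
  then have "permute_list (sum_perm \<tau>s ls) (concat xss) = map (nth (concat xss)) ?w"
    unfolding sum_perm_def using n by (intro permute_list_perm_of_word) simp
  also have "\<dots> = concat (map2 permute_list \<tau>s (map (map (nth (concat xss))) (split_blocks ls [0..<?n])))"
    using assms(2) by (intro map_permute_blocks) (simp add: map_length_split_blocks)
  also have "map (map (nth (concat xss))) (split_blocks ls [0..<?n]) = xss"
    using n assms(1) by (simp add: map_split_blocks map_nth flip: n) (simp add: split_blocks_concat)
  finally show ?thesis .
qed

lemma block_perms_inv: "block_perms ls \<tau>s \<Longrightarrow> block_perms ls (map inv \<tau>s)"
  by (auto simp: block_perms_def permutes_inv)

lemma permute_blocks_inv: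
  "block_perms (map length xss) \<tau>s \<Longrightarrow> map2 permute_list (map inv \<tau>s) (map2 permute_list \<tau>s xss) = xss"
  by (induction xss arbitrary: \<tau>s) (auto simp: block_perms_Cons permute_list_inv)

lemma sum_perm_inv:
  assumes "block_perms ls \<tau>s"
  shows "inv (sum_perm \<tau>s ls) = sum_perm (map inv \<tau>s) ls"
proof -
  let ?n = "sum_list ls" let ?b = "split_blocks ls [0..<?n]"
  let ?p = "sum_perm \<tau>s ls" and ?q = "sum_perm (map inv \<tau>s) ls"
  have p: "?p permutes {..<?n}" and q: "?q permutes {..<?n}"
    using assms by (auto intro: sum_perm_permutes block_perms_inv)
  have b: "map length ?b = ls" by (simp add: map_length_split_blocks)
  have l: "length (concat ?b) = ?n" by (simp add: concat_split_blocks)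
  have b': "map length (map2 permute_list \<tau>s ?b) = ls"
    using b assms by (auto simp: block_perms_def intro!: nth_equalityI)
       (metis length_map length_split_blocks nth_map)
  have "permute_list ?q (permute_list ?p (concat ?b)) = concat ?b"
    unfolding permute_list_sum_perm[OF b assms] permute_list_sum_perm[OF b' block_perms_inv[OF assms]]
    using permute_blocks_inv[of ?b \<tau>s] b assms by simp
  then have "permute_list (?p \<circ> ?q) [0..<?n] = [0..<?n]"
    using permute_list_compose[of ?q "[0..<?n]" ?p] q by (simp add: concat_split_blocks)
  then have "map (?p \<circ> ?q) [0..<?n] = map id [0..<?n]"
    using permute_list_upt[OF permutes_compose[OF q p]] by simp
  then have "?p \<circ> ?q = id"
    by (intro permutes_eqI_list[OF permutes_compose[OF q p] permutes_id])
  then show ?thesis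
    using permutes_inv_o[OF p] by (metis comp_assoc comp_id fun.map_id id_comp)
qed

subsection \<open>Unshuffles\<close>

abbreviation perm_blocks :: "nat list \<Rightarrow> (nat \<Rightarrow> nat) \<Rightarrow> nat list list" where
  "perm_blocks ls \<sigma> \<equiv> split_blocks ls (map \<sigma> [0..<sum_list ls])"

text \<open>The normal form of the coset of \<sigma> modulo the Young subgroup acting from the
  right: sorting the blocks of the word of \<sigma> picks the unshuffle in that coset.\<close>

definition sort_blocks :: "nat list \<Rightarrow> (nat \<Rightarrow> nat) \<Rightarrow> nat \<Rightarrow> nat" where
  "sort_blocks ls \<sigma> = perm_of_word (concat (map sort (perm_blocks ls \<sigma>)))"

lemma mset_concat_sort: "mset (concat (map sort xss)) = mset (concat xss)"
  by (induction xss) auto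

lemma mset_map_perm:
  assumes "\<sigma> permutes {..<n}" shows "mset (map \<sigma> [0..<n]) = mset [0..<n]"
  using assms permute_list_upt[OF assms] mset_permute_list[of \<sigma> "[0..<n]"] by simp

lemma sort_blocks_word_mset:
  assumes "\<sigma> permutes {..<sum_list ls}"
  shows "mset (concat (map sort (perm_blocks ls \<sigma>))) = mset [0..<sum_list ls]"
  using mset_map_perm[OF assms] by (simp add: mset_concat_sort concat_split_blocks)

lemma perm_blocks_sort_blocks:
  assumes "\<sigma> permutes {..<sum_list ls}"
  shows "perm_blocks ls (sort_blocks ls \<sigma>) = map sort (perm_blocks ls \<sigma>)"
proof -
  let ?w = "concat (map sort (perm_blocks ls \<sigma>))"
  have "length ?w = sum_list ls" using mset_eq_length[OF sort_blocks_word_mset[OF assms]] by simp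
  then have "map (sort_blocks ls \<sigma>) [0..<sum_list ls] = ?w"
    unfolding sort_blocks_def using map_perm_of_word[of ?w] by simp
  moreover have "map length (map sort (perm_blocks ls \<sigma>)) = ls"
    using map_length_split_blocks[of "map \<sigma> [0..<sum_list ls]" ls] by (simp add: comp_def)
  ultimately show ?thesis by (simp add: split_blocks_concat)
qed

lemma sort_blocks_permutes:
  "\<sigma> permutes {..<sum_list ls} \<Longrightarrow> sort_blocks ls \<sigma> permutes {..<sum_list ls}"
  unfolding sort_blocks_def by (rule perm_of_word_permutes) (rule sort_blocks_word_mset)

lemma sort_blocks_unshuffle:
  "\<sigma> permutes {..<sum_list ls} \<Longrightarrow> sort_blocks ls \<sigma> \<in> unshuffles ls"
  by (auto simp: unshuffles_def sort_blocks_permutes perm_blocks_sort_blocks)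

lemma perm_blocks_eqI:
  assumes "\<sigma> permutes {..<sum_list ls}" "\<tau> permutes {..<sum_list ls}" "perm_blocks ls \<sigma> = perm_blocks ls \<tau>"
  shows "\<sigma> = \<tau>"
proof -
  have "concat (perm_blocks ls \<sigma>) = concat (perm_blocks ls \<tau>)" using assms(3) by simp
  then have "map \<sigma> [0..<sum_list ls] = map \<tau> [0..<sum_list ls]"
    by (simp only: concat_split_blocks length_map length_upt minus_nat.diff_0)
  then show ?thesis by (rule permutes_eqI_list[OF assms(1,2)])
qed

lemma sort_blocks_id:
  assumes "\<sigma> \<in> unshuffles ls" shows "sort_blocks ls \<sigma> = \<sigma>"
proof (rule perm_blocks_eqI)
  show \<sigma>: "\<sigma> permutes {..<sum_list ls}" using assms by (simp add: unshuffles_def)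
  then show "sort_blocks ls \<sigma> permutes {..<sum_list ls}" by (rule sort_blocks_permutes)
  have "map sort (perm_blocks ls \<sigma>) = map (\<lambda>x. x) (perm_blocks ls \<sigma>)"
    using assms by (intro map_cong) (auto simp: unshuffles_def sorted_sort_id)
  then show "perm_blocks ls (sort_blocks ls \<sigma>) = perm_blocks ls \<sigma>"
    by (simp add: perm_blocks_sort_blocks[OF \<sigma>])
qed

text \<open>Left translation is well defined on cosets: sorting a block after applying \<pi> forgets
  whether it was sorted before.\<close>

lemma sort_blocks_comp:
  assumes "\<sigma> permutes {..<sum_list ls}" "\<pi> permutes {..<sum_list ls}"
  shows "sort_blocks ls (\<pi> \<circ> sort_blocks ls \<sigma>) = sort_blocks ls (\<pi> \<circ> \<sigma>)"
proof -
  have 1: "perm_blocks ls (\<pi> \<circ> \<rho>) = map (map \<pi>) (perm_blocks ls \<rho>)" for \<rho>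
    by (simp add: map_split_blocks)
  have "sort (map \<pi> (sort b)) = sort (map \<pi> b)" for b
    by (rule properties_for_sort) simp_all
  then show ?thesis
    unfolding sort_blocks_def[of ls "\<pi> \<circ> _"] 1 perm_blocks_sort_blocks[OF assms(1)] by (simp add: comp_def)
qed

lemma sort_blocks_bij:
  assumes "\<pi> permutes {..<sum_list ls}"
  shows "bij_betw (\<lambda>\<sigma>. sort_blocks ls (\<pi> \<circ> \<sigma>)) (unshuffles ls) (unshuffles ls)"
proof (rule bij_betw_byWitness[where f' = "\<lambda>\<sigma>. sort_blocks ls (inv \<pi> \<circ> \<sigma>)"])
  have p: "\<sigma> permutes {..<sum_list ls}" if "\<sigma> \<in> unshuffles ls" for \<sigma>
    using that by (simp add: unshuffles_def)
  note i = permutes_inv[OF assms]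
  show "\<forall>\<sigma>\<in>unshuffles ls. sort_blocks ls (inv \<pi> \<circ> sort_blocks ls (\<pi> \<circ> \<sigma>)) = \<sigma>"
    by (simp add: sort_blocks_comp p i assms permutes_compose permutes_inv_o[OF assms] sort_blocks_id
        flip: comp_assoc)
  show "\<forall>\<sigma>\<in>unshuffles ls. sort_blocks ls (\<pi> \<circ> sort_blocks ls (inv \<pi> \<circ> \<sigma>)) = \<sigma>"
    by (simp add: sort_blocks_comp p i assms permutes_compose permutes_inv_o[OF assms] sort_blocks_id
        flip: comp_assoc)
  show "(\<lambda>\<sigma>. sort_blocks ls (\<pi> \<circ> \<sigma>)) ` unshuffles ls \<subseteq> unshuffles ls"
    using sort_blocks_unshuffle permutes_compose[OF p assms] by blast
  show "(\<lambda>\<sigma>. sort_blocks ls (inv \<pi> \<circ> \<sigma>)) ` unshuffles ls \<subseteq> unshuffles ls"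
    using sort_blocks_unshuffle permutes_compose[OF p i] by blast
qed

lemma sort_blocks_factor:
  assumes "\<sigma> permutes {..<sum_list ls}"
  shows "\<exists>\<tau>s. block_perms ls \<tau>s \<and> sort_blocks ls \<sigma> = \<sigma> \<circ> sum_perm \<tau>s ls"
proof -
  let ?b = "perm_blocks ls \<sigma>"
  have lens: "map length ?b = ls" by (simp add: map_length_split_blocks)
  have "\<exists>\<tau>s. block_perms (map length xss) \<tau>s \<and> map sort xss = map2 permute_list \<tau>s xss" for xss :: "nat list list"
  proof (induction xss)
    case Nil
    then show ?case by (simp add: block_perms_def)
  next
    case (Cons xs xss)
    then obtain \<tau>s where "block_perms (map length xss) \<tau>s" "map sort xss = map2 permute_list \<tau>s xss" by blast
    moreover obtain \<tau> where "\<tau> permutes {..<length xs}" "permute_list \<tau> xs = sort xs"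
      using mset_eq_permutation[of "sort xs" xs] by auto
    ultimately have "block_perms (map length (xs # xss)) (\<tau> # \<tau>s) \<and>
        map sort (xs # xss) = map2 permute_list (\<tau> # \<tau>s) (xs # xss)"
      by (simp add: block_perms_Cons)
    then show ?case by blast
  qed
  then obtain \<tau>s where \<tau>s: "block_perms ls \<tau>s" "map sort ?b = map2 permute_list \<tau>s ?b" using lens by metis
  have "map (\<sigma> \<circ> sum_perm \<tau>s ls) [0..<sum_list ls] = permute_list (sum_perm \<tau>s ls) (map \<sigma> [0..<sum_list ls])"
    using permute_list_map[of "sum_perm \<tau>s ls" "[0..<sum_list ls]" \<sigma>] sum_perm_permutes[OF \<tau>s(1)]
    by (simp add: permute_list_upt)
  also have "\<dots> = concat (map sort ?b)"
    using permute_list_sum_perm[OF lens \<tau>s(1)] \<tau>s(2) by (simp add: concat_split_blocks)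
  finally have "perm_blocks ls (\<sigma> \<circ> sum_perm \<tau>s ls) = map sort ?b"
    using lens by (simp add: split_blocks_concat comp_def)
  then have "sort_blocks ls \<sigma> = \<sigma> \<circ> sum_perm \<tau>s ls"
    using assms \<tau>s(1)
    by (intro perm_blocks_eqI[of _ ls])
      (auto simp: perm_blocks_sort_blocks sort_blocks_permutes intro: permutes_compose sum_perm_permutes)
  with \<tau>s(1) show ?thesis by blast
qed

text \<open>The unshuffles represent the left cosets of the block subgroup: left translation, followed by sorting
  the blocks, permutes them.\<close>

lemma sum_unshuffles_translate:
  assumes "\<pi> permutes {..<sum_list ls}"
    and "\<And>\<sigma> \<tau>s. \<sigma> permutes {..<sum_list ls} \<Longrightarrow> block_perms ls \<tau>s \<Longrightarrow> \<Psi> (\<sigma> \<circ> sum_perm \<tau>s ls) = \<Psi> \<sigma>"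
  shows "(\<Sum>\<sigma>\<in>unshuffles ls. \<Psi> (\<pi> \<circ> \<sigma>)) = (\<Sum>\<sigma>\<in>unshuffles ls. \<Psi> \<sigma>)"
proof -
  have "\<Psi> (\<pi> \<circ> \<sigma>) = \<Psi> (sort_blocks ls (\<pi> \<circ> \<sigma>))" if "\<sigma> \<in> unshuffles ls" for \<sigma>
  proof -
    have p: "\<pi> \<circ> \<sigma> permutes {..<sum_list ls}"
      using that assms(1) by (auto simp: unshuffles_def intro: permutes_compose)
    from sort_blocks_factor[OF this] assms(2)[OF p] show ?thesis by force
  qed
  then show ?thesis using sum.reindex_bij_betw[OF sort_blocks_bij[OF assms(1)], of \<Psi>] by simp
qed

subsection \<open>Schur functors\<close>

lemma carr_arity_space [simp]: "carr (arity_space P n) = ops P n"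
  and scl_arity_space [simp]: "scl (arity_space P n) = smul P"
  by (simp_all add: arity_space_def)

lemma linear_between_ground_iff:
  "linear_between V ground f \<longleftrightarrow> (\<forall>x\<in>carr V. \<forall>y\<in>carr V. f (x + y) = f x + f y) \<and>
    (\<forall>c. \<forall>x\<in>carr V. f (scl V c x) = c * f x)"
  by (auto simp: linear_between_def)

lemma multilinear_between_append:
  assumes "multilinear_between (replicate (a + n + b) V) W F"
    and "length xs = a" "length ys = b" "set xs \<subseteq> carr V" "set ys \<subseteq> carr V"
  shows "multilinear_between (replicate n V) W (\<lambda>v. F (xs @ v @ ys))"
  unfolding multilinear_between_def
proof (intro ballI conjI allI impI)
  fix v assume "v \<in> listset (map carr (replicate n V))"
  then have l: "length v = n" and v: "xs @ v @ ys \<in> listset (map carr (replicate (a + n + b) V))"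
    using assms by (auto simp: listset_replicate_iff)
  show "F (xs @ v @ ys) \<in> carr W" by (rule multilinear_betweenD(1)[OF assms(1) v])
  fix i assume "i < length (replicate n V)"
  then show "linear_between (replicate n V ! i) W (\<lambda>y. F (xs @ v[i := y] @ ys))"
    using multilinear_betweenD(2)[OF assms(1) v, of "a + i"] assms(2) l
    by (simp add: list_update_append)
qed

lemma multilinear_between_pointwise:
  fixes F :: "'v::ab_group_add list \<Rightarrow> 'x \<Rightarrow> 'k::field"
  assumes "\<And>q. multilinear_between Vs ground (\<lambda>xs. F xs q)"
  shows "multilinear_between Vs \<lparr>carr = UNIV, scl = fun_scale\<rparr> F"
proof -
  have "linear_between (Vs ! i) ground (\<lambda>y. F (xs[i := y]) q)"
    if "i < length Vs" "xs \<in> listset (map carr Vs)" for xs i q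
    using multilinear_betweenD(2)[OF assms that(2,1)] .
  then show ?thesis
    by (auto simp: multilinear_between_def linear_between_def fun_eq_iff fun_scale_def)
qed

text \<open>Here membership in the quotient is known on generators only. The values are first
  regarded in the space of all functions, where multilinearity is pointwise, and the span argument
  then puts them into the subspace.\<close>

lemma multilinear_presentedI_gen:
  assumes "\<And>q. multilinear_between Vs ground (\<lambda>xs. F xs q)"
    and "list_all2 (\<lambda>V B. is_vspace V \<and> carr V = module.span (scl V) B) Vs Bs"
    and "\<And>bs. bs \<in> listset Bs \<Longrightarrow> F bs \<in> carr (presented_space X Q)"
  shows "multilinear_between Vs (presented_space X Q) F"
proof (rule multilinear_presentedI)
  show "multilinear_between Vs ground (\<lambda>xs. F xs q)" for q by (rule assms(1))
  fix xs assume xs: "xs \<in> listset (map carr Vs)"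
  have "fun_space.subspace (carr (presented_space X Q))"
    by (simp add: carr_presented)
  then show "F xs \<in> carr (presented_space X Q)"
    using multilinear_between_span[OF multilinear_between_pointwise[of Vs F, OF assms(1)] _ _ assms(2) _ xs]
      assms(3) by (simp add: is_vspace_def vector_space_fun_scale)
next
  fix V assume "V \<in> set Vs"
  then show "is_vspace V"
    using list_all2_nthD[OF assms(2)] by (auto simp: in_set_conv_nth)
qed

lemma list_all2_presented:
  "list_all2 (\<lambda>V B. is_vspace V \<and> carr V = module.span (scl V) B)
     (replicate n (presented_space X Q)) (replicate n (gen Q ` X))"
  by (auto simp: list_all2_conv_all_nth is_vspace_presented_space carr_presented)

lemma gens_listset:
  "ts \<in> listset (replicate n (gen Q ` X)) \<longleftrightarrow> (\<exists>ps\<in>listset (replicate n X). ts = map (gen Q) ps)"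
proof (induction n arbitrary: ts)
  case (Suc n)
  then show ?case
    by (auto simp: listset_eq_Cons image_iff) (metis listset_Cons_iff list.simps(9))+
qed auto

lemma multilinear_presented_eqI:
  assumes "is_vspace W" "multilinear_between (replicate n (presented_space X Q)) W F"
    and "multilinear_between (replicate n (presented_space X Q)) W G"
    and "\<And>ps. ps \<in> listset (replicate n X) \<Longrightarrow> F (map (gen Q) ps) = G (map (gen Q) ps)"
    and "ts \<in> listset (replicate n (carr (presented_space X Q)))"
  shows "F ts = G ts"
proof -
  interpret W: vector_space "scl W" using assms(1) by (rule is_vspace_vector_space)
  have "multilinear_between (replicate n (presented_space X Q)) W (\<lambda>ts. scl W (- 1) (F ts) + G ts)"
    by (rule multilinear_between_combine[OF assms(1-3)])
  then have "scl W (- 1) (F ts) + G ts \<in> {0}"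
    by (rule multilinear_between_span[OF _ assms(1) _ list_all2_presented])
      (use assms(4,5) in \<open>auto simp: gens_listset\<close>)
  then show ?thesis by simp
qed

lemma schur_formsI:
  assumes "\<And>v. set v \<subseteq> carr V \<Longrightarrow> linear_between (arity_space P (length v)) ground (\<lambda>b. g (b, v))"
    and "\<And>n b. b \<in> ops P n \<Longrightarrow> multilinear_between (replicate n V) ground (\<lambda>v. g (b, v))"
    and "\<And>b v \<sigma>. b \<in> ops P (length v) \<Longrightarrow> set v \<subseteq> carr V \<Longrightarrow> \<sigma> permutes {..<length v} \<Longrightarrow>
      g (act P (length v) \<sigma> b, permute_list \<sigma> v) = g (b, v)"
  shows "g \<in> schur_forms P V"
  using assms by (auto simp: schur_forms_def listset_replicate_iff)

lemma schur_formsD: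
  assumes "g \<in> schur_forms P V"
  shows "set v \<subseteq> carr V \<Longrightarrow> linear_between (arity_space P (length v)) ground (\<lambda>b. g (b, v))"
    and "b \<in> ops P n \<Longrightarrow> multilinear_between (replicate n V) ground (\<lambda>v. g (b, v))"
    and "b \<in> ops P (length v) \<Longrightarrow> set v \<subseteq> carr V \<Longrightarrow> \<sigma> permutes {..<length v} \<Longrightarrow>
      g (act P (length v) \<sigma> b, permute_list \<sigma> v) = g (b, v)"
  using assms by (auto simp: schur_forms_def listset_replicate_iff)

lemma is_vspace_schur: "is_vspace (schur P V)"
  by (simp add: schur_def is_vspace_presented_space)

lemma scl_schur [simp]: "scl (schur P V) = fun_scale"
  by (simp add: schur_def)

lemma in_schur_symbols [simp]: "(b, v) \<in> schur_symbols P V \<longleftrightarrow> b \<in> ops P (length v) \<and> set v \<subseteq> carr V"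
  by (simp add: schur_symbols_def)

lemma gen_in_schur: "b \<in> ops P (length v) \<Longrightarrow> set v \<subseteq> carr V \<Longrightarrow> gen (schur_forms P V) (b, v) \<in> carr (schur P V)"
  unfolding schur_def by (rule gen_in_carr) simp

context symmetric_module
begin

lemma act_closed: "\<sigma> permutes {..<n} \<Longrightarrow> a \<in> ops P n \<Longrightarrow> act P n \<sigma> a \<in> ops P n"
  using linear_betweenD(1)[OF act_linear] by simp

lemma act_inv:
  assumes "\<sigma> permutes {..<n}" "a \<in> ops P n"
  shows "act P n (inv \<sigma>) (act P n \<sigma> a) = a" "act P n \<sigma> (act P n (inv \<sigma>) a) = a"
  using act_comp[OF assms(1) permutes_inv[OF assms(1)] assms(2)]
    act_comp[OF permutes_inv[OF assms(1)] assms(1) assms(2)] act_id[OF assms(2)]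
    permutes_inv_o[OF assms(1)] by simp_all

lemma form_space_schur:
  assumes "is_vspace V"
  shows "form_space (schur_symbols P V) (schur_forms P V)"
proof (rule form_spaceI)
  show "(\<lambda>x. 0) \<in> schur_forms P V"
    by (rule schur_formsI)
      (simp_all add: linear_between_const_zero multilinear_between_const_zero is_vspace_ground)
  show "(\<lambda>x. c * q x + q' x) \<in> schur_forms P V" if "q \<in> schur_forms P V" "q' \<in> schur_forms P V" for c q q'
  proof (rule schur_formsI)
    show "linear_between (arity_space P (length v)) ground (\<lambda>b. c * q (b, v) + q' (b, v))"
      if "set v \<subseteq> carr V" for v
      using linear_between_combine[OF is_vspace_ground schur_formsD(1)[OF _ that] schur_formsD(1)[OF _ that]]
        \<open>q \<in> _\<close> \<open>q' \<in> _\<close> by simp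
    show "multilinear_between (replicate n V) ground (\<lambda>v. c * q (b, v) + q' (b, v))"
      if "b \<in> ops P n" for n b
      using multilinear_between_combine[OF is_vspace_ground schur_formsD(2)[OF _ that] schur_formsD(2)[OF _ that]]
        \<open>q \<in> _\<close> \<open>q' \<in> _\<close> by simp
  qed (use schur_formsD(3)[OF that(1)] schur_formsD(3)[OF that(2)] in simp)
  show "q' \<in> schur_forms P V"
    if q: "q \<in> schur_forms P V" and e: "\<And>x. x \<in> schur_symbols P V \<Longrightarrow> q' x = q x" for q q'
  proof (rule schur_formsI)
    show "linear_between (arity_space P (length v)) ground (\<lambda>b. q' (b, v))" if "set v \<subseteq> carr V" for v
      using schur_formsD(1)[OF q that] that e
      by (subst linear_between_cong[OF _ vspace, of _ _ "\<lambda>b. q (b, v)"]) auto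
    show "multilinear_between (replicate n V) ground (\<lambda>v. q' (b, v))" if "b \<in> ops P n" for n b
      using schur_formsD(2)[OF q that] that e assms
      by (subst multilinear_between_cong[of _ _ "\<lambda>v. q (b, v)"]) (auto simp: listset_replicate_iff)
    show "q' (act P (length v) \<sigma> b, permute_list \<sigma> v) = q' (b, v)"
      if "b \<in> ops P (length v)" "set v \<subseteq> carr V" "\<sigma> permutes {..<length v}" for b v \<sigma>
      using schur_formsD(3)[OF q that] that e[of "(b, v)"] e[of "(act P (length v) \<sigma> b, permute_list \<sigma> v)"]
      by (simp add: act_closed)
  qed
qed

lemma gen_schur_linear:
  assumes "set v \<subseteq> carr V"
  shows "linear_between (arity_space P (length v)) (schur P V) (\<lambda>b. gen (schur_forms P V) (b, v))"
  unfolding schur_def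
proof (rule linear_presentedI)
  show "gen (schur_forms P V) (b, v) \<in> carr (presented_space (schur_symbols P V) (schur_forms P V))"
    if "b \<in> carr (arity_space P (length v))" for b
    using that assms by (intro gen_in_carr) simp
  show "linear_between (arity_space P (length v)) ground (\<lambda>b. gen (schur_forms P V) (b, v) q)"
    if "q \<in> schur_forms P V" for q
    using schur_formsD(1)[OF that assms] that by (simp add: gen_def)
qed (rule vspace)

lemma gen_schur_multilinear:
  assumes "is_vspace V" "b \<in> ops P n"
  shows "multilinear_between (replicate n V) (schur P V) (\<lambda>v. gen (schur_forms P V) (b, v))"
  unfolding schur_def
proof (rule multilinear_presentedI)
  show "gen (schur_forms P V) (b, v) \<in> carr (presented_space (schur_symbols P V) (schur_forms P V))"
    if "v \<in> listset (map carr (replicate n V))" for v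
    using that assms by (intro gen_in_carr) (auto simp: listset_replicate_iff)
  show "multilinear_between (replicate n V) ground (\<lambda>v. gen (schur_forms P V) (b, v) q)"
    if "q \<in> schur_forms P V" for q
    using schur_formsD(2)[OF that assms(2)] that by (simp add: gen_def)
qed (use assms(1) in simp)

lemma gen_schur_act:
  assumes "b \<in> ops P (length v)" "set v \<subseteq> carr V" "\<sigma> permutes {..<length v}"
  shows "gen (schur_forms P V) (act P (length v) \<sigma> b, permute_list \<sigma> v) = gen (schur_forms P V) (b, v)"
  using schur_formsD(3)[OF _ assms] by (auto simp: gen_def)

lemma schur_form_compose:
  assumes "\<And>v. set v \<subseteq> carr V \<Longrightarrow> linear_between (arity_space P (length v)) W (\<lambda>b. F (b, v))"
    and "\<And>n b. b \<in> ops P n \<Longrightarrow> multilinear_between (replicate n V) W (\<lambda>v. F (b, v))"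
    and "\<And>b v \<sigma>. b \<in> ops P (length v) \<Longrightarrow> set v \<subseteq> carr V \<Longrightarrow> \<sigma> permutes {..<length v} \<Longrightarrow>
      F (act P (length v) \<sigma> b, permute_list \<sigma> v) = F (b, v)"
    and "linear_between W ground l"
  shows "(\<lambda>x. l (F x)) \<in> schur_forms P V"
  by (rule schur_formsI)
    (use assms(3) linear_between_compose[OF assms(1) assms(4)] multilinear_between_compose[OF assms(2) assms(4)] in auto)

lemma presented_map_schur:
  assumes "\<And>v. set v \<subseteq> carr V \<Longrightarrow> linear_between (arity_space P (length v)) (presented_space Y R) (\<lambda>b. F (b, v))"
    and "\<And>n b. b \<in> ops P n \<Longrightarrow> multilinear_between (replicate n V) (presented_space Y R) (\<lambda>v. F (b, v))"
    and "\<And>b v \<sigma>. b \<in> ops P (length v) \<Longrightarrow> set v \<subseteq> carr V \<Longrightarrow> \<sigma> permutes {..<length v} \<Longrightarrow>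
      F (act P (length v) \<sigma> b, permute_list \<sigma> v) = F (b, v)"
  shows "presented_map (schur_symbols P V) (schur_forms P V) Y R F"
  unfolding presented_map_def
proof (intro conjI ballI)
  fix x assume "x \<in> schur_symbols P V"
  then show "F x \<in> carr (presented_space Y R)"
    using linear_betweenD(1)[OF assms(1), of "snd x" "fst x"] by (cases x) simp
next
  fix q
  show "(\<lambda>x. F x q) \<in> schur_forms P V"
    by (rule schur_form_compose[where F = F and W = "presented_space Y R" and l = "\<lambda>t. t q",
          OF assms linear_between_apply])
qed

lemma schur_linear_exists:
  assumes "is_vspace W"
    and "\<And>v. set v \<subseteq> carr V \<Longrightarrow> linear_between (arity_space P (length v)) W (\<lambda>b. F (b, v))"
    and "\<And>n b. b \<in> ops P n \<Longrightarrow> multilinear_between (replicate n V) W (\<lambda>v. F (b, v))"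
    and "\<And>b v \<sigma>. b \<in> ops P (length v) \<Longrightarrow> set v \<subseteq> carr V \<Longrightarrow> \<sigma> permutes {..<length v} \<Longrightarrow>
      F (act P (length v) \<sigma> b, permute_list \<sigma> v) = F (b, v)"
  shows "\<exists>h. linear_between (schur P V) W h \<and>
    (\<forall>b v. b \<in> ops P (length v) \<longrightarrow> set v \<subseteq> carr V \<longrightarrow> h (gen (schur_forms P V) (b, v)) = F (b, v))"
proof -
  have "\<exists>h. linear_between (presented_space (schur_symbols P V) (schur_forms P V)) W h \<and>
      (\<forall>x\<in>schur_symbols P V. h (gen (schur_forms P V) x) = F x)"
  proof (rule presented_linear_exists[OF assms(1)])
    show "F x \<in> carr W" if "x \<in> schur_symbols P V" for x
      using linear_betweenD(1)[OF assms(2), of "snd x" "fst x"] that by (cases x) simp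
    show "(\<lambda>x. l (F x)) \<in> schur_forms P V" if "linear_between W ground l" for l
      by (rule schur_form_compose[OF assms(2-4) that])
  qed
  then show ?thesis unfolding schur_def by auto
qed

lemma schur_linear_eqI:
  assumes "linear_between (schur P V) W f" "linear_between (schur P V) W g"
    and "\<And>b v. b \<in> ops P (length v) \<Longrightarrow> set v \<subseteq> carr V \<Longrightarrow>
      f (gen (schur_forms P V) (b, v)) = g (gen (schur_forms P V) (b, v))"
    and "t \<in> carr (schur P V)"
  shows "f t = g t"
  by (rule presented_linear_eqI[OF assms(1,2)[unfolded schur_def] _ assms(4)[unfolded schur_def]])
    (use assms(3) in auto)

text \<open>The common source of maps out of tensor powers of a Schur functor: a function of
  operations and of the concatenated word that is multilinear in both and invariant under the Young
  subgroups respects the relations in every factor. It yields the composition of the free algebra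
  and, later, the functionals that separate elements of the induced modules.\<close>

lemma mform_blocks:
  assumes V: "is_vspace V"
    and lin: "\<And>ls xs. length ls = k \<Longrightarrow> length xs = sum_list ls \<Longrightarrow> set xs \<subseteq> carr V \<Longrightarrow>
      multilinear_between (map (arity_space P) ls) ground (\<lambda>as. \<Gamma> ls as xs)"
    and mul: "\<And>ls as. length ls = k \<Longrightarrow> as \<in> listset (map (ops P) ls) \<Longrightarrow>
      multilinear_between (replicate (sum_list ls) V) ground (\<Gamma> ls as)"
    and inv: "\<And>ls as xs \<tau>s. length ls = k \<Longrightarrow> as \<in> listset (map (ops P) ls) \<Longrightarrow> length xs = sum_list ls \<Longrightarrow>
      set xs \<subseteq> carr V \<Longrightarrow> block_perms ls \<tau>s \<Longrightarrow>
      \<Gamma> ls (map (\<lambda>(l, \<tau>, b). act P l \<tau> b) (zip ls (zip \<tau>s as))) (permute_list (sum_perm \<tau>s ls) xs) = \<Gamma> ls as xs"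
  shows "mform (replicate k (schur_symbols P V, schur_forms P V))
    (\<lambda>ps. \<Gamma> (map (length \<circ> snd) ps) (map fst ps) (concat (map snd ps)))"
proof (rule mformI)
  show "form_spaces (replicate k (schur_symbols P V, schur_forms P V))"
    using form_space_schur[OF V] by simp
next
  fix ps i assume "ps \<in> listset (map fst (replicate k (schur_symbols P V, schur_forms P V)))"
    and "i < length (replicate k (schur_symbols P V, schur_forms P V))"
  then have k: "length ps = k" and ps: "set ps \<subseteq> schur_symbols P V" and i: "i < k"
    by (auto simp: listset_replicate_iff)
  define as us ls where "as = map fst ps" and "us = map snd ps" and "ls = map (length \<circ> snd) ps"
  have len: "length as = k" "length us = k" "length ls = k" using k by (simp_all add: as_def us_def ls_def)
  have sym: "as ! j \<in> ops P (ls ! j)" "set (us ! j) \<subseteq> carr V" "length (us ! j) = ls ! j" if "j < k" for j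
    using subsetD[OF ps nth_mem[of j ps]] that k by (auto simp: as_def us_def ls_def schur_symbols_def split_beta)
  have lsu: "ls = map length us" by (simp add: ls_def us_def)
  have as: "as[i := b] \<in> listset (map (ops P) (ls[i := n]))" if "b \<in> ops P n" for b n
    using sym len that i by (auto simp: listset_iff_nth nth_list_update)
  have sl: "length (concat (us[i := v])) = sum_list (ls[i := length v])" for v
    by (simp add: lsu length_concat map_update)
  have "\<forall>u\<in>set us. set u \<subseteq> carr V"
    using ps by (fastforce simp: us_def schur_symbols_def)
  then have us: "set (concat (us[i := v])) \<subseteq> carr V" if "set v \<subseteq> carr V" for v
    using that set_update_subset_insert[of us i v] by auto
  \<comment> \<open>The dependence on factor i alone. A new word may have a new length, so the list
    of lengths varies with it.\<close>
  define g where "g = (\<lambda>(b, v). \<Gamma> (ls[i := length v]) (as[i := b]) (concat (us[i := v])))"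
  have "g \<in> schur_forms P V"
  proof (rule schur_formsI)
    fix v assume v: "set v \<subseteq> carr V"
    let ?l = "ls[i := length v]"
    \<comment> \<open>Some operation of this arity must fill slot i before multilinearity can be
      applied there; 0 is always available.\<close>
    have z: "0 \<in> ops P (length v)" using is_vspace_zero[OF vspace[of "length v"]] by simp
    show "linear_between (arity_space P (length v)) ground (\<lambda>b. g (b, v))"
      using multilinear_betweenD(2)[OF lin[OF _ sl us[OF v]], of "as[i := 0]" i] as[OF z] i len
      by (simp add: comp_def g_def)
  next
    fix n b assume b: "b \<in> ops P n"
    let ?c = "\<Gamma> (ls[i := n]) (as[i := b])"
    let ?x = "concat (take i us)" and ?y = "concat (drop (Suc i) us)"
    have split: "concat (us[i := v]) = ?x @ v @ ?y" for v using i len by (simp add: upd_conv_take_nth_drop)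
    have n: "sum_list (ls[i := n]) = length ?x + n + length ?y"
      using sl[of "replicate n undefined"] split by simp
    have "multilinear_between (replicate (length ?x + n + length ?y) V) ground ?c"
      using mul[OF _ as[OF b]] n len by simp
    moreover have "set ?x \<subseteq> carr V" "set ?y \<subseteq> carr V"
      using us[of "[]"] split[of "[]"] by auto
    ultimately have "multilinear_between (replicate n V) ground (\<lambda>v. ?c (?x @ v @ ?y))"
      by (intro multilinear_between_append[of "length ?x" n "length ?y" V ground ?c]) auto
    then show "multilinear_between (replicate n V) ground (\<lambda>v. g (b, v))"
      using V by (subst multilinear_between_cong[of _ _ "\<lambda>v. ?c (?x @ v @ ?y)"])
        (auto simp: g_def split listset_replicate_iff)
  next
    fix b v \<tau> assume b: "b \<in> ops P (length v)" and v: "set v \<subseteq> carr V" and \<tau>: "\<tau> permutes {..<length v}"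
    \<comment> \<open>The relation in a single factor comes from the Young subgroup element with
      identities in the other slots.\<close>
    let ?l = "ls[i := length v]" and ?\<tau>s = "(replicate k id)[i := \<tau>]"
    have bp: "block_perms ?l ?\<tau>s" using \<tau> len i
      by (auto simp: block_perms_def nth_list_update permutes_id)
    have 1: "map (\<lambda>(l, \<tau>, b). act P l \<tau> b) (zip ?l (zip ?\<tau>s (as[i := b]))) = as[i := act P (length v) \<tau> b]"
      using len sym i by (intro nth_equalityI) (auto simp: nth_list_update act_id)
    have 2: "map2 permute_list ?\<tau>s (us[i := v]) = us[i := permute_list \<tau> v]"
      using len i by (intro nth_equalityI) (auto simp: nth_list_update)
    have "concat (us[i := permute_list \<tau> v]) = permute_list (sum_perm ?\<tau>s ?l) (concat (us[i := v]))"
      using permute_list_sum_perm[of "us[i := v]" ?l ?\<tau>s] bp 2 by (simp add: lsu map_update)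
    then show "g (act P (length v) \<tau> b, permute_list \<tau> v) = g (b, v)"
      using inv[OF _ as[OF b] sl us[OF v] bp] len 1 by (simp add: g_def)
  qed
  moreover have "(\<lambda>x. \<Gamma> (map (length \<circ> snd) (ps[i := x])) (map fst (ps[i := x]))
      (concat (map snd (ps[i := x])))) = g"
    by (auto simp: g_def as_def us_def ls_def map_update)
  ultimately show "(\<lambda>x. \<Gamma> (map (length \<circ> snd) (ps[i := x])) (map fst (ps[i := x]))
      (concat (map snd (ps[i := x])))) \<in> snd (replicate k (schur_symbols P V, schur_forms P V) ! i)"
    using i by simp
qed

end

subsection \<open>Free algebras\<close>

lemma map2_gen_replicate:
  "length ps = n \<Longrightarrow> map2 (\<lambda>S x. gen (snd S) x) (replicate n (X, Q)) ps = map (gen Q) ps"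
  by (rule nth_equalityI) auto

lemma mev_zero: "ts \<in> listset (replicate n (carr (presented_space X Q))) \<Longrightarrow> mev ts (\<lambda>xs. 0) = 0"
proof (induction ts arbitrary: n)
  case (Cons t ts)
  then obtain m where "n = Suc m" by (cases n) auto
  with Cons show ?case by (auto intro: presented_zero)
qed simp

context symmetric_operad
begin

lemma gam_closed:
  "a \<in> ops P (length ls) \<Longrightarrow> bs \<in> listset (map (ops P) ls) \<Longrightarrow> gam P ls a bs \<in> ops P (sum_list ls)"
  using multilinear_betweenD(1)[OF gam_multilinear] by (simp add: comp_def)

text \<open>Inner equivariance of the composition is what makes it compatible with the coinvariants
  in each argument.\<close>

lemma mform_free:
  assumes V: "is_vspace V" and q: "q \<in> schur_forms P V" and a: "a \<in> ops P k"
  shows "mform (replicate k (schur_symbols P V, schur_forms P V))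
    (\<lambda>ps. q (gam P (map (length \<circ> snd) ps) a (map fst ps), concat (map snd ps)))"
proof (rule mform_blocks[OF V, where \<Gamma> = "\<lambda>ls as xs. q (gam P ls a as, xs)"])
  show "multilinear_between (map (arity_space P) ls) ground (\<lambda>as. q (gam P ls a as, xs))"
    if "length ls = k" "length xs = sum_list ls" "set xs \<subseteq> carr V" for ls xs
    using multilinear_between_compose[OF gam_multilinear, of a ls ground "\<lambda>b. q (b, xs)"]
      schur_formsD(1)[OF q that(3)] that a by simp
  show "multilinear_between (replicate (sum_list ls) V) ground (\<lambda>xs. q (gam P ls a as, xs))"
    if "length ls = k" "as \<in> listset (map (ops P) ls)" for ls as
    using schur_formsD(2)[OF q gam_closed] that a by simp
  show "q (gam P ls a (map (\<lambda>(l, \<tau>, b). act P l \<tau> b) (zip ls (zip \<tau>s as))), permute_list (sum_perm \<tau>s ls) xs) =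
      q (gam P ls a as, xs)"
    if "length ls = k" "as \<in> listset (map (ops P) ls)" "length xs = sum_list ls" "set xs \<subseteq> carr V"
      "block_perms ls \<tau>s" for ls as xs \<tau>s
  proof -
    have "gam P ls a (map (\<lambda>(l, \<tau>, b). act P l \<tau> b) (zip ls (zip \<tau>s as))) =
        act P (sum_list ls) (sum_perm \<tau>s ls) (gam P ls a as)"
      by (rule gam_equivariant_inner) (use that a in \<open>auto simp: block_perms_def\<close>)
    then show ?thesis
      using schur_formsD(3)[OF q _ that(4), of "gam P ls a as" "sum_perm \<tau>s ls"] that a
        gam_closed[of a ls as] sum_perm_permutes[of ls \<tau>s] by simp
  qed
qed

lemma free_ev_gen:
  assumes "is_vspace V" "a \<in> ops P k" "ps \<in> listset (replicate k (schur_symbols P V))"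
  shows "free_ev P V a (map (gen (schur_forms P V)) ps) =
    gen (schur_forms P V) (gam P (map (length \<circ> snd) ps) a (map fst ps), concat (map snd ps))"
proof
  fix q
  show "free_ev P V a (map (gen (schur_forms P V)) ps) q =
    gen (schur_forms P V) (gam P (map (length \<circ> snd) ps) a (map fst ps), concat (map snd ps)) q"
  proof (cases "q \<in> schur_forms P V")
    case True
    show ?thesis
      using mev_gen[OF _ mform_free[OF assms(1) True assms(2)], of ps] assms(3) form_space_schur[OF assms(1)]
        True listset_length[OF assms(3)]
      by (simp add: free_ev_def multi_ext_apply gen_def[of _ "(_, _)"] map2_gen_replicate)
  next
    case False
    have "map (gen (schur_forms P V)) ps \<in> listset (replicate k (carr (presented_space (schur_symbols P V) (schur_forms P V))))"
      using assms(3) by (auto simp: listset_replicate_iff intro!: gen_in_carr)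
    from mev_zero[OF this] False show ?thesis
      by (simp add: free_ev_def multi_ext_apply gen_def[of _ "(_, _)"])
  qed
qed

lemma free_ev_multilinear:
  assumes "is_vspace V" "a \<in> ops P k"
  shows "multilinear_between (replicate k (schur P V)) (schur P V) (free_ev P V a)"
  unfolding schur_def
proof (rule multilinear_presentedI_gen[OF _ list_all2_presented])
  fix q
  show "multilinear_between (replicate k (presented_space (schur_symbols P V) (schur_forms P V))) ground
      (\<lambda>xs. free_ev P V a xs q)"
  proof (cases "q \<in> schur_forms P V")
    case True
    then show ?thesis
      using mev_multilinear[OF _ mform_free[OF assms(1) True assms(2)]] form_space_schur[OF assms(1)]
      by (simp add: free_ev_def multi_ext_apply gen_def)
  next
    case False
    then show ?thesis
      using mev_zero[of _ k "schur_symbols P V" "schur_forms P V"] multilinear_between_const_zero[OF is_vspace_ground]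
      by (subst multilinear_between_cong[of _ _ "\<lambda>_. 0"])
        (auto simp: free_ev_def multi_ext_apply gen_def is_vspace_presented_space)
  qed
next
  fix bs assume "bs \<in> listset (replicate k (gen (schur_forms P V) ` schur_symbols P V))"
  then obtain ps where ps: "bs = map (gen (schur_forms P V)) ps" "ps \<in> listset (replicate k (schur_symbols P V))"
    by (auto simp: gens_listset)
  have "\<forall>p\<in>set ps. set (snd p) \<subseteq> carr V"
    using ps(2) by (fastforce simp: listset_replicate_iff schur_symbols_def)
  then have "set (concat (map snd ps)) \<subseteq> carr V" by auto
  moreover have "map fst ps \<in> listset (map (ops P) (map (length \<circ> snd) ps))"
    using ps(2) by (force simp: listset_replicate_iff listset_iff_nth schur_symbols_def split_beta dest: nth_mem)+
  moreover have "length (concat (map snd ps)) = sum_list (map (length \<circ> snd) ps)"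
    by (simp add: length_concat comp_def)
  ultimately show "free_ev P V a bs \<in> carr (presented_space (schur_symbols P V) (schur_forms P V))"
    using free_ev_gen[OF assms ps(2)] gam_closed[of a "map (length \<circ> snd) ps" "map fst ps"] assms(2)
      listset_length[OF ps(2)]
    by (simp add: ps(1) gen_in_schur[unfolded schur_def])
qed

end

subsection \<open>Dual modules and dual bases\<close>

lemma sum_fun_apply: "(\<Sum>i\<in>I. F i) x = (\<Sum>i\<in>I. F i x :: 'k::comm_monoid_add)"
  by (induction I rule: infinite_finite_induct) auto

lemma ops_dual: "f \<in> ops (dual_smodule P) n \<longleftrightarrow>
    linear_between (arity_space P n) ground f \<and> (\<forall>a. a \<notin> ops P n \<longrightarrow> f a = 0)"
  and act_dual: "act (dual_smodule P) n \<sigma> f a = (if a \<in> ops P n then f (act P n (inv \<sigma>) a) else 0)"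
  and smul_dual [simp]: "smul (dual_smodule P) = fun_scale"
  by (simp_all add: dual_smodule_def)

lemma (in symmetric_module) symmetric_module_dual: "symmetric_module (dual_smodule P)"
proof
  let ?D = "dual_smodule P"
  show "is_vspace (arity_space ?D n)" for n
  proof -
    have "fun_space.subspace (ops ?D n)"
    proof (rule fun_space.subspaceI)
      show "0 \<in> ops ?D n"
        using linear_between_const_zero[OF is_vspace_ground, of "arity_space P n"] by (simp add: ops_dual zero_fun_def)
      show "f + g \<in> ops ?D n" if "f \<in> ops ?D n" "g \<in> ops ?D n" for f g
        using linear_between_combine[OF is_vspace_ground, of "arity_space P n" f g 1] that
        by (simp add: ops_dual plus_fun_def)
      show "fun_scale c f \<in> ops ?D n" if "f \<in> ops ?D n" for c f
        using linear_between_combine[OF is_vspace_ground, of "arity_space P n" f "\<lambda>_. 0" c]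
          linear_between_const_zero[OF is_vspace_ground, of "arity_space P n"] that
        by (simp add: ops_dual fun_scale_def)
    qed
    then show ?thesis by (simp add: is_vspace_def vector_space_fun_scale)
  qed
  have cl: "act ?D n \<sigma> f \<in> ops ?D n" if \<sigma>: "\<sigma> permutes {..<n}" and f: "f \<in> ops ?D n" for n \<sigma> f
  proof -
    have "linear_between (arity_space P n) ground (\<lambda>a. f (act P n (inv \<sigma>) a))"
      using f linear_between_compose[OF act_linear[OF permutes_inv[OF \<sigma>]], of ground f] by (simp add: ops_dual)
    then have "linear_between (arity_space P n) ground (act ?D n \<sigma> f)"
      by (rule linear_between_cong[THEN iffD1, rotated 2]) (simp_all add: act_dual vspace)
    then show ?thesis by (simp add: ops_dual act_dual)
  qed
  show "linear_between (arity_space ?D n) (arity_space ?D n) (act ?D n \<sigma>)" if "\<sigma> permutes {..<n}" for n \<sigma>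
    using cl[OF that] by (simp add: linear_between_def act_dual fun_eq_iff fun_scale_def)
  show "act ?D n id f = f" if "f \<in> ops ?D n" for n f
    using that by (auto simp: act_dual act_id ops_dual fun_eq_iff)
  show "act ?D n (\<sigma> \<circ> \<tau>) f = act ?D n \<tau> (act ?D n \<sigma> f)"
    if \<sigma>: "\<sigma> permutes {..<n}" and \<tau>: "\<tau> permutes {..<n}" for n \<sigma> \<tau> f
  proof
    fix a
    \<comment> \<open>Inversion and precomposition each reverse the order, so the dual of a right
      action is again a right action.\<close>
    have "inv (\<sigma> \<circ> \<tau>) = inv \<tau> \<circ> inv \<sigma>"
      using permutes_bij[OF \<sigma>] permutes_bij[OF \<tau>] by (rule o_inv_distrib)
    then show "act ?D n (\<sigma> \<circ> \<tau>) f a = act ?D n \<tau> (act ?D n \<sigma> f) a"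
      using act_comp[OF permutes_inv[OF \<tau>] permutes_inv[OF \<sigma>]] act_closed[OF permutes_inv[OF \<tau>]]
      by (simp add: act_dual)
  qed
qed

locale fd_module = symmetric_module +
  assumes fd: "finite_dimensional P"
begin

sublocale dual: symmetric_module "dual_smodule P"
  by (rule symmetric_module_dual)

lemma vector_space_smul: "vector_space (smul P)"
  using is_vspace_vector_space[OF vspace] by simp

lemma basis_of:
  shows "finite (basis_of P n)" "\<not> module.dependent (smul P) (basis_of P n)"
    "module.span (smul P) (basis_of P n) = ops P n"
proof -
  interpret A: vector_space "smul P" by (rule vector_space_smul)
  obtain B where B: "finite B" "A.span B = ops P n" using fd by (auto simp: finite_dimensional_def)
  obtain B' where "B' \<subseteq> B" "A.independent B'" "B \<subseteq> A.span B'" by (rule A.maximal_independent_subset)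
  then have "finite B' \<and> A.independent B' \<and> A.span B' = ops P n"
    using B by (metis A.span_eq A.span_superset finite_subset order_trans)
  then have "\<exists>B. finite B \<and> A.independent B \<and> A.span B = ops P n" by blast
  from someI_ex[OF this]
  show "finite (basis_of P n)" "\<not> module.dependent (smul P) (basis_of P n)"
    "module.span (smul P) (basis_of P n) = ops P n"
    unfolding basis_of_def by auto
qed

lemma basis_in_ops: "b \<in> basis_of P n \<Longrightarrow> b \<in> ops P n"
proof -
  interpret A: vector_space "smul P" by (rule vector_space_smul)
  show "b \<in> basis_of P n \<Longrightarrow> b \<in> ops P n" using A.span_base basis_of(3) by blast
qed

lemma dual_basis_in_dual: "dual_basis_of P n b \<in> ops (dual_smodule P) n"
proof -
  interpret A: vector_space "smul P" by (rule vector_space_smul)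
  have "A.representation (basis_of P n) a = (\<lambda>b. 0)" if "a \<notin> ops P n" for a
    using that unfolding A.representation_def basis_of(3) by simp
  moreover have "linear_between (arity_space P n) ground (dual_basis_of P n b)"
    using A.representation_add[OF basis_of(2)] A.representation_scale[OF basis_of(2)]
    by (simp add: linear_between_ground_iff dual_basis_of_def basis_of(3))
  ultimately show ?thesis by (simp add: ops_dual dual_basis_of_def)
qed

lemma dual_basis_apply: "b \<in> basis_of P n \<Longrightarrow> dual_basis_of P n c b = (if b = c then 1 else 0)"
proof -
  interpret A: vector_space "smul P" by (rule vector_space_smul)
  show "b \<in> basis_of P n \<Longrightarrow> dual_basis_of P n c b = (if b = c then 1 else 0)"
    by (simp add: dual_basis_of_def A.representation_basis[OF basis_of(2)])
qed

lemma basis_expand: "a \<in> ops P n \<Longrightarrow> a = (\<Sum>b\<in>basis_of P n. smul P (dual_basis_of P n b a) b)"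
proof -
  interpret A: vector_space "smul P" by (rule vector_space_smul)
  show "a \<in> ops P n \<Longrightarrow> a = (\<Sum>b\<in>basis_of P n. smul P (dual_basis_of P n b a) b)"
    unfolding dual_basis_of_def using basis_of(1,3)[of n]
    by (subst A.sum_representation_eq[OF basis_of(2)]) auto
qed

lemma linear_on_basis:
  assumes "linear_between (arity_space P n) W g" "a \<in> ops P n"
  shows "g a = (\<Sum>b\<in>basis_of P n. scl W (dual_basis_of P n b a) (g b))"
proof -
  have "g a = g (\<Sum>b\<in>basis_of P n. smul P (dual_basis_of P n b a) b)"
    using basis_expand[OF assms(2)] by simp
  also have "\<dots> = (\<Sum>b\<in>basis_of P n. g (smul P (dual_basis_of P n b a) b))"
    using is_vspace_scale[OF vspace] basis_in_ops
    by (intro linear_between_sum[OF assms(1) vspace]) (metis carr_arity_space scl_arity_space)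
  also have "\<dots> = (\<Sum>b\<in>basis_of P n. scl W (dual_basis_of P n b a) (g b))"
    using linear_betweenD(3)[OF assms(1)] basis_in_ops by (intro sum.cong) auto
  finally show ?thesis .
qed

lemma dual_expand:
  assumes "f \<in> ops (dual_smodule P) n"
  shows "f = (\<Sum>b\<in>basis_of P n. fun_scale (f b) (dual_basis_of P n b))"
proof
  fix a
  have "f a = (\<Sum>b\<in>basis_of P n. dual_basis_of P n b a * f b)"
  proof (cases "a \<in> ops P n")
    case True
    then show ?thesis using linear_on_basis[of n ground f a] assms by (simp add: ops_dual)
  next
    case False
    then show ?thesis using assms dual_basis_in_dual[of n] by (simp add: ops_dual)
  qed
  then show "f a = (\<Sum>b\<in>basis_of P n. fun_scale (f b) (dual_basis_of P n b)) a"
    by (simp add: fun_scale_def sum_fun_apply mult.commute)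
qed

lemma linear_on_dual_basis:
  assumes "linear_between (arity_space (dual_smodule P) n) W Q" "is_vspace W" "f \<in> ops (dual_smodule P) n"
  shows "Q f = (\<Sum>b\<in>basis_of P n. scl W (f b) (Q (dual_basis_of P n b)))"
proof -
  have "Q f = Q (\<Sum>b\<in>basis_of P n. fun_scale (f b) (dual_basis_of P n b))"
    using dual_expand[OF assms(3)] by simp
  also have "\<dots> = (\<Sum>b\<in>basis_of P n. Q (fun_scale (f b) (dual_basis_of P n b)))"
    using is_vspace_scale[OF dual.vspace] dual_basis_in_dual
    by (intro linear_between_sum[OF assms(1) dual.vspace]) (metis carr_arity_space scl_arity_space smul_dual)
  also have "\<dots> = (\<Sum>b\<in>basis_of P n. scl W (f b) (Q (dual_basis_of P n b)))"
    using linear_betweenD(3)[OF assms(1)] dual_basis_in_dual by (intro sum.cong) auto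
  finally show ?thesis .
qed

text \<open>The canonical element of a module tensored with its dual, the sum of basis vectors
  tensored with dual basis vectors, is invariant; here it is paired with g and Q.\<close>

lemma dual_pairing_invariant:
  assumes g: "linear_between (arity_space P n) ground g"
    and Q: "linear_between (arity_space (dual_smodule P) n) ground Q" and \<tau>: "\<tau> permutes {..<n}"
  shows "(\<Sum>b\<in>basis_of P n. g (act P n \<tau> b) * Q (act (dual_smodule P) n \<tau> (dual_basis_of P n b))) =
    (\<Sum>b\<in>basis_of P n. g b * Q (dual_basis_of P n b))"
proof -
  let ?B = "basis_of P n" and ?d = "dual_basis_of P n"
  \<comment> \<open>The dual basis vector of c is \<tau> applied to its translate by
    \<open>inv \<tau>\<close>, and the coefficients of that translate in the dual basis are the
    values of \<open>?d c\<close> at \<open>act P n \<tau> b\<close>.\<close>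
  have *: "(\<Sum>b\<in>?B. ?d c (act P n \<tau> b) * Q (act (dual_smodule P) n \<tau> (?d b))) = Q (?d c)" for c
  proof -
    let ?f = "act (dual_smodule P) n (inv \<tau>) (?d c)"
    have f: "?f \<in> ops (dual_smodule P) n"
      by (rule dual.act_closed[OF permutes_inv[OF \<tau>] dual_basis_in_dual])
    have fb: "?f b = ?d c (act P n \<tau> b)" if "b \<in> ?B" for b
      using basis_in_ops[OF that] by (simp add: act_dual permutes_inv_inv[OF \<tau>])
    have "Q (act (dual_smodule P) n \<tau> ?f) = (\<Sum>b\<in>?B. ?f b * Q (act (dual_smodule P) n \<tau> (?d b)))"
      using linear_on_dual_basis[OF linear_between_compose[OF dual.act_linear[OF \<tau>] Q] is_vspace_ground f] by simp
    then show ?thesis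
      using dual.act_inv(2)[OF \<tau> dual_basis_in_dual] fb by simp
  qed
  have "(\<Sum>b\<in>?B. g (act P n \<tau> b) * Q (act (dual_smodule P) n \<tau> (?d b))) =
    (\<Sum>b\<in>?B. \<Sum>c\<in>?B. g c * (?d c (act P n \<tau> b) * Q (act (dual_smodule P) n \<tau> (?d b))))"
    using linear_on_basis[OF g act_closed[OF \<tau> basis_in_ops]]
    by (intro sum.cong) (simp_all add: sum_distrib_left algebra_simps)
  also have "\<dots> = (\<Sum>c\<in>?B. g c * (\<Sum>b\<in>?B. ?d c (act P n \<tau> b) * Q (act (dual_smodule P) n \<tau> (?d b))))"
    by (subst sum.swap) (simp add: sum_distrib_left)
  finally show ?thesis by (simp add: *)
qed

abbreviation act_list :: "nat list \<Rightarrow> (nat \<Rightarrow> nat) list \<Rightarrow> 'b list \<Rightarrow> 'b list" where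
  "act_list ls \<tau>s bs \<equiv> map (\<lambda>(l, \<tau>, b). act P l \<tau> b) (zip ls (zip \<tau>s bs))"

abbreviation dual_act_list :: "nat list \<Rightarrow> (nat \<Rightarrow> nat) list \<Rightarrow> ('b \<Rightarrow> 'a) list \<Rightarrow> ('b \<Rightarrow> 'a) list" where
  "dual_act_list ls \<tau>s bs \<equiv> map (\<lambda>(l, \<tau>, b). act (dual_smodule P) l \<tau> b) (zip ls (zip \<tau>s bs))"

abbreviation dual_list :: "nat list \<Rightarrow> 'b list \<Rightarrow> ('b \<Rightarrow> 'a) list" where
  "dual_list ls bs \<equiv> map2 (dual_basis_of P) ls bs"

lemma act_list_in:
  "block_perms ls \<tau>s \<Longrightarrow> bs \<in> listset (map (ops P) ls) \<Longrightarrow> act_list ls \<tau>s bs \<in> listset (map (ops P) ls)"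
  by (auto simp: listset_iff_nth block_perms_def act_closed)

lemma dual_act_list_in:
  "block_perms ls \<tau>s \<Longrightarrow> bs \<in> listset (map (ops (dual_smodule P)) ls) \<Longrightarrow>
    dual_act_list ls \<tau>s bs \<in> listset (map (ops (dual_smodule P)) ls)"
  by (auto simp: listset_iff_nth block_perms_def dual.act_closed)

lemma dual_list_in: "length bs = length ls \<Longrightarrow> dual_list ls bs \<in> listset (map (ops (dual_smodule P)) ls)"
  by (auto simp: listset_iff_nth dual_basis_in_dual)

lemma basis_list_in: "bs \<in> listset (map (basis_of P) ls) \<Longrightarrow> bs \<in> listset (map (ops P) ls)"
  by (auto simp: listset_iff_nth basis_in_ops)

text \<open>The same for the tensor product over the blocks. The order of summation is changed so
  that the head and then the tail can be treated while the other is held fixed.\<close>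

lemma dual_pairing_invariant_list:
  assumes "multilinear_between (map (arity_space P) ls) ground G"
    and "multilinear_between (map (arity_space (dual_smodule P)) ls) ground Q" and "block_perms ls \<tau>s"
  shows "(\<Sum>bs\<in>listset (map (basis_of P) ls). G (act_list ls \<tau>s bs) * Q (dual_act_list ls \<tau>s (dual_list ls bs))) =
    (\<Sum>bs\<in>listset (map (basis_of P) ls). G bs * Q (dual_list ls bs))"
  using assms
proof (induction ls arbitrary: G Q \<tau>s)
  case Nil
  then show ?case by (simp add: block_perms_def)
next
  case (Cons l ls)
  then obtain \<tau> \<tau>s' where \<tau>s: "\<tau>s = \<tau> # \<tau>s'" "\<tau> permutes {..<l}" "block_perms ls \<tau>s'"
    by (auto simp: block_perms_Cons)
  let ?B = "basis_of P l" and ?Bs = "listset (map (basis_of P) ls)"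
  let ?a = "act_list ls \<tau>s'" and ?d = "\<lambda>bs. dual_act_list ls \<tau>s' (dual_list ls bs)"
  have "(\<Sum>bs\<in>listset (map (basis_of P) (l # ls)).
      G (act_list (l # ls) \<tau>s bs) * Q (dual_act_list (l # ls) \<tau>s (dual_list (l # ls) bs))) =
    (\<Sum>bs\<in>?Bs. \<Sum>b\<in>?B. G (act P l \<tau> b # ?a bs) * Q (act (dual_smodule P) l \<tau> (dual_basis_of P l b) # ?d bs))"
    by (simp add: sum_listset_Cons \<tau>s(1)) (rule sum.swap)
  also have "\<dots> = (\<Sum>bs\<in>?Bs. \<Sum>b\<in>?B. G (b # ?a bs) * Q (dual_basis_of P l b # ?d bs))"
  proof (rule sum.cong[OF refl])
    fix bs assume bs: "bs \<in> ?Bs"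
    have "?a bs \<in> listset (map (ops P) ls)" by (rule act_list_in[OF \<tau>s(3) basis_list_in[OF bs]])
    then have g: "linear_between (arity_space P l) ground (\<lambda>b. G (b # ?a bs))"
      using Cons.prems(1) by (simp add: multilinear_between_Cons comp_def)
    have "?d bs \<in> listset (map (ops (dual_smodule P)) ls)"
      using dual_act_list_in[OF \<tau>s(3) dual_list_in] listset_length[OF bs] by simp
    then have q: "linear_between (arity_space (dual_smodule P) l) ground (\<lambda>b. Q (b # ?d bs))"
      using Cons.prems(2) by (simp add: multilinear_between_Cons comp_def)
    show "(\<Sum>b\<in>?B. G (act P l \<tau> b # ?a bs) * Q (act (dual_smodule P) l \<tau> (dual_basis_of P l b) # ?d bs)) =
      (\<Sum>b\<in>?B. G (b # ?a bs) * Q (dual_basis_of P l b # ?d bs))"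
      by (rule dual_pairing_invariant[OF g q \<tau>s(2)])
  qed
  also have "\<dots> = (\<Sum>b\<in>?B. \<Sum>bs\<in>?Bs. G (b # ?a bs) * Q (dual_basis_of P l b # ?d bs))"
    by (rule sum.swap)
  also have "\<dots> = (\<Sum>b\<in>?B. \<Sum>bs\<in>?Bs. G (b # bs) * Q (dual_basis_of P l b # dual_list ls bs))"
  proof (rule sum.cong[OF refl])
    fix b assume b: "b \<in> ?B"
    show "(\<Sum>bs\<in>?Bs. G (b # ?a bs) * Q (dual_basis_of P l b # ?d bs)) =
      (\<Sum>bs\<in>?Bs. G (b # bs) * Q (dual_basis_of P l b # dual_list ls bs))"
      by (rule Cons.IH[OF _ _ \<tau>s(3)])
        (use Cons.prems basis_in_ops[OF b] dual_basis_in_dual in \<open>auto simp: multilinear_between_Cons\<close>)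
  qed
  finally show ?case by (simp add: sum_listset_Cons)
qed

end

subsection \<open>The cofree coalgebra\<close>

text \<open>Changing one letter changes one block, hence one argument of Q.\<close>

lemma multilinear_blocks:
  fixes V :: "('k::field, 'v::ab_group_add) vspace"
  assumes "multilinear_between (replicate k S) W Q" "length ls = k"
    and "\<And>i. i < k \<Longrightarrow> multilinear_between (replicate (ls ! i) V) S (h i)"
  shows "multilinear_between (replicate (sum_list ls) V) W (\<lambda>u. Q (map (\<lambda>i. h i (split_blocks ls u ! i)) [0..<k]))"
  unfolding multilinear_between_def
proof (intro ballI conjI allI impI)
  fix u assume "u \<in> listset (map carr (replicate (sum_list ls) V))"
  then have u: "length u = sum_list ls" "set u \<subseteq> carr V" by (auto simp: listset_replicate_iff)
  have bl: "split_blocks ls u ! i \<in> listset (map carr (replicate (ls ! i) V))" if "i < k" for i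
    using length_split_blocks_nth[OF u(1)] set_split_blocks[of "split_blocks ls u ! i" ls u] u(2) that assms(2)
    by (auto simp: listset_replicate_iff)
  let ?m = "\<lambda>u. map (\<lambda>i. h i (split_blocks ls u ! i)) [0..<k]"
  have m: "?m u \<in> listset (map carr (replicate k S))"
    using multilinear_betweenD(1)[OF assms(3) bl] by (auto simp: listset_iff_nth)
  show "Q (?m u) \<in> carr W" by (rule multilinear_betweenD(1)[OF assms(1) m])
  fix j assume "j < length (replicate (sum_list ls) V)"
  then have j: "j < sum_list ls" by simp
  from split_blocks_update[OF j, where ?'x = 'v] obtain i j' where i: "i < length ls" "j' < ls ! i"
    and h: "\<And>y. split_blocks ls (u[j := y]) = (split_blocks ls u)[i := (split_blocks ls u ! i)[j' := y]]"
    using u(1) by meson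
  have "?m (u[j := y]) = (?m u)[i := h i ((split_blocks ls u ! i)[j' := y])]" for y
    using i assms(2) unfolding h by (intro nth_equalityI) (auto simp: nth_list_update)
  moreover have "linear_between V W (\<lambda>y. Q ((?m u)[i := h i ((split_blocks ls u ! i)[j' := y])]))"
    using linear_between_compose[of V S "\<lambda>y. h i ((split_blocks ls u ! i)[j' := y])" W "\<lambda>z. Q ((?m u)[i := z])"]
      multilinear_betweenD(2)[OF assms(1) m, of i] multilinear_betweenD(2)[OF assms(3) bl, of i j'] i assms(2)
    by simp
  ultimately show "linear_between (replicate (sum_list ls) V ! j) W (\<lambda>y. Q (?m (u[j := y])))"
    using j by simp
qed

lemma multilinear_map2:
  assumes "multilinear_between (replicate k S) W Q" "length Vs = k" "length us = k"
    and "\<And>i. i < k \<Longrightarrow> linear_between (Vs ! i) S (\<lambda>c. h c (us ! i))"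
  shows "multilinear_between Vs W (\<lambda>cs. Q (map2 h cs us))"
  unfolding multilinear_between_def
proof (intro ballI conjI allI impI)
  fix cs assume cs: "cs \<in> listset (map carr Vs)"
  then have lc: "length cs = k" and ci: "\<And>i. i < k \<Longrightarrow> cs ! i \<in> carr (Vs ! i)"
    using assms(2) by (auto simp: listset_iff_nth)
  have m: "map2 h cs us \<in> listset (map carr (replicate k S))"
    using lc assms(3) linear_betweenD(1)[OF assms(4) ci] by (auto simp: listset_iff_nth)
  show "Q (map2 h cs us) \<in> carr W" by (rule multilinear_betweenD(1)[OF assms(1) m])
  fix i assume i: "i < length Vs"
  have "map2 h (cs[i := c]) us = (map2 h cs us)[i := h c (us ! i)]" for c
    using i assms(2,3) lc by (intro nth_equalityI) (auto simp: nth_list_update)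
  then show "linear_between (Vs ! i) W (\<lambda>c. Q (map2 h (cs[i := c]) us))"
    using linear_between_compose[OF assms(4), of i W "\<lambda>z. Q ((map2 h cs us)[i := z])"]
      multilinear_betweenD(2)[OF assms(1) m, of i] i assms(2) by simp
qed

lemma split_blocks_sum_perm:
  assumes "length u = sum_list ls" "block_perms ls \<tau>s"
  shows "split_blocks ls (permute_list (sum_perm \<tau>s ls) u) = map2 permute_list \<tau>s (split_blocks ls u)"
proof -
  have "length (map2 permute_list \<tau>s (split_blocks ls u)) = length ls" using assms(2) by (simp add: block_perms_def)
  then have lens: "map length (map2 permute_list \<tau>s (split_blocks ls u)) = ls"
    using assms length_split_blocks_nth[OF assms(1)] by (intro nth_equalityI) (auto simp: block_perms_def)
  show ?thesis
    using permute_list_sum_perm[OF map_length_split_blocks[OF assms(1)] assms(2)]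
      split_blocks_concat[OF lens] by (simp add: concat_split_blocks[OF assms(1)])
qed

lemma linear_between_ground_sum:
  "(\<And>i. i \<in> I \<Longrightarrow> linear_between V ground (f i)) \<Longrightarrow> linear_between V ground (\<lambda>x. \<Sum>i\<in>I. f i x)"
  using linear_between_sum_scale[OF is_vspace_ground, of I V f "\<lambda>_. 1"] by simp

lemma multilinear_between_ground_sum:
  "(\<And>i. i \<in> I \<Longrightarrow> multilinear_between Vs ground (f i)) \<Longrightarrow> multilinear_between Vs ground (\<lambda>x. \<Sum>i\<in>I. f i x)"
  using multilinear_between_sum_scale[OF is_vspace_ground, of I Vs f "\<lambda>_. 1"] by simp

lemma linear_between_ground_mult:
  "linear_between V ground f \<Longrightarrow> linear_between V ground (\<lambda>x. f x * c)"
  by (auto simp: linear_between_ground_iff algebra_simps)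

lemma multilinear_between_ground_mult:
  "multilinear_between Vs ground f \<Longrightarrow> multilinear_between Vs ground (\<lambda>x. c * f x)"
  by (auto simp: multilinear_between_def linear_between_ground_iff algebra_simps)

locale fd_operad = symmetric_operad + fd_module
begin

abbreviation block_gens where
  "block_gens V ls bs us \<equiv> map (\<lambda>(l, b, u). gen (schur_forms (dual_smodule P) V) (dual_basis_of P l b, u))
     (zip ls (zip bs us))"

text \<open>The innermost sum of the cofree coalgebra structure, paired with a form q on the tensor
  power. Working after this pairing keeps the well-definedness checks scalar.\<close>

definition block_term where
  "block_term V q \<delta> ls f u = (\<Sum>bs\<in>listset (map (basis_of P) ls).
     f (gam P ls \<delta> bs) * q (block_gens V ls bs (split_blocks ls u)))"

definition cofree_term where
  "cofree_term V q k \<delta> = (\<lambda>(f, v). \<Sum>ls\<in>compositions k (length v). \<Sum>\<sigma>\<in>unshuffles ls.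
     block_term V q \<delta> ls (act (dual_smodule P) (length v) \<sigma> f) (permute_list \<sigma> v))"

text \<open>Equivariance of the composition moves the inverse block permutations from f to the basis
  elements, the coinvariant relations move them from the words to the dual basis elements, and the
  canonical element absorbs both. Hence the summand of an unshuffle depends on its coset
  alone.\<close>

lemma block_term_invariant:
  assumes V: "is_vspace V" and q: "q \<in> tensor_forms (schur (dual_smodule P) V) k" and \<delta>: "\<delta> \<in> ops P k"
    and ls: "length ls = k" and bp: "block_perms ls \<tau>s" and f: "f \<in> ops (dual_smodule P) (sum_list ls)"
    and u: "length u = sum_list ls" "set u \<subseteq> carr V"
  shows "block_term V q \<delta> ls (act (dual_smodule P) (sum_list ls) (sum_perm \<tau>s ls) f)
      (permute_list (sum_perm \<tau>s ls) u) = block_term V q \<delta> ls f u"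
proof -
  let ?D = "dual_smodule P" and ?\<rho> = "sum_perm \<tau>s ls" and ?n = "sum_list ls"
  let ?us = "split_blocks ls u"
  note bi = block_perms_inv[OF bp]
  have us: "length (?us ! i) = ls ! i" "set (?us ! i) \<subseteq> carr V" if "i < k" for i
    using length_split_blocks_nth[OF u(1)] set_split_blocks[of "?us ! i" ls u] u(2) that ls by auto
  note su = split_blocks_sum_perm[OF u(1) bp]
  define Q where "Q cs = q (map2 (\<lambda>c u. gen (schur_forms ?D V) (c, u)) cs ?us)" for cs
  define G where "G bs = f (gam P ls \<delta> bs)" for bs
  have Gml: "multilinear_between (map (arity_space P) ls) ground G"
    unfolding G_def using multilinear_between_compose[OF gam_multilinear, of \<delta> ls ground f] f \<delta> ls by (simp add: ops_dual)
  have Qml: "multilinear_between (map (arity_space ?D) ls) ground Q"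
    unfolding Q_def
  proof (rule multilinear_map2[OF q[unfolded tensor_forms_def, simplified]])
    show "linear_between (map (arity_space ?D) ls ! i) (schur ?D V) (\<lambda>c. gen (schur_forms ?D V) (c, ?us ! i))"
      if "i < k" for i
      using dual.gen_schur_linear[of "?us ! i" V] us[OF that] that ls by simp
  qed (use ls in simp_all)
  have "block_term V q \<delta> ls (act ?D ?n ?\<rho> f) (permute_list ?\<rho> u) =
    (\<Sum>bs\<in>listset (map (basis_of P) ls). G (act_list ls (map inv \<tau>s) bs) *
      Q (dual_act_list ls (map inv \<tau>s) (dual_list ls bs)))"
    unfolding block_term_def
  proof (intro sum.cong refl arg_cong2[where f = "(*)"])
    fix bs assume "bs \<in> listset (map (basis_of P) ls)"
    note bs = basis_list_in[OF this]
    have lb: "length bs = k" using listset_length[OF bs] ls by simp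
    have "gam P ls \<delta> bs \<in> ops P ?n" using gam_closed[OF _ bs] \<delta> ls by simp
    moreover have "gam P ls \<delta> (act_list ls (map inv \<tau>s) bs) =
        act P ?n (sum_perm (map inv \<tau>s) ls) (gam P ls \<delta> bs)"
      by (rule gam_equivariant_inner) (use \<delta> ls bs bi[unfolded block_perms_def] in auto)
    ultimately show "act ?D ?n ?\<rho> f (gam P ls \<delta> bs) = G (act_list ls (map inv \<tau>s) bs)"
      by (simp add: act_dual G_def sum_perm_inv[OF bp])
    have "block_gens V ls bs (map2 permute_list \<tau>s ?us) =
      map2 (\<lambda>c u. gen (schur_forms ?D V) (c, u)) (dual_act_list ls (map inv \<tau>s) (dual_list ls bs)) ?us"
    proof (rule nth_equalityI)
      fix i assume "i < length (block_gens V ls bs (map2 permute_list \<tau>s ?us))"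
      then have i: "i < k" using ls by simp
      have \<tau>: "\<tau>s ! i permutes {..<ls ! i}" using bp i ls by (simp add: block_perms_def)
      let ?b = "dual_basis_of P (ls ! i) (bs ! i)"
      have "gen (schur_forms ?D V) (act ?D (ls ! i) (\<tau>s ! i) (act ?D (ls ! i) (inv (\<tau>s ! i)) ?b), permute_list (\<tau>s ! i) (?us ! i)) =
        gen (schur_forms ?D V) (act ?D (ls ! i) (inv (\<tau>s ! i)) ?b, ?us ! i)"
        using dual.gen_schur_act[of "act ?D (ls ! i) (inv (\<tau>s ! i)) ?b" "?us ! i" V "\<tau>s ! i"] us[OF i] \<tau>
          dual.act_closed[OF permutes_inv[OF \<tau>] dual_basis_in_dual] by simp
      then show "block_gens V ls bs (map2 permute_list \<tau>s ?us) ! i =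
        map2 (\<lambda>c u. gen (schur_forms ?D V) (c, u)) (dual_act_list ls (map inv \<tau>s) (dual_list ls bs)) ?us ! i"
        using i lb ls bp dual.act_inv(2)[OF \<tau> dual_basis_in_dual, of "bs ! i"] by (simp add: block_perms_def)
    qed (use lb ls bp in \<open>simp add: block_perms_def\<close>)
    then show "q (block_gens V ls bs (split_blocks ls (permute_list ?\<rho> u))) =
      Q (dual_act_list ls (map inv \<tau>s) (dual_list ls bs))"
      by (simp add: Q_def su)
  qed
  also have "\<dots> = (\<Sum>bs\<in>listset (map (basis_of P) ls). G bs * Q (dual_list ls bs))"
    by (rule dual_pairing_invariant_list[OF Gml Qml bi])
  also have "\<dots> = block_term V q \<delta> ls f u"
    unfolding block_term_def
  proof (intro sum.cong refl arg_cong2[where f = "(*)"])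
    fix bs assume "bs \<in> listset (map (basis_of P) ls)"
    then have "length bs = k" using listset_length ls by fastforce
    then have "map2 (\<lambda>c u. gen (schur_forms ?D V) (c, u)) (dual_list ls bs) ?us = block_gens V ls bs ?us"
      using ls by (intro nth_equalityI) auto
    then show "Q (dual_list ls bs) = q (block_gens V ls bs (split_blocks ls u))" by (simp add: Q_def)
  qed (simp add: G_def)
  finally show ?thesis .
qed

lemma block_gens_multilinear:
  assumes V: "is_vspace V" and q: "q \<in> tensor_forms (schur (dual_smodule P) V) k"
    and ls: "length ls = k" and bs: "length bs = k"
  shows "multilinear_between (replicate (sum_list ls) V) ground (\<lambda>u. q (block_gens V ls bs (split_blocks ls u)))"
proof -
  let ?h = "\<lambda>i u. gen (schur_forms (dual_smodule P) V) (dual_basis_of P (ls ! i) (bs ! i), u)"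
  have "multilinear_between (replicate (sum_list ls) V) ground
      (\<lambda>u. q (map (\<lambda>i. ?h i (split_blocks ls u ! i)) [0..<k]))"
    by (rule multilinear_blocks[of k "schur (dual_smodule P) V"])
      (use q ls dual.gen_schur_multilinear[OF V dual_basis_in_dual] in \<open>auto simp: tensor_forms_def\<close>)
  moreover have "map (\<lambda>i. ?h i (split_blocks ls u ! i)) [0..<k] = block_gens V ls bs (split_blocks ls u)" for u
    using ls bs by (intro nth_equalityI) auto
  ultimately show ?thesis by simp
qed

text \<open>Replacing (f, v) by its translate under \<pi> turns the summand of \<sigma> into that of
  \<pi> \<circ> \<sigma>, and left translation only permutes the cosets.\<close>

lemma cofree_term_form:
  assumes V: "is_vspace V" and q: "q \<in> tensor_forms (schur (dual_smodule P) V) k" and \<delta>: "\<delta> \<in> ops P k"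
  shows "cofree_term V q k \<delta> \<in> schur_forms (dual_smodule P) V"
proof (rule schur_formsI)
  let ?D = "dual_smodule P"
  have comp: "length ls = k" "sum_list ls = n" if "ls \<in> compositions k n" for ls n
    using that by (auto simp: compositions_def)
  have unsh: "\<sigma> permutes {..<sum_list ls}" if "\<sigma> \<in> unshuffles ls" for \<sigma> ls
    using that by (simp add: unshuffles_def)
  have gin: "gam P ls \<delta> bs \<in> ops P n" if "bs \<in> listset (map (basis_of P) ls)" "ls \<in> compositions k n" for bs ls n
    using gam_closed[OF _ basis_list_in[OF that(1)]] comp[OF that(2)] \<delta> by simp
  show "linear_between (arity_space ?D (length v)) ground (\<lambda>f. cofree_term V q k \<delta> (f, v))" if "set v \<subseteq> carr V" for v
    unfolding cofree_term_def block_term_def prod.case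
  proof (intro linear_between_ground_sum linear_between_ground_mult)
    fix ls \<sigma> bs assume "ls \<in> compositions k (length v)" "bs \<in> listset (map (basis_of P) ls)"
    then have "gam P ls \<delta> bs \<in> ops P (length v)" by (intro gin)
    then show "linear_between (arity_space ?D (length v)) ground (\<lambda>f. act ?D (length v) \<sigma> f (gam P ls \<delta> bs))"
      by (simp add: linear_between_ground_iff act_dual fun_scale_def)
  qed
  show "multilinear_between (replicate n V) ground (\<lambda>v. cofree_term V q k \<delta> (f, v))" for n f
  proof -
    have "multilinear_between (replicate n V) ground (\<lambda>v. \<Sum>ls\<in>compositions k n. \<Sum>\<sigma>\<in>unshuffles ls.
       block_term V q \<delta> ls (act ?D n \<sigma> f) (permute_list \<sigma> v))"
      unfolding block_term_def
    proof (intro multilinear_between_ground_sum multilinear_between_ground_mult)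
      fix ls \<sigma> bs assume ls: "ls \<in> compositions k n" and \<sigma>: "\<sigma> \<in> unshuffles ls" and bs: "bs \<in> listset (map (basis_of P) ls)"
      show "multilinear_between (replicate n V) ground (\<lambda>v. q (block_gens V ls bs (split_blocks ls (permute_list \<sigma> v))))"
        using multilinear_between_permute[OF block_gens_multilinear[OF V q comp(1)[OF ls]], of bs \<sigma>]
          unsh[OF \<sigma>] comp[OF ls] listset_length[OF bs] by simp
    qed
    then show ?thesis
      using V by (subst multilinear_between_cong[of _ _ "\<lambda>v. \<Sum>ls\<in>compositions k n. \<Sum>\<sigma>\<in>unshuffles ls.
       block_term V q \<delta> ls (act ?D n \<sigma> f) (permute_list \<sigma> v)"])
       (auto simp: cofree_term_def listset_replicate_iff)
  qed
  fix f v \<pi> assume f: "f \<in> ops ?D (length v)" and v: "set v \<subseteq> carr V" and \<pi>: "\<pi> permutes {..<length v}"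
  have "(\<Sum>\<sigma>\<in>unshuffles ls. block_term V q \<delta> ls (act ?D (length v) \<sigma> (act ?D (length v) \<pi> f)) (permute_list \<sigma> (permute_list \<pi> v))) =
      (\<Sum>\<sigma>\<in>unshuffles ls. block_term V q \<delta> ls (act ?D (length v) \<sigma> f) (permute_list \<sigma> v))"
    if ls: "ls \<in> compositions k (length v)" for ls
  proof -
    note n = comp(2)[OF ls]
    define \<Psi> where "\<Psi> \<sigma> = block_term V q \<delta> ls (act ?D (length v) \<sigma> f) (permute_list \<sigma> v)" for \<sigma>
    have inv: "\<Psi> (\<sigma> \<circ> sum_perm \<tau>s ls) = \<Psi> \<sigma>" if \<sigma>: "\<sigma> permutes {..<sum_list ls}" and bp: "block_perms ls \<tau>s" for \<sigma> \<tau>s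
    proof -
      have \<sigma>': "\<sigma> permutes {..<length v}" and \<rho>: "sum_perm \<tau>s ls permutes {..<length v}"
        using \<sigma> sum_perm_permutes[OF bp] n by simp_all
      show ?thesis unfolding \<Psi>_def
        using block_term_invariant[OF V q \<delta> comp(1)[OF ls] bp, of "act ?D (length v) \<sigma> f" "permute_list \<sigma> v"]
          dual.act_closed[OF \<sigma>' f] v \<sigma>' n dual.act_comp[OF \<sigma>' \<rho> f] permute_list_compose[OF \<rho>, of \<sigma>]
        by simp
    qed
    have "block_term V q \<delta> ls (act ?D (length v) \<sigma> (act ?D (length v) \<pi> f)) (permute_list \<sigma> (permute_list \<pi> v)) =
        \<Psi> (\<pi> \<circ> \<sigma>)" if "\<sigma> \<in> unshuffles ls" for \<sigma>
      using unsh[OF that] n dual.act_comp[OF \<pi> _ f, of \<sigma>] permute_list_compose[of \<sigma> v \<pi>] by (simp add: \<Psi>_def)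
    then show ?thesis
      using sum_unshuffles_translate[of \<pi> ls \<Psi>] \<pi> n inv by (simp add: \<Psi>_def)
  qed
  then show "cofree_term V q k \<delta> (act ?D (length v) \<pi> f, permute_list \<pi> v) = cofree_term V q k \<delta> (f, v)"
    by (simp add: cofree_term_def)
qed

definition cofree_sum where
  "cofree_sum V k \<delta> = (\<lambda>(f, v). \<Sum>ls\<in>compositions k (length v). \<Sum>\<sigma>\<in>unshuffles ls.
     \<Sum>bs\<in>listset (map (basis_of P) ls). fun_scale (act (dual_smodule P) (length v) \<sigma> f (gam P ls \<delta> bs))
       (pure (schur (dual_smodule P) V) k (block_gens V ls bs (split_blocks ls (permute_list \<sigma> v)))))"

lemma block_gens_in:
  assumes "length bs = length ls" "length u = sum_list ls" "set u \<subseteq> carr V"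
  shows "block_gens V ls bs (split_blocks ls u) \<in> listset (replicate (length ls) (carr (schur (dual_smodule P) V)))"
  using assms length_split_blocks_nth[OF assms(2)] set_split_blocks[of _ ls u]
  unfolding listset_iff_nth by (auto intro!: gen_in_schur dual_basis_in_dual) (metis length_split_blocks nth_mem subsetD)

lemma cofree_presented_map:
  assumes V: "is_vspace V" and \<delta>: "\<delta> \<in> ops P k"
  shows "presented_map (schur_symbols (dual_smodule P) V) (schur_forms (dual_smodule P) V)
    (listset (replicate k (carr (schur (dual_smodule P) V)))) (tensor_forms (schur (dual_smodule P) V) k) (cofree_sum V k \<delta>)"
  unfolding presented_map_def
proof (intro conjI ballI)
  fix q assume q: "q \<in> tensor_forms (schur (dual_smodule P) V) k"
  have "(\<lambda>x. cofree_sum V k \<delta> x q) = cofree_term V q k \<delta>"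
    using q by (auto simp: cofree_sum_def cofree_term_def block_term_def sum_fun_apply fun_scale_def gen_def[of "tensor_forms _ _"])
  then show "(\<lambda>x. cofree_sum V k \<delta> x q) \<in> schur_forms (dual_smodule P) V"
    using cofree_term_form[OF V q \<delta>] by simp
next
  fix x assume x: "x \<in> schur_symbols (dual_smodule P) V"
  obtain f v where fv: "x = (f, v)" by (cases x)
  let ?T = "presented_space (listset (replicate k (carr (schur (dual_smodule P) V)))) (tensor_forms (schur (dual_smodule P) V) k)"
  have "fun_scale c (pure (schur (dual_smodule P) V) k (block_gens V ls bs (split_blocks ls (permute_list \<sigma> v)))) \<in> carr ?T"
    if ls: "ls \<in> compositions k (length v)" and \<sigma>: "\<sigma> \<in> unshuffles ls" and bs: "bs \<in> listset (map (basis_of P) ls)" for ls \<sigma> bs c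
  proof -
    have "length ls = k" "sum_list ls = length v" "\<sigma> permutes {..<length v}" "length bs = length ls"
      using ls \<sigma> listset_length[OF bs] by (auto simp: compositions_def unshuffles_def)
    then have "block_gens V ls bs (split_blocks ls (permute_list \<sigma> v)) \<in> listset (replicate k (carr (schur (dual_smodule P) V)))"
      using block_gens_in[of bs ls "permute_list \<sigma> v" V] x fv by simp
    from is_vspace_scale[OF is_vspace_presented_space gen_in_carr[OF this]] show ?thesis by simp
  qed
  then show "cofree_sum V k \<delta> x \<in> carr ?T"
    unfolding fv cofree_sum_def prod.case by (intro is_vspace_sum is_vspace_presented_space)
qed

lemma cofree_cop_linear:
  assumes "is_vspace V" "\<delta> \<in> ops P k"
  shows "linear_between (schur (dual_smodule P) V) (tensor_power (schur (dual_smodule P) V) k) (cofree_cop P V k \<delta>)"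
  using lin_ext_linear[OF dual.form_space_schur[OF assms(1)] cofree_presented_map[OF assms]]
  unfolding cofree_cop_def[abs_def] cofree_sum_def schur_def[symmetric] tensor_power_def[symmetric] .

lemma cofree_cop_gen:
  assumes "is_vspace V" "\<delta> \<in> ops P k" "f \<in> ops (dual_smodule P) (length v)" "set v \<subseteq> carr V"
  shows "cofree_cop P V k \<delta> (gen (schur_forms (dual_smodule P) V) (f, v)) = cofree_sum V k \<delta> (f, v)"
  using lin_ext_gen_map[OF dual.form_space_schur[OF assms(1)] cofree_presented_map[OF assms(1,2)], of "(f, v)"] assms(3,4)
  unfolding cofree_cop_def[abs_def] cofree_sum_def by simp

end

subsection \<open>Evaluation of confluence laws\<close>

lemma block_perms_listset: "\<tau>s \<in> listset (map (\<lambda>l. {\<tau>. \<tau> permutes {..<l}}) ls) \<longleftrightarrow> block_perms ls \<tau>s"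
  by (auto simp: listset_iff_nth block_perms_def)

lemma conf_formsI:
  assumes "\<And>ls w. ls \<in> compositions m n \<Longrightarrow> w permutes {..<n} \<Longrightarrow>
      multilinear_between (map (arity_space A) ls) ground (\<lambda>as. g (ls, as, w))"
    and "\<And>ls w as \<tau>s. ls \<in> compositions m n \<Longrightarrow> w permutes {..<n} \<Longrightarrow> as \<in> listset (map (ops A) ls) \<Longrightarrow>
      block_perms ls \<tau>s \<Longrightarrow>
      g (ls, map (\<lambda>(l, \<tau>, a). act A l \<tau> a) (zip ls (zip \<tau>s as)), w) = g (ls, as, sum_perm \<tau>s ls \<circ> w)"
  shows "g \<in> conf_forms A m n"
  using assms by (auto simp: conf_forms_def block_perms_listset)

lemma conf_formsD:
  assumes "g \<in> conf_forms A m n" "ls \<in> compositions m n" "w permutes {..<n}"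
  shows "multilinear_between (map (arity_space A) ls) ground (\<lambda>as. g (ls, as, w))"
    and "as \<in> listset (map (ops A) ls) \<Longrightarrow> block_perms ls \<tau>s \<Longrightarrow>
      g (ls, map (\<lambda>(l, \<tau>, a). act A l \<tau> a) (zip ls (zip \<tau>s as)), w) = g (ls, as, sum_perm \<tau>s ls \<circ> w)"
  using assms by (auto simp: conf_forms_def block_perms_listset)

lemma in_compositions: "ls \<in> compositions m n \<longleftrightarrow> length ls = m \<and> sum_list ls = n \<and> (\<forall>l\<in>set ls. 1 \<le> l)"
  by (simp add: compositions_def)

context symmetric_module
begin

lemma form_space_conf: "form_space (conf_symbols P m n) (conf_forms P m n)"
proof (rule form_spaceI)
  show "(\<lambda>x. 0) \<in> conf_forms P m n"
    by (rule conf_formsI) (simp_all add: multilinear_between_const_zero is_vspace_ground)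
  show "(\<lambda>x. c * q x + q' x) \<in> conf_forms P m n" if "q \<in> conf_forms P m n" "q' \<in> conf_forms P m n" for c q q'
  proof (rule conf_formsI)
    fix ls w assume *: "ls \<in> compositions m n" "w permutes {..<n}"
    show "multilinear_between (map (arity_space P) ls) ground (\<lambda>as. c * q (ls, as, w) + q' (ls, as, w))"
      using multilinear_between_combine[OF is_vspace_ground conf_formsD(1)[OF _ *] conf_formsD(1)[OF _ *]] that by simp
  qed (use conf_formsD(2)[OF that(1)] conf_formsD(2)[OF that(2)] in simp)
  show "q' \<in> conf_forms P m n"
    if q: "q \<in> conf_forms P m n" and e: "\<And>x. x \<in> conf_symbols P m n \<Longrightarrow> q' x = q x" for q q'
  proof (rule conf_formsI)
    fix ls w assume *: "ls \<in> compositions m n" "w permutes {..<n}"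
    show "multilinear_between (map (arity_space P) ls) ground (\<lambda>as. q' (ls, as, w))"
      using conf_formsD(1)[OF q *] e * vspace
      by (subst multilinear_between_cong[of _ _ "\<lambda>as. q (ls, as, w)"]) (auto simp: conf_symbols_def comp_def)
    fix as \<tau>s assume as: "as \<in> listset (map (ops P) ls)" and bp: "block_perms ls \<tau>s"
    have "map (\<lambda>(l, \<tau>, a). act P l \<tau> a) (zip ls (zip \<tau>s as)) \<in> listset (map (ops P) ls)"
      using as bp by (auto simp: listset_iff_nth block_perms_def act_closed)
    moreover have "sum_perm \<tau>s ls \<circ> w permutes {..<n}"
      using permutes_compose[OF *(2)] sum_perm_permutes[OF bp] *(1) by (simp add: in_compositions)
    ultimately show "q' (ls, map (\<lambda>(l, \<tau>, a). act P l \<tau> a) (zip ls (zip \<tau>s as)), w) = q' (ls, as, sum_perm \<tau>s ls \<circ> w)"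
      using conf_formsD(2)[OF q * as bp] e * as by (simp add: conf_symbols_def)
  qed
qed

definition conf_term where
  "conf_term H ev m ps = (\<lambda>(ls, as, w). pure H m (map2 ev as (split_blocks ls (permute_list (inv w) ps))))"

text \<open>Evaluation respects the relation that moves a block permutation between the operations
  and w. Linearity and equivariance are asked for words in the letters of ps, so that the lemma
  applies to \<open>free_ev\<close> at words of generators without the algebra axioms for the free
  algebra.\<close>

lemma conf_presented_map:
  assumes H: "is_vspace H" and n: "length ps = n"
    and lin: "\<And>u. set u \<subseteq> set ps \<Longrightarrow> linear_between (arity_space P (length u)) H (\<lambda>a. ev a u)"
    and inv: "\<And>a u \<tau>. a \<in> ops P (length u) \<Longrightarrow> set u \<subseteq> set ps \<Longrightarrow> \<tau> permutes {..<length u} \<Longrightarrow>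
      ev (act P (length u) \<tau> a) (permute_list \<tau> u) = ev a u"
  shows "presented_map (conf_symbols P m n) (conf_forms P m n)
    (listset (replicate m (carr H))) (tensor_forms H m) (conf_term H ev m ps)"
  unfolding presented_map_def
proof (intro conjI ballI)
  have us: "length (split_blocks ls (permute_list (inv w) ps) ! i) = ls ! i"
      "set (split_blocks ls (permute_list (inv w) ps) ! i) \<subseteq> set ps"
    if "ls \<in> compositions m n" "w permutes {..<n}" "i < m" for ls w i
    using length_split_blocks_nth[of "permute_list (inv w) ps" ls i]
      set_split_blocks[of "split_blocks ls (permute_list (inv w) ps) ! i" ls "permute_list (inv w) ps"]
      that n permutes_inv[OF that(2)] by (auto simp: in_compositions)
  {
    fix x assume "x \<in> conf_symbols P m n"
    then obtain ls as w where x: "x = (ls, as, w)" "ls \<in> compositions m n" "as \<in> listset (map (ops P) ls)"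
      "w permutes {..<n}" by (auto simp: conf_symbols_def)
    have "map2 ev as (split_blocks ls (permute_list (inv w) ps)) \<in> listset (replicate m (carr H))"
      using us[OF x(2,4)] x(2,3) linear_betweenD(1)[OF lin[OF us(2)[OF x(2,4)]]]
      by (auto simp: listset_iff_nth in_compositions)
    then show "conf_term H ev m ps x \<in> carr (presented_space (listset (replicate m (carr H))) (tensor_forms H m))"
      unfolding conf_term_def x(1) prod.case by (rule gen_in_carr)
  }
  fix q assume q: "q \<in> tensor_forms H m"
  show "(\<lambda>x. conf_term H ev m ps x q) \<in> conf_forms P m n"
  proof (rule conf_formsI)
    fix ls w assume ls: "ls \<in> compositions m n" and w: "w permutes {..<n}"
    let ?us = "split_blocks ls (permute_list (inv w) ps)"
    have "multilinear_between (map (arity_space P) ls) ground (\<lambda>as. q (map2 ev as ?us))"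
    proof (rule multilinear_map2[OF q[unfolded tensor_forms_def, simplified]])
      show "linear_between (map (arity_space P) ls ! i) H (\<lambda>c. ev c (?us ! i))" if "i < m" for i
        using lin[OF us(2)[OF ls w that]] us(1)[OF ls w that] that ls by (simp add: in_compositions)
    qed (use ls in \<open>simp_all add: in_compositions\<close>)
    then show "multilinear_between (map (arity_space P) ls) ground (\<lambda>as. conf_term H ev m ps (ls, as, w) q)"
      using q by (simp add: conf_term_def gen_def)
    fix as \<tau>s assume as: "as \<in> listset (map (ops P) ls)" and bp: "block_perms ls \<tau>s"
    let ?\<rho> = "sum_perm \<tau>s ls"
    have \<rho>: "?\<rho> permutes {..<n}" using sum_perm_permutes[OF bp] ls by (simp add: in_compositions)
    have "inv (?\<rho> \<circ> w) = inv w \<circ> inv ?\<rho>"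
      using permutes_bij[OF \<rho>] permutes_bij[OF w] by (rule o_inv_distrib)
    then have "split_blocks ls (permute_list (inv (?\<rho> \<circ> w)) ps) = map2 permute_list (map inv \<tau>s) ?us"
      using permute_list_compose[of "inv ?\<rho>" ps "inv w"] permutes_inv[OF \<rho>] n ls
        split_blocks_sum_perm[OF _ block_perms_inv[OF bp], of "permute_list (inv w) ps"]
      by (simp add: sum_perm_inv[OF bp] in_compositions)
    moreover have "map2 ev (map (\<lambda>(l, \<tau>, a). act P l \<tau> a) (zip ls (zip \<tau>s as))) ?us =
      map2 ev as (map2 permute_list (map inv \<tau>s) ?us)"
    proof (rule nth_equalityI)
      fix i assume "i < length (map2 ev (map (\<lambda>(l, \<tau>, a). act P l \<tau> a) (zip ls (zip \<tau>s as))) ?us)"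
      then have i: "i < m" using ls by (simp add: in_compositions)
      note len = us[OF ls w i]
      have \<tau>: "\<tau>s ! i permutes {..<ls ! i}" and a: "as ! i \<in> ops P (ls ! i)"
        using bp as i ls by (auto simp: block_perms_def listset_iff_nth in_compositions)
      let ?v = "permute_list (inv (\<tau>s ! i)) (?us ! i)"
      have "ev (act P (ls ! i) (\<tau>s ! i) (as ! i)) (permute_list (\<tau>s ! i) ?v) = ev (as ! i) ?v"
        using inv[of "as ! i" ?v "\<tau>s ! i"] a \<tau> len permutes_inv[OF \<tau>] by simp
      then have "ev (act P (ls ! i) (\<tau>s ! i) (as ! i)) (?us ! i) = ev (as ! i) ?v"
        using permute_list_inv(2)[of "\<tau>s ! i" "?us ! i"] \<tau> len by simp
      then show "map2 ev (map (\<lambda>(l, \<tau>, a). act P l \<tau> a) (zip ls (zip \<tau>s as))) ?us ! i =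
        map2 ev as (map2 permute_list (map inv \<tau>s) ?us) ! i"
        using i ls bp listset_length[OF as] by (simp add: block_perms_def in_compositions)
    qed (use ls bp listset_length[OF as] in \<open>simp add: block_perms_def\<close>)
    ultimately show "conf_term H ev m ps (ls, map (\<lambda>(l, \<tau>, a). act P l \<tau> a) (zip ls (zip \<tau>s as)), w) q =
      conf_term H ev m ps (ls, as, ?\<rho> \<circ> w) q"
      by (simp add: conf_term_def)
  qed
qed

end

subsection \<open>The multilinear part of a free algebra\<close>

lemma is_vspace_coord_space: "is_vspace (coord_space n :: ('k::field, nat \<Rightarrow> 'k) vspace)"
  unfolding is_vspace_def coord_space_def
  by (simp add: vector_space_fun_scale fun_space.subspace_def fun_scale_def)

lemma unit_vector_in_coord_space: "i < n \<Longrightarrow> unit_vector i \<in> carr (coord_space n)"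
  by (simp add: coord_space_def unit_vector_def)

text \<open>On words in the standard basis this form picks out the permutation w, which separates the summands of
  the induced module.\<close>

definition monomial_form :: "nat \<Rightarrow> (nat \<Rightarrow> nat) \<Rightarrow> (nat \<Rightarrow> 'k::field) list \<Rightarrow> 'k" where
  "monomial_form n w xs = (\<Prod>j<n. (xs ! j) (inv w j))"

lemma monomial_form_multilinear: "multilinear_between (replicate n (coord_space n)) ground (monomial_form n w)"
  unfolding multilinear_between_def
proof (intro ballI conjI allI impI)
  fix xs :: "(nat \<Rightarrow> 'a) list" and i
  assume "xs \<in> listset (map carr (replicate n (coord_space n)))" and i: "i < length (replicate n (coord_space n))"
  then have l: "length xs = n" by (simp add: listset_replicate_iff)
  have "monomial_form n w (xs[i := y]) = y (inv w i) * (\<Prod>j\<in>{..<n} - {i}. (xs ! j) (inv w j))" for y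
  proof -
    have "monomial_form n w (xs[i := y]) = ((xs[i := y]) ! i) (inv w i) * (\<Prod>j\<in>{..<n} - {i}. ((xs[i := y]) ! j) (inv w j))"
      unfolding monomial_form_def using i by (intro prod.remove) auto
    then show ?thesis using i l by simp
  qed
  then show "linear_between (replicate n (coord_space n) ! i) ground (\<lambda>y. monomial_form n w (xs[i := y]))"
    using i by (simp add: linear_between_ground_iff coord_space_def fun_scale_def algebra_simps)
qed simp

lemma monomial_form_permute:
  assumes "\<rho> permutes {..<n}" "w permutes {..<n}" "length xs = n"
  shows "monomial_form n w (permute_list \<rho> xs) = monomial_form n (\<rho> \<circ> w) xs"
proof -
  have "inv (\<rho> \<circ> w) = inv w \<circ> inv \<rho>"
    using permutes_bij[OF assms(1)] permutes_bij[OF assms(2)] by (rule o_inv_distrib)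
  then have "monomial_form n (\<rho> \<circ> w) xs = (\<Prod>j<n. (xs ! \<rho> j) (inv w (inv \<rho> (\<rho> j))))"
    unfolding monomial_form_def using permutes_imp_bij[OF assms(1)]
    by (subst prod.reindex_bij_betw[symmetric, of \<rho> "{..<n}" "{..<n}"]) auto
  then show ?thesis
    using assms by (simp add: monomial_form_def permute_list_def permutes_inverses(2)[OF assms(1)])
qed

lemma monomial_form_unit_vectors:
  assumes "w permutes {..<n}" "v permutes {..<n}"
  shows "monomial_form n w (permute_list (inv v) (map unit_vector [0..<n])) = (if w = v then 1 else 0)"
proof -
  have iv: "inv v j < n" if "j < n" for j using permutes_in_image[OF permutes_inv[OF assms(2)], of j] that by simp
  have e: "monomial_form n w (permute_list (inv v) (map unit_vector [0..<n])) =
    (\<Prod>j<n. if inv w j = inv v j then 1 else 0)"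
    unfolding monomial_form_def by (intro prod.cong) (auto simp: permute_list_def iv unit_vector_def)
  show ?thesis
  proof (cases "\<forall>j<n. inv w j = inv v j")
    case True
    have "inv w = inv v"
    proof
      fix j show "inv w j = inv v j"
        using True permutes_not_in[OF permutes_inv[OF assms(1)], of j] permutes_not_in[OF permutes_inv[OF assms(2)], of j]
        by (cases "j < n") auto
    qed
    then have "w = v" using permutes_inv_inv[OF assms(1)] permutes_inv_inv[OF assms(2)] by metis
    then show ?thesis unfolding e by simp
  next
    case False
    then show ?thesis unfolding e by (auto simp: prod_zero_iff)
  qed
qed

context symmetric_operad
begin

lemma free_ev_units:
  assumes "is_vspace V" "a \<in> ops P (length u)" "set u \<subseteq> carr V"
  shows "free_ev P V a (map (\<lambda>x. gen (schur_forms P V) (unit P, [x])) u) = gen (schur_forms P V) (a, u)"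
proof -
  let ?ps = "map (\<lambda>x. (unit P, [x])) u"
  have "?ps \<in> listset (replicate (length u) (schur_symbols P V))"
    using assms unit_closed by (auto simp: listset_replicate_iff)
  from free_ev_gen[OF assms(1,2) this]
  show ?thesis using gam_unit_right[OF assms(2)] by (simp add: comp_def map_replicate_const)
qed

text \<open>Uniqueness of the law. For every form g on the induced module a form F on the tensor
  power of A(V) is built whose value at the evaluation of Z is Z g, so evaluating at the standard
  basis loses nothing.\<close>

lemma conf_eval_inj:
  assumes X: "X \<in> carr (conf_space P k n)" and Y: "Y \<in> carr (conf_space P k n)"
    and V: "V = coord_space n"
    and e: "e = map (\<lambda>x. gen (schur_forms P V) (unit P, [x])) (map unit_vector [0..<n])"
    and eq: "conf_eval (schur P V) (free_ev P V) k X e = conf_eval (schur P V) (free_ev P V) k Y e"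
  shows "X = Y"
proof (rule presented_eqI[OF X[unfolded conf_space_def] Y[unfolded conf_space_def]])
  have vs: "is_vspace V" by (simp add: V is_vspace_coord_space)
  let ?S = "{w. w permutes {..<n}}"
  fix g assume g: "g \<in> conf_forms P k n"
  \<comment> \<open>On a word of standard basis vectors in the order given by w, all monomial forms
    but that of w vanish and g (ls, as, w) remains. For other ls nothing is known about g, hence the
    default 0.\<close>
  define \<Gamma> where "\<Gamma> ls as xs = (if ls \<in> compositions k n then
      \<Sum>w\<in>?S. monomial_form n w xs * g (ls, as, w) else 0)" for ls :: "nat list" and as xs
  define G where "G ps = \<Gamma> (map (length \<circ> snd) ps) (map fst ps) (concat (map snd ps))" for ps
  have mf: "mform (replicate k (schur_symbols P V, schur_forms P V)) G"
    unfolding G_def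
  proof (rule mform_blocks[OF vs])
    fix ls :: "nat list" assume ls: "length ls = k"
    show "multilinear_between (map (arity_space P) ls) ground (\<lambda>as. \<Gamma> ls as xs)" for xs
    proof (cases "ls \<in> compositions k n")
      case True
      have "multilinear_between (map (arity_space P) ls) ground
          (\<lambda>as. \<Sum>w\<in>?S. monomial_form n w xs * g (ls, as, w))"
        using conf_formsD(1)[OF g True]
        by (intro multilinear_between_ground_sum multilinear_between_ground_mult) simp
      then show ?thesis using True by (simp add: \<Gamma>_def)
    qed (simp add: \<Gamma>_def multilinear_between_const_zero is_vspace_ground)
    fix as assume as: "as \<in> listset (map (ops P) ls)"
    show "multilinear_between (replicate (sum_list ls) V) ground (\<Gamma> ls as)"
    proof (cases "ls \<in> compositions k n")
      case True
      then have n: "sum_list ls = n" by (simp add: in_compositions)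
      have "multilinear_between (replicate n V) ground (\<lambda>xs. \<Sum>w\<in>?S. g (ls, as, w) * monomial_form n w xs)"
        unfolding V by (intro multilinear_between_ground_sum multilinear_between_ground_mult monomial_form_multilinear)
      then show ?thesis using n True by (simp add: \<Gamma>_def[abs_def] mult.commute)
    qed (simp add: \<Gamma>_def[abs_def] multilinear_between_const_zero is_vspace_ground)
    fix xs :: "(nat \<Rightarrow> 'k) list" and \<tau>s assume xs: "length xs = sum_list ls" and bp: "block_perms ls \<tau>s"
    show "\<Gamma> ls (map (\<lambda>(l, \<tau>, b). act P l \<tau> b) (zip ls (zip \<tau>s as))) (permute_list (sum_perm \<tau>s ls) xs) = \<Gamma> ls as xs"
    proof (cases "ls \<in> compositions k n")
      case True
      let ?\<rho> = "sum_perm \<tau>s ls"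
      have n: "sum_list ls = n" using True by (simp add: in_compositions)
      have \<rho>: "?\<rho> permutes {..<n}" using sum_perm_permutes[OF bp] n by simp
      \<comment> \<open>Both factors absorb the block permutation as left multiplication on w, so
        the sum is merely reindexed.\<close>
      have "(\<Sum>w\<in>?S. monomial_form n w (permute_list ?\<rho> xs) * g (ls, map (\<lambda>(l, \<tau>, b). act P l \<tau> b) (zip ls (zip \<tau>s as)), w)) =
        (\<Sum>w\<in>?S. monomial_form n (?\<rho> \<circ> w) xs * g (ls, as, ?\<rho> \<circ> w))"
        using conf_formsD(2)[OF g True _ as bp] xs n by (intro sum.cong) (simp_all add: monomial_form_permute[OF \<rho>])
      also have "\<dots> = (\<Sum>w\<in>?S. monomial_form n w xs * g (ls, as, w))"
        by (rule setum_permutations_compose_left[OF \<rho>, symmetric])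
      finally show ?thesis using True by (simp add: \<Gamma>_def)
    qed (simp add: \<Gamma>_def)
  qed
  define F where "F ts = mev ts G" for ts
  have fs: "form_spaces (replicate k (schur_symbols P V, schur_forms P V))"
    using form_space_schur[OF vs] by simp
  have F: "F \<in> tensor_forms (schur P V) k"
    using mev_multilinear[OF fs mf] by (simp add: tensor_forms_def F_def[abs_def] schur_def)
  have val: "conf_term (schur P V) (free_ev P V) k e s F = g s" if s: "s \<in> conf_symbols P k n" for s
  proof -
    from s obtain ls as w where s: "s = (ls, as, w)" "ls \<in> compositions k n" "as \<in> listset (map (ops P) ls)"
      "w permutes {..<n}" by (auto simp: conf_symbols_def)
    let ?x = "permute_list (inv w) (map unit_vector [0..<n]) :: (nat \<Rightarrow> 'k) list"
    let ?us = "split_blocks ls ?x" and ?\<iota> = "\<lambda>x. gen (schur_forms P V) (unit P, [x])"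
    have c: "set ?x \<subseteq> carr V" using permutes_inv[OF s(4)] unit_vector_in_coord_space by (auto simp: V)
    have lx: "length ?x = sum_list ls" using s(2) by (simp add: in_compositions)
    have us: "length (?us ! i) = ls ! i" "set (?us ! i) \<subseteq> carr V" "as ! i \<in> ops P (ls ! i)" if "i < k" for i
      using length_split_blocks_nth[OF lx, of i] set_split_blocks[of "?us ! i" ls ?x] c that s(2,3)
      by (auto simp: in_compositions listset_iff_nth)
    have la: "length as = k" "length ls = k" using listset_length[OF s(3)] s(2) by (auto simp: in_compositions)
    have "split_blocks ls (permute_list (inv w) e) = map (map ?\<iota>) ?us"
      using permutes_inv[OF s(4)] by (simp add: e map_split_blocks permute_list_map)
    then have "map2 (free_ev P V) as (split_blocks ls (permute_list (inv w) e)) =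
        map (gen (schur_forms P V)) (zip as ?us)"
      using us la by (intro nth_equalityI) (auto intro!: free_ev_units[OF vs])
    also have "F \<dots> = G (zip as ?us)"
      using mev_gen[OF fs mf, of "zip as ?us"] us la
      by (simp add: F_def map2_gen_replicate listset_iff_nth)
    also have "\<dots> = \<Gamma> ls as ?x"
      using la lx by (simp add: G_def concat_split_blocks map_length_split_blocks flip: map_map)
    also have "\<dots> = (\<Sum>v\<in>?S. if v = w then g (ls, as, v) else 0)"
      using s(2) by (auto simp: \<Gamma>_def monomial_form_unit_vectors[OF _ s(4)] intro!: sum.cong)
    also have "\<dots> = g (ls, as, w)" using s(4) by (simp add: finite_permutations)
    finally show ?thesis using F by (simp add: conf_term_def s(1) gen_def)
  qed
  have "conf_eval (schur P V) (free_ev P V) k Z e F = Z g" if "Z \<in> carr (conf_space P k n)" for Z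
  proof -
    have "conf_eval (schur P V) (free_ev P V) k Z e F = Z (\<lambda>s. conf_term (schur P V) (free_ev P V) k e s F)"
      by (simp add: conf_eval_def lin_ext_def conf_term_def)
    also have "\<dots> = Z g"
      by (rule presented_cong[OF that[unfolded conf_space_def] form_space_conf val])
    finally show ?thesis .
  qed
  from this[OF X] this[OF Y] eq show "X g = Y g" by simp
qed

end

subsection \<open>The associated confluence law\<close>

lemma lin_ext_sum: "lin_ext (\<Sum>i\<in>I. t i) F = (\<Sum>i\<in>I. lin_ext (t i) F)"
  by (rule ext) (simp add: lin_ext_def sum_fun_apply)

lemma multilinear_apply_form:
  "multilinear_between (replicate n V) (presented_space X Q) F \<Longrightarrow> (\<lambda>xs. F xs q) \<in> tensor_forms V n"
  using multilinear_between_compose[of "replicate n V" "presented_space X Q" F ground "\<lambda>t. t q"]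
    linear_between_apply[of X Q q] by (simp add: tensor_forms_def)

lemma tensor_map_pure:
  assumes "is_vspace W" "linear_between V W h"
  shows "tensor_map W n h (pure V n xs) = pure W n (map h xs)"
  unfolding tensor_map_def
  by (rule lin_ext_gen)
    (rule multilinear_apply_form[OF multilinear_between_map[OF multilinear_pure[OF assms(1), unfolded tensor_power_def] assms(2)]])

locale law_pair =
  A: connected_operad A + C: connected_operad C
  for A C :: "('k::field_char_0, 'a::ab_group_add) operad" +
  fixes \<phi> :: "nat \<Rightarrow> 'a \<Rightarrow> 'a \<Rightarrow> 'k"
  assumes same_module: "smodule.truncate A = smodule.truncate C"
    and fdA: "finite_dimensional A"
    and iso: "smodule_iso A (dual_smodule C) \<phi>"
begin

lemma ops_eq: "ops C = ops A" and act_eq: "act C = act A" and smul_eq: "smul C = smul A"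
  using same_module by (simp_all add: smodule.truncate_def)

sublocale C: fd_operad C
  by unfold_locales (use fdA in \<open>simp add: finite_dimensional_def ops_eq smul_eq\<close>)

abbreviation "D \<equiv> dual_smodule C"

definition \<theta> :: "nat \<Rightarrow> ('a \<Rightarrow> 'k) \<Rightarrow> 'a" where
  "\<theta> l = inv_into (ops A l) (\<phi> l)"

lemma phi_linear: "linear_between (arity_space A n) (arity_space D n) (\<phi> n)"
  and phi_bij: "bij_betw (\<phi> n) (ops A n) (ops D n)"
  and phi_act: "\<sigma> permutes {..<n} \<Longrightarrow> a \<in> ops A n \<Longrightarrow> \<phi> n (act A n \<sigma> a) = act D n \<sigma> (\<phi> n a)"
  using iso by (auto simp: smodule_iso_def)

lemma phi_in: "a \<in> ops A n \<Longrightarrow> \<phi> n a \<in> ops D n"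
  and theta_in: "f \<in> ops D n \<Longrightarrow> \<theta> n f \<in> ops A n"
  and theta_phi: "a \<in> ops A n \<Longrightarrow> \<theta> n (\<phi> n a) = a"
  and phi_theta: "f \<in> ops D n \<Longrightarrow> \<phi> n (\<theta> n f) = f"
  unfolding \<theta>_def using phi_bij[of n]
  by (auto simp: bij_betw_def inv_into_into f_inv_into_f)

lemma theta_linear: "linear_between (arity_space D n) (arity_space A n) (\<theta> n)"
  unfolding \<theta>_def
  using linear_between_inv_into[OF phi_linear, of n] phi_bij[of n] A.vspace by simp

lemma theta_act: "\<sigma> permutes {..<n} \<Longrightarrow> f \<in> ops D n \<Longrightarrow> \<theta> n (act D n \<sigma> f) = act A n \<sigma> (\<theta> n f)"
  using phi_act[of \<sigma> n "\<theta> n f"] theta_phi[of "act A n \<sigma> (\<theta> n f)" n] A.act_closed theta_in phi_theta by metis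

lemma schur_map_phi:
  assumes V: "is_vspace V"
  shows "linear_between (schur A V) (schur D V) (schur_map D V \<phi>)"
    and "a \<in> ops A (length v) \<Longrightarrow> set v \<subseteq> carr V \<Longrightarrow>
      schur_map D V \<phi> (gen (schur_forms A V) (a, v)) = gen (schur_forms D V) (\<phi> (length v) a, v)"
proof -
  let ?F = "\<lambda>(b, v). gen (schur_forms D V) (\<phi> (length v) b, v)"
  have "presented_map (schur_symbols A V) (schur_forms A V) (schur_symbols D V) (schur_forms D V) ?F"
  proof (rule A.presented_map_schur)
    show "linear_between (arity_space A (length v)) (presented_space (schur_symbols D V) (schur_forms D V)) (\<lambda>b. ?F (b, v))"
      if "set v \<subseteq> carr V" for v
      using linear_between_compose[OF phi_linear C.dual.gen_schur_linear[OF that]] by (simp add: schur_def)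
    show "multilinear_between (replicate n V) (presented_space (schur_symbols D V) (schur_forms D V)) (\<lambda>v. ?F (b, v))"
      if "b \<in> ops A n" for n b
      using C.dual.gen_schur_multilinear[OF V phi_in[OF that]] V
      by (subst multilinear_between_cong[of _ _ "\<lambda>v. gen (schur_forms D V) (\<phi> n b, v)"])
        (auto simp: schur_def listset_replicate_iff)
    show "?F (act A (length v) \<sigma> b, permute_list \<sigma> v) = ?F (b, v)"
      if "b \<in> ops A (length v)" "set v \<subseteq> carr V" "\<sigma> permutes {..<length v}" for b v \<sigma>
      using C.dual.gen_schur_act[OF phi_in[OF that(1)] that(2,3)] phi_act[OF that(3,1)] by simp
  qed
  note m = this
  show "linear_between (schur A V) (schur D V) (schur_map D V \<phi>)"
    using lin_ext_linear[OF A.form_space_schur[OF V] m] by (simp add: schur_map_def[abs_def] schur_def)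
  show "schur_map D V \<phi> (gen (schur_forms A V) (a, v)) = gen (schur_forms D V) (\<phi> (length v) a, v)"
    if "a \<in> ops A (length v)" "set v \<subseteq> carr V"
    using lin_ext_gen_map[OF A.form_space_schur[OF V] m, of "(a, v)"] that by (simp add: schur_map_def)
qed

lemma schur_map_theta:
  assumes V: "is_vspace V"
  shows "linear_between (schur D V) (schur A V) (schur_map A V \<theta>)"
    and "f \<in> ops D (length v) \<Longrightarrow> set v \<subseteq> carr V \<Longrightarrow>
      schur_map A V \<theta> (gen (schur_forms D V) (f, v)) = gen (schur_forms A V) (\<theta> (length v) f, v)"
proof -
  let ?F = "\<lambda>(b, v). gen (schur_forms A V) (\<theta> (length v) b, v)"
  have "presented_map (schur_symbols D V) (schur_forms D V) (schur_symbols A V) (schur_forms A V) ?F"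
  proof (rule C.dual.presented_map_schur)
    show "linear_between (arity_space D (length v)) (presented_space (schur_symbols A V) (schur_forms A V)) (\<lambda>b. ?F (b, v))"
      if "set v \<subseteq> carr V" for v
      using linear_between_compose[OF theta_linear A.gen_schur_linear[OF that]] by (simp add: schur_def)
    show "multilinear_between (replicate n V) (presented_space (schur_symbols A V) (schur_forms A V)) (\<lambda>v. ?F (b, v))"
      if "b \<in> ops D n" for n b
      using A.gen_schur_multilinear[OF V theta_in[OF that]] V
      by (subst multilinear_between_cong[of _ _ "\<lambda>v. gen (schur_forms A V) (\<theta> n b, v)"])
        (auto simp: schur_def listset_replicate_iff)
    show "?F (act D (length v) \<sigma> b, permute_list \<sigma> v) = ?F (b, v)"
      if "b \<in> ops D (length v)" "set v \<subseteq> carr V" "\<sigma> permutes {..<length v}" for b v \<sigma>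
      using A.gen_schur_act[OF theta_in[OF that(1)] that(2,3)] theta_act[OF that(3,1)] by simp
  qed
  note m = this
  show "linear_between (schur D V) (schur A V) (schur_map A V \<theta>)"
    using lin_ext_linear[OF C.dual.form_space_schur[OF V] m] by (simp add: schur_map_def[abs_def] schur_def)
  show "schur_map A V \<theta> (gen (schur_forms D V) (f, v)) = gen (schur_forms A V) (\<theta> (length v) f, v)"
    if "f \<in> ops D (length v)" "set v \<subseteq> carr V"
    using lin_ext_gen_map[OF C.dual.form_space_schur[OF V] m, of "(f, v)"] that by (simp add: schur_map_def)
qed

text \<open>The shape shared by all coproduct formulas below; \<kappa> l b u is what a block u with
  dual basis index b contributes. The cofree coalgebra, its transport to A(V) and the evaluated law
  in H are instances with different U and \<kappa>.\<close>

definition law_sum ::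
  "('k, 'h::ab_group_add) vspace \<Rightarrow> (nat \<Rightarrow> 'a \<Rightarrow> 'v list \<Rightarrow> 'h) \<Rightarrow> nat \<Rightarrow> 'a \<Rightarrow> ('a \<Rightarrow> 'k) \<Rightarrow> 'v list
    \<Rightarrow> ('k, 'h list) presented" where
  "law_sum U \<kappa> k \<delta> f v = (\<Sum>ls\<in>compositions k (length v). \<Sum>\<sigma>\<in>unshuffles ls. \<Sum>bs\<in>listset (map (basis_of C) ls).
     fun_scale (act D (length v) \<sigma> f (gam C ls \<delta> bs))
       (pure U k (map (\<lambda>(l, b, u). \<kappa> l b u) (zip ls (zip bs (split_blocks ls (permute_list \<sigma> v)))))))"

lemma law_sum_cong_scaled:
  assumes "\<And>ls \<sigma> bs. ls \<in> compositions k (length v) \<Longrightarrow> \<sigma> permutes {..<length v} \<Longrightarrow>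
      bs \<in> listset (map (basis_of C) ls) \<Longrightarrow>
      fun_scale (act D (length v) \<sigma> f (gam C ls \<delta> bs))
        (pure U k (map (\<lambda>(l, b, u). \<kappa> l b u) (zip ls (zip bs (split_blocks ls (permute_list \<sigma> v)))))) =
      fun_scale (act D (length v) \<sigma> f' (gam C ls \<delta> bs))
        (pure U k (map (\<lambda>(l, b, u). \<kappa>' l b u) (zip ls (zip bs (split_blocks ls (permute_list \<sigma> v))))))"
  shows "law_sum U \<kappa> k \<delta> f v = law_sum U \<kappa>' k \<delta> f' v"
  unfolding law_sum_def using assms
  by (intro sum.cong refl) (auto simp: unshuffles_def in_compositions)

lemma law_sum_blocks:
  assumes "ls \<in> compositions k (length v)" "\<sigma> permutes {..<length v}" "bs \<in> listset (map (basis_of C) ls)" "i < k"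
  shows "length ls = k" "length bs = k" "bs ! i \<in> basis_of C (ls ! i)"
    "length (split_blocks ls (permute_list \<sigma> v) ! i) = ls ! i"
    "set (split_blocks ls (permute_list \<sigma> v) ! i) \<subseteq> set v"
  using assms listset_length[OF assms(3)] length_split_blocks_nth[of "permute_list \<sigma> v" ls i]
    set_split_blocks[of "split_blocks ls (permute_list \<sigma> v) ! i" ls "permute_list \<sigma> v"]
  by (auto simp: in_compositions listset_iff_nth)

lemma law_sum_cong:
  assumes "\<And>b u. b \<in> basis_of C (length u) \<Longrightarrow> set u \<subseteq> set v \<Longrightarrow> \<kappa> (length u) b u = \<kappa>' (length u) b u"
  shows "law_sum U \<kappa> k \<delta> f v = law_sum U \<kappa>' k \<delta> f v"
proof (rule law_sum_cong_scaled)
  fix ls \<sigma> bs assume *: "ls \<in> compositions k (length v)" "\<sigma> permutes {..<length v}" "bs \<in> listset (map (basis_of C) ls)"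
  have "map (\<lambda>(l, b, u). \<kappa> l b u) (zip ls (zip bs (split_blocks ls (permute_list \<sigma> v)))) =
      map (\<lambda>(l, b, u). \<kappa>' l b u) (zip ls (zip bs (split_blocks ls (permute_list \<sigma> v))))"
  proof (rule nth_equalityI)
    fix i assume "i < length (map (\<lambda>(l, b, u). \<kappa> l b u) (zip ls (zip bs (split_blocks ls (permute_list \<sigma> v)))))"
    then have i: "i < k" using *(1) by (simp add: in_compositions)
    show "map (\<lambda>(l, b, u). \<kappa> l b u) (zip ls (zip bs (split_blocks ls (permute_list \<sigma> v)))) ! i =
      map (\<lambda>(l, b, u). \<kappa>' l b u) (zip ls (zip bs (split_blocks ls (permute_list \<sigma> v)))) ! i"
      using law_sum_blocks[OF * i] assms[of "bs ! i" "split_blocks ls (permute_list \<sigma> v) ! i"] i by simp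
  qed simp
  then show "fun_scale (act D (length v) \<sigma> f (gam C ls \<delta> bs))
        (pure U k (map (\<lambda>(l, b, u). \<kappa> l b u) (zip ls (zip bs (split_blocks ls (permute_list \<sigma> v)))))) =
      fun_scale (act D (length v) \<sigma> f (gam C ls \<delta> bs))
        (pure U k (map (\<lambda>(l, b, u). \<kappa>' l b u) (zip ls (zip bs (split_blocks ls (permute_list \<sigma> v))))))" by (rule arg_cong)
qed

lemma cofree_sum_eq: "C.cofree_sum V k \<delta> (f, v) =
    law_sum (schur D V) (\<lambda>l b u. gen (schur_forms D V) (dual_basis_of C l b, u)) k \<delta> f v"
  by (simp add: C.cofree_sum_def law_sum_def)

lemma tensor_map_law_sum:
  assumes "is_vspace W" "linear_between U W h"
  shows "tensor_map W k h (law_sum U \<kappa> k \<delta> f v) = law_sum W (\<lambda>l b u. h (\<kappa> l b u)) k \<delta> f v"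
  unfolding law_sum_def tensor_map_def lin_ext_sum lin_ext_scale
    tensor_map_pure[OF assms, unfolded tensor_map_def]
  by (simp add: comp_def case_prod_unfold)

text \<open>The explicit candidate for the law. Its permutation is \<open>inv \<sigma>\<close>
  because \<open>conf_eval\<close> reads the letters through the inverse.\<close>

definition law_element :: "nat \<Rightarrow> nat \<Rightarrow> 'a \<Rightarrow> 'a \<Rightarrow> ('k, 'a conf_symbol) presented" where
  "law_element k n \<delta> \<mu> = (\<Sum>ls\<in>compositions k n. \<Sum>\<sigma>\<in>unshuffles ls. \<Sum>bs\<in>listset (map (basis_of C) ls).
     fun_scale (act D n \<sigma> (\<phi> n \<mu>) (gam C ls \<delta> bs))
       (gen (conf_forms A k n) (ls, map2 (\<lambda>l b. \<theta> l (dual_basis_of C l b)) ls bs, inv \<sigma>)))"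

lemma law_element_in: "law_element k n \<delta> \<mu> \<in> carr (conf_space A k n)"
proof -
  have "fun_scale c (gen (conf_forms A k n) (ls, map2 (\<lambda>l b. \<theta> l (dual_basis_of C l b)) ls bs, inv \<sigma>)) \<in>
      carr (presented_space (conf_symbols A k n) (conf_forms A k n))"
    if "ls \<in> compositions k n" "\<sigma> \<in> unshuffles ls" "bs \<in> listset (map (basis_of C) ls)" for c ls \<sigma> bs
  proof -
    have "(ls, map2 (\<lambda>l b. \<theta> l (dual_basis_of C l b)) ls bs, inv \<sigma>) \<in> conf_symbols A k n"
      using that listset_length[OF that(3)] permutes_inv
      by (auto simp: conf_symbols_def listset_iff_nth unshuffles_def in_compositions
          intro!: theta_in C.dual_basis_in_dual)
    from is_vspace_scale[OF is_vspace_presented_space gen_in_carr[OF this]] show ?thesis by simp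
  qed
  then show ?thesis unfolding law_element_def conf_space_def by (intro is_vspace_sum is_vspace_presented_space)
qed

lemma conf_eval_law_element:
  assumes H: "is_vspace H"
    and lin: "\<And>u. set u \<subseteq> set ps \<Longrightarrow> linear_between (arity_space A (length u)) H (\<lambda>a. ev a u)"
    and inv: "\<And>a u \<tau>. a \<in> ops A (length u) \<Longrightarrow> set u \<subseteq> set ps \<Longrightarrow> \<tau> permutes {..<length u} \<Longrightarrow>
      ev (act A (length u) \<tau> a) (permute_list \<tau> u) = ev a u"
  shows "conf_eval H ev k (law_element k (length ps) \<delta> \<mu>) ps =
    law_sum H (\<lambda>l b u. ev (\<theta> l (dual_basis_of C l b)) u) k \<delta> (\<phi> (length ps) \<mu>) ps"
proof -
  let ?n = "length ps"
  note pm = A.conf_presented_map[where ev = ev and m = k, OF H refl lin inv]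
  have g: "lin_ext (gen (conf_forms A k ?n) s) (A.conf_term H ev k ps) = A.conf_term H ev k ps s"
    if "s \<in> conf_symbols A k ?n" for s
    by (rule lin_ext_gen_map[OF A.form_space_conf pm that])
  have "lin_ext (law_element k ?n \<delta> \<mu>) (A.conf_term H ev k ps) =
    (\<Sum>ls\<in>compositions k ?n. \<Sum>\<sigma>\<in>unshuffles ls. \<Sum>bs\<in>listset (map (basis_of C) ls).
     fun_scale (act D ?n \<sigma> (\<phi> ?n \<mu>) (gam C ls \<delta> bs))
       (lin_ext (gen (conf_forms A k ?n) (ls, map2 (\<lambda>l b. \<theta> l (dual_basis_of C l b)) ls bs, inv \<sigma>)) (A.conf_term H ev k ps)))"
    by (simp add: law_element_def lin_ext_sum lin_ext_scale)
  also have "\<dots> = law_sum H (\<lambda>l b u. ev (\<theta> l (dual_basis_of C l b)) u) k \<delta> (\<phi> ?n \<mu>) ps"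
    unfolding law_sum_def
  proof (intro sum.cong refl arg_cong2[where f = fun_scale])
    fix ls \<sigma> bs assume ls: "ls \<in> compositions k ?n" and "\<sigma> \<in> unshuffles ls" and bs: "bs \<in> listset (map (basis_of C) ls)"
    then have \<sigma>: "\<sigma> permutes {..<?n}" by (simp add: unshuffles_def in_compositions)
    let ?as = "map2 (\<lambda>l b. \<theta> l (dual_basis_of C l b)) ls bs"
    have "(ls, ?as, inv \<sigma>) \<in> conf_symbols A k ?n"
      using ls bs listset_length[OF bs] permutes_inv[OF \<sigma>]
      by (auto simp: conf_symbols_def listset_iff_nth in_compositions intro!: theta_in C.dual_basis_in_dual)
    note g[OF this]
    moreover have "map2 ev ?as (split_blocks ls (permute_list \<sigma> ps)) =
      map (\<lambda>(l, b, u). ev (\<theta> l (dual_basis_of C l b)) u) (zip ls (zip bs (split_blocks ls (permute_list \<sigma> ps))))"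
      using listset_length[OF bs] by (intro nth_equalityI) auto
    ultimately show "lin_ext (gen (conf_forms A k ?n) (ls, ?as, inv \<sigma>)) (A.conf_term H ev k ps) =
      pure H k (map (\<lambda>(l, b, u). ev (\<theta> l (dual_basis_of C l b)) u) (zip ls (zip bs (split_blocks ls (permute_list \<sigma> ps)))))"
      by (simp add: A.conf_term_def permutes_inv_inv[OF \<sigma>])
  qed
  finally show ?thesis by (simp add: conf_eval_def A.conf_term_def[abs_def])
qed

lemma transported_cop_gen:
  assumes V: "is_vspace V" and \<delta>: "\<delta> \<in> ops C k" and \<mu>: "\<mu> \<in> ops A (length v)" and v: "set v \<subseteq> carr V"
  shows "transported_cop A C \<phi> V k \<delta> (gen (schur_forms A V) (\<mu>, v)) =
    law_sum (schur A V) (\<lambda>l b u. gen (schur_forms A V) (\<theta> l (dual_basis_of C l b), u)) k \<delta> (\<phi> (length v) \<mu>) v"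
proof -
  have "transported_cop A C \<phi> V k \<delta> (gen (schur_forms A V) (\<mu>, v)) =
    tensor_map (schur A V) k (schur_map A V \<theta>) (C.cofree_sum V k \<delta> (\<phi> (length v) \<mu>, v))"
    unfolding transported_cop_def schur_map_phi(2)[OF V \<mu> v]
    by (simp add: C.cofree_cop_gen[OF V \<delta> phi_in[OF \<mu>] v] \<theta>_def[abs_def])
  also have "\<dots> = law_sum (schur A V)
      (\<lambda>l b u. schur_map A V \<theta> (gen (schur_forms D V) (dual_basis_of C l b, u))) k \<delta> (\<phi> (length v) \<mu>) v"
    unfolding cofree_sum_eq by (rule tensor_map_law_sum[OF is_vspace_schur schur_map_theta(1)[OF V]])
  also have "\<dots> = law_sum (schur A V) (\<lambda>l b u. gen (schur_forms A V) (\<theta> l (dual_basis_of C l b), u)) k \<delta> (\<phi> (length v) \<mu>) v"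
    using v by (intro law_sum_cong schur_map_theta(2)[OF V] C.dual_basis_in_dual) auto
  finally show ?thesis .
qed

text \<open>The explicit element solves the defining equation at the standard basis, and
  \<open>conf_eval_inj\<close> leaves no other solution.\<close>

theorem associated_law_eq:
  assumes \<delta>: "\<delta> \<in> ops C k" and \<mu>: "\<mu> \<in> ops A n"
  shows "associated_law A C \<phi> k n \<delta> \<mu> = law_element k n \<delta> \<mu>"
proof -
  define V :: "('k, nat \<Rightarrow> 'k) vspace" where "V = coord_space n"
  define e :: "(nat \<Rightarrow> 'k) list" where "e = map unit_vector [0..<n]"
  define \<iota> where "\<iota> x = gen (schur_forms A V) (unit A, [x])" for x
  have V: "is_vspace V" by (simp add: V_def is_vspace_coord_space)
  have e: "length e = n" "set e \<subseteq> carr V" by (auto simp: e_def V_def unit_vector_in_coord_space)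
  have block: "\<exists>u'. u = map \<iota> u' \<and> set u' \<subseteq> set e" if "set u \<subseteq> set (map \<iota> e)" for u
  proof -
    have "\<forall>x\<in>set u. \<exists>y. y \<in> set e \<and> \<iota> y = x" using that by auto
    from bchoice[OF this] obtain h where h: "\<forall>x\<in>set u. h x \<in> set e \<and> \<iota> (h x) = x" ..
    then have "u = map \<iota> (map h u)" by (simp add: map_idI)
    then show ?thesis using h by (intro exI[of _ "map h u"]) auto
  qed
  \<comment> \<open>On words of degree-one generators free evaluation just forms a generator, which
    supplies the linearity and equivariance required of \<open>free_ev\<close>.\<close>
  have fe: "free_ev A V a (map \<iota> u) = gen (schur_forms A V) (a, u)" if "a \<in> ops A (length u)" "set u \<subseteq> set e" for a u
    unfolding \<iota>_def using A.free_ev_units[OF V that(1)] that(2) e(2) by simp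
  have ce: "conf_eval (schur A V) (free_ev A V) k (law_element k n \<delta> \<mu>) (map \<iota> e) =
      law_sum (schur A V) (\<lambda>l b u. free_ev A V (\<theta> l (dual_basis_of C l b)) u) k \<delta> (\<phi> n \<mu>) (map \<iota> e)"
  proof -
    have "conf_eval (schur A V) (free_ev A V) k (law_element k (length (map \<iota> e)) \<delta> \<mu>) (map \<iota> e) =
      law_sum (schur A V) (\<lambda>l b u. free_ev A V (\<theta> l (dual_basis_of C l b)) u) k \<delta> (\<phi> (length (map \<iota> e)) \<mu>) (map \<iota> e)"
    proof (rule conf_eval_law_element[OF is_vspace_schur])
      fix u assume "set u \<subseteq> set (map \<iota> e)"
      then obtain u' where u: "u = map \<iota> u'" "set u' \<subseteq> set e" using block by blast
      show "linear_between (arity_space A (length u)) (schur A V) (\<lambda>a. free_ev A V a u)"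
        using A.gen_schur_linear[of u' V] u e(2)
        by (subst linear_between_cong[OF _ A.vspace, of _ _ "\<lambda>a. gen (schur_forms A V) (a, u')"]) (auto simp: fe)
      fix a \<tau> assume a: "a \<in> ops A (length u)" and \<tau>: "\<tau> permutes {..<length u}"
      have "free_ev A V (act A (length u) \<tau> a) (map \<iota> (permute_list \<tau> u')) =
          gen (schur_forms A V) (act A (length u) \<tau> a, permute_list \<tau> u')"
        using u a \<tau> A.act_closed[OF \<tau> a] by (intro fe) auto
      then show "free_ev A V (act A (length u) \<tau> a) (permute_list \<tau> u) = free_ev A V a u"
        using u a \<tau> e(2) A.gen_schur_act[of a u' V \<tau>] by (simp add: fe permute_list_map)
    qed
    then show ?thesis by (simp add: e(1))
  qed
  also have "\<dots> = law_sum (schur A V) (\<lambda>l b u. gen (schur_forms A V) (\<theta> l (dual_basis_of C l b), u)) k \<delta> (\<phi> n \<mu>) e"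
    unfolding law_sum_def length_map e(1)
  proof (intro sum.cong refl arg_cong2[where f = fun_scale] arg_cong[where f = "pure (schur A V) k"])
    fix ls \<sigma> bs assume ls: "ls \<in> compositions k n" and "\<sigma> \<in> unshuffles ls" and bs: "bs \<in> listset (map (basis_of C) ls)"
    then have \<sigma>: "\<sigma> permutes {..<length e}" by (simp add: unshuffles_def in_compositions e(1))
    have sb: "split_blocks ls (permute_list \<sigma> (map \<iota> e)) = map (map \<iota>) (split_blocks ls (permute_list \<sigma> e))"
      using \<sigma> by (simp add: permute_list_map map_split_blocks)
    note bl = law_sum_blocks[of ls k e \<sigma> bs, unfolded e(1), OF ls \<sigma>[unfolded e(1)] bs]
    show "map (\<lambda>(l, b, u). free_ev A V (\<theta> l (dual_basis_of C l b)) u) (zip ls (zip bs (split_blocks ls (permute_list \<sigma> (map \<iota> e))))) =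
      map (\<lambda>(l, b, u). gen (schur_forms A V) (\<theta> l (dual_basis_of C l b), u)) (zip ls (zip bs (split_blocks ls (permute_list \<sigma> e))))"
      unfolding sb
    proof (rule nth_equalityI)
      fix i assume "i < length (map (\<lambda>(l, b, u). free_ev A V (\<theta> l (dual_basis_of C l b)) u)
        (zip ls (zip bs (map (map \<iota>) (split_blocks ls (permute_list \<sigma> e))))))"
      then have i: "i < k" using ls by (simp add: in_compositions)
      show "map (\<lambda>(l, b, u). free_ev A V (\<theta> l (dual_basis_of C l b)) u)
          (zip ls (zip bs (map (map \<iota>) (split_blocks ls (permute_list \<sigma> e))))) ! i =
        map (\<lambda>(l, b, u). gen (schur_forms A V) (\<theta> l (dual_basis_of C l b), u)) (zip ls (zip bs (split_blocks ls (permute_list \<sigma> e)))) ! i"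
        using bl[OF i] i fe[of "\<theta> (ls ! i) (dual_basis_of C (ls ! i) (bs ! i))" "split_blocks ls (permute_list \<sigma> e) ! i"]
          theta_in[OF C.dual_basis_in_dual] by simp
    qed simp
  qed
  also have "\<dots> = transported_cop A C \<phi> V k \<delta> (gen (schur_forms A V) (\<mu>, e))"
    using transported_cop_gen[OF V \<delta>, of \<mu> e] \<mu> e by simp
  finally have eq: "conf_eval (schur A V) (free_ev A V) k (law_element k n \<delta> \<mu>) (map \<iota> e) =
    transported_cop A C \<phi> V k \<delta> (gen (schur_forms A V) (\<mu>, e))" .
  have "(THE X. X \<in> carr (conf_space A k n) \<and>
       conf_eval (schur A V) (free_ev A V) k X (map \<iota> e) =
       transported_cop A C \<phi> V k \<delta> (gen (schur_forms A V) (\<mu>, e))) = law_element k n \<delta> \<mu>"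
  proof (rule the_equality)
    fix X assume X: "X \<in> carr (conf_space A k n) \<and> conf_eval (schur A V) (free_ev A V) k X (map \<iota> e) =
       transported_cop A C \<phi> V k \<delta> (gen (schur_forms A V) (\<mu>, e))"
    show "X = law_element k n \<delta> \<mu>"
      by (rule A.conf_eval_inj[of X k n _ V "map \<iota> e"]) (use X eq in \<open>simp_all add: law_element_in V_def e_def \<iota>_def[abs_def]\<close>)
  qed (use eq law_element_in in simp)
  then show ?thesis by (simp add: associated_law_def V_def e_def \<iota>_def[abs_def])
qed

lemma conf_eval_associated_law:
  assumes "operad_algebra A H ev" "\<delta> \<in> ops C k" "\<mu> \<in> ops A (length ps)" "set ps \<subseteq> carr H"
  shows "conf_eval H ev k (associated_law A C \<phi> k (length ps) \<delta> \<mu>) ps =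
    law_sum H (\<lambda>l b u. ev (\<theta> l (dual_basis_of C l b)) u) k \<delta> (\<phi> (length ps) \<mu>) ps"
proof -
  interpret H: operad_algebra A H ev by (rule assms(1))
  show ?thesis
    unfolding associated_law_eq[OF assms(2,3)]
  proof (rule conf_eval_law_element[OF H.vspace])
    fix u assume u: "set u \<subseteq> set ps"
    then have u': "u \<in> listset (replicate (length u) (carr H))" using assms(4) by (auto simp: listset_replicate_iff)
    then show "linear_between (arity_space A (length u)) H (\<lambda>a. ev a u)" by (rule H.ev_linear)
    show "ev (act A (length u) \<tau> a) (permute_list \<tau> u) = ev a u"
      if "a \<in> ops A (length u)" "\<tau> permutes {..<length u}" for a \<tau>
      by (rule H.ev_equivariant[OF that(1) u' that(2)])
  qed
qed

end

subsection \<open>Rescaling the isomorphism\<close>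

context law_pair
begin

lemma unit_A_in: "unit A \<in> ops A 1" and unit_C_in: "unit C \<in> ops A 1"
  using A.unit_closed C.unit_closed by (simp_all add: ops_eq)

lemma dual_one_eqI:
  assumes "f \<in> ops D 1" "g \<in> ops D 1" "f (unit C) = g (unit C)"
  shows "f = g"
proof
  fix a
  show "f a = g a"
  proof (cases "a \<in> ops C 1")
    case True
    then obtain s where "a = smul C s (unit C)" using C.ops_1 by auto
    then show ?thesis
      using assms C.unit_closed linear_betweenD(3)[of "arity_space C 1" ground f "unit C" s]
        linear_betweenD(3)[of "arity_space C 1" ground g "unit C" s] by (simp add: ops_dual)
  qed (use assms in \<open>simp add: ops_dual\<close>)
qed

lemma counit_form: "counit_form C \<in> ops D 1" "counit_form C (unit C) = 1"
proof -
  interpret S: vector_space "smul C" by (rule C.vector_space_smul)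
  have ind: "S.independent {unit C}" using C.unit_nonzero by simp
  have sp: "S.span {unit C} = ops C 1" using C.ops_1 by (auto simp: S.span_singleton)
  have "S.representation {unit C} a = (\<lambda>b. 0)" if "a \<notin> ops C 1" for a
    using that unfolding S.representation_def sp by simp
  moreover have "linear_between (arity_space C 1) ground (counit_form C)"
    using S.representation_add[OF ind] S.representation_scale[OF ind]
    by (simp add: linear_between_ground_iff counit_form_def sp)
  ultimately show "counit_form C \<in> ops D 1" by (simp add: ops_dual counit_form_def)
  show "counit_form C (unit C) = 1" by (simp add: counit_form_def S.representation_basis[OF ind])
qed

definition unit_scalar :: 'k where "unit_scalar = \<phi> 1 (unit A) (unit C)"

lemma phi_unit: "\<phi> 1 (unit A) = fun_scale unit_scalar (counit_form C)"
  using is_vspace_scale[OF C.dual.vspace, of "counit_form C" 1 unit_scalar] counit_form phi_in[OF unit_A_in]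
  by (intro dual_one_eqI) (simp_all add: unit_scalar_def fun_scale_def)

text \<open>\<phi> is injective in arity 1 and the unit of A is not 0.\<close>

lemma unit_scalar_nonzero: "unit_scalar \<noteq> 0"
proof
  assume "unit_scalar = 0"
  then have "\<phi> 1 (unit A) = \<phi> 1 0"
    using linear_between_zero[OF phi_linear A.vspace] by (simp add: phi_unit[unfolded One_nat_def] fun_scale_def zero_fun_def)
  then have "unit A = 0"
    using theta_phi[OF unit_A_in] theta_phi[of 0 1] is_vspace_zero[OF A.vspace, of 1] by simp
  then show False using A.unit_nonzero by simp
qed

definition phi_scaled :: "nat \<Rightarrow> 'a \<Rightarrow> 'a \<Rightarrow> 'k" where
  "phi_scaled n a = fun_scale (inverse unit_scalar ^ n) (\<phi> n a)"

lemma phi_scaled_unit: "phi_scaled 1 (unit A) = counit_form C"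
  using unit_scalar_nonzero by (simp add: phi_scaled_def phi_unit[unfolded One_nat_def] fun_scale_def flip: mult.assoc)

lemma law_pair_scaled: "law_pair A C phi_scaled"
proof (intro law_pair.intro law_pair_axioms.intro A.connected_operad_axioms C.connected_operad_axioms same_module fdA)
  let ?c = "\<lambda>n. inverse unit_scalar ^ n"
  have nz: "?c n \<noteq> 0" for n using unit_scalar_nonzero by simp
  interpret S: vector_space "fun_scale :: 'k \<Rightarrow> ('a \<Rightarrow> 'k) \<Rightarrow> _" by (rule vector_space_fun_scale)
  show "smodule_iso A D phi_scaled"
    unfolding smodule_iso_def
  proof (intro allI conjI impI ballI)
    fix n
    show "linear_between (arity_space A n) (arity_space D n) (phi_scaled n)"
      using linear_between_combine[OF C.dual.vspace phi_linear linear_between_const_zero[OF C.dual.vspace], of n "?c n"]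
      by (simp add: phi_scaled_def[abs_def])
    show "bij_betw (phi_scaled n) (ops A n) (ops D n)"
    proof (rule bij_betw_byWitness[where f' = "\<lambda>f. \<theta> n (fun_scale (inverse (?c n)) f)"])
      have sc: "fun_scale r f \<in> ops D n" if "f \<in> ops D n" for r f
        using is_vspace_scale[OF C.dual.vspace, of f n r] that by simp
      show "\<forall>a\<in>ops A n. \<theta> n (fun_scale (inverse (?c n)) (phi_scaled n a)) = a"
        using theta_phi nz[of n] by (simp add: phi_scaled_def)
      show "\<forall>f\<in>ops D n. phi_scaled n (\<theta> n (fun_scale (inverse (?c n)) f)) = f"
        using phi_theta[OF sc] nz[of n] by (simp add: phi_scaled_def)
      show "phi_scaled n ` ops A n \<subseteq> ops D n" using phi_in sc by (auto simp: phi_scaled_def)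
      show "(\<lambda>f. \<theta> n (fun_scale (inverse (?c n)) f)) ` ops D n \<subseteq> ops A n" using theta_in sc by auto
    qed
    fix \<sigma> a assume \<sigma>: "\<sigma> permutes {..<n}" and a: "a \<in> ops A n"
    show "phi_scaled n (act A n \<sigma> a) = act D n \<sigma> (phi_scaled n a)"
      using phi_act[OF \<sigma> a] linear_betweenD(3)[OF C.dual.act_linear[OF \<sigma>], of "\<phi> n a" "?c n"] phi_in[OF a]
      by (simp add: phi_scaled_def)
  qed
qed

lemma theta_scaled:
  assumes "f \<in> ops D l"
  shows "law_pair.\<theta> A phi_scaled l f = smul A (unit_scalar ^ l) (\<theta> l f)"
proof -
  interpret N: law_pair A C phi_scaled by (rule law_pair_scaled)
  let ?a = "smul A (unit_scalar ^ l) (\<theta> l f)"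
  have a: "?a \<in> ops A l"
    using is_vspace_scale[OF A.vspace, of "\<theta> l f" l "unit_scalar ^ l"] theta_in[OF assms] by simp
  have "phi_scaled l ?a = f"
    using linear_betweenD(3)[OF phi_linear, of "\<theta> l f" l "unit_scalar ^ l"] theta_in[OF assms] phi_theta[OF assms]
      unit_scalar_nonzero by (simp add: phi_scaled_def fun_scale_def power_inverse mult.assoc[symmetric])
  with N.theta_phi[OF a] show ?thesis by simp
qed

lemma prod_list_power: "prod_list (map (\<lambda>l. (c::'k) ^ l) ls) = c ^ sum_list ls"
  by (induction ls) (simp_all add: power_add)

text \<open>With c = \<open>unit_scalar\<close>, the inverse isomorphism is multiplied by c^l on a
  block of length l. The blocks of a composition of n together give c^n, which cancels the factor
  c^(-n) on \<phi>.\<close>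

lemma law_sum_scaled:
  assumes H: "operad_algebra A H ev" and ps: "set ps \<subseteq> carr H" and \<delta>: "\<delta> \<in> ops C k" and f: "f \<in> ops D (length ps)"
  shows "law_sum H (\<lambda>l b u. ev (law_pair.\<theta> A phi_scaled l (dual_basis_of C l b)) u) k \<delta>
      (fun_scale (inverse unit_scalar ^ length ps) f) ps =
    law_sum H (\<lambda>l b u. ev (\<theta> l (dual_basis_of C l b)) u) k \<delta> f ps"
proof (rule law_sum_cong_scaled)
  interpret H: operad_algebra A H ev by (rule H)
  let ?n = "length ps"
  fix ls \<sigma> bs assume *: "ls \<in> compositions k ?n" "\<sigma> permutes {..<?n}" "bs \<in> listset (map (basis_of C) ls)"
  let ?us = "split_blocks ls (permute_list \<sigma> ps)"
  let ?xs = "map (\<lambda>(l, b, u). ev (\<theta> l (dual_basis_of C l b)) u) (zip ls (zip bs ?us))"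
  note bl = law_sum_blocks[OF *]
  have k: "length ls = k" "length bs = k" using *(1) listset_length[OF *(3)] by (simp_all add: in_compositions)
  have u: "?us ! i \<in> listset (replicate (ls ! i) (carr H))" if "i < k" for i
    using bl[OF that] ps by (auto simp: listset_replicate_iff)
  have in_H: "ev a (?us ! i) \<in> carr H" if "i < k" "a \<in> ops A (ls ! i)" for i a
    using linear_betweenD(1)[OF H.ev_linear[OF u[OF that(1)]]] that(2) by simp
  have sc: "ev (smul A c a) (?us ! i) = scl H c (ev a (?us ! i))" if "i < k" "a \<in> ops A (ls ! i)" for i a c
    using linear_betweenD(3)[OF H.ev_linear[OF u[OF that(1)]], of a] that(2) by simp
  have xs: "length ?xs = k" "set ?xs \<subseteq> carr H"
    using k in_H theta_in[OF C.dual_basis_in_dual] by (auto simp: in_set_conv_nth)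
  have "map (\<lambda>(l, b, u). ev (law_pair.\<theta> A phi_scaled l (dual_basis_of C l b)) u) (zip ls (zip bs ?us)) =
      map2 (scl H) (map (\<lambda>l. unit_scalar ^ l) ls) ?xs"
    using k sc theta_in[OF C.dual_basis_in_dual]
    by (intro nth_equalityI) (simp_all add: theta_scaled[OF C.dual_basis_in_dual])
  also have "pure H k \<dots> = fun_scale (prod_list (map (\<lambda>l. unit_scalar ^ l) ls)) (pure H k ?xs)"
    using multilinear_scale_each[OF H.vspace is_vspace_tensor_power multilinear_pure[OF H.vspace],
      where cs = "map (\<lambda>l. unit_scalar ^ l) ls" and xs = ?xs and n = k] xs k by simp
  finally have "pure H k (map (\<lambda>(l, b, u). ev (law_pair.\<theta> A phi_scaled l (dual_basis_of C l b)) u) (zip ls (zip bs ?us))) =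
      fun_scale (unit_scalar ^ ?n) (pure H k ?xs)"
    using *(1) by (simp add: prod_list_power in_compositions)
  moreover have "act D ?n \<sigma> (fun_scale (inverse unit_scalar ^ ?n) f) (gam C ls \<delta> bs) =
      inverse unit_scalar ^ ?n * act D ?n \<sigma> f (gam C ls \<delta> bs)"
    by (simp add: act_dual fun_scale_def)
  ultimately show "fun_scale (act D ?n \<sigma> (fun_scale (inverse unit_scalar ^ ?n) f) (gam C ls \<delta> bs))
     (pure H k (map (\<lambda>(l, b, u). ev (law_pair.\<theta> A phi_scaled l (dual_basis_of C l b)) u) (zip ls (zip bs ?us)))) =
     fun_scale (act D ?n \<sigma> f (gam C ls \<delta> bs)) (pure H k ?xs)"
    using unit_scalar_nonzero by (simp add: fun_scale_def fun_eq_iff power_inverse)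
qed

end

subsection \<open>Adapted bases and tensor coordinates\<close>

lemma multilinear_prod_list: "multilinear_between (replicate n ground) ground prod_list"
proof (induction n)
  case 0
  show ?case by simp
next
  case (Suc n)
  then show ?case
    by (auto simp: multilinear_between_Cons linear_between_ground_iff algebra_simps
        intro: multilinear_between_ground_mult)
qed

text \<open>The decomposable form with factors Ls; such forms serve as coordinates on tensor
  powers.\<close>

definition linear_product :: "('v \<Rightarrow> 'k::field) list \<Rightarrow> 'v list \<Rightarrow> 'k" where
  "linear_product Ls xs = prod_list (map2 (\<lambda>x l. l x) xs Ls)"

lemma linear_product_form:
  assumes "length Ls = n" "\<And>i. i < n \<Longrightarrow> linear_between V ground (Ls ! i)"
  shows "linear_product Ls \<in> tensor_forms V n"
  using multilinear_map2[OF multilinear_prod_list[of n], of "replicate n V" Ls "\<lambda>x l. l x"] assms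
  by (simp add: tensor_forms_def linear_product_def[abs_def])

text \<open>The constant function 1 erases the i-th factor while keeping the positions of the
  others; it is a placeholder, not a linear form.\<close>

lemma linear_product_split:
  assumes "i < length xs" "length Ls = length xs"
  shows "linear_product Ls xs = (Ls ! i) (xs ! i) * linear_product (Ls[i := \<lambda>_. 1]) xs"
  using assms
proof (induction xs arbitrary: Ls i)
  case (Cons x xs)
  then obtain l Ls' where Ls: "Ls = l # Ls'" by (cases Ls) auto
  show ?case
  proof (cases i)
    case 0
    then show ?thesis using Ls by (simp add: linear_product_def)
  next
    case (Suc j)
    have "linear_product Ls' xs = (Ls' ! j) (xs ! j) * linear_product (Ls'[j := \<lambda>_. 1]) xs"
      by (rule Cons.IH) (use Cons.prems Ls Suc in auto)
    then show ?thesis using Ls Suc by (simp add: linear_product_def mult.left_commute)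
  qed
qed simp

text \<open>A basis of V extended to one of H, with \<pi> the projection along the added vectors.
  The last two properties let coordinates decide whether a tensor is built from elements of V: the
  added coordinates vanish on V, the others do not see \<pi>.\<close>

lemma adapted_basis_exists:
  assumes H: "is_vspace H" and V: "is_vspace V" and sub: "carr V \<subseteq> carr H" "scl V = scl H"
  obtains B B' coord \<pi> where "B' \<subseteq> B" "B \<subseteq> carr H" "carr H = module.span (scl H) B"
    "\<And>b. linear_between H ground (coord b)"
    "\<And>b b'. b \<in> B \<Longrightarrow> coord b' b = (if b = b' then 1 else 0)"
    "linear_between H V \<pi>" "\<And>v. v \<in> carr V \<Longrightarrow> \<pi> v = v"
    "\<And>b v. b \<in> B - B' \<Longrightarrow> v \<in> carr V \<Longrightarrow> coord b v = 0"
    "\<And>b x. b \<in> B' \<Longrightarrow> x \<in> carr H \<Longrightarrow> coord b (\<pi> x) = coord b x"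
proof -
  interpret S: vector_space "scl H" using H by (rule is_vspace_vector_space)
  interpret SS: vector_space_pair "scl H" "scl H" ..
  have sH: "S.subspace (carr H)" and sV: "S.subspace (carr V)" using H V sub by (auto simp: is_vspace_def)
  obtain B' where B': "B' \<subseteq> carr V" "S.independent B'" "carr V \<subseteq> S.span B'"
    by (rule S.maximal_independent_subset)
  obtain B where B: "B' \<subseteq> B" "B \<subseteq> carr H" "S.independent B" "carr H \<subseteq> S.span B"
    using S.maximal_independent_subset_extend[of B' "carr H"] B' sub by blast
  have spH: "carr H = S.span B" using B sH by (metis S.span_minimal subset_antisym)
  have spV: "carr V = S.span B'" using B' sV by (metis S.span_minimal subset_antisym)
  define coord where "coord b x = S.representation B x b" for b x
  define \<pi> where "\<pi> = SS.construct B (\<lambda>b. if b \<in> B' then b else 0)"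
  have lin: "Vector_Spaces.linear (scl H) (scl H) \<pi>"
    unfolding \<pi>_def by (rule SS.linear_construct[OF B(3)])
  interpret \<pi>: Vector_Spaces.linear "scl H" "scl H" \<pi> by (rule lin)
  have \<pi>b: "\<pi> b = (if b \<in> B' then b else 0)" if "b \<in> B" for b
    unfolding \<pi>_def by (rule SS.construct_basis[OF B(3) that])
  have \<pi>V: "\<pi> v = v" if "v \<in> carr V" for v
  proof -
    have "v \<in> S.span B'" using that spV by simp
    then show ?thesis
      by (induction rule: S.span_induct_alt) (use \<pi>b B(1) in \<open>auto simp: \<pi>.add \<pi>.scale\<close>)
  qed
  have \<pi>in: "\<pi> x \<in> carr V" if "x \<in> carr H" for x
  proof -
    have "x \<in> S.span B" using that spH by simp
    then show ?thesis
      by (induction rule: S.span_induct_alt)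
        (use \<pi>b spV in \<open>auto simp: \<pi>.add \<pi>.scale S.span_add S.span_scale S.span_base S.span_zero\<close>)
  qed
  have cl: "linear_between H ground (coord b)" for b
    using S.representation_add[OF B(3)] S.representation_scale[OF B(3)]
    by (simp add: linear_between_ground_iff coord_def spH)
  have cb: "coord b' b = (if b = b' then 1 else 0)" if "b \<in> B" for b b'
    using S.representation_basis[OF B(3) that] by (simp add: coord_def)
  have cV: "coord b v = 0" if "b \<in> B - B'" "v \<in> carr V" for b v
  proof -
    have "S.representation B v = S.representation B' v"
      using S.representation_extend[OF B(3) _ B(1)] that(2) spV by blast
    then show ?thesis using S.representation_ne_zero that(1) unfolding coord_def by (metis DiffD2)
  qed
  have c\<pi>: "coord b (\<pi> x) = coord b x" if "b \<in> B'" "x \<in> carr H" for b x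
  proof -
    have "x \<in> S.span B" using that(2) spH by simp
    then have "x \<in> carr H \<and> coord b (\<pi> x) = coord b x"
    proof (induction rule: S.span_induct_alt)
      case base
      show ?case using is_vspace_zero[OF H] by simp
    next
      case (step c x y)
      have x: "x \<in> carr H" using step B(2) by auto
      note cx = is_vspace_scale[OF H x, of c]
      have px: "\<pi> x \<in> carr H" "scl H c (\<pi> x) \<in> carr H" and py: "\<pi> y \<in> carr H"
        using \<pi>in x step sub(1) is_vspace_scale[OF H] by auto
      have "coord b (\<pi> x) = coord b x"
        using \<pi>b[OF step(1)] cb[OF step(1), of b] that(1) linear_between_zero[OF cl H] by auto
      then show ?case
        using step is_vspace_add[OF H cx] linear_betweenD(2)[OF cl cx, of y] linear_betweenD(3)[OF cl x]
          linear_betweenD(2)[OF cl px(2) py] linear_betweenD(3)[OF cl px(1)]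
        by (simp add: \<pi>.add \<pi>.scale)
    qed
    then show ?thesis ..
  qed
  have "linear_between H V \<pi>" using \<pi>in sub(2) by (simp add: linear_between_def \<pi>.add \<pi>.scale)
  from that[OF B(1,2) spH cl cb this \<pi>V cV c\<pi>] show thesis .
qed

lemma tensor_eqI_coords:
  assumes H: "is_vspace H" and B: "B \<subseteq> carr H" "carr H = module.span (scl H) B"
    and cl: "\<And>b. linear_between H ground (coord b)"
    and cb: "\<And>b b'. b \<in> B \<Longrightarrow> coord b' b = (if b = b' then 1 else 0)"
    and t: "t \<in> carr (tensor_power H n)" "u \<in> carr (tensor_power H n)"
    and eq: "\<And>e. length e = n \<Longrightarrow> set e \<subseteq> B \<Longrightarrow> t (linear_product (map coord e)) = u (linear_product (map coord e))"
  shows "t = u"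
proof -
  let ?c = "\<lambda>e. linear_product (map coord e)"
  let ?E = "{e. length e = n \<and> set e \<subseteq> B}"
  have cf: "?c e \<in> tensor_forms H n" if "length e = n" for e
    using that cl by (intro linear_product_form) auto
  have ce: "?c e' e = (if e = e' then 1 else 0)" if "e \<in> ?E" "length e' = n" for e e'
    using that cb
  proof (induction e arbitrary: e' n)
    case (Cons b e)
    then obtain b' e'' where "e' = b' # e''" by (cases e') auto
    then show ?case using Cons by (auto simp: linear_product_def)
  qed (simp add: linear_product_def)
  have span: "t \<in> fun_space.span (pure H n ` ?E)" if "t \<in> carr (tensor_power H n)" for t
  proof -
    have "pure H n xs \<in> fun_space.span (pure H n ` ?E)" if "xs \<in> listset (replicate n (carr H))" for xs
    proof (rule multilinear_between_span[OF multilinear_pure[OF H] is_vspace_tensor_power])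
      show "module.subspace (scl (tensor_power H n)) (fun_space.span (pure H n ` ?E))" by simp
      show "list_all2 (\<lambda>V B. is_vspace V \<and> carr V = module.span (scl V) B) (replicate n H) (replicate n B)"
        using H B(2) by (simp add: list_all2_conv_all_nth)
      show "pure H n bs \<in> fun_space.span (pure H n ` ?E)" if "bs \<in> listset (replicate n B)" for bs
        using that by (intro fun_space.span_base) (auto simp: listset_replicate_iff)
    qed (use that in simp)
    then have "pure H n ` listset (replicate n (carr H)) \<subseteq> fun_space.span (pure H n ` ?E)" by auto
    then have "fun_space.span (pure H n ` listset (replicate n (carr H))) \<subseteq> fun_space.span (pure H n ` ?E)"
      by (intro fun_space.span_minimal) auto
    then show ?thesis using that by (auto simp: tensor_power_def carr_presented)
  qed
  define expands where "expands t E \<longleftrightarrow> finite E \<and> E \<subseteq> ?E \<and> (\<forall>E' q. finite E' \<longrightarrow> E \<subseteq> E' \<longrightarrow> E' \<subseteq> ?E \<longrightarrow>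
      q \<in> tensor_forms H n \<longrightarrow> t q = (\<Sum>e\<in>E'. t (?c e) * q e))" for t E
  have expand: "\<exists>E. expands t E" if "t \<in> fun_space.span (pure H n ` ?E)" for t
  proof (rule fun_space.span_induct_alt[OF that])
    show "\<exists>E. expands 0 E" by (intro exI[of _ "{}"]) (simp add: expands_def)
  next
    fix c x y assume "x \<in> pure H n ` ?E" and "\<exists>E. expands y E"
    then obtain e E where e: "e \<in> ?E" "x = pure H n e" and E: "expands y E" by blast
    have "(fun_scale c x + y) q = (\<Sum>d\<in>E'. (fun_scale c x + y) (?c d) * q d)"
      if E': "finite E'" "insert e E \<subseteq> E'" "E' \<subseteq> ?E" and q: "q \<in> tensor_forms H n" for E' q
    proof -
      have "(\<Sum>d\<in>E'. x (?c d) * q d) = (\<Sum>d\<in>E'. if d = e then q d else 0)"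
      proof (rule sum.cong[OF refl])
        fix d assume "d \<in> E'"
        then have "length d = n" using E'(3) by blast
        then show "x (?c d) * q d = (if d = e then q d else 0)"
          using ce[OF e(1), of d] cf[of d] e(2) by (auto simp: gen_def)
      qed
      also have "\<dots> = q e" using E' by simp
      finally have "x q = (\<Sum>d\<in>E'. x (?c d) * q d)" using q e by (simp add: gen_def)
      moreover have "y q = (\<Sum>d\<in>E'. y (?c d) * q d)" using E E' q unfolding expands_def by simp
      ultimately show ?thesis
        by (simp add: fun_scale_def algebra_simps sum.distrib sum_distrib_left)
    qed
    then have "expands (fun_scale c x + y) (insert e E)" using e(1) E unfolding expands_def by simp
    then show "\<exists>E. expands (fun_scale c x + y) E" ..
  qed
  show ?thesis
  proof (rule presented_eqI[OF t[unfolded tensor_power_def]])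
    fix q assume q: "q \<in> tensor_forms H n"
    obtain E1 E2 where E: "expands t E1" "expands u E2"
      using expand[OF span[OF t(1)]] expand[OF span[OF t(2)]] by blast
    have U: "finite (E1 \<union> E2)" "E1 \<subseteq> E1 \<union> E2" "E2 \<subseteq> E1 \<union> E2" "E1 \<union> E2 \<subseteq> ?E"
      using E unfolding expands_def by auto
    have ex: "v q = (\<Sum>e\<in>E1 \<union> E2. v (?c e) * q e)" if v: "expands v F" "F \<subseteq> E1 \<union> E2" for v F
      using v(1)[unfolded expands_def, THEN conjunct2, THEN conjunct2, rule_format, OF U(1) v(2) U(4) q] .
    have "t q = (\<Sum>e\<in>E1 \<union> E2. t (?c e) * q e)" by (rule ex[OF E(1) U(2)])
    also have "\<dots> = (\<Sum>e\<in>E1 \<union> E2. u (?c e) * q e)"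
    proof (rule sum.cong[OF refl])
      fix e assume "e \<in> E1 \<union> E2"
      then have "length e = n" "set e \<subseteq> B" using U(4) by auto
      then show "t (?c e) * q e = u (?c e) * q e" using eq by simp
    qed
    also have "\<dots> = u q" by (rule ex[OF E(2) U(3), symmetric])
    finally show "t q = u q" .
  qed
qed

subsection \<open>Bialgebras over the associated law\<close>

lemma length_le_sum_list: "\<forall>l\<in>set ls. 1 \<le> l \<Longrightarrow> length ls \<le> sum_list (ls :: nat list)"
  by (induction ls) auto

lemma compositions_empty: "n < k \<Longrightarrow> compositions k n = {}"
  using length_le_sum_list by (fastforce simp: compositions_def)

lemma compositions_self: "compositions n n = {replicate n 1}"
proof -
  have "ls = replicate (length ls) 1" if "\<forall>l\<in>set ls. 1 \<le> l" "sum_list ls = length ls" for ls :: "nat list"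
    using that
  proof (induction ls)
    case (Cons l ls)
    then have "sum_list ls = length ls" "l = 1" using length_le_sum_list[of ls] by auto
    with Cons show ?case by simp
  qed simp
  note ones = this
  have "ls \<in> compositions n n \<longleftrightarrow> ls = replicate n 1" for ls
    using ones[of ls] by (auto simp: compositions_def sum_list_replicate)
  then show ?thesis by blast
qed

lemma split_blocks_ones: "length xs = n \<Longrightarrow> split_blocks (replicate n 1) xs = map (\<lambda>x. [x]) xs"
  by (induction xs arbitrary: n) auto

lemma unshuffles_ones: "unshuffles (replicate n 1) = {\<sigma>. \<sigma> permutes {..<n}}"
  by (auto simp: unshuffles_def sum_list_replicate split_blocks_ones[of _ n, unfolded One_nat_def])

lemma listset_replicate_singleton: "listset (replicate n {b}) = {replicate n b}"
  by (auto simp: listset_replicate_iff intro!: replicate_eqI)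

text \<open>The chosen basis of C(1) need not be the identity itself; the unknown factor s cancels
  in \<open>cop_ev_top\<close>.\<close>

lemma (in law_pair) basis_of_one: "\<exists>b s. basis_of C 1 = {b} \<and> s \<noteq> 0 \<and> b = smul C s (unit C)"
proof -
  interpret S: vector_space "smul C" by (rule C.vector_space_smul)
  have ind: "S.independent {unit C}" using C.unit_nonzero by simp
  have sp: "S.span {unit C} = ops C 1" using C.ops_1 by (auto simp: S.span_singleton)
  have "card (basis_of C 1) = S.dim (ops C 1)"
    using C.basis_of[of 1] S.span_superset by (intro S.basis_card_eq_dim) auto
  also have "\<dots> = 1" using S.dim_span_eq_card_independent[OF ind] sp by simp
  finally obtain b where b: "basis_of C 1 = {b}" by (auto simp: card_1_singleton_iff)
  moreover obtain s where s: "b = smul C s (unit C)" using C.basis_in_ops[of b 1] b C.ops_1 by auto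
  moreover have "s \<noteq> 0"
  proof
    assume "s = 0"
    then have "b = 0" using s by simp
    then show False using C.basis_of(2)[of 1] b by simp
  qed
  ultimately show ?thesis by blast
qed

text \<open>The situation after the law has been computed and the isomorphism rescaled:
  \<open>normalised\<close> fixes the scale, and \<open>cop_ev\<close> is the compatibility
  condition with the explicit law inserted.\<close>

locale law_bialgebra =
  law_pair A C \<phi> + alg: operad_algebra A H ev + coalg: operad_coalgebra C H cop
  for A C :: "('k::field_char_0, 'a::ab_group_add) operad" and \<phi>
    and H :: "('k, 'h::ab_group_add) vspace" and ev cop +
  assumes normalised: "\<phi> 1 (unit A) = counit_form C"
    and conil: "conilpotent C H cop"
    and cop_ev: "\<delta> \<in> ops C k \<Longrightarrow> \<mu> \<in> ops A (length ps) \<Longrightarrow> set ps \<subseteq> filtration C H cop 1 \<Longrightarrow>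
      cop k \<delta> (ev \<mu> ps) =
        law_sum H (\<lambda>l b u. ev (\<theta> l (dual_basis_of C l b)) u) k \<delta> (\<phi> (length ps) \<mu>) ps"
begin

abbreviation "V \<equiv> Prim C H cop"

lemma carr_V: "carr V = filtration C H cop 1" and scl_V [simp]: "scl V = scl H"
  by (simp_all add: Prim_def)

lemma cop_in: "\<delta> \<in> ops C n \<Longrightarrow> x \<in> carr H \<Longrightarrow> cop n \<delta> x \<in> carr (tensor_power H n)"
  using linear_betweenD(1)[OF coalg.cop_linear] by blast

lemma V_sub: "carr V \<subseteq> carr H"
  by (auto simp: carr_V filtration_def)

lemma is_vspace_V: "is_vspace V"
proof -
  interpret S: vector_space "scl H" by (rule is_vspace_vector_space[OF alg.vspace])
  have "S.subspace (carr V)"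
  proof (rule S.subspaceI)
    show "0 \<in> carr V"
      using is_vspace_zero[OF alg.vspace] linear_between_zero[OF coalg.cop_linear alg.vspace]
      by (simp add: carr_V filtration_def)
    show "x + y \<in> carr V" if "x \<in> carr V" "y \<in> carr V" for x y
      using that is_vspace_add[OF alg.vspace] linear_betweenD(2)[OF coalg.cop_linear]
      by (simp add: carr_V filtration_def)
    show "scl H c x \<in> carr V" if "x \<in> carr V" for c x
      using that is_vspace_scale[OF alg.vspace] linear_betweenD(3)[OF coalg.cop_linear]
      by (simp add: carr_V filtration_def fun_scale_def zero_fun_def)
  qed
  then show ?thesis using S.vector_space_axioms by (simp add: is_vspace_def)
qed

lemma linear_V_H: "linear_between V H (\<lambda>x. x)"
  using V_sub by (auto simp: linear_between_def)

text \<open>A number n has no composition into more than n positive parts. So the values of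
  operations of arity n on primitives lie in the n-th step of the filtration.\<close>

lemma cop_ev_zero:
  assumes "\<delta> \<in> ops C k" "\<mu> \<in> ops A (length ps)" "set ps \<subseteq> carr V" "length ps < k"
  shows "cop k \<delta> (ev \<mu> ps) = 0"
  using cop_ev[OF assms(1,2)] assms(3,4) by (simp add: carr_V law_sum_def compositions_empty)

text \<open>The only composition of n into n parts is (1, ..., 1), its unshuffles are all
  permutations, and C(1) has a single basis element b, s times the identity. Composing \<delta> with
  n copies of b gives a factor s^n, which the n blocks cancel with 1/s each.\<close>

lemma cop_ev_top:
  assumes \<delta>: "\<delta> \<in> ops C n" and \<mu>: "\<mu> \<in> ops A n" and ps: "length ps = n" "set ps \<subseteq> carr V"
  shows "cop n \<delta> (ev \<mu> ps) =
    (\<Sum>\<sigma> | \<sigma> permutes {..<n}. fun_scale (act D n \<sigma> (\<phi> n \<mu>) \<delta>) (pure H n (permute_list \<sigma> ps)))"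
proof -
  obtain b s where b: "basis_of C 1 = {b}" "s \<noteq> 0" "b = smul C s (unit C)" using basis_of_one by blast
  interpret S: vector_space "smul C" by (rule C.vector_space_smul)
  interpret T: vector_space "scl H" by (rule is_vspace_vector_space[OF alg.vspace])
  let ?ones = "replicate n (1::nat)"
  have psH: "set ps \<subseteq> carr H" using ps V_sub by auto
  have "dual_basis_of C 1 b = fun_scale (inverse s) (counit_form C)"
  proof (rule dual_one_eqI)
    show "fun_scale (inverse s) (counit_form C) \<in> ops D 1"
      using is_vspace_scale[OF C.dual.vspace, of "counit_form C" 1 "inverse s"] counit_form by simp
    have "dual_basis_of C 1 b b = s * dual_basis_of C 1 b (unit C)"
      using linear_betweenD(3)[of "arity_space C 1" ground "dual_basis_of C 1 b" "unit C" s]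
        C.dual_basis_in_dual[of 1 b] C.unit_closed b(3) by (simp add: ops_dual)
    moreover have "dual_basis_of C 1 b b = 1" using C.dual_basis_apply[of b 1 b] b(1) by simp
    ultimately have "dual_basis_of C 1 b (unit C) = inverse s" using b(2) by (simp add: field_simps)
    then show "dual_basis_of C 1 b (unit C) = fun_scale (inverse s) (counit_form C) (unit C)"
      using counit_form(2) by (simp add: fun_scale_def)
  qed (rule C.dual_basis_in_dual)
  \<comment> \<open>The normalisation enters here: the dual basis element is 1/s times the counit,
    and the counit corresponds to the unit of A.\<close>
  then have th: "\<theta> 1 (dual_basis_of C 1 b) = smul A (inverse s) (unit A)"
    using linear_betweenD(3)[OF theta_linear, of "counit_form C" 1 "inverse s"] counit_form(1)
      theta_phi[OF unit_A_in] normalised by simp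
  have e1: "ev (\<theta> 1 (dual_basis_of C 1 b)) [x] = scl H (inverse s) x" if "x \<in> carr H" for x
    using linear_betweenD(3)[OF alg.ev_linear[of "[x]" 1], of "unit A" "inverse s"] that unit_A_in alg.ev_unit[OF that]
    by (simp add: th[unfolded One_nat_def])
  have ga: "gam C ?ones \<delta> (replicate n b) = smul C (s ^ n) \<delta>"
  proof -
    have "gam C ?ones \<delta> (map2 (smul C) (replicate n s) (replicate n (unit C))) =
        smul C (prod_list (replicate n s)) (gam C ?ones \<delta> (replicate n (unit C)))"
      using multilinear_scale_each[OF C.vspace C.vspace, of n 1 n "gam C ?ones \<delta>" "replicate n s" "replicate n (unit C)"]
        C.gam_multilinear[of \<delta> ?ones] \<delta> C.unit_closed by (simp add: sum_list_replicate set_replicate_conv_if)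
    then show ?thesis using C.gam_unit_right[OF \<delta>] b(3) by (simp add: zip_replicate map_replicate prod_list_replicate)
  qed
  have summand: "fun_scale (act D n \<sigma> (\<phi> n \<mu>) (gam C ?ones \<delta> (replicate n b)))
      (pure H n (map (\<lambda>(l, b, u). ev (\<theta> l (dual_basis_of C l b)) u)
        (zip ?ones (zip (replicate n b) (split_blocks ?ones (permute_list \<sigma> ps)))))) =
      fun_scale (act D n \<sigma> (\<phi> n \<mu>) \<delta>) (pure H n (permute_list \<sigma> ps))" if \<sigma>: "\<sigma> permutes {..<n}" for \<sigma>
  proof -
    let ?xs = "permute_list \<sigma> ps"
    have xs: "length ?xs = n" "set ?xs \<subseteq> carr H" using \<sigma> ps psH by auto
    have "map (\<lambda>(l, b, u). ev (\<theta> l (dual_basis_of C l b)) u)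
        (zip ?ones (zip (replicate n b) (split_blocks ?ones ?xs))) =
        map2 (scl H) (replicate n (inverse s)) ?xs"
      using xs e1 by (intro nth_equalityI) (auto simp: split_blocks_ones[unfolded One_nat_def] subset_iff)
    also have "pure H n \<dots> = fun_scale (inverse s ^ n) (pure H n ?xs)"
      using multilinear_scale_each[OF alg.vspace is_vspace_tensor_power multilinear_pure[OF alg.vspace],
        where cs = "replicate n (inverse s)" and xs = ?xs and n = n] xs
      by (simp add: prod_list_replicate)
    moreover have "act D n \<sigma> (\<phi> n \<mu>) (smul C (s ^ n) \<delta>) = s ^ n * act D n \<sigma> (\<phi> n \<mu>) \<delta>"
      using C.dual.act_closed[OF \<sigma> phi_in[OF \<mu>]] linear_betweenD(3)[of "arity_space C n" ground _ \<delta> "s ^ n"] \<delta>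
      by (simp add: ops_dual)
    ultimately show ?thesis using b(2) by (simp add: ga[unfolded One_nat_def] fun_scale_def fun_eq_iff power_inverse)
  qed
  have "cop n \<delta> (ev \<mu> ps) = law_sum H (\<lambda>l b u. ev (\<theta> l (dual_basis_of C l b)) u) n \<delta> (\<phi> n \<mu>) ps"
    using cop_ev[OF \<delta>, of \<mu> ps] \<mu> ps carr_V by simp
  also have "\<dots> = (\<Sum>\<sigma> | \<sigma> permutes {..<n}. fun_scale (act D n \<sigma> (\<phi> n \<mu>) \<delta>) (pure H n (permute_list \<sigma> ps)))"
    using summand ps(1) unfolding law_sum_def
    by (simp add: compositions_self unshuffles_ones b(1)[unfolded One_nat_def] listset_replicate_singleton
        unshuffles_ones[unfolded One_nat_def])
  finally show ?thesis .
qed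

section \<open>The map from the free algebra and its injectivity\<close>

lemma free_map_exists: "\<exists>f. linear_between (schur A V) H f \<and>
    (\<forall>a v. a \<in> ops A (length v) \<longrightarrow> set v \<subseteq> carr V \<longrightarrow> f (gen (schur_forms A V) (a, v)) = ev a v)"
proof -
  have "\<exists>f. linear_between (schur A V) H f \<and>
    (\<forall>a v. a \<in> ops A (length v) \<longrightarrow> set v \<subseteq> carr V \<longrightarrow>
      f (gen (schur_forms A V) (a, v)) = (\<lambda>(a, v). ev a v) (a, v))"
  proof (rule A.schur_linear_exists[OF alg.vspace])
    show "linear_between (arity_space A (length v)) H (\<lambda>b. (\<lambda>(a, v). ev a v) (b, v))" if "set v \<subseteq> carr V" for v
      using alg.ev_linear[of v "length v"] that V_sub by (simp add: listset_replicate_iff)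
    show "multilinear_between (replicate n V) H (\<lambda>v. (\<lambda>(a, v). ev a v) (b, v))" if "b \<in> ops A n" for n b
      using multilinear_between_map[OF alg.ev_multilinear[OF that] linear_V_H] by simp
    show "(\<lambda>(a, v). ev a v) (act A (length v) \<sigma> b, permute_list \<sigma> v) = (\<lambda>(a, v). ev a v) (b, v)"
      if "b \<in> ops A (length v)" "set v \<subseteq> carr V" "\<sigma> permutes {..<length v}" for b v \<sigma>
      using alg.ev_equivariant[OF that(1) _ that(3)] that(2) V_sub by (simp add: listset_replicate_iff)
  qed
  then show ?thesis by simp
qed

definition free_map where
  "free_map = (SOME f. linear_between (schur A V) H f \<and>
    (\<forall>a v. a \<in> ops A (length v) \<longrightarrow> set v \<subseteq> carr V \<longrightarrow> f (gen (schur_forms A V) (a, v)) = ev a v))"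

lemma free_map_linear: "linear_between (schur A V) H free_map"
  and free_map_gen: "a \<in> ops A (length v) \<Longrightarrow> set v \<subseteq> carr V \<Longrightarrow> free_map (gen (schur_forms A V) (a, v)) = ev a v"
  using someI_ex[OF free_map_exists] unfolding free_map_def by auto

lemma free_map_unit: "p \<in> carr V \<Longrightarrow> free_map (gen (schur_forms A V) (unit A, [p])) = p"
  using free_map_gen[of "unit A" "[p]"] A.unit_closed alg.ev_unit[of p] V_sub by auto

lemma theta_dual_expand:
  assumes Q: "linear_between (arity_space A n) W Q" and W: "is_vspace W" and a: "a \<in> ops A n"
  shows "Q a = (\<Sum>b\<in>basis_of C n. scl W (\<phi> n a b) (Q (\<theta> n (dual_basis_of C n b))))"
  using C.linear_on_dual_basis[OF linear_between_compose[OF theta_linear Q] W phi_in[OF a]] theta_phi[OF a] by simp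

text \<open>For each \<sigma> the sum over b rebuilds the translate of a by \<sigma>, and q takes
  the same value at all translates of (a, v).\<close>

lemma symmetrised_pairing:
  assumes q: "q \<in> schur_forms A V" and a: "a \<in> ops A n" and v: "length v = n" "set v \<subseteq> carr V"
  shows "(\<Sum>b\<in>basis_of C n. \<Sum>\<sigma> | \<sigma> permutes {..<n}.
      act D n \<sigma> (\<phi> n a) b * q (\<theta> n (dual_basis_of C n b), permute_list \<sigma> v)) = fact n * q (a, v)"
proof -
  have "(\<Sum>b\<in>basis_of C n. act D n \<sigma> (\<phi> n a) b * q (\<theta> n (dual_basis_of C n b), permute_list \<sigma> v)) = q (a, v)"
    if \<sigma>: "\<sigma> permutes {..<n}" for \<sigma>
  proof -
    have l: "linear_between (arity_space A n) ground (\<lambda>a. q (a, permute_list \<sigma> v))"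
      using schur_formsD(1)[OF q, of "permute_list \<sigma> v"] v \<sigma> by simp
    from theta_dual_expand[OF l is_vspace_ground A.act_closed[OF \<sigma> a]] schur_formsD(3)[OF q, of a v \<sigma>] a v \<sigma>
    show ?thesis by (simp add: phi_act[OF \<sigma> a])
  qed
  then show ?thesis
    by (subst sum.swap) (simp add: card_permutations[of "{..<n}" n])
qed

lemma projection_exists:
  "\<exists>\<pi>. linear_between H V \<pi> \<and> (\<forall>v\<in>carr V. \<pi> v = v)"
  by (rule adapted_basis_exists[OF alg.vspace is_vspace_V V_sub scl_V]) blast

definition bounded_symbols where
  "bounded_symbols N = {x \<in> schur_symbols A V. length (snd x) < N}"

lemma bounded_sub: "carr (presented_space (bounded_symbols N) (schur_forms A V)) \<subseteq> carr (schur A V)"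
  unfolding schur_def carr_presented by (rule fun_space.span_mono) (auto simp: bounded_symbols_def)

lemma bounded_exists:
  assumes "t \<in> carr (schur A V)"
  shows "\<exists>N. t \<in> carr (presented_space (bounded_symbols N) (schur_forms A V))"
  using assms unfolding schur_def
proof (induction rule: presented_induct)
  case zero
  show ?case using is_vspace_zero[OF is_vspace_presented_space] by blast
next
  case (step c x u)
  then obtain N where N: "u \<in> carr (presented_space (bounded_symbols N) (schur_forms A V))" by blast
  let ?M = "max N (Suc (length (snd x)))"
  have "u \<in> carr (presented_space (bounded_symbols ?M) (schur_forms A V))"
  proof -
    have "gen (schur_forms A V) ` bounded_symbols N \<subseteq> gen (schur_forms A V) ` bounded_symbols ?M"
      by (intro image_mono) (auto simp: bounded_symbols_def)
    from fun_space.span_mono[OF this] N show ?thesis unfolding carr_presented by blast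
  qed
  moreover have "gen (schur_forms A V) x \<in> carr (presented_space (bounded_symbols ?M) (schur_forms A V))"
    using step.hyps(1) by (intro gen_in_carr) (simp add: bounded_symbols_def)
  ultimately have "fun_scale c (gen (schur_forms A V) x) + u \<in> carr (presented_space (bounded_symbols ?M) (schur_forms A V))"
    using is_vspace_add[OF is_vspace_presented_space] is_vspace_scale[OF is_vspace_presented_space] by (metis scl_presented)
  then show ?case by blast
qed

lemma free_map_kernel:
  assumes "t \<in> carr (schur A V)" "free_map t = 0"
  shows "t = 0"
proof -
  let ?Q = "schur_forms A V"
  obtain \<pi> where \<pi>: "linear_between H V \<pi>" "\<And>v. v \<in> carr V \<Longrightarrow> \<pi> v = v" using projection_exists by blast
  have main: "t = 0" if "t \<in> carr (presented_space (bounded_symbols N) ?Q)" "free_map t = 0" for N t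
    using that
  proof (induction N arbitrary: t)
    case 0
    have "bounded_symbols 0 = {}" by (auto simp: bounded_symbols_def)
    then show ?case using 0(1) by (simp add: carr_presented)
  next
    case (Suc N)
    let ?top = "{x \<in> schur_symbols A V. length (snd x) = N}"
    have "\<exists>t1 t2. t = t1 + t2 \<and> t1 \<in> carr (presented_space ?top ?Q) \<and> t2 \<in> carr (presented_space (bounded_symbols N) ?Q)"
    proof -
      have "bounded_symbols (Suc N) = ?top \<union> bounded_symbols N" by (auto simp: bounded_symbols_def)
      then show ?thesis using Suc.prems(1) by (auto simp: carr_presented image_Un fun_space.span_Un)
    qed
    then obtain t1 t2 where t: "t = t1 + t2" "t1 \<in> carr (presented_space ?top ?Q)"
      "t2 \<in> carr (presented_space (bounded_symbols N) ?Q)" by blast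
    have topsub: "carr (presented_space ?top ?Q) \<subseteq> carr (schur A V)"
      unfolding schur_def carr_presented by (rule fun_space.span_mono) auto
    have f1: "linear_between (presented_space ?top ?Q) H free_map"
      and f2: "linear_between (presented_space (bounded_symbols N) ?Q) H free_map"
      using free_map_linear topsub bounded_sub[of N] by (auto simp: linear_between_def subset_iff)
    \<comment> \<open>Shorter words are killed in arity N, so cooperations of arity N see only the
      part t1 of exact length N.\<close>
    have c2: "cop N \<delta> (free_map t2) = 0" if \<delta>: "\<delta> \<in> ops C N" for \<delta>
    proof -
      have "cop N \<delta> (free_map t2) = (\<lambda>_. 0) t2"
      proof (rule presented_linear_eqI[OF linear_between_compose[OF f2 coalg.cop_linear[OF \<delta>]] _ _ t(3)])
        show "linear_between (presented_space (bounded_symbols N) ?Q) (tensor_power H N) (\<lambda>_. 0)"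
          by (rule linear_between_const_zero[OF is_vspace_tensor_power])
        show "cop N \<delta> (free_map (gen ?Q x)) = 0" if "x \<in> bounded_symbols N" for x
          using that cop_ev_zero[OF \<delta>] free_map_gen by (cases x) (auto simp: bounded_symbols_def)
      qed
      then show ?thesis by simp
    qed
    have c1: "cop N \<delta> (free_map t1) = 0" if \<delta>: "\<delta> \<in> ops C N" for \<delta>
    proof -
      have m: "t1 \<in> carr (schur A V)" "t2 \<in> carr (schur A V)" using t topsub bounded_sub[of N] by auto
      note lin = linear_between_compose[OF free_map_linear coalg.cop_linear[OF \<delta>]]
      have "cop N \<delta> (free_map t) = cop N \<delta> (free_map t1) + cop N \<delta> (free_map t2)"
        unfolding t(1) by (rule linear_betweenD(2)[OF lin m])
      then show ?thesis
        using Suc.prems(2) c2[OF \<delta>] linear_between_zero[OF coalg.cop_linear[OF \<delta>] alg.vspace] by simp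
    qed
    have "t1 q = 0" if q: "q \<in> ?Q" for q
    proof -
      \<comment> \<open>q only knows words in V; composing with \<pi> extends it to tensors over H
        without changing it on primitive letters.\<close>
      let ?r = "\<lambda>b ys. q (\<theta> N (dual_basis_of C N b), map \<pi> ys)"
      have r: "?r b \<in> tensor_forms H N" for b
        using multilinear_between_map[OF schur_formsD(2)[OF q theta_in[OF C.dual_basis_in_dual]] \<pi>(1)]
        by (simp add: tensor_forms_def)
      \<comment> \<open>All terms on the left vanish by \<open>c1\<close>, so characteristic 0
        forces t1 q = 0.\<close>
      have "(\<Sum>b\<in>basis_of C N. cop N b (free_map t1) (?r b)) = fact N * t1 q"
      proof (rule presented_linear_eqI[OF _ _ _ t(2), where W = ground])
        have "linear_between (presented_space ?top ?Q) ground (\<lambda>t. cop N b (free_map t) (?r b))" if "b \<in> basis_of C N" for b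
          using linear_between_compose[OF linear_between_compose[OF f1 coalg.cop_linear[OF C.basis_in_ops[OF that]]],
            of ground "\<lambda>s. s (?r b)"] linear_between_apply unfolding tensor_power_def by blast
        then show "linear_between (presented_space ?top ?Q) ground (\<lambda>t. \<Sum>b\<in>basis_of C N. cop N b (free_map t) (?r b))"
          by (rule linear_between_ground_sum)
        show "linear_between (presented_space ?top ?Q) ground (\<lambda>t. fact N * t q)"
          by (simp add: linear_between_ground_iff fun_scale_def algebra_simps)
        fix x assume "x \<in> ?top"
        then obtain a v where x: "x = (a, v)" "a \<in> ops A N" "length v = N" "set v \<subseteq> carr V" by (cases x) auto
        have \<pi>v: "map \<pi> (permute_list \<sigma> v) = permute_list \<sigma> v" if "\<sigma> permutes {..<N}" for \<sigma>
          using \<pi>(2) x(3,4) that by (intro map_idI) (auto simp: subset_iff)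
        have "(\<Sum>b\<in>basis_of C N. cop N b (free_map (gen ?Q x)) (?r b)) =
          (\<Sum>b\<in>basis_of C N. \<Sum>\<sigma> | \<sigma> permutes {..<N}.
            act D N \<sigma> (\<phi> N a) b * q (\<theta> N (dual_basis_of C N b), permute_list \<sigma> v))"
          using x free_map_gen[of a v] cop_ev_top[OF C.basis_in_ops x(2-4)] r \<pi>v
          by (intro sum.cong) (simp_all add: sum_fun_apply fun_scale_def gen_def[of "tensor_forms _ _"])
        also have "\<dots> = fact N * gen ?Q x q"
          using symmetrised_pairing[OF q x(2-4)] q x(1) by (simp add: gen_def)
        finally show "(\<Sum>b\<in>basis_of C N. cop N b (free_map (gen ?Q x)) (?r b)) = fact N * gen ?Q x q" .
      qed
      then show ?thesis using c1 C.basis_in_ops by simp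
    qed
    moreover have "t1 q = 0" if "q \<notin> ?Q" for q using presented_outside[OF t(2) that] .
    ultimately have "t1 = 0" by (intro ext) (metis zero_fun_apply)
    then have "t = t2" using t(1) by simp
    then show "t = 0" using Suc.IH t(3) Suc.prems(2) by blast
  qed
  obtain N where "t \<in> carr (presented_space (bounded_symbols N) ?Q)" using bounded_exists[OF assms(1)] by blast
  then show ?thesis using main assms(2) by blast
qed

text \<open>All slots of a tensor except the i-th are contracted with the given functionals. This
  turns a component of \<delta>(x) into an element of H whose primitivity can be tested.\<close>

lemma contraction_exists:
  assumes Ls: "length Ls = n" "\<And>j. j < n \<Longrightarrow> linear_between H ground (Ls ! j)" and i: "i < n"
  shows "\<exists>\<kappa>. linear_between (tensor_power H n) H \<kappa> \<and>
    (\<forall>l t. linear_between H ground l \<longrightarrow> t \<in> carr (tensor_power H n) \<longrightarrow> l (\<kappa> t) = t (linear_product (Ls[i := l])))"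
proof -
  let ?F = "\<lambda>xs. scl H (linear_product (Ls[i := \<lambda>_. 1]) xs) (xs ! i)"
  have form: "linear_product (Ls[i := l]) \<in> tensor_forms H n" if "linear_between H ground l" for l
    using Ls i that by (intro linear_product_form) (auto simp: nth_list_update)
  have val: "l (?F xs) = linear_product (Ls[i := l]) xs"
    if "linear_between H ground l" "length xs = n" "set xs \<subseteq> carr H" for l xs
    using linear_betweenD(3)[OF that(1), of "xs ! i"] that(2,3) i Ls(1) linear_product_split[of i xs "Ls[i := l]"]
    by (simp add: subset_iff mult.commute)
  have "\<exists>\<kappa>. linear_between (presented_space (listset (replicate n (carr H))) (tensor_forms H n)) H \<kappa> \<and>
      (\<forall>xs\<in>listset (replicate n (carr H)). \<kappa> (pure H n xs) = ?F xs)"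
  proof (rule presented_linear_exists[OF alg.vspace])
    show "?F xs \<in> carr H" if "xs \<in> listset (replicate n (carr H))" for xs
      using that i is_vspace_scale[OF alg.vspace] by (auto simp: listset_replicate_iff subset_iff)
    show "(\<lambda>xs. l (?F xs)) \<in> tensor_forms H n" if "linear_between H ground l" for l
      using form_space_cong[OF form_space_tensor[OF alg.vspace], of n "\<lambda>xs. l (?F xs)" "linear_product (Ls[i := l])"]
        val[OF that] form[OF that] by (simp add: listset_replicate_iff)
  qed
  then obtain \<kappa> where \<kappa>: "linear_between (tensor_power H n) H \<kappa>"
    "\<And>xs. xs \<in> listset (replicate n (carr H)) \<Longrightarrow> \<kappa> (pure H n xs) = ?F xs" by (auto simp: tensor_power_def)
  have "l (\<kappa> t) = t (linear_product (Ls[i := l]))"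
    if l: "linear_between H ground l" and t: "t \<in> carr (tensor_power H n)" for l t
  proof (rule tensor_linear_eqI[OF linear_between_compose[OF \<kappa>(1) l] _ _ t])
    show "linear_between (tensor_power H n) ground (\<lambda>t. t (linear_product (Ls[i := l])))"
      unfolding tensor_power_def by (rule linear_between_apply)
    show "l (\<kappa> (pure H n xs)) = pure H n xs (linear_product (Ls[i := l]))" if "length xs = n" "set xs \<subseteq> carr H" for xs
      using \<kappa>(2)[of xs] val[OF l that] form[OF l] that by (simp add: listset_replicate_iff gen_def)
  qed
  with \<kappa>(1) show ?thesis by blast
qed

text \<open>Composing \<open>\<delta>\<close> in its i-th slot with an operation \<open>\<delta>'\<close> of arity p > 1 gives an operation of
  arity larger than n, which kills x.\<close>

lemma cop_slot_vanishes:
  assumes x: "x \<in> filtration C H cop n" and \<delta>: "\<delta> \<in> ops C n"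
    and Ls: "length Ls = n" "\<And>j. j < n \<Longrightarrow> linear_between H ground (Ls ! j)" and i: "i < n"
    and p: "1 < p" "\<delta>' \<in> ops C p" "l \<in> tensor_forms H p"
  shows "cop n \<delta> x (linear_product (Ls[i := \<lambda>y. cop p \<delta>' y l])) = 0"
proof -
  let ?t = "cop n \<delta> x" and ?L = "Ls[i := \<lambda>y. cop p \<delta>' y l]"
  \<comment> \<open>The identity sits in every slot but the i-th; the resulting arity n - 1 + p
    exceeds n because p > 1.\<close>
  let ?ls = "(replicate n 1)[i := p]" and ?\<delta>s = "(replicate n (unit C))[i := \<delta>']"
  let ?Gs = "(map (\<lambda>l ys. l (hd ys)) Ls)[i := l]"
  let ?Ss = "map (\<lambda>l. (listset (replicate l (carr H)), tensor_forms H l)) ?ls"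
  have xH: "x \<in> carr H" using x by (simp add: filtration_def)
  have t: "?t \<in> carr (tensor_power H n)" by (rule cop_in[OF \<delta> xH])
  have ls: "length ?ls = n" "sum_list ?ls = n - 1 + p"
    using i by (simp_all add: sum_list_update sum_list_replicate)
  have \<delta>s: "?\<delta>s \<in> listset (map (ops C) ?ls)"
    using p(2) C.unit_closed i by (auto simp: listset_iff_nth nth_list_update)
  have "gam C ?ls \<delta> ?\<delta>s \<in> ops C (n - 1 + p)" using C.gam_closed[OF _ \<delta>s] \<delta> ls by simp
  then have "cop (n - 1 + p) (gam C ?ls \<delta> ?\<delta>s) x = 0"
    using x i p(1) by (simp add: filtration_def)
  then have zero: "cop_tensor cop H ?ls ?\<delta>s ?t = 0"
    using coalg.cop_gam[of \<delta> ?ls ?\<delta>s x] \<delta> \<delta>s xH ls by simp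
  \<comment> \<open>The product form on words of length n - 1 + p: the word is cut into the blocks
    of \<open>?ls\<close>, l is applied to block i, and the functional of each other slot to its
    single letter.\<close>
  define R where "R ys = prod_list (map (\<lambda>j. (?Gs ! j) (split_blocks ?ls ys ! j)) [0..<n])" for ys
  have hdf: "(\<lambda>ys. f (hd ys)) \<in> tensor_forms H 1" if "linear_between H ground f" for f
    using that by (simp add: tensor_forms_def multilinear_between_Cons)
  have G: "?Gs ! j \<in> tensor_forms H (?ls ! j)" if "j < n" for j
    using that i p(3) hdf[OF Ls(2)[OF that]] Ls(1) by (simp add: nth_list_update)
  have R: "R \<in> tensor_forms H (sum_list ?ls)"
    unfolding R_def[abs_def] tensor_forms_def
    using multilinear_blocks[OF multilinear_prod_list[of n] ls(1), of H "\<lambda>j. ?Gs ! j"] G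
    by (simp add: tensor_forms_def)
  have fs: "form_spaces ?Ss" using form_space_tensor[OF alg.vspace] by auto
  have inner: "mev (map (\<lambda>(l, \<delta>, x). cop l \<delta> x) (zip ?ls (zip ?\<delta>s xs)))
      (\<lambda>yss. pure H (sum_list ?ls) (concat yss) R) = linear_product ?L xs"
    if xs: "length xs = n" "set xs \<subseteq> carr H" for xs
  proof -
    let ?ts = "map (\<lambda>(l, \<delta>, x). cop l \<delta> x) (zip ?ls (zip ?\<delta>s xs))"
    have ts_nth: "?ts ! j = cop (?ls ! j) (?\<delta>s ! j) (xs ! j)" if "j < n" for j using that xs(1) by simp
    have ts_in: "?ts ! j \<in> carr (tensor_power H (?ls ! j))" if "j < n" for j
      using ts_nth[OF that] cop_in[of "?\<delta>s ! j" "?ls ! j" "xs ! j"] \<delta>s xs that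
      by (simp add: listset_iff_nth subset_iff)
    have ts: "?ts \<in> listset (map (\<lambda>S. carr (pspace S)) ?Ss)"
      using ts_in xs(1) by (simp add: listset_iff_nth tensor_power_def)
    have "mev ?ts (\<lambda>yss. pure H (sum_list ?ls) (concat yss) R) =
        mev ?ts (\<lambda>yss. 1 * prod_list (map2 (\<lambda>g x. g x) ?Gs yss))"
    proof (rule mev_cong[OF fs ts])
      fix yss assume "yss \<in> listset (map fst ?Ss)"
      then have yl: "length yss = n" "\<And>j. j < n \<Longrightarrow> length (yss ! j) = ?ls ! j"
        by (auto simp: listset_iff_nth listset_replicate_iff)
      then have "map length yss = ?ls" by (intro nth_equalityI) auto
      then have "split_blocks ?ls (concat yss) = yss" by (rule split_blocks_concat)
      then have "R (concat yss) = prod_list (map2 (\<lambda>g x. g x) ?Gs yss)"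
        unfolding R_def using yl(1) Ls(1) by (intro arg_cong[where f = prod_list] nth_equalityI) simp_all
      then show "pure H (sum_list ?ls) (concat yss) R = 1 * prod_list (map2 (\<lambda>g x. g x) ?Gs yss)"
        using R by (simp add: gen_def)
    qed
    also have "\<dots> = 1 * prod_list (map2 (\<lambda>t g. t g) ?ts ?Gs)"
    proof (rule mev_prod)
      show "list_all2 (\<lambda>t S. form_space (fst S) (snd S) \<and> t \<in> carr (pspace S)) ?ts ?Ss"
        using ts_in xs(1) form_space_tensor[OF alg.vspace]
        by (simp add: list_all2_conv_all_nth tensor_power_def)
      show "list_all2 (\<lambda>g S. g \<in> snd S) ?Gs ?Ss"
        using G Ls(1) by (simp add: list_all2_conv_all_nth)
    qed
    also have "map2 (\<lambda>t g. t g) ?ts ?Gs = map2 (\<lambda>x l. l x) xs ?L"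
    proof (rule nth_equalityI)
      fix j assume "j < length (map2 (\<lambda>t g. t g) ?ts ?Gs)"
      then have j: "j < n" using xs(1) Ls(1) by simp
      have xj: "xs ! j \<in> carr H" using xs j by auto
      have "cop 1 (unit C) (xs ! j) (\<lambda>ys. (Ls ! j) (hd ys)) = (Ls ! j) (xs ! j)"
        using coalg.cop_unit[OF xj] hdf[OF Ls(2)[OF j]] by (simp add: gen_def)
      then have "(?ts ! j) (?Gs ! j) = (?L ! j) (xs ! j)"
        unfolding ts_nth[OF j] using j Ls(1) by (cases "j = i") simp_all
      then show "map2 (\<lambda>t g. t g) ?ts ?Gs ! j = map2 (\<lambda>x l. l x) xs ?L ! j"
        using j xs(1) Ls(1) by simp
    qed (use xs(1) Ls(1) in simp)
    finally show ?thesis by (simp add: linear_product_def)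
  qed
  have "cop_tensor cop H ?ls ?\<delta>s ?t R = ?t (linear_product ?L)"
    unfolding cop_tensor_def lin_ext_def multi_ext_apply
    by (rule presented_cong[OF t[unfolded tensor_power_def] form_space_tensor[OF alg.vspace]])
      (use inner in \<open>simp add: listset_replicate_iff\<close>)
  then show ?thesis using zero by simp
qed

text \<open>Contracting the other slots of \<delta>(x) gives an element that every operation of
  arity above 1 kills, by the preceding lemma. It is therefore primitive, and the i-th functional
  vanishes on it.\<close>

lemma cop_coordinate_vanishes:
  assumes x: "x \<in> filtration C H cop n" and \<delta>: "\<delta> \<in> ops C n"
    and Ls: "length Ls = n" "\<And>j. j < n \<Longrightarrow> linear_between H ground (Ls ! j)"
    and i: "i < n" and van: "\<And>v. v \<in> carr V \<Longrightarrow> (Ls ! i) v = 0"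
  shows "cop n \<delta> x (linear_product Ls) = 0"
proof -
  let ?t = "cop n \<delta> x"
  have t: "?t \<in> carr (tensor_power H n)" using cop_in[OF \<delta>] x by (simp add: filtration_def)
  obtain \<kappa> where \<kappa>: "linear_between (tensor_power H n) H \<kappa>"
    "\<And>l t. linear_between H ground l \<Longrightarrow> t \<in> carr (tensor_power H n) \<Longrightarrow> l (\<kappa> t) = t (linear_product (Ls[i := l]))"
    using contraction_exists[OF Ls i] by blast
  have \<kappa>H: "\<kappa> ?t \<in> carr H" by (rule linear_betweenD(1)[OF \<kappa>(1) t])
  have "cop p \<delta>' (\<kappa> ?t) = 0" if p: "1 < p" "\<delta>' \<in> ops C p" for p \<delta>'
  proof (rule presented_eqI)
    show "cop p \<delta>' (\<kappa> ?t) \<in> carr (presented_space (listset (replicate p (carr H))) (tensor_forms H p))"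
      using cop_in[OF p(2) \<kappa>H] by (simp add: tensor_power_def)
    show "0 \<in> carr (presented_space (listset (replicate p (carr H))) (tensor_forms H p))"
      by (rule is_vspace_zero[OF is_vspace_presented_space])
    fix l assume l: "l \<in> tensor_forms H p"
    have "linear_between H ground (\<lambda>y. cop p \<delta>' y l)"
      by (rule linear_between_compose[OF coalg.cop_linear[OF p(2), unfolded tensor_power_def] linear_between_apply])
    from \<kappa>(2)[OF this t] cop_slot_vanishes[OF x \<delta> Ls i p l]
    show "cop p \<delta>' (\<kappa> ?t) l = 0 l" by simp
  qed
  then have "\<kappa> ?t \<in> carr V" using \<kappa>H by (simp add: carr_V filtration_def)
  then show ?thesis using \<kappa>(2)[OF Ls(2)[OF i] t] van by simp
qed

text \<open>That \<delta>(x) is a tensor of primitives is expressed as invariance under \<pi> in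
  every slot, since the tensor power of V is not literally a subspace of that of H. One projection
  serves all n, \<delta> and x.\<close>

lemma cop_top_primitive:
  "\<exists>\<pi>. linear_between H V \<pi> \<and> (\<forall>v\<in>carr V. \<pi> v = v) \<and>
    (\<forall>n \<delta> x. \<delta> \<in> ops C n \<longrightarrow> x \<in> filtration C H cop n \<longrightarrow> tensor_map H n \<pi> (cop n \<delta> x) = cop n \<delta> x)"
proof -
  obtain B B' coord \<pi> where B: "B' \<subseteq> B" "B \<subseteq> carr H" "carr H = module.span (scl H) B"
    and cl: "\<And>b. linear_between H ground (coord b)"
    and cb: "\<And>b b'. b \<in> B \<Longrightarrow> coord b' b = (if b = b' then 1 else 0)"
    and \<pi>: "linear_between H V \<pi>" "\<And>v. v \<in> carr V \<Longrightarrow> \<pi> v = v"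
    and cV: "\<And>b v. b \<in> B - B' \<Longrightarrow> v \<in> carr V \<Longrightarrow> coord b v = 0"
    and c\<pi>: "\<And>b x. b \<in> B' \<Longrightarrow> x \<in> carr H \<Longrightarrow> coord b (\<pi> x) = coord b x"
    by (rule adapted_basis_exists[OF alg.vspace is_vspace_V V_sub scl_V]) blast
  have \<pi>H: "linear_between H H \<pi>" using \<pi>(1) linear_between_compose[OF \<pi>(1) linear_V_H] by simp
  have "tensor_map H n \<pi> (cop n \<delta> x) = cop n \<delta> x" if \<delta>: "\<delta> \<in> ops C n" and x: "x \<in> filtration C H cop n" for n \<delta> x
  proof (rule tensor_eqI_coords[OF alg.vspace B(2,3) cl cb])
    let ?t = "cop n \<delta> x"
    show t: "?t \<in> carr (tensor_power H n)" using cop_in[OF \<delta>] x by (simp add: filtration_def)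
    show "tensor_map H n \<pi> ?t \<in> carr (tensor_power H n)"
      by (rule linear_betweenD(1)[OF tensor_map_linear(1)[OF alg.vspace alg.vspace \<pi>H] t])
    fix e assume e: "length e = n" "set e \<subseteq> B"
    let ?c = "linear_product (map coord e)"
    have cf: "?c \<in> tensor_forms H n" using e(1) cl by (intro linear_product_form) auto
    have "tensor_map H n \<pi> ?t ?c = ?t (\<lambda>xs. ?c (map \<pi> xs))"
      using cf by (simp add: tensor_map_def lin_ext_def gen_def)
    also have "\<dots> = ?t ?c"
    proof (cases "set e \<subseteq> B'")
      case True
      have "?c (map \<pi> xs) = ?c xs" if "length xs = n" "set xs \<subseteq> carr H" for xs
        unfolding linear_product_def using that e(1) True c\<pi>
        by (intro arg_cong[where f = prod_list] nth_equalityI) (simp_all add: subset_iff)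
      then show ?thesis
        by (intro presented_cong[OF t[unfolded tensor_power_def] form_space_tensor[OF alg.vspace]])
          (simp add: listset_replicate_iff)
    next
      \<comment> \<open>A letter outside B' makes both coordinates 0: the projected one because
        \<pi> lands in V, the original one by the preceding lemma.\<close>
      case False
      then obtain i where i: "i < n" "e ! i \<in> B - B'" using e by (auto simp: in_set_conv_nth subset_iff)
      have "?c (map \<pi> xs) = 0" if "length xs = n" "set xs \<subseteq> carr H" for xs
      proof -
        have "coord (e ! i) (\<pi> (xs ! i)) = 0"
          using that i linear_betweenD(1)[OF \<pi>(1)] by (intro cV) (auto simp: subset_iff)
        then show ?thesis using linear_product_split[of i "map \<pi> xs" "map coord e"] that e(1) i(1) by simp
      qed
      then have "?t (\<lambda>xs. ?c (map \<pi> xs)) = ?t (\<lambda>_. 0)"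
        by (intro presented_cong[OF t[unfolded tensor_power_def] form_space_tensor[OF alg.vspace]])
          (simp add: listset_replicate_iff)
      moreover have "?t ?c = 0"
        by (rule cop_coordinate_vanishes[OF x \<delta> _ _ i(1)]) (use e(1) cl i cV in auto)
      ultimately show ?thesis using presented_zero[OF t[unfolded tensor_power_def]] by simp
    qed
    finally show "tensor_map H n \<pi> ?t ?c = ?t ?c" .
  qed
  with \<pi> show ?thesis by blast
qed

end

section \<open>Surjectivity and the two isomorphisms\<close>

context law_bialgebra
begin

lemma filtration_sub: "filtration C H cop n \<subseteq> carr H"
  by (auto simp: filtration_def)

text \<open>The identity operation reproduces x, so an element killed already in arity 1 is 0. This
  starts the induction along the filtration.\<close>

lemma filtration_zero: "x \<in> filtration C H cop 0 \<Longrightarrow> x = 0"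
proof -
  assume x: "x \<in> filtration C H cop 0"
  then have xH: "x \<in> carr H" using filtration_sub by blast
  have "cop 1 (unit C) x = 0" using x C.unit_closed by (simp add: filtration_def)
  then have p: "pure H 1 [x] = 0" using coalg.cop_unit[OF xH] by simp
  have "multilinear_between (replicate 1 H) H hd"
    by (simp add: multilinear_between_Cons linear_between_def)
  from tensor_linear_exists[OF alg.vspace alg.vspace this]
  obtain h where h: "linear_between (tensor_power H 1) H h" "h (pure H 1 [x]) = x" using xH by fastforce
  then show "x = 0" using linear_between_zero[OF h(1) is_vspace_tensor_power] p by simp
qed

lemma free_map_approximates:
  assumes x: "x \<in> filtration C H cop (Suc n)"
  shows "\<exists>y\<in>carr (schur A V). x - free_map y \<in> filtration C H cop n"
proof -
  let ?N = "Suc n" and ?S = "{\<sigma>. \<sigma> permutes {..<Suc n}}"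
  have xH: "x \<in> carr H" using x filtration_sub by blast
  obtain \<pi> where \<pi>: "linear_between H V \<pi>"
    and prim: "\<And>\<delta>. \<delta> \<in> ops C ?N \<Longrightarrow> tensor_map H ?N \<pi> (cop ?N \<delta> x) = cop ?N \<delta> x"
    using cop_top_primitive x by blast
  have \<pi>H: "linear_between H H \<pi>" using linear_between_compose[OF \<pi> linear_V_H] .
  have \<pi>V: "set (map \<pi> ys) \<subseteq> carr V" if "set ys \<subseteq> carr H" for ys
    using linear_betweenD(1)[OF \<pi>] that by auto
  \<comment> \<open>The element of A(V) made from a tensor over H and a dual basis element.
    Replacing the letters by their projections changes nothing for the top cooperations of x, by
    \<open>prim\<close>.\<close>
  define Y where "Y b t = lin_ext t (\<lambda>ys. gen (schur_forms A V) (\<theta> ?N (dual_basis_of C ?N b), map \<pi> ys))" for b t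
  have Yml: "multilinear_between (replicate ?N H) (presented_space (schur_symbols A V) (schur_forms A V))
      (\<lambda>ys. gen (schur_forms A V) (\<theta> ?N (dual_basis_of C ?N b), map \<pi> ys))" for b
    using multilinear_between_map[OF A.gen_schur_multilinear[OF is_vspace_V theta_in[OF C.dual_basis_in_dual]] \<pi>]
    unfolding schur_def .
  have Ylin: "linear_between (tensor_power H ?N) (schur A V) (Y b)" for b
    using lin_ext_tensor(1)[OF alg.vspace Yml[of b]] by (simp add: schur_def Y_def[abs_def])
  have Ypure: "free_map (Y b (pure H ?N ys)) = ev (\<theta> ?N (dual_basis_of C ?N b)) (map \<pi> ys)"
    if ys: "length ys = ?N" "set ys \<subseteq> carr H" for b ys
    using lin_ext_tensor(2)[OF alg.vspace Yml[of b] ys] free_map_gen[OF _ \<pi>V[OF ys(2)]]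
      theta_in[OF C.dual_basis_in_dual] ys(1) by (simp add: Y_def)
  have above: "cop p \<delta> (free_map (Y b t)) = 0"
    if "?N < p" "\<delta> \<in> ops C p" "t \<in> carr (tensor_power H ?N)" for p \<delta> b t
  proof -
    have "cop p \<delta> (free_map (Y b t)) = (\<lambda>_. 0) t"
    proof (rule tensor_linear_eqI[OF _ _ _ that(3)])
      show "linear_between (tensor_power H ?N) (tensor_power H p) (\<lambda>t. cop p \<delta> (free_map (Y b t)))"
        by (rule linear_between_compose[OF linear_between_compose[OF Ylin free_map_linear] coalg.cop_linear[OF that(2)]])
      show "linear_between (tensor_power H ?N) (tensor_power H p) (\<lambda>_. 0)"
        by (rule linear_between_const_zero[OF is_vspace_tensor_power])
      show "cop p \<delta> (free_map (Y b (pure H ?N ys))) = 0" if ys: "length ys = ?N" "set ys \<subseteq> carr H" for ys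
        unfolding Ypure[OF ys]
        by (rule cop_ev_zero[OF \<open>\<delta> \<in> ops C p\<close> _ \<pi>V[OF ys(2)]])
          (use ys(1) \<open>?N < p\<close> theta_in[OF C.dual_basis_in_dual] in simp_all)
    qed
    then show ?thesis by simp
  qed
  have top: "cop ?N \<delta> (free_map (Y b t)) =
      (\<Sum>\<sigma>\<in>?S. fun_scale (act D ?N \<sigma> (dual_basis_of C ?N b) \<delta>) (tensor_permute H ?N \<sigma> (tensor_map H ?N \<pi> t)))"
    if \<delta>: "\<delta> \<in> ops C ?N" and t: "t \<in> carr (tensor_power H ?N)" for \<delta> b t
  proof (rule tensor_linear_eqI[OF _ _ _ t])
    show "linear_between (tensor_power H ?N) (tensor_power H ?N) (\<lambda>t. cop ?N \<delta> (free_map (Y b t)))"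
      by (rule linear_between_compose[OF linear_between_compose[OF Ylin free_map_linear] coalg.cop_linear[OF \<delta>]])
    have "linear_between (tensor_power H ?N) (tensor_power H ?N)
        (\<lambda>t. \<Sum>\<sigma>\<in>?S. scl (tensor_power H ?N) (act D ?N \<sigma> (dual_basis_of C ?N b) \<delta>) (tensor_permute H ?N \<sigma> (tensor_map H ?N \<pi> t)))"
      by (rule linear_between_sum_scale[OF is_vspace_tensor_power],
          rule linear_between_compose[OF tensor_map_linear(1)[OF alg.vspace alg.vspace \<pi>H] tensor_permute_linear(1)[OF alg.vspace]])
        simp
    then show "linear_between (tensor_power H ?N) (tensor_power H ?N)
        (\<lambda>t. \<Sum>\<sigma>\<in>?S. fun_scale (act D ?N \<sigma> (dual_basis_of C ?N b) \<delta>) (tensor_permute H ?N \<sigma> (tensor_map H ?N \<pi> t)))"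
      by simp
    fix ys assume ys: "length ys = ?N" "set ys \<subseteq> carr H"
    have l: "length (map \<pi> ys) = ?N" and sH: "set (map \<pi> ys) \<subseteq> carr H" using ys(1) \<pi>V[OF ys(2)] V_sub by auto
    have "cop ?N \<delta> (free_map (Y b (pure H ?N ys))) = (\<Sum>\<sigma>\<in>?S. fun_scale (act D ?N \<sigma> (dual_basis_of C ?N b) \<delta>)
        (pure H ?N (permute_list \<sigma> (map \<pi> ys))))"
      unfolding Ypure[OF ys] cop_ev_top[OF \<delta> theta_in[OF C.dual_basis_in_dual] l \<pi>V[OF ys(2)]]
      by (simp add: phi_theta[OF C.dual_basis_in_dual])
    also have "\<dots> = (\<Sum>\<sigma>\<in>?S. fun_scale (act D ?N \<sigma> (dual_basis_of C ?N b) \<delta>)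
        (tensor_permute H ?N \<sigma> (tensor_map H ?N \<pi> (pure H ?N ys))))"
    proof (intro sum.cong refl arg_cong[where f = "fun_scale _"])
      fix \<sigma> assume \<sigma>: "\<sigma> \<in> ?S"
      show "pure H ?N (permute_list \<sigma> (map \<pi> ys)) = tensor_permute H ?N \<sigma> (tensor_map H ?N \<pi> (pure H ?N ys))"
        unfolding tensor_map_pure[OF alg.vspace \<pi>H]
        by (rule tensor_permute_linear(2)[OF alg.vspace _ l sH, symmetric]) (use \<sigma> in simp)
    qed
    finally show "cop ?N \<delta> (free_map (Y b (pure H ?N ys))) = \<dots>" .
  qed
  \<comment> \<open>In the top cooperation of the sum over b, every permutation contributes
    \<delta>(x) once, whence the inverse factorial.\<close>
  define y where "y = fun_scale (inverse (fact ?N)) (\<Sum>b\<in>basis_of C ?N. Y b (cop ?N b x))"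
  have tb: "cop ?N b x \<in> carr (tensor_power H ?N)" if "b \<in> basis_of C ?N" for b
    using cop_in[OF C.basis_in_ops[OF that] xH] .
  have Yin: "Y b (cop ?N b x) \<in> carr (schur A V)" if "b \<in> basis_of C ?N" for b
    by (rule linear_betweenD(1)[OF Ylin tb[OF that]])
  have sin: "(\<Sum>b\<in>basis_of C ?N. Y b (cop ?N b x)) \<in> carr (schur A V)"
    by (rule is_vspace_sum[OF is_vspace_schur Yin])
  have y: "y \<in> carr (schur A V)"
    using is_vspace_scale[OF is_vspace_schur sin, of "inverse (fact ?N)"] by (simp add: y_def)
  have copy: "cop p \<delta> (free_map y) = fun_scale (inverse (fact ?N)) (\<Sum>b\<in>basis_of C ?N. cop p \<delta> (free_map (Y b (cop ?N b x))))"
    if "\<delta> \<in> ops C p" for p \<delta>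
  proof -
    note l = linear_between_compose[OF free_map_linear coalg.cop_linear[OF that]]
    show ?thesis
      unfolding y_def using linear_betweenD(3)[OF l sin] linear_between_sum[OF l is_vspace_schur, of "basis_of C ?N" "\<lambda>b. Y b (cop ?N b x)"] Yin
      by simp
  qed
  have eq_top: "cop ?N \<delta> (free_map y) = cop ?N \<delta> x" if \<delta>: "\<delta> \<in> ops C ?N" for \<delta>
  proof -
    \<comment> \<open>The coefficient of b is the b-coordinate of the translate of \<delta> by
      \<open>inv \<sigma>\<close>, so the sum over b rebuilds that translate, and equivariance
      undoes the translation.\<close>
    have inner: "(\<Sum>b\<in>basis_of C ?N. fun_scale (act D ?N \<sigma> (dual_basis_of C ?N b) \<delta>) (tensor_permute H ?N \<sigma> (cop ?N b x))) =
        cop ?N \<delta> x" if \<sigma>: "\<sigma> permutes {..<?N}" for \<sigma>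
    proof -
      let ?a = "act C ?N (inv \<sigma>) \<delta>"
      have a: "?a \<in> ops C ?N" by (rule C.act_closed[OF permutes_inv[OF \<sigma>] \<delta>])
      have "linear_between (arity_space C ?N) (tensor_power H ?N) (\<lambda>c. cop ?N (act C ?N \<sigma> c) x)"
        by (rule linear_between_compose[OF C.act_linear[OF \<sigma>] coalg.cop_linear_op[OF xH]])
      from C.linear_on_basis[OF this a]
      have "cop ?N (act C ?N \<sigma> ?a) x = (\<Sum>b\<in>basis_of C ?N. fun_scale (dual_basis_of C ?N b ?a) (cop ?N (act C ?N \<sigma> b) x))"
        by simp
      then have "cop ?N \<delta> x = (\<Sum>b\<in>basis_of C ?N. fun_scale (dual_basis_of C ?N b ?a) (cop ?N (act C ?N \<sigma> b) x))"
        using C.act_inv(2)[OF \<sigma> \<delta>] by simp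
      also have "\<dots> = (\<Sum>b\<in>basis_of C ?N. fun_scale (act D ?N \<sigma> (dual_basis_of C ?N b) \<delta>) (tensor_permute H ?N \<sigma> (cop ?N b x)))"
        using \<delta> coalg.cop_equivariant[OF C.basis_in_ops xH \<sigma>] by (intro sum.cong) (simp_all add: act_dual)
      finally show ?thesis ..
    qed
    have "(\<Sum>b\<in>basis_of C ?N. cop ?N \<delta> (free_map (Y b (cop ?N b x)))) =
      (\<Sum>b\<in>basis_of C ?N. \<Sum>\<sigma>\<in>?S. fun_scale (act D ?N \<sigma> (dual_basis_of C ?N b) \<delta>) (tensor_permute H ?N \<sigma> (cop ?N b x)))"
      using top[OF \<delta> tb] prim C.basis_in_ops by (intro sum.cong) simp_all
    also have "\<dots> = (\<Sum>\<sigma>\<in>?S. cop ?N \<delta> x)"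
      by (subst sum.swap) (use inner in simp)
    also have "\<dots> = fun_scale (fact ?N) (cop ?N \<delta> x)"
      by (rule ext, simp only: sum_fun_apply)
        (simp add: fun_scale_def card_permutations[of "{..<?N}" ?N] del: fact_Suc)
    finally show ?thesis unfolding copy[OF \<delta>] by (simp del: fact_Suc)
  qed
  have fy: "free_map y \<in> carr H" by (rule linear_betweenD(1)[OF free_map_linear y])
  have "cop p \<delta> (x - free_map y) = 0" if p: "n < p" "\<delta> \<in> ops C p" for p \<delta>
  proof -
    have "cop p \<delta> (x - free_map y) = cop p \<delta> x - cop p \<delta> (free_map y)"
      by (rule linear_between_diff[OF coalg.cop_linear[OF p(2)] alg.vspace xH fy])
    moreover have "cop p \<delta> x = cop p \<delta> (free_map y)"
    proof (cases "p = ?N")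
      case True
      then show ?thesis using eq_top p(2) by simp
    next
      case False
      then have "?N < p" using p(1) by simp
      then have "cop p \<delta> x = 0" "cop p \<delta> (free_map y) = 0"
        using x p(2) above[OF _ p(2) tb] copy[OF p(2)] by (simp_all add: filtration_def fun_scale_def zero_fun_def)
      then show ?thesis by simp
    qed
    ultimately show ?thesis by simp
  qed
  then have "x - free_map y \<in> filtration C H cop n"
    using is_vspace_diff[OF alg.vspace xH fy] by (simp add: filtration_def)
  with y show ?thesis by blast
qed

lemma filtration_in_range: "filtration C H cop n \<subseteq> free_map ` carr (schur A V)"
proof (induction n)
  case 0
  have "free_map 0 = 0" "0 \<in> carr (schur A V)"
    using linear_between_zero[OF free_map_linear is_vspace_schur] is_vspace_zero[OF is_vspace_schur] by auto
  then show ?case using filtration_zero by force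
next
  case (Suc n)
  show ?case
  proof
    fix x assume x: "x \<in> filtration C H cop (Suc n)"
    then obtain y where y: "y \<in> carr (schur A V)" "x - free_map y \<in> filtration C H cop n"
      using free_map_approximates by blast
    then obtain w where w: "w \<in> carr (schur A V)" "x - free_map y = free_map w" using Suc by blast
    have "x = free_map (w + y)"
      using linear_betweenD(2)[OF free_map_linear w(1) y(1)] w(2) by (simp add: algebra_simps)
    then show "x \<in> free_map ` carr (schur A V)" using is_vspace_add[OF is_vspace_schur w(1) y(1)] by blast
  qed
qed

lemma free_map_bij: "bij_betw free_map (carr (schur A V)) (carr H)"
  unfolding bij_betw_def
proof
  show "inj_on free_map (carr (schur A V))"
  proof (rule inj_onI)
    fix s t assume s: "s \<in> carr (schur A V)" and t: "t \<in> carr (schur A V)" and eq: "free_map s = free_map t"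
    have "free_map (s - t) = 0" using linear_between_diff[OF free_map_linear is_vspace_schur s t] eq by simp
    then have "s - t = 0" using free_map_kernel is_vspace_diff[OF is_vspace_schur s t] by blast
    then show "s = t" by simp
  qed
  show "free_map ` carr (schur A V) = carr H"
    using filtration_in_range conil linear_betweenD(1)[OF free_map_linear] unfolding conilpotent_def by blast
qed

text \<open>Both sides are multilinear, so generators suffice; there the claim is the composition
  axiom of the algebra H.\<close>

theorem free_map_algebra_iso: "algebra_iso A (schur A V) (free_ev A V) H ev free_map"
  unfolding algebra_iso_def
proof (intro conjI free_map_linear free_map_bij allI ballI)
  fix n a xs assume a: "a \<in> ops A n" and xs: "xs \<in> listset (replicate n (carr (schur A V)))"
  show "free_map (free_ev A V a xs) = ev a (map free_map xs)"
  proof (rule multilinear_presented_eqI[OF alg.vspace _ _ _ xs[unfolded schur_def]])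
    show "multilinear_between (replicate n (presented_space (schur_symbols A V) (schur_forms A V))) H
        (\<lambda>xs. free_map (free_ev A V a xs))"
      using multilinear_between_compose[OF A.free_ev_multilinear[OF is_vspace_V a] free_map_linear]
      by (simp add: schur_def)
    show "multilinear_between (replicate n (presented_space (schur_symbols A V) (schur_forms A V))) H
        (\<lambda>xs. ev a (map free_map xs))"
      using multilinear_between_map[OF alg.ev_multilinear[OF a] free_map_linear] by (simp add: schur_def)
    fix ps assume ps: "ps \<in> listset (replicate n (schur_symbols A V))"
    then have n: "length ps = n" and sym: "\<And>b v. (b, v) \<in> set ps \<Longrightarrow> b \<in> ops A (length v) \<and> set v \<subseteq> carr V"
      by (auto simp: listset_replicate_iff subset_iff schur_symbols_def)
    have bs: "map fst ps \<in> listset (map (\<lambda>v. ops A (length v)) (map snd ps))"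
      using sym by (auto simp: listset_iff_nth)
    have vs: "set (concat (map snd ps)) \<subseteq> carr V" using sym by fastforce
    have "gam A (map (length \<circ> snd) ps) a (map fst ps) \<in> ops A (length (concat (map snd ps)))"
      using A.gam_closed[of a "map (length \<circ> snd) ps" "map fst ps"] a n bs by (simp add: length_concat comp_def)
    then have "free_map (free_ev A V a (map (gen (schur_forms A V)) ps)) =
        ev (gam A (map length (map snd ps)) a (map fst ps)) (concat (map snd ps))"
      unfolding A.free_ev_gen[OF is_vspace_V a ps] using free_map_gen[OF _ vs] by simp
    also have "\<dots> = ev a (map2 ev (map fst ps) (map snd ps))"
      using alg.ev_gam[of a "map snd ps" "map fst ps"] a n bs vs V_sub by auto
    also have "map2 ev (map fst ps) (map snd ps) = map free_map (map (gen (schur_forms A V)) ps)"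
    proof (rule nth_equalityI)
      fix i assume "i < length (map2 ev (map fst ps) (map snd ps))"
      then have i: "i < length ps" by simp
      have "(fst (ps ! i), snd (ps ! i)) \<in> set ps" using i by simp
      from sym[OF this] free_map_gen[of "fst (ps ! i)" "snd (ps ! i)"]
      show "map2 ev (map fst ps) (map snd ps) ! i = map free_map (map (gen (schur_forms A V)) ps) ! i"
        using i by (simp add: case_prod_beta')
    qed simp
    finally show "free_map (free_ev A V a (map (gen (schur_forms A V)) ps)) =
        ev a (map free_map (map (gen (schur_forms A V)) ps))" .
  qed
qed

definition cofree_map where
  "cofree_map x = schur_map D V \<phi> (inv_into (carr (schur A V)) free_map x)"

lemma cofree_map_free_map: "t \<in> carr (schur A V) \<Longrightarrow> cofree_map (free_map t) = schur_map D V \<phi> t"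
  using bij_betw_inv_into_left[OF free_map_bij] by (simp add: cofree_map_def)

lemma cofree_map_linear: "linear_between H (schur D V) cofree_map"
  unfolding cofree_map_def[abs_def]
  by (rule linear_between_compose[OF linear_between_inv_into[OF free_map_linear free_map_bij is_vspace_schur]
        schur_map_phi(1)[OF is_vspace_V]])

lemma schur_map_bij: "bij_betw (schur_map D V \<phi>) (carr (schur A V)) (carr (schur D V))"
proof (rule bij_betw_byWitness[where f' = "schur_map A V \<theta>"])
  note p = schur_map_phi[OF is_vspace_V] and t = schur_map_theta[OF is_vspace_V]
  show "\<forall>x\<in>carr (schur A V). schur_map A V \<theta> (schur_map D V \<phi> x) = x"
  proof
    fix x assume x: "x \<in> carr (schur A V)"
    show "schur_map A V \<theta> (schur_map D V \<phi> x) = x"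
      by (rule A.schur_linear_eqI[OF linear_between_compose[OF p(1) t(1)] _ _ x])
        (simp_all add: linear_between_def p(2) t(2) phi_in theta_phi)
  qed
  show "\<forall>x\<in>carr (schur D V). schur_map D V \<phi> (schur_map A V \<theta> x) = x"
  proof
    fix x assume x: "x \<in> carr (schur D V)"
    show "schur_map D V \<phi> (schur_map A V \<theta> x) = x"
      by (rule C.dual.schur_linear_eqI[OF linear_between_compose[OF t(1) p(1)] _ _ x])
        (simp_all add: linear_between_def p(2) t(2) theta_in phi_theta)
  qed
qed (use linear_betweenD(1)[OF schur_map_phi(1)[OF is_vspace_V]] linear_betweenD(1)[OF schur_map_theta(1)[OF is_vspace_V]] in auto)

text \<open>Precomposed with \<open>free_map\<close>, both sides are linear on A(V), so generators
  suffice. There both coproducts are instances of \<open>law_sum\<close>, and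
  \<open>cofree_map\<close> matches their blocks.\<close>

theorem cofree_map_coalgebra_iso: "coalgebra_iso C H cop (schur D V) (cofree_cop C V) cofree_map"
  unfolding coalgebra_iso_def
proof (intro conjI cofree_map_linear allI ballI)
  show "bij_betw cofree_map (carr H) (carr (schur D V))"
    using bij_betw_trans[OF bij_betw_inv_into[OF free_map_bij] schur_map_bij]
    by (simp add: cofree_map_def[abs_def] comp_def)
  fix k \<delta> x assume \<delta>: "\<delta> \<in> ops C k" and "x \<in> carr H"
  then obtain t where t: "t \<in> carr (schur A V)" "x = free_map t"
    using bij_betw_imp_surj_on[OF free_map_bij] by blast
  have "cofree_cop C V k \<delta> (schur_map D V \<phi> t) = tensor_map (schur D V) k cofree_map (cop k \<delta> (free_map t))"
  proof (rule A.schur_linear_eqI[OF _ _ _ t(1)])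
    show "linear_between (schur A V) (tensor_power (schur D V) k) (\<lambda>t. cofree_cop C V k \<delta> (schur_map D V \<phi> t))"
      by (rule linear_between_compose[OF schur_map_phi(1)[OF is_vspace_V] C.cofree_cop_linear[OF is_vspace_V \<delta>]])
    show "linear_between (schur A V) (tensor_power (schur D V) k)
        (\<lambda>t. tensor_map (schur D V) k cofree_map (cop k \<delta> (free_map t)))"
      by (rule linear_between_compose[OF linear_between_compose[OF free_map_linear coalg.cop_linear[OF \<delta>]]
            tensor_map_linear(1)[OF alg.vspace is_vspace_schur cofree_map_linear]])
    fix a v assume a: "a \<in> ops A (length v)" and v: "set v \<subseteq> carr V"
    have "cofree_cop C V k \<delta> (schur_map D V \<phi> (gen (schur_forms A V) (a, v))) =
        law_sum (schur D V) (\<lambda>l b u. gen (schur_forms D V) (dual_basis_of C l b, u)) k \<delta> (\<phi> (length v) a) v"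
      using schur_map_phi(2)[OF is_vspace_V a v] C.cofree_cop_gen[OF is_vspace_V \<delta> phi_in[OF a] v]
      by (simp add: cofree_sum_eq)
    also have "\<dots> = law_sum (schur D V) (\<lambda>l b u. cofree_map (ev (\<theta> l (dual_basis_of C l b)) u)) k \<delta> (\<phi> (length v) a) v"
    proof (rule law_sum_cong)
      fix b :: 'a and u :: "'h list" assume u: "set u \<subseteq> set v"
      let ?f = "dual_basis_of C (length u) b"
      note f = theta_in[OF C.dual_basis_in_dual, of "length u" b]
      have u: "set u \<subseteq> carr V" using u v by blast
      have "cofree_map (ev (\<theta> (length u) ?f) u) = schur_map D V \<phi> (gen (schur_forms A V) (\<theta> (length u) ?f, u))"
        using cofree_map_free_map[OF gen_in_schur[OF f u]] free_map_gen[OF f u] by simp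
      also have "\<dots> = gen (schur_forms D V) (?f, u)"
        using schur_map_phi(2)[OF is_vspace_V f u] phi_theta[OF C.dual_basis_in_dual] by simp
      finally show "gen (schur_forms D V) (?f, u) = cofree_map (ev (\<theta> (length u) ?f) u)" ..
    qed
    also have "\<dots> = tensor_map (schur D V) k cofree_map
        (law_sum H (\<lambda>l b u. ev (\<theta> l (dual_basis_of C l b)) u) k \<delta> (\<phi> (length v) a) v)"
      by (rule tensor_map_law_sum[OF is_vspace_schur cofree_map_linear, symmetric])
    also have "\<dots> = tensor_map (schur D V) k cofree_map (cop k \<delta> (free_map (gen (schur_forms A V) (a, v))))"
      using cop_ev[OF \<delta> a] v free_map_gen[OF a v] by (simp add: carr_V)
    finally show "cofree_cop C V k \<delta> (schur_map D V \<phi> (gen (schur_forms A V) (a, v))) =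
        tensor_map (schur D V) k cofree_map (cop k \<delta> (free_map (gen (schur_forms A V) (a, v))))" .
  qed
  then show "cofree_cop C V k \<delta> (cofree_map x) = tensor_map (schur D V) k cofree_map (cop k \<delta> x)"
    using cofree_map_free_map[OF t(1)] t(2) by simp
qed

lemma cofree_map_primitive:
  assumes "p \<in> carr V"
  shows "cofree_map p = gen (schur_forms D V) (counit_form C, [p])"
proof -
  have u: "unit A \<in> ops A (length [p])" and p: "set [p] \<subseteq> carr V" using A.unit_closed assms by simp_all
  have "cofree_map p = schur_map D V \<phi> (gen (schur_forms A V) (unit A, [p]))"
    using cofree_map_free_map[OF gen_in_schur[OF u p]] free_map_unit[OF assms] by simp
  then show ?thesis using schur_map_phi(2)[OF is_vspace_V u p] normalised by simp
qed

end

text \<open>The isomorphisms come from the rescaled family. The conclusion does not mention \<phi>,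
  so they serve the original family as well.\<close>

lemma (in law_pair) bialgebra_free_cofree:
  assumes B: "bialgebra A C (associated_law A C \<phi>) H ev cop" and conil: "conilpotent C H cop"
  shows "let V = Prim C H cop in
          (\<exists>f. algebra_iso A (schur A V) (free_ev A V) H ev f \<and>
             (\<forall>p\<in>carr V. f (gen (schur_forms A V) (unit A, [p])) = p)) \<and>
          (\<exists>g. coalgebra_iso C H cop (schur (dual_smodule C) V) (cofree_cop C V) g \<and>
             (\<forall>p\<in>carr V. g p = gen (schur_forms (dual_smodule C) V) (counit_form C, [p])))"
proof -
  interpret B: bialgebra A C "associated_law A C \<phi>" H ev cop by (rule B)
  interpret N: law_pair A C phi_scaled by (rule law_pair_scaled)
  note alg = B.operad_algebra_axioms
  interpret L: law_bialgebra A C phi_scaled H ev cop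
  proof unfold_locales
    show "phi_scaled 1 (unit A) = counit_form C" by (rule phi_scaled_unit)
    show "conilpotent C H cop" by (rule conil)
    fix k \<delta> \<mu> ps assume \<delta>: "\<delta> \<in> ops C k" and \<mu>: "\<mu> \<in> ops A (length ps)" and ps: "set ps \<subseteq> filtration C H cop 1"
    have psH: "set ps \<subseteq> carr H" using ps by (auto simp: filtration_def)
    have "cop k \<delta> (ev \<mu> ps) = conf_eval H ev k (associated_law A C \<phi> k (length ps) \<delta> \<mu>) ps"
      using B.compatible[OF \<delta> \<mu>] ps by (simp add: Prim_def listset_replicate_iff)
    also have "\<dots> = law_sum H (\<lambda>l b u. ev (\<theta> l (dual_basis_of C l b)) u) k \<delta> (\<phi> (length ps) \<mu>) ps"
      by (rule conf_eval_associated_law[OF alg \<delta> \<mu> psH])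
    also have "\<dots> = law_sum H (\<lambda>l b u. ev (N.\<theta> l (dual_basis_of C l b)) u) k \<delta> (phi_scaled (length ps) \<mu>) ps"
      using law_sum_scaled[OF alg psH \<delta> phi_in[OF \<mu>]] by (simp add: phi_scaled_def)
    finally show "cop k \<delta> (ev \<mu> ps) = N.law_sum H (\<lambda>l b u. ev (N.\<theta> l (dual_basis_of C l b)) u) k \<delta> (phi_scaled (length ps) \<mu>) ps" .
  qed
  show ?thesis
    unfolding Let_def
    using L.free_map_algebra_iso L.free_map_unit L.cofree_map_coalgebra_iso L.cofree_map_primitive by blast
qed

subsection \<open>Self-duality of modules over symmetric groups\<close>

lemma funpow_inv_permutes:
  assumes "\<sigma> permutes S"
  shows "(inv \<sigma> ^^ k) ((\<sigma> ^^ k) x) = x" "(\<sigma> ^^ k) ((inv \<sigma> ^^ k) x) = x"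
  by (induction k arbitrary: x)
    (simp_all add: funpow_swap1 permutes_inverses[OF assms])

text \<open>On each cycle a base point r is fixed and \<sigma>^k r is sent to \<sigma>^(-k) r, which
  reverses the direction of the cycle.\<close>

lemma permutes_conj_inverse:
  fixes n :: nat
  assumes \<sigma>: "\<sigma> permutes {..<n}"
  shows "\<exists>\<tau>. \<tau> permutes {..<n} \<and> \<tau> \<circ> \<sigma> \<circ> inv \<tau> = inv \<sigma>"
proof -
  let ?g = "inv \<sigma>"
  have inj: "inj \<sigma>" by (rule permutes_inj[OF \<sigma>])
  \<comment> \<open>The base point is the least element of the cycle, so points of one cycle share
    it.\<close>
  define root where "root x = (LEAST y. \<exists>k. x = (\<sigma> ^^ k) y)" for x
  have root: "\<exists>k. x = (\<sigma> ^^ k) (root x)" for x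
    unfolding root_def by (rule LeastI[of _ x]) (rule exI[of _ 0], simp)
  have root_\<sigma>: "root (\<sigma> x) = root x" for x
  proof -
    have "(\<exists>k. \<sigma> x = (\<sigma> ^^ k) y) \<longleftrightarrow> (\<exists>k. x = (\<sigma> ^^ k) y)" for y
    proof
      assume "\<exists>k. x = (\<sigma> ^^ k) y"
      then obtain k where "x = (\<sigma> ^^ k) y" ..
      then have "\<sigma> x = (\<sigma> ^^ Suc k) y" by simp
      then show "\<exists>k. \<sigma> x = (\<sigma> ^^ k) y" ..
    next
      assume "\<exists>k. \<sigma> x = (\<sigma> ^^ k) y"
      then obtain k where k: "\<sigma> x = (\<sigma> ^^ k) y" ..
      show "\<exists>k. x = (\<sigma> ^^ k) y"
      proof (cases k)
        case (Suc j)
        then have "x = (\<sigma> ^^ j) y" using k injD[OF inj] by simp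
        then show ?thesis ..
      next
        case 0
        \<comment> \<open>Going backwards along a cycle with nonnegative powers uses the finite
          order of \<sigma>.\<close>
        obtain m where m: "(\<sigma> ^^ m) x = x" "0 < m"
          using permutation_self[of \<sigma> x] permutes_imp_permutation[OF _ \<sigma>] by auto
        then obtain j where "m = Suc j" by (cases m) auto
        then have "x = (\<sigma> ^^ j) (\<sigma> x)" using m(1) by (simp add: funpow_swap1)
        then show ?thesis using k 0 by auto
      qed
    qed
    then show ?thesis unfolding root_def by presburger
  qed
  have root_pow: "root ((\<sigma> ^^ k) x) = root x" for k x
    by (induction k) (simp_all add: root_\<sigma>)
  have root_inv: "root ((?g ^^ k) x) = root x" for k x
    using root_pow[of k "(?g ^^ k) x"] funpow_inv_permutes(2)[OF \<sigma>] by simp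
  \<comment> \<open>The reflected point must not depend on the exponent: both sides are the power k
    + l of the inverse applied to the common point \<sigma>^k r = \<sigma>^l r.\<close>
  have wd: "(?g ^^ k) r = (?g ^^ l) r" if "(\<sigma> ^^ k) r = (\<sigma> ^^ l) r" for k l r
  proof -
    have "(?g ^^ k) r = (?g ^^ (k + l)) ((\<sigma> ^^ l) r)"
      by (simp add: funpow_add funpow_inv_permutes[OF \<sigma>])
    also have "\<dots> = (?g ^^ (l + k)) ((\<sigma> ^^ k) r)" using that by (simp add: add.commute)
    also have "\<dots> = (?g ^^ l) r" by (simp add: funpow_add funpow_inv_permutes[OF \<sigma>])
    finally show ?thesis .
  qed
  have wd': "(\<sigma> ^^ k) r = (\<sigma> ^^ l) r" if "(?g ^^ k) r = (?g ^^ l) r" for k l r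
  proof -
    have "(\<sigma> ^^ k) r = (\<sigma> ^^ (k + l)) ((?g ^^ l) r)"
      by (simp add: funpow_add funpow_inv_permutes[OF \<sigma>])
    also have "\<dots> = (\<sigma> ^^ (l + k)) ((?g ^^ k) r)" using that by (simp add: add.commute)
    also have "\<dots> = (\<sigma> ^^ l) r" by (simp add: funpow_add funpow_inv_permutes[OF \<sigma>])
    finally show ?thesis .
  qed
  define e where "e x = (SOME k. x = (\<sigma> ^^ k) (root x))" for x
  have e: "x = (\<sigma> ^^ e x) (root x)" for x
    unfolding e_def by (rule someI_ex[OF root])
  define \<tau> where "\<tau> x = (?g ^^ e x) (root x)" for x
  have \<tau>_eq: "\<tau> x = (?g ^^ k) (root x)" if "x = (\<sigma> ^^ k) (root x)" for x k
    unfolding \<tau>_def by (rule wd) (use that e[of x] in simp)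
  have \<tau>_comm: "\<tau> (\<sigma> x) = ?g (\<tau> x)" for x
  proof -
    have "\<sigma> x = (\<sigma> ^^ Suc (e x)) (root (\<sigma> x))" using e[of x] root_\<sigma> by simp
    from \<tau>_eq[OF this] show ?thesis by (simp add: root_\<sigma> \<tau>_def)
  qed
  have \<tau>_inj: "inj \<tau>"
  proof (rule injI)
    fix x y assume eq: "\<tau> x = \<tau> y"
    have "root (\<tau> x) = root x" for x
      using root_inv[of "e x" "root x"] root_pow[of "e x" "root x"] e[of x] by (simp add: \<tau>_def)
    then have r: "root x = root y" using eq by metis
    have "(?g ^^ e x) (root x) = (?g ^^ e y) (root x)" using eq r by (simp add: \<tau>_def)
    from wd'[OF this] e[of x] e[of y] r show "x = y" by simp
  qed
  have \<tau>_out: "\<tau> x = x" if "x \<notin> {..<n}" for x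
  proof -
    have fx: "\<sigma> x = x" using permutes_not_in[OF \<sigma> that] .
    have "?g x = x" using permutes_not_in[OF permutes_inv[OF \<sigma>] that] .
    then have "(?g ^^ k) x = x" for k by (induction k) auto
    then have "root x = x" using e[of x] funpow_inv_permutes(1)[OF \<sigma>, of "e x" "root x"] by simp
    then show ?thesis using \<open>\<And>k. (?g ^^ k) x = x\<close> by (simp add: \<tau>_def)
  qed
  have "\<tau> x \<in> {..<n}" if "x \<in> {..<n}" for x
  proof (rule ccontr)
    assume *: "\<tau> x \<notin> {..<n}"
    then have "\<tau> x = x" using \<tau>_out[OF *] injD[OF \<tau>_inj] by blast
    then show False using * that by simp
  qed
  then have \<tau>: "\<tau> permutes {..<n}"
    using \<tau>_out inj_on_subset[OF \<tau>_inj subset_UNIV] by (intro inj_imp_permutes) auto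
  have "\<tau> \<circ> \<sigma> \<circ> inv \<tau> = ?g \<circ> \<tau> \<circ> inv \<tau>" using \<tau>_comm by (auto simp: fun_eq_iff)
  also have "\<dots> = ?g" using permutes_inv_o(1)[OF \<tau>] by (simp add: comp_assoc)
  finally show ?thesis using \<tau> by blast
qed

text \<open>The trace of an idempotent is its rank, which is nonzero in characteristic 0 unless the
  idempotent vanishes.\<close>

lemma idempotent_trace_zero:
  fixes s :: "'k::field_char_0 \<Rightarrow> 'w \<Rightarrow> 'w::ab_group_add"
  assumes W: "is_vspace \<lparr>carr = W, scl = s\<rparr>" and I: "finite I" and w: "\<And>i. i \<in> I \<Longrightarrow> w i \<in> W"
    and c: "\<And>i. i \<in> I \<Longrightarrow> linear_between \<lparr>carr = W, scl = s\<rparr> ground (c i)"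
    and expand: "\<And>x. x \<in> W \<Longrightarrow> x = (\<Sum>i\<in>I. s (c i x) (w i))"
    and e: "linear_between \<lparr>carr = W, scl = s\<rparr> \<lparr>carr = W, scl = s\<rparr> e"
    and idem: "\<And>x. x \<in> W \<Longrightarrow> e (e x) = e x"
    and trace: "(\<Sum>i\<in>I. c i (e (w i))) = 0" and x: "x \<in> W"
  shows "e x = 0"
proof -
  let ?W = "\<lparr>carr = W, scl = s\<rparr>"
  interpret S: vector_space s using is_vspace_vector_space[OF W] by simp
  have eW: "e y \<in> W" if "y \<in> W" for y using linear_betweenD(1)[OF e, of y] that by simp
  \<comment> \<open>A basis of the image of e, on which e is the identity; the trace comes out as
    its cardinality.\<close>
  obtain U where U: "U \<subseteq> e ` w ` I" "S.independent U" "e ` w ` I \<subseteq> S.span U"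
    by (rule S.maximal_independent_subset)
  have fU: "finite U" using U(1) I by (meson finite_imageI finite_subset)
  have UW: "U \<subseteq> W" using U(1) w eW by auto
  have e_sum: "e (\<Sum>i\<in>I. s (a i) (w i)) = (\<Sum>i\<in>I. s (a i) (e (w i)))" for a
  proof -
    have "e (\<Sum>i\<in>I. s (a i) (w i)) = (\<Sum>i\<in>I. e (s (a i) (w i)))"
      using linear_between_sum[OF e W, of I "\<lambda>i. s (a i) (w i)"] is_vspace_scale[OF W] w by simp
    also have "\<dots> = (\<Sum>i\<in>I. s (a i) (e (w i)))"
      using linear_betweenD(3)[OF e] w by (intro sum.cong) simp_all
    finally show ?thesis .
  qed
  have e_span: "e y \<in> S.span U" if "y \<in> W" for y
  proof -
    have "e y = (\<Sum>i\<in>I. s (c i y) (e (w i)))" using expand[OF that] e_sum by metis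
    then show ?thesis using U(3) by (auto intro!: S.span_sum S.span_scale)
  qed
  have ew: "e (w i) = (\<Sum>u\<in>U. s (S.representation U (e (w i)) u) u)" if "i \<in> I" for i
    using S.sum_representation_eq[OF U(2) e_span[OF w[OF that]] fU order_refl] by simp
  have eu: "e u = u" if "u \<in> U" for u using U(1) idem w that by auto
  \<comment> \<open>This is the u-coordinate of e u = u, with u first expanded in the family
    w.\<close>
  have one: "(\<Sum>i\<in>I. S.representation U (e (w i)) u * c i u) = 1" if u: "u \<in> U" for u
  proof -
    have "S.representation U u u = S.representation U (e (\<Sum>i\<in>I. s (c i u) (w i))) u"
      using expand[of u] eu[OF u] UW u by auto
    also have "\<dots> = (\<Sum>i\<in>I. c i u * S.representation U (e (w i)) u)"
      unfolding e_sum using e_span[OF w]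
      by (simp add: S.representation_sum[OF U(2)] S.representation_scale[OF U(2)] S.span_scale)
    finally show ?thesis using S.representation_basis[OF U(2) u] by (simp add: mult.commute)
  qed
  have "(\<Sum>i\<in>I. c i (e (w i))) = (\<Sum>i\<in>I. \<Sum>u\<in>U. S.representation U (e (w i)) u * c i u)"
  proof (rule sum.cong[OF refl])
    fix i assume i: "i \<in> I"
    have "c i (e (w i)) = c i (\<Sum>u\<in>U. s (S.representation U (e (w i)) u) u)" using ew[OF i] by simp
    also have "\<dots> = (\<Sum>u\<in>U. c i (s (S.representation U (e (w i)) u) u))"
      using linear_between_sum[OF c[OF i] W, of U "\<lambda>u. s (S.representation U (e (w i)) u) u"]
        is_vspace_scale[OF W] UW by (simp add: subset_iff)
    also have "\<dots> = (\<Sum>u\<in>U. S.representation U (e (w i)) u * c i u)"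
      using linear_betweenD(3)[OF c[OF i]] UW by (intro sum.cong) auto
    finally show "c i (e (w i)) = (\<Sum>u\<in>U. S.representation U (e (w i)) u * c i u)" .
  qed
  also have "\<dots> = of_nat (card U)" by (subst sum.swap) (simp add: one)
  finally have "U = {}" using trace fU by simp
  then show ?thesis using e_span[OF x] by simp
qed


section \<open>Invariant bilinear forms\<close>

locale char0_module = fd_module P
  for P :: "('k::field_char_0, 'a::ab_group_add, 'z) smodule_scheme"
begin

abbreviation restrict_to :: "'a set \<Rightarrow> ('k, 'a) vspace" where
  "restrict_to R \<equiv> \<lparr>carr = R, scl = smul P\<rparr>"

definition stable :: "nat \<Rightarrow> 'a set \<Rightarrow> bool" where
  "stable n R \<longleftrightarrow> is_vspace (restrict_to R) \<and> R \<subseteq> ops P n \<and>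
    (\<forall>\<sigma> x. \<sigma> permutes {..<n} \<longrightarrow> x \<in> R \<longrightarrow> act P n \<sigma> x \<in> R)"

definition invariant_form :: "nat \<Rightarrow> 'a set \<Rightarrow> ('a \<Rightarrow> 'a \<Rightarrow> 'k) \<Rightarrow> bool" where
  "invariant_form n R \<beta> \<longleftrightarrow> (\<forall>x\<in>R. linear_between (restrict_to R) ground (\<beta> x)) \<and>
    (\<forall>y\<in>R. linear_between (restrict_to R) ground (\<lambda>x. \<beta> x y)) \<and>
    (\<forall>\<sigma>. \<sigma> permutes {..<n} \<longrightarrow> (\<forall>x\<in>R. \<forall>y\<in>R. \<beta> (act P n \<sigma> x) (act P n \<sigma> y) = \<beta> x y))"

lemma act_linear_stable:
  "stable n R \<Longrightarrow> \<sigma> permutes {..<n} \<Longrightarrow> linear_between (restrict_to R) (restrict_to R) (act P n \<sigma>)"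
  using act_linear[of \<sigma> n] by (auto simp: stable_def linear_between_def subset_iff)

lemma finite_basis_exists:
  assumes "stable n R"
  obtains B where "finite B" "B \<subseteq> R" "\<not> module.dependent (smul P) B" "module.span (smul P) B = R"
proof -
  interpret S: vector_space "smul P" by (rule vector_space_smul)
  have R: "S.subspace R" "R \<subseteq> ops P n" using assms by (simp_all add: stable_def is_vspace_def)
  obtain B where B: "B \<subseteq> R" "S.independent B" "R \<subseteq> S.span B" by (rule S.maximal_independent_subset)
  have "B \<subseteq> S.span (basis_of P n)" using B R basis_of(3) by blast
  then have "finite B" using S.independent_span_bound[OF basis_of(1) B(2)] by blast
  moreover have "S.span B = R" using B R by (metis S.span_minimal subset_antisym)
  ultimately show ?thesis using that B by blast
qed

text \<open>If all averaged forms vanish, then the squared character of R sums to zero. Since a permutation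
  is conjugate to its inverse, that sum is the trace of the averaging idempotent on End(R), up to the
  factor n!.\<close>

lemma nonzero_invariant_form_exists:
  assumes R: "stable n R" and nz: "R \<noteq> {0}"
  shows "\<exists>\<beta>. invariant_form n R \<beta> \<and> (\<exists>x\<in>R. \<exists>y\<in>R. \<beta> x y \<noteq> 0)"
proof (rule ccontr)
  assume none: "\<not> ?thesis"
  interpret S: vector_space "smul P" by (rule vector_space_smul)
  let ?R = "restrict_to R" and ?G = "{\<sigma>. \<sigma> permutes {..<n}}"
  have vR: "is_vspace ?R" and Rsub: "R \<subseteq> ops P n" using R by (simp_all add: stable_def)
  have aR: "act P n \<sigma> x \<in> R" if "\<sigma> permutes {..<n}" "x \<in> R" for \<sigma> x using R that by (simp add: stable_def)
  have aRi: "act P n (inv \<sigma>) x \<in> R" if "\<sigma> permutes {..<n}" "x \<in> R" for \<sigma> x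
    by (rule aR[OF permutes_inv[OF that(1)] that(2)])
  note al = act_linear_stable[OF R]
  obtain B where B: "finite B" "B \<subseteq> R" "S.independent B" "S.span B = R" by (rule finite_basis_exists[OF R])
  define coord where "coord b x = S.representation B x b" for b x
  have cl: "linear_between ?R ground (coord b)" for b
    using S.representation_add[OF B(3)] S.representation_scale[OF B(3)]
    by (simp add: linear_between_ground_iff coord_def B(4))
  have expand: "x = (\<Sum>b\<in>B. smul P (coord b x) b)" if "x \<in> R" for x
    using S.sum_representation_eq[OF B(3) _ B(1) order_refl, of x] that B(4) by (simp add: coord_def)
  have lin_expand: "f x = (\<Sum>b\<in>B. coord b x * f b)" if "linear_between ?R ground f" "x \<in> R" for f x
  proof -
    have "f x = f (\<Sum>b\<in>B. smul P (coord b x) b)" using expand[OF that(2)] by simp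
    also have "\<dots> = (\<Sum>b\<in>B. f (smul P (coord b x) b))"
      using linear_between_sum[OF that(1) vR, of B "\<lambda>b. smul P (coord b x) b"] is_vspace_scale[OF vR] B(2) by auto
    also have "\<dots> = (\<Sum>b\<in>B. coord b x * f b)"
      using linear_betweenD(3)[OF that(1)] B(2) by (intro sum.cong) auto
    finally show ?thesis .
  qed
  define tr where "tr f = (\<Sum>b\<in>B. coord b (f b))" for f
  define \<chi> where "\<chi> \<sigma> = tr (act P n \<sigma>)" for \<sigma>
  have tr_comm: "tr (\<lambda>x. f (g x)) = tr (\<lambda>x. g (f x))"
    if f: "linear_between ?R ?R f" and g: "linear_between ?R ?R g" for f g
  proof -
    have *: "tr (\<lambda>x. f (g x)) = (\<Sum>b\<in>B. \<Sum>c\<in>B. coord c (g b) * coord b (f c))"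
      if "linear_between ?R ?R f" "linear_between ?R ?R g" for f g
      unfolding tr_def using B(2) linear_betweenD(1)[OF that(2)]
      by (intro sum.cong refl lin_expand[OF linear_between_compose[OF that(1) cl]]) auto
    show ?thesis unfolding *[OF f g] *[OF g f] by (subst sum.swap) (simp add: mult.commute)
  qed
  \<comment> \<open>A conjugating permutation \<tau> can be rotated around inside the trace and
    cancels.\<close>
  have \<chi>_inv: "\<chi> (inv \<sigma>) = \<chi> \<sigma>" if \<sigma>: "\<sigma> permutes {..<n}" for \<sigma>
  proof -
    obtain \<tau> where \<tau>: "\<tau> permutes {..<n}" "\<tau> \<circ> \<sigma> \<circ> inv \<tau> = inv \<sigma>"
      using permutes_conj_inverse[OF \<sigma>] by blast
    note \<tau>i = permutes_inv[OF \<tau>(1)]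
    have e: "act P n (inv \<sigma>) b = act P n (inv \<tau>) (act P n \<sigma> (act P n \<tau> b))" if "b \<in> R" for b
      using act_comp[OF permutes_compose[OF \<sigma> \<tau>(1)] \<tau>i, of b] act_comp[OF \<tau>(1) \<sigma>, of b] Rsub that
      by (simp flip: \<tau>(2)) blast
    have "\<chi> (inv \<sigma>) = tr (\<lambda>x. act P n (inv \<tau>) (act P n \<sigma> (act P n \<tau> x)))"
      unfolding \<chi>_def tr_def using e B(2) by (intro sum.cong) auto
    also have "\<dots> = tr (\<lambda>x. act P n \<sigma> (act P n \<tau> (act P n (inv \<tau>) x)))"
      by (rule tr_comm[OF al[OF \<tau>i] linear_between_compose[OF al[OF \<tau>(1)] al[OF \<sigma>]]])
    also have "\<dots> = \<chi> \<sigma>"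
      unfolding \<chi>_def tr_def using act_inv(2)[OF \<tau>(1)] B(2) Rsub by (intro sum.cong) auto
    finally show ?thesis .
  qed
  have sum_chi: "(\<Sum>\<sigma>\<in>?G. \<chi> \<sigma> * \<chi> \<sigma>) = 0"
  proof -
    \<comment> \<open>The group sum of the rank-one form \<open>coord b\<close> \<otimes>
      \<open>coord c\<close> is invariant, hence 0 by assumption; its value at (b, c) is the sum
      displayed here.\<close>
    have "(\<Sum>\<sigma>\<in>?G. coord b (act P n \<sigma> b) * coord c (act P n \<sigma> c)) = 0" if b: "b \<in> B" and c: "c \<in> B" for b c
    proof -
      let ?\<beta> = "\<lambda>x y. \<Sum>\<sigma>\<in>?G. coord b (act P n \<sigma> x) * coord c (act P n \<sigma> y)"
      have "invariant_form n R ?\<beta>"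
        unfolding invariant_form_def
      proof (intro conjI ballI allI impI)
        show "linear_between ?R ground (?\<beta> x)" for x
        proof (intro linear_between_ground_sum)
          fix \<sigma> assume "\<sigma> \<in> ?G"
          then have "linear_between ?R ground (\<lambda>y. coord c (act P n \<sigma> y) * coord b (act P n \<sigma> x))"
            by (intro linear_between_ground_mult linear_between_compose[OF al cl]) simp
          then show "linear_between ?R ground (\<lambda>y. coord b (act P n \<sigma> x) * coord c (act P n \<sigma> y))"
            by (simp add: mult.commute)
        qed
        show "linear_between ?R ground (\<lambda>x. ?\<beta> x y)" for y
          by (intro linear_between_ground_sum linear_between_ground_mult linear_between_compose[OF al cl]) simp
        fix \<tau> x y assume \<tau>: "\<tau> permutes {..<n}" and "x \<in> R" "y \<in> R"
        then have xy: "x \<in> ops P n" "y \<in> ops P n" using Rsub by auto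
        have "?\<beta> (act P n \<tau> x) (act P n \<tau> y) =
            (\<Sum>\<sigma>\<in>?G. coord b (act P n (\<tau> \<circ> \<sigma>) x) * coord c (act P n (\<tau> \<circ> \<sigma>) y))"
          using act_comp[OF \<tau>] xy by (intro sum.cong) auto
        also have "\<dots> = ?\<beta> x y" by (rule setum_permutations_compose_left[OF \<tau>, symmetric])
        finally show "?\<beta> (act P n \<tau> x) (act P n \<tau> y) = ?\<beta> x y" .
      qed
      then show ?thesis using none b c B(2) by blast
    qed
    then have "(\<Sum>b\<in>B. \<Sum>c\<in>B. \<Sum>\<sigma>\<in>?G. coord b (act P n \<sigma> b) * coord c (act P n \<sigma> c)) = 0" by simp
    also have "(\<Sum>b\<in>B. \<Sum>c\<in>B. \<Sum>\<sigma>\<in>?G. coord b (act P n \<sigma> b) * coord c (act P n \<sigma> c)) =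
        (\<Sum>b\<in>B. \<Sum>\<sigma>\<in>?G. \<Sum>c\<in>B. coord b (act P n \<sigma> b) * coord c (act P n \<sigma> c))"
      by (intro sum.cong refl sum.swap)
    also have "\<dots> = (\<Sum>\<sigma>\<in>?G. \<Sum>b\<in>B. \<Sum>c\<in>B. coord b (act P n \<sigma> b) * coord c (act P n \<sigma> c))"
      by (rule sum.swap)
    finally show ?thesis by (simp add: \<chi>_def tr_def sum_product)
  qed
  \<comment> \<open>W is End(R), with elements extended by 0 so that they are determined on R. In
    what follows w lists its matrix units, c the matrix entries, and e averages over
    conjugation.\<close>
  define W where "W = {T. linear_between ?R ?R T \<and> (\<forall>x. x \<notin> R \<longrightarrow> T x = 0)}"
  define s where "s c T = (\<lambda>x. smul P c (T x))" for c and T :: "'a \<Rightarrow> 'a"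
  define N where "N = inverse (fact n :: 'k)"
  define e where "e T = (\<lambda>x. if x \<in> R then smul P N (\<Sum>\<sigma>\<in>?G. act P n \<sigma> (T (act P n (inv \<sigma>) x))) else 0)" for T
  define w where "w i = (\<lambda>x. if x \<in> R then smul P (coord (snd i) x) (fst i) else 0)" for i
  define c where "c i T = coord (fst i) (T (snd i))" for i and T :: "'a \<Rightarrow> 'a"
  have Wlin: "linear_between ?R ?R T" if "T \<in> W" for T using that by (simp add: W_def)
  have WR: "T x \<in> R" if "T \<in> W" "x \<in> R" for T x using linear_betweenD(1)[OF Wlin[OF that(1)]] that(2) by simp
  have "vector_space s"
    unfolding s_def by unfold_locales
      (auto simp: fun_eq_iff S.scale_right_distrib S.scale_left_distrib)
  then interpret T: vector_space s .
  have Wc: "(\<lambda>x. smul P a (T x) + T' x) \<in> W" if "T \<in> W" "T' \<in> W" for a T T'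
    using linear_between_combine[OF vR Wlin[OF that(1)] Wlin[OF that(2)], of a] that by (simp add: W_def)
  have W0: "(\<lambda>x. 0) \<in> W" using linear_between_const_zero[OF vR] by (simp add: W_def)
  have vW: "is_vspace \<lparr>carr = W, scl = s\<rparr>"
  proof -
    have "T.subspace W"
    proof (rule T.subspaceI)
      show "0 \<in> W" using W0 by (simp add: zero_fun_def)
      show "T + T' \<in> W" if "T \<in> W" "T' \<in> W" for T T'
        using Wc[OF that, of 1] by (simp add: plus_fun_def)
      show "s a T \<in> W" if "T \<in> W" for a T
        using Wc[OF that W0, of a] by (simp add: s_def)
    qed
    then show ?thesis by (simp add: is_vspace_def T.vector_space_axioms)
  qed
  have term_lin: "linear_between ?R ?R (\<lambda>x. act P n \<sigma> (T (act P n (inv \<sigma>) x)))" if "T \<in> W" "\<sigma> \<in> ?G" for T \<sigma>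
    using that permutes_inv[of \<sigma>]
    by (intro linear_between_compose[OF linear_between_compose[OF al Wlin] al]) auto
  have eW: "e T \<in> W" if "T \<in> W" for T
  proof -
    have "linear_between ?R ?R (\<lambda>x. \<Sum>\<sigma>\<in>?G. scl ?R N (act P n \<sigma> (T (act P n (inv \<sigma>) x))))"
      by (rule linear_between_sum_scale[OF vR]) (rule term_lin[OF that])
    then have "linear_between ?R ?R (e T)"
      by (rule linear_between_cong[THEN iffD1, rotated 2]) (simp_all add: e_def S.scale_sum_right vR)
    then show ?thesis by (simp add: W_def e_def)
  qed
  have e_inv: "act P n \<tau> (e T (act P n (inv \<tau>) x)) = e T x" if T: "T \<in> W" and \<tau>: "\<tau> permutes {..<n}" and x: "x \<in> R" for T \<tau> x
  proof -
    note \<tau>i = permutes_inv[OF \<tau>]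
    have m: "act P n \<sigma> (T (act P n (inv \<sigma>) y)) \<in> R" if "\<sigma> \<in> ?G" "y \<in> R" for \<sigma> y
      using linear_betweenD(1)[OF term_lin[OF T that(1)]] that(2) by simp
    have "act P n \<tau> (e T (act P n (inv \<tau>) x)) =
        smul P N (act P n \<tau> (\<Sum>\<sigma>\<in>?G. act P n \<sigma> (T (act P n (inv \<sigma>) (act P n (inv \<tau>) x)))))"
      using linear_betweenD(3)[OF al[OF \<tau>]] is_vspace_sum[OF vR, of ?G "\<lambda>\<sigma>. act P n \<sigma> (T (act P n (inv \<sigma>) (act P n (inv \<tau>) x)))"]
        m aR[OF \<tau>i x] by (simp add: e_def)
    also have "act P n \<tau> (\<Sum>\<sigma>\<in>?G. act P n \<sigma> (T (act P n (inv \<sigma>) (act P n (inv \<tau>) x)))) =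
        (\<Sum>\<sigma>\<in>?G. act P n \<tau> (act P n \<sigma> (T (act P n (inv \<sigma>) (act P n (inv \<tau>) x)))))"
      using m aR[OF \<tau>i x] by (intro linear_between_sum[OF al[OF \<tau>] vR]) simp
    also have "\<dots> = (\<Sum>\<sigma>\<in>?G. act P n (\<sigma> \<circ> \<tau>) (T (act P n (inv (\<sigma> \<circ> \<tau>)) x)))"
    proof (rule sum.cong[OF refl])
      fix \<sigma> assume "\<sigma> \<in> ?G"
      then have \<sigma>: "\<sigma> permutes {..<n}" by simp
      have i: "inv (\<sigma> \<circ> \<tau>) = inv \<tau> \<circ> inv \<sigma>" using permutes_bij[OF \<sigma>] permutes_bij[OF \<tau>] by (rule o_inv_distrib)
      have xi: "act P n (inv (\<sigma> \<circ> \<tau>)) x = act P n (inv \<sigma>) (act P n (inv \<tau>) x)"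
        unfolding i by (rule act_comp[OF \<tau>i permutes_inv[OF \<sigma>]]) (use x Rsub in blast)
      have "T (act P n (inv \<sigma>) (act P n (inv \<tau>) x)) \<in> ops P n"
        using WR[OF T] aR \<tau>i permutes_inv[OF \<sigma>] x Rsub by blast
      then show "act P n \<tau> (act P n \<sigma> (T (act P n (inv \<sigma>) (act P n (inv \<tau>) x)))) =
          act P n (\<sigma> \<circ> \<tau>) (T (act P n (inv (\<sigma> \<circ> \<tau>)) x))"
        unfolding xi by (rule act_comp[OF \<sigma> \<tau>, symmetric])
    qed
    also have "\<dots> = (\<Sum>\<sigma>\<in>?G. act P n \<sigma> (T (act P n (inv \<sigma>) x)))"
      by (rule sum_permutations_compose_right[OF \<tau>, symmetric])
    finally show ?thesis using x by (simp add: e_def)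
  qed
  have e_fix: "e T = T" if T: "T \<in> W" and fixed: "\<And>\<sigma> x. \<sigma> permutes {..<n} \<Longrightarrow> x \<in> R \<Longrightarrow> act P n \<sigma> (T (act P n (inv \<sigma>) x)) = T x" for T
  proof
    fix x
    show "e T x = T x"
    proof (cases "x \<in> R")
      case True
      have "(\<Sum>\<sigma>\<in>?G. act P n \<sigma> (T (act P n (inv \<sigma>) x))) = (\<Sum>\<sigma>\<in>?G. smul P 1 (T x))"
        using fixed True by (intro sum.cong) auto
      also have "\<dots> = smul P (fact n) (T x)"
        by (subst S.scale_sum_left[symmetric]) (simp add: card_permutations[of "{..<n}" n])
      finally show ?thesis using True by (simp add: e_def N_def)
    next
      case False
      then show ?thesis using T by (simp add: e_def W_def)
    qed
  qed
  have cW: "linear_between \<lparr>carr = W, scl = s\<rparr> ground (c i)" if "i \<in> B \<times> B" for i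
    using that B(2) WR linear_betweenD(2,3)[OF cl[of "fst i"]] by (auto simp: linear_between_ground_iff c_def s_def)
  have wW: "w i \<in> W" if "i \<in> B \<times> B" for i
  proof -
    have "linear_between ?R ?R (\<lambda>x. smul P (coord (snd i) x) (fst i))"
      using that B(2) is_vspace_scale[OF vR, of "fst i"] linear_betweenD(2,3)[OF cl[of "snd i"]]
      by (auto simp: linear_between_def S.scale_left_distrib)
    then have "linear_between ?R ?R (w i)"
      by (rule linear_between_cong[THEN iffD1, rotated 2]) (simp_all add: w_def vR)
    then show ?thesis by (simp add: W_def w_def)
  qed
  have w_expand: "T = (\<Sum>i\<in>B \<times> B. s (c i T) (w i))" if T: "T \<in> W" for T
  proof
    fix x
    show "T x = (\<Sum>i\<in>B \<times> B. s (c i T) (w i)) x"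
    proof (cases "x \<in> R")
      case True
      have "T x = (\<Sum>b\<in>B. smul P (coord b (T x)) b)" by (rule expand[OF WR[OF T True]])
      also have "\<dots> = (\<Sum>b\<in>B. \<Sum>d\<in>B. smul P (coord d x * coord b (T d)) b)"
        by (intro sum.cong refl, subst lin_expand[OF linear_between_compose[OF Wlin[OF T] cl] True])
          (simp add: S.scale_sum_left)
      also have "\<dots> = (\<Sum>i\<in>B \<times> B. s (c i T) (w i) x)"
        using True by (simp add: sum.cartesian_product s_def c_def w_def split_beta mult.commute)
      finally show ?thesis by (simp add: sum_fun_apply)
    next
      case False
      then show ?thesis using T by (simp add: sum_fun_apply s_def w_def W_def)
    qed
  qed
  have e_lin: "linear_between \<lparr>carr = W, scl = s\<rparr> \<lparr>carr = W, scl = s\<rparr> e"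
  proof -
    have "e (T + T') = e T + e T'" if "T \<in> W" "T' \<in> W" for T T'
    proof
      fix x
      have "act P n \<sigma> (T y + T' y) = act P n \<sigma> (T y) + act P n \<sigma> (T' y)" if "\<sigma> \<in> ?G" "y \<in> R" for \<sigma> y
        using linear_betweenD(2)[OF al, of \<sigma> "T y" "T' y"] WR \<open>T \<in> W\<close> \<open>T' \<in> W\<close> that by simp
      then have "(\<Sum>\<sigma>\<in>?G. act P n \<sigma> (T (act P n (inv \<sigma>) x) + T' (act P n (inv \<sigma>) x))) =
          (\<Sum>\<sigma>\<in>?G. act P n \<sigma> (T (act P n (inv \<sigma>) x))) + (\<Sum>\<sigma>\<in>?G. act P n \<sigma> (T' (act P n (inv \<sigma>) x)))"
        if "x \<in> R" unfolding sum.distrib[symmetric] using aRi that by (intro sum.cong) simp_all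
      then show "e (T + T') x = (e T + e T') x" by (simp add: e_def S.scale_right_distrib)
    qed
    moreover have "e (s a T) = s a (e T)" if "T \<in> W" for a T
    proof
      fix x
      have "act P n \<sigma> (smul P a (T y)) = smul P a (act P n \<sigma> (T y))" if "\<sigma> \<in> ?G" "y \<in> R" for \<sigma> y
        using linear_betweenD(3)[OF al, of \<sigma> "T y" a] WR \<open>T \<in> W\<close> that by simp
      then have "(\<Sum>\<sigma>\<in>?G. act P n \<sigma> (smul P a (T (act P n (inv \<sigma>) x)))) =
          smul P a (\<Sum>\<sigma>\<in>?G. act P n \<sigma> (T (act P n (inv \<sigma>) x)))"
        if "x \<in> R" unfolding S.scale_sum_right using aRi that by (intro sum.cong) simp_all
      then show "e (s a T) x = s a (e T) x" by (simp add: e_def s_def mult.commute)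
    qed
    ultimately show ?thesis using eW by (simp add: linear_between_def)
  qed
  \<comment> \<open>Conjugation by \<sigma> on End(R) has trace \<chi> \<sigma> times the value of
    \<chi> at the inverse, and \<chi> does not distinguish the two.\<close>
  have trace: "(\<Sum>i\<in>B \<times> B. c i (e (w i))) = 0"
  proof -
    have "c (b, d) (e (w (b, d))) = N * (\<Sum>\<sigma>\<in>?G. coord b (act P n \<sigma> b) * coord d (act P n (inv \<sigma>) d))"
      if b: "b \<in> B" and d: "d \<in> B" for b d
    proof -
      have bR: "b \<in> R" and dR: "d \<in> R" using b d B(2) by auto
      have t: "act P n \<sigma> (w (b, d) (act P n (inv \<sigma>) d)) = smul P (coord d (act P n (inv \<sigma>) d)) (act P n \<sigma> b)"
        if "\<sigma> \<in> ?G" for \<sigma>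
        using linear_betweenD(3)[OF al, of \<sigma> b] bR aR[OF permutes_inv dR, of \<sigma>] that by (simp add: w_def)
      have m: "smul P (coord d (act P n (inv \<sigma>) d)) (act P n \<sigma> b) \<in> R" if "\<sigma> \<in> ?G" for \<sigma>
        using is_vspace_scale[OF vR] aR bR that by simp
      have "c (b, d) (e (w (b, d))) = coord b (smul P N (\<Sum>\<sigma>\<in>?G. smul P (coord d (act P n (inv \<sigma>) d)) (act P n \<sigma> b)))"
        using t dR by (simp add: c_def e_def)
      also have "\<dots> = N * coord b (\<Sum>\<sigma>\<in>?G. smul P (coord d (act P n (inv \<sigma>) d)) (act P n \<sigma> b))"
        using linear_betweenD(3)[OF cl] is_vspace_sum[OF vR, of ?G] m by simp
      also have "coord b (\<Sum>\<sigma>\<in>?G. smul P (coord d (act P n (inv \<sigma>) d)) (act P n \<sigma> b)) =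
          (\<Sum>\<sigma>\<in>?G. coord b (smul P (coord d (act P n (inv \<sigma>) d)) (act P n \<sigma> b)))"
        using m by (intro linear_between_sum[OF cl vR]) simp
      also have "\<dots> = (\<Sum>\<sigma>\<in>?G. coord b (act P n \<sigma> b) * coord d (act P n (inv \<sigma>) d))"
        using linear_betweenD(3)[OF cl] aR bR by (intro sum.cong) (simp_all add: mult.commute)
      finally show ?thesis .
    qed
    then have "(\<Sum>i\<in>B \<times> B. c i (e (w i))) =
        (\<Sum>b\<in>B. \<Sum>d\<in>B. N * (\<Sum>\<sigma>\<in>?G. coord b (act P n \<sigma> b) * coord d (act P n (inv \<sigma>) d)))"
      unfolding sum.cartesian_product by (intro sum.cong) auto
    also have "\<dots> = N * (\<Sum>b\<in>B. \<Sum>d\<in>B. \<Sum>\<sigma>\<in>?G. coord b (act P n \<sigma> b) * coord d (act P n (inv \<sigma>) d))"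
      by (simp add: sum_distrib_left)
    also have "(\<Sum>b\<in>B. \<Sum>d\<in>B. \<Sum>\<sigma>\<in>?G. coord b (act P n \<sigma> b) * coord d (act P n (inv \<sigma>) d)) =
        (\<Sum>b\<in>B. \<Sum>\<sigma>\<in>?G. \<Sum>d\<in>B. coord b (act P n \<sigma> b) * coord d (act P n (inv \<sigma>) d))"
      by (intro sum.cong refl sum.swap)
    also have "\<dots> = (\<Sum>\<sigma>\<in>?G. \<Sum>b\<in>B. \<Sum>d\<in>B. coord b (act P n \<sigma> b) * coord d (act P n (inv \<sigma>) d))"
      by (rule sum.swap)
    also have "\<dots> = (\<Sum>\<sigma>\<in>?G. \<chi> \<sigma> * \<chi> (inv \<sigma>))" by (simp add: \<chi>_def tr_def sum_product)
    also have "\<dots> = 0" using sum_chi \<chi>_inv by simp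
    finally show ?thesis by simp
  qed
  \<comment> \<open>The identity of R commutes with the action and is fixed by e; as e vanishes, R
    would be 0.\<close>
  define T where "T x = (if x \<in> R then x else 0)" for x
  have TW: "T \<in> W"
    using is_vspace_add[OF vR] is_vspace_scale[OF vR] by (simp add: W_def T_def linear_between_def)
  have eT: "e T = T"
  proof (rule e_fix[OF TW])
    fix \<sigma> x assume \<sigma>: "\<sigma> permutes {..<n}" and x: "x \<in> R"
    have "x \<in> ops P n" using x Rsub by blast
    then show "act P n \<sigma> (T (act P n (inv \<sigma>) x)) = T x"
      using aRi[OF \<sigma> x] x act_inv(2)[OF \<sigma>] by (simp add: T_def)
  qed
  have idem: "e (e T') = e T'" if "T' \<in> W" for T'
    by (rule e_fix[OF eW[OF that] e_inv[OF that]])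
  have fBB: "finite (B \<times> B)" using B(1) by simp
  have "e T = 0"
    by (rule idempotent_trace_zero[where W = W and s = s and I = "B \<times> B" and w = w and c = c and e = e,
          OF vW fBB wW cW w_expand e_lin idem trace TW])
  then have "T x = 0" for x using eT by simp
  then have "R \<subseteq> {0}" unfolding T_def by (metis insertI1 subsetI)
  then show False using nz is_vspace_zero[OF vR] by auto
qed


text \<open>The symmetric and the alternating combination of \<beta> cannot both vanish at (x, y),
  as they add up to 2 \<beta> x y there. The sign \<epsilon> serves to identify left and right
  radicals.\<close>

lemma reflexive_invariant_form_exists:
  assumes R: "stable n R" and nz: "R \<noteq> {0}"
  shows "\<exists>\<beta> (\<epsilon>::'k). invariant_form n R \<beta> \<and> (\<exists>x\<in>R. \<exists>y\<in>R. \<beta> x y \<noteq> 0) \<and>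
    (\<forall>x\<in>R. \<forall>y\<in>R. \<beta> y x = \<epsilon> * \<beta> x y)"
proof -
  obtain \<beta> x y where \<beta>: "invariant_form n R \<beta>" "x \<in> R" "y \<in> R" "\<beta> x y \<noteq> 0"
    using nonzero_invariant_form_exists[OF R nz] by blast
  have comb: "invariant_form n R (\<lambda>x y. \<epsilon> * \<beta> y x + \<beta> x y)" for \<epsilon>
    unfolding invariant_form_def
  proof (intro conjI ballI allI impI)
    fix x assume x: "x \<in> R"
    have l: "linear_between (restrict_to R) ground (\<beta> x)" "linear_between (restrict_to R) ground (\<lambda>y. \<beta> y x)"
      using \<beta>(1) x by (auto simp: invariant_form_def)
    show "linear_between (restrict_to R) ground (\<lambda>y. \<epsilon> * \<beta> y x + \<beta> x y)"
      using linear_between_combine[OF is_vspace_ground l(2,1), of \<epsilon>] by simp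
    show "linear_between (restrict_to R) ground (\<lambda>y. \<epsilon> * \<beta> x y + \<beta> y x)"
      using linear_between_combine[OF is_vspace_ground l, of \<epsilon>] by simp
  qed (use \<beta>(1) in \<open>simp add: invariant_form_def\<close>)
  show ?thesis
  proof (cases "\<beta> y x + \<beta> x y = 0")
    case False
    then show ?thesis
      using comb[of 1] \<beta>(2,3)
      by (intro exI[of _ "\<lambda>x y. 1 * \<beta> y x + \<beta> x y"] exI[of _ 1]) (auto simp: add.commute)
  next
    case True
    have "- \<beta> y x + \<beta> x y \<noteq> 0"
    proof
      assume "- \<beta> y x + \<beta> x y = 0"
      then have "2 * \<beta> x y = 0" using True by (simp add: algebra_simps)
      then show False using \<beta>(4) by simp
    qed
    then show ?thesis
      using comb[of "-1"] \<beta>(2,3)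
      by (intro exI[of _ "\<lambda>x y. -1 * \<beta> y x + \<beta> x y"] exI[of _ "-1"]) auto
  qed
qed

text \<open>Maschke's argument: the conjugates of a linear projection onto R are averaged over the
  group, which uses that n! is invertible.\<close>

lemma equivariant_projection_exists:
  assumes R: "stable n R"
  shows "\<exists>\<pi>. linear_between (arity_space P n) (restrict_to R) \<pi> \<and> (\<forall>x\<in>R. \<pi> x = x) \<and>
    (\<forall>\<sigma>. \<sigma> permutes {..<n} \<longrightarrow> (\<forall>x\<in>ops P n. \<pi> (act P n \<sigma> x) = act P n \<sigma> (\<pi> x)))"
proof -
  interpret S: vector_space "smul P" by (rule vector_space_smul)
  let ?R = "restrict_to R" and ?G = "{\<sigma>. \<sigma> permutes {..<n}}"
  have vR: "is_vspace ?R" and Rsub: "R \<subseteq> ops P n" using R by (simp_all add: stable_def)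
  have aR: "act P n \<sigma> x \<in> R" if "\<sigma> permutes {..<n}" "x \<in> R" for \<sigma> x using R that by (simp add: stable_def)
  note al = act_linear_stable[OF R]
  obtain p where p: "linear_between (arity_space P n) ?R p" "\<And>x. x \<in> R \<Longrightarrow> p x = x"
    by (rule adapted_basis_exists[OF vspace[of n] vR]) (use Rsub in auto)
  define N where "N = inverse (fact n :: 'k)"
  define \<pi> where "\<pi> x = (\<Sum>\<sigma>\<in>?G. smul P N (act P n (inv \<sigma>) (p (act P n \<sigma> x))))" for x
  have "linear_between (arity_space P n) ?R (\<lambda>x. \<Sum>\<sigma>\<in>?G. scl ?R N (act P n (inv \<sigma>) (p (act P n \<sigma> x))))"
  proof (rule linear_between_sum_scale[OF vR])
    fix \<sigma> assume "\<sigma> \<in> ?G"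
    then have \<sigma>: "\<sigma> permutes {..<n}" by simp
    show "linear_between (arity_space P n) ?R (\<lambda>x. act P n (inv \<sigma>) (p (act P n \<sigma> x)))"
      by (rule linear_between_compose[OF linear_between_compose[OF act_linear[OF \<sigma>] p(1)] al[OF permutes_inv[OF \<sigma>]]])
  qed
  then have lin: "linear_between (arity_space P n) ?R \<pi>" by (simp add: \<pi>_def[abs_def])
  have fixed: "\<pi> x = x" if x: "x \<in> R" for x
  proof -
    have "\<pi> x = (\<Sum>\<sigma>\<in>?G. smul P N x)"
      unfolding \<pi>_def using x Rsub aR p(2) act_inv(1) by (intro sum.cong) auto
    also have "\<dots> = smul P (\<Sum>\<sigma>\<in>?G. N) x" by (rule S.scale_sum_left[symmetric])
    also have "(\<Sum>\<sigma>\<in>?G. N) = 1" by (simp add: N_def card_permutations[of "{..<n}" n])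
    finally show ?thesis by simp
  qed
  have equi: "\<pi> (act P n \<tau> x) = act P n \<tau> (\<pi> x)" if \<tau>: "\<tau> permutes {..<n}" and x: "x \<in> ops P n" for \<tau> x
  proof -
    let ?f = "\<lambda>\<sigma>. act P n (inv \<sigma>) (p (act P n \<sigma> x))"
    have pR: "p y \<in> R" if "y \<in> ops P n" for y using linear_betweenD(1)[OF p(1)] that by simp
    have fR: "?f \<sigma> \<in> R" if "\<sigma> permutes {..<n}" for \<sigma>
      using aR[OF permutes_inv[OF that]] pR act_closed[OF that x] by simp
    \<comment> \<open>For a right action, precomposing with \<tau> replaces \<sigma> by \<tau>
      \<circ> \<sigma>, and the outer inverse leaves a compensating \<tau>.\<close>
    have summand: "smul P N (act P n (inv \<sigma>) (p (act P n \<sigma> (act P n \<tau> x)))) = act P n \<tau> (smul P N (?f (\<tau> \<circ> \<sigma>)))"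
      if \<sigma>: "\<sigma> permutes {..<n}" for \<sigma>
    proof -
      have "inv (\<tau> \<circ> \<sigma>) = inv \<sigma> \<circ> inv \<tau>" using permutes_bij[OF \<tau>] permutes_bij[OF \<sigma>] by (rule o_inv_distrib)
      moreover have pin: "p (act P n (\<tau> \<circ> \<sigma>) x) \<in> ops P n"
        using pR act_closed[OF permutes_compose[OF \<sigma> \<tau>] x] Rsub by blast
      ultimately have "?f (\<tau> \<circ> \<sigma>) = act P n (inv \<tau>) (act P n (inv \<sigma>) (p (act P n (\<tau> \<circ> \<sigma>) x)))"
        using act_comp[OF permutes_inv[OF \<sigma>] permutes_inv[OF \<tau>]] by simp
      then have "act P n \<tau> (?f (\<tau> \<circ> \<sigma>)) = act P n (inv \<sigma>) (p (act P n (\<tau> \<circ> \<sigma>) x))"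
        using act_inv(2)[OF \<tau> act_closed[OF permutes_inv[OF \<sigma>] pin]] by simp
      then show ?thesis
        using linear_betweenD(3)[OF al[OF \<tau>], of "?f (\<tau> \<circ> \<sigma>)" N] fR[OF permutes_compose[OF \<sigma> \<tau>]]
          act_comp[OF \<tau> \<sigma> x] by simp
    qed
    have "\<pi> (act P n \<tau> x) = (\<Sum>\<sigma>\<in>?G. act P n \<tau> (smul P N (?f (\<tau> \<circ> \<sigma>))))"
      unfolding \<pi>_def using summand by (intro sum.cong) auto
    also have "\<dots> = (\<Sum>\<sigma>\<in>?G. act P n \<tau> (smul P N (?f \<sigma>)))"
      by (rule setum_permutations_compose_left[OF \<tau>, symmetric])
    also have "\<dots> = act P n \<tau> (\<pi> x)"
      unfolding \<pi>_def using is_vspace_scale[OF vR] fR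
      by (intro linear_between_sum[OF al[OF \<tau>] vR, symmetric]) simp
    finally show ?thesis .
  qed
  show ?thesis using lin fixed equi by blast
qed

text \<open>The basis B carries the dimension of R, on which the induction runs.\<close>

lemma nondegenerate_form_exists:
  assumes "stable n R" "finite B" "\<not> module.dependent (smul P) B" "module.span (smul P) B = R"
  shows "\<exists>\<beta>. invariant_form n R \<beta> \<and> (\<forall>x\<in>R. (\<forall>y\<in>R. \<beta> x y = 0) \<longrightarrow> x = 0)"
  using assms
proof (induction "card B" arbitrary: B R rule: less_induct)
  case less
  interpret S: vector_space "smul P" by (rule vector_space_smul)
  let ?R = "restrict_to R"
  note R = less.prems(1)
  have vR: "is_vspace ?R" and Rsub: "R \<subseteq> ops P n" using R by (simp_all add: stable_def)
  have aR: "act P n \<sigma> x \<in> R" if "\<sigma> permutes {..<n}" "x \<in> R" for \<sigma> x using R that by (simp add: stable_def)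
  show ?case
  proof (cases "R = {0}")
    case True
    have "invariant_form n R (\<lambda>x y. 0)"
      by (simp add: invariant_form_def linear_between_const_zero is_vspace_ground)
    then show ?thesis using True by auto
  next
    case False
    obtain \<beta> \<epsilon> x0 y0 where \<beta>: "invariant_form n R \<beta>" "x0 \<in> R" "y0 \<in> R" "\<beta> x0 y0 \<noteq> 0"
      and refl: "\<And>x y. x \<in> R \<Longrightarrow> y \<in> R \<Longrightarrow> \<beta> y x = \<epsilon> * \<beta> x y"
      using reflexive_invariant_form_exists[OF R False] by blast
    have \<beta>l: "linear_between ?R ground (\<beta> x)" "linear_between ?R ground (\<lambda>y. \<beta> y x)" if "x \<in> R" for x
      using \<beta>(1) that by (auto simp: invariant_form_def)
    have \<beta>i: "\<beta> (act P n \<sigma> x) (act P n \<sigma> y) = \<beta> x y" if "\<sigma> permutes {..<n}" "x \<in> R" "y \<in> R" for \<sigma> x y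
      using \<beta>(1) that by (auto simp: invariant_form_def)
    define Rad where "Rad = {x \<in> R. \<forall>y\<in>R. \<beta> x y = 0}"
    have "S.subspace Rad"
    proof (rule S.subspaceI)
      show "0 \<in> Rad" using is_vspace_zero[OF vR] linear_between_zero[OF \<beta>l(2) vR] by (simp add: Rad_def)
      show "x + y \<in> Rad" if "x \<in> Rad" "y \<in> Rad" for x y
        using that is_vspace_add[OF vR] linear_betweenD(2)[OF \<beta>l(2)] by (simp add: Rad_def)
      show "smul P c x \<in> Rad" if "x \<in> Rad" for c x
        using that is_vspace_scale[OF vR] linear_betweenD(3)[OF \<beta>l(2)] by (simp add: Rad_def)
    qed
    moreover have "act P n \<sigma> x \<in> Rad" if \<sigma>: "\<sigma> permutes {..<n}" and x: "x \<in> Rad" for \<sigma> x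
    proof -
      have "\<beta> (act P n \<sigma> x) y = 0" if y: "y \<in> R" for y
      proof -
        have "\<beta> (act P n \<sigma> x) (act P n \<sigma> (act P n (inv \<sigma>) y)) = \<beta> x (act P n (inv \<sigma>) y)"
          using x by (intro \<beta>i[OF \<sigma> _ aR[OF permutes_inv[OF \<sigma>] y]]) (simp add: Rad_def)
        then show ?thesis
          using act_inv(2)[OF \<sigma>, of y] y Rsub x aR[OF permutes_inv[OF \<sigma>] y] by (auto simp: Rad_def)
      qed
      then show ?thesis using x aR[OF \<sigma>] by (simp add: Rad_def)
    qed
    ultimately have Rad: "stable n Rad"
      using Rsub S.vector_space_axioms by (auto simp: stable_def is_vspace_def Rad_def)
    have RadR: "Rad \<subseteq> R" by (auto simp: Rad_def)
    obtain B1 where B1: "finite B1" "B1 \<subseteq> Rad" "S.independent B1" "S.span B1 = Rad"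
      by (rule finite_basis_exists[OF Rad])
    \<comment> \<open>x0 lies outside the radical, so a basis of the radical extends properly to one
      of R.\<close>
    have "card B1 < card B"
    proof -
      obtain B2 where B2: "B1 \<subseteq> B2" "B2 \<subseteq> R" "S.independent B2" "R \<subseteq> S.span B2"
        using S.maximal_independent_subset_extend[of B1 R] B1 RadR by blast
      have "B2 \<subseteq> S.span B" using B2(2) less.prems(4) by simp
      then have b2: "finite B2" "card B2 \<le> card B"
        using S.independent_span_bound[OF less.prems(2) B2(3)] by auto
      have "x0 \<notin> Rad" using \<beta>(3,4) by (auto simp: Rad_def)
      then have "B1 \<noteq> B2" using B2(4) \<beta>(2) B1(4) by auto
      then have "card B1 < card B2" using B2(1) b2(1) by (intro psubset_card_mono) auto
      then show ?thesis using b2(2) by simp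
    qed
    from less.hyps[OF this Rad B1(1,3,4)] obtain \<gamma> where \<gamma>: "invariant_form n Rad \<gamma>"
      "\<And>x. x \<in> Rad \<Longrightarrow> (\<And>y. y \<in> Rad \<Longrightarrow> \<gamma> x y = 0) \<Longrightarrow> x = 0" by blast
    obtain \<pi> where \<pi>: "linear_between (arity_space P n) (restrict_to Rad) \<pi>" "\<And>x. x \<in> Rad \<Longrightarrow> \<pi> x = x"
      "\<And>\<sigma> x. \<sigma> permutes {..<n} \<Longrightarrow> x \<in> ops P n \<Longrightarrow> \<pi> (act P n \<sigma> x) = act P n \<sigma> (\<pi> x)"
      using equivariant_projection_exists[OF Rad] by blast
    have \<pi>R: "linear_between ?R (restrict_to Rad) \<pi>" using \<pi>(1) Rsub by (auto simp: linear_between_def subset_iff)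
    have \<pi>in: "\<pi> x \<in> Rad" if "x \<in> R" for x using linear_betweenD(1)[OF \<pi>R] that by simp
    let ?\<beta> = "\<lambda>x y. \<beta> x y + \<gamma> (\<pi> x) (\<pi> y)"
    have "invariant_form n R ?\<beta>"
      unfolding invariant_form_def
    proof (intro conjI ballI allI impI)
      fix x assume x: "x \<in> R"
      have \<gamma>l: "linear_between (restrict_to Rad) ground (\<gamma> (\<pi> x))" "linear_between (restrict_to Rad) ground (\<lambda>y. \<gamma> y (\<pi> x))"
        using \<gamma>(1) \<pi>in[OF x] by (auto simp: invariant_form_def)
      show "linear_between ?R ground (?\<beta> x)"
        using linear_between_combine[OF is_vspace_ground \<beta>l(1)[OF x] linear_between_compose[OF \<pi>R \<gamma>l(1)], of 1] by simp
      show "linear_between ?R ground (\<lambda>y. ?\<beta> y x)"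
        using linear_between_combine[OF is_vspace_ground \<beta>l(2)[OF x] linear_between_compose[OF \<pi>R \<gamma>l(2)], of 1] by simp
      fix \<sigma> y assume \<sigma>: "\<sigma> permutes {..<n}" and y: "y \<in> R"
      have "\<gamma> (act P n \<sigma> (\<pi> x)) (act P n \<sigma> (\<pi> y)) = \<gamma> (\<pi> x) (\<pi> y)"
        using \<gamma>(1) \<sigma> \<pi>in[OF x] \<pi>in[OF y] by (auto simp: invariant_form_def)
      then show "?\<beta> (act P n \<sigma> x) (act P n \<sigma> y) = ?\<beta> x y"
        using \<beta>i[OF \<sigma> x y] \<pi>(3)[OF \<sigma>] x y Rsub by (simp add: subset_iff)
    qed
    moreover have "x = 0" if x: "x \<in> R" and deg: "\<forall>y\<in>R. ?\<beta> x y = 0" for x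
    proof -
      \<comment> \<open>For y in the radical \<beta> y x = 0, and reflexivity turns this into
        \<beta> x y = 0, leaving only the \<gamma> term.\<close>
      have "\<gamma> (\<pi> x) y = 0" if y: "y \<in> Rad" for y
        using deg y RadR refl[of y x] x \<pi>(2)[OF y] by (auto simp: Rad_def)
      then have "\<pi> x = 0" using \<gamma>(2)[OF \<pi>in[OF x]] by blast
      moreover have "\<gamma> 0 z = 0" if "z \<in> Rad" for z
        using \<gamma>(1) that linear_between_zero[of "restrict_to Rad" ground "\<lambda>y. \<gamma> y z"] Rad
        by (simp add: invariant_form_def stable_def)
      ultimately have "\<beta> x y = 0" if "y \<in> R" for y using deg that \<pi>in[OF that] by auto
      then have "x \<in> Rad" using x by (simp add: Rad_def)
      then show "x = 0" using \<open>\<pi> x = 0\<close> \<pi>(2) by simp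
    qed
    ultimately show ?thesis by blast
  qed
qed

theorem self_dual: "\<exists>\<phi>. smodule_iso P (dual_smodule P) \<phi>"
proof -
  interpret S: vector_space "smul P" by (rule vector_space_smul)
  interpret SF: vector_space_pair "smul P" "fun_scale :: 'k \<Rightarrow> ('a \<Rightarrow> 'k) \<Rightarrow> _" ..
  let ?D = "dual_smodule P"
  have "\<exists>\<phi>. linear_between (arity_space P n) (arity_space ?D n) \<phi> \<and> bij_betw \<phi> (ops P n) (ops ?D n) \<and>
     (\<forall>\<sigma>. \<sigma> permutes {..<n} \<longrightarrow> (\<forall>a\<in>ops P n. \<phi> (act P n \<sigma> a) = act ?D n \<sigma> (\<phi> a)))" for n
  proof -
    have R: "stable n (ops P n)"
      using vspace[of n] act_closed by (simp add: stable_def arity_space_def)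
    have re: "restrict_to (ops P n) = arity_space P n" by (simp add: arity_space_def)
    let ?B = "basis_of P n"
    obtain \<beta> where \<beta>: "invariant_form n (ops P n) \<beta>"
      "\<And>x. x \<in> ops P n \<Longrightarrow> (\<And>y. y \<in> ops P n \<Longrightarrow> \<beta> x y = 0) \<Longrightarrow> x = 0"
      using nondegenerate_form_exists[OF R basis_of] by blast
    have \<beta>l: "linear_between (arity_space P n) ground (\<beta> x)" "linear_between (arity_space P n) ground (\<lambda>y. \<beta> y x)"
      if "x \<in> ops P n" for x
      using \<beta>(1) that by (auto simp: invariant_form_def re)
    define \<phi> where "\<phi> a = (\<lambda>b. if b \<in> ops P n then \<beta> a b else 0)" for a
    have \<phi>in: "\<phi> a \<in> ops ?D n" if "a \<in> ops P n" for a
    proof -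
      have "linear_between (arity_space P n) ground (\<phi> a)"
        by (rule linear_between_cong[THEN iffD1, OF _ vspace \<beta>l(1)[OF that]]) (simp add: \<phi>_def)
      then show ?thesis by (simp add: ops_dual \<phi>_def)
    qed
    have lin: "linear_between (arity_space P n) (arity_space ?D n) \<phi>"
      using \<phi>in linear_betweenD(2,3)[OF \<beta>l(2)] by (auto simp: linear_between_def \<phi>_def fun_scale_def)
    have inj: "inj_on \<phi> (ops P n)"
    proof (rule inj_onI)
      fix a b assume a: "a \<in> ops P n" and b: "b \<in> ops P n" and eq: "\<phi> a = \<phi> b"
      have ab: "a - b \<in> ops P n" using is_vspace_diff[OF vspace[of n]] a b by simp
      have "\<beta> (a - b) y = 0" if y: "y \<in> ops P n" for y
        using linear_between_diff[OF \<beta>l(2)[OF y] vspace] a b fun_cong[OF eq, of y] y by (simp add: \<phi>_def)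
      then show "a = b" using \<beta>(2)[OF ab] by simp
    qed
    have surj: "f \<in> \<phi> ` ops P n" if f: "f \<in> ops ?D n" for f
    proof -
      \<comment> \<open>\<phi> is linear on the module only; the ambient linear map \<psi> agrees
        with it there and makes independence and dimension arguments available.\<close>
      define \<psi> where "\<psi> = SF.construct ?B \<phi>"
      have \<psi>: "Vector_Spaces.linear (smul P) fun_scale \<psi>" unfolding \<psi>_def by (rule SF.linear_construct[OF basis_of(2)])
      interpret L: Vector_Spaces.linear "smul P" fun_scale \<psi> by (rule \<psi>)
      have \<psi>\<phi>: "\<psi> a = \<phi> a" if "a \<in> ops P n" for a
      proof -
        have l: "linear_between (arity_space P n) \<lparr>carr = UNIV, scl = fun_scale\<rparr> \<psi>"
          by (simp add: linear_between_def L.add L.scale)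
        have l': "linear_between (arity_space P n) \<lparr>carr = UNIV, scl = fun_scale\<rparr> \<phi>"
          using lin by (simp add: linear_between_def)
        have "\<psi> b = \<phi> b" if "b \<in> ?B" for b unfolding \<psi>_def by (rule SF.construct_basis[OF basis_of(2) that])
        then show ?thesis unfolding linear_on_basis[OF l that] linear_on_basis[OF l' that] by simp
      qed
      have "inj_on \<psi> (S.span ?B)" using inj \<psi>\<phi> unfolding basis_of(3) by (simp cong: inj_on_cong)
      then have ind: "fun_space.independent (\<psi> ` ?B)" and card: "card (\<psi> ` ?B) = card ?B"
        using SF.linear_independent_injective_image[OF \<psi> basis_of(2)]
        by (auto intro!: card_image inj_on_subset[OF _ S.span_superset])
      let ?E = "dual_basis_of P n ` ?B"
      have span_E: "g \<in> fun_space.span ?E" if "g \<in> ops ?D n" for g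
        by (subst dual_expand[OF that], intro fun_space.span_sum fun_space.span_scale fun_space.span_base) auto
      have \<psi>B: "\<psi> ` ?B \<subseteq> ops ?D n" using \<psi>\<phi> \<phi>in basis_in_ops by auto
      have "f \<in> fun_space.span (\<psi> ` ?B)"
      proof (rule ccontr)
        \<comment> \<open>A form outside the span would give more independent forms than there are
          dual basis elements.\<close>
        assume nf: "f \<notin> fun_space.span (\<psi> ` ?B)"
        then have i: "fun_space.independent (insert f (\<psi> ` ?B))"
          by (rule fun_space.independent_insertI[OF _ ind])
        have "insert f (\<psi> ` ?B) \<subseteq> fun_space.span ?E" using \<psi>B f span_E by auto
        then have "card (insert f (\<psi> ` ?B)) \<le> card ?E"
          using fun_space.independent_span_bound[OF finite_imageI[OF basis_of(1)] i] by blast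
        also have "\<dots> \<le> card ?B" by (rule card_image_le[OF basis_of(1)])
        finally show False
          using nf fun_space.span_base[of f "\<psi> ` ?B"] card basis_of(1)[of n]
          by (auto simp: card_insert_if split: if_splits)
      qed
      then have "f \<in> \<psi> ` S.span ?B" by (simp add: L.span_image)
      then show ?thesis unfolding basis_of(3) using \<psi>\<phi> by auto
    qed
    have "\<phi> (act P n \<sigma> a) = act ?D n \<sigma> (\<phi> a)" if \<sigma>: "\<sigma> permutes {..<n}" and a: "a \<in> ops P n" for \<sigma> a
    proof
      fix b
      show "\<phi> (act P n \<sigma> a) b = act ?D n \<sigma> (\<phi> a) b"
      proof (cases "b \<in> ops P n")
        case True
        note ib = act_closed[OF permutes_inv[OF \<sigma>] True]
        have "\<beta> (act P n \<sigma> a) (act P n \<sigma> (act P n (inv \<sigma>) b)) = \<beta> a (act P n (inv \<sigma>) b)"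
          using \<beta>(1) \<sigma> a ib by (auto simp: invariant_form_def)
        then show ?thesis using act_inv(2)[OF \<sigma> True] True ib by (simp add: \<phi>_def act_dual)
      qed (simp add: \<phi>_def act_dual)
    qed
    moreover have "bij_betw \<phi> (ops P n) (ops ?D n)"
      using inj surj \<phi>in by (auto simp: bij_betw_def)
    ultimately show ?thesis using lin by blast
  qed
  then show ?thesis unfolding smodule_iso_def by metis
qed

end

theorem theorem1p6p4:
  fixes A C :: "('k::field_char_0, 'a::ab_group_add) operad"
  assumes "connected_operad A" and "connected_operad C"
    and "smodule.truncate A = smodule.truncate C"
    and "finite_dimensional A"
  shows "(\<exists>\<phi>. smodule_iso A (dual_smodule C) \<phi>) \<and>
    (\<forall>\<phi>. smodule_iso A (dual_smodule C) \<phi> \<longrightarrow>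
      (\<forall>(H :: ('k, 'h::ab_group_add) vspace) ev cop.
         bialgebra A C (associated_law A C \<phi>) H ev cop \<and> conilpotent C H cop \<longrightarrow>
         (let V = Prim C H cop in
          (\<exists>f. algebra_iso A (schur A V) (free_ev A V) H ev f \<and>
             (\<forall>p\<in>carr V. f (gen (schur_forms A V) (unit A, [p])) = p)) \<and>
          (\<exists>g. coalgebra_iso C H cop (schur (dual_smodule C) V) (cofree_cop C V) g \<and>
             (\<forall>p\<in>carr V. g p = gen (schur_forms (dual_smodule C) V) (counit_form C, [p]))))))"
proof (intro conjI allI impI)
  interpret A: connected_operad A by (rule assms(1))
  interpret A: char0_module A by unfold_locales (rule assms(4))
  have eq: "ops C = ops A" "act C = act A" "smul C = smul A"
    using assms(3) by (simp_all add: smodule.truncate_def)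
  \<comment> \<open>The dual depends on the symmetric module alone, which the two operads
    share.\<close>
  have "dual_smodule C = dual_smodule A"
    unfolding dual_smodule_def arity_space_def eq ..
  then show "\<exists>\<phi>. smodule_iso A (dual_smodule C) \<phi>" using A.self_dual by simp
next
  fix \<phi> and H :: "('k, 'h) vspace" and ev cop
  assume "smodule_iso A (dual_smodule C) \<phi>"
  then have "law_pair A C \<phi>" using assms by (intro law_pair.intro law_pair_axioms.intro)
  moreover assume "bialgebra A C (associated_law A C \<phi>) H ev cop \<and> conilpotent C H cop"
  ultimately show "let V = Prim C H cop in
          (\<exists>f. algebra_iso A (schur A V) (free_ev A V) H ev f \<and>
             (\<forall>p\<in>carr V. f (gen (schur_forms A V) (unit A, [p])) = p)) \<and>
          (\<exists>g. coalgebra_iso C H cop (schur (dual_smodule C) V) (cofree_cop C V) g \<and>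
             (\<forall>p\<in>carr V. g p = gen (schur_forms (dual_smodule C) V) (counit_form C, [p])))"
    using law_pair.bialgebra_free_cofree by blast
qed

end
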